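(* Let $1\le m\le n$, $\eta=(m,1^{n-m})$, let $\gamma=(\gamma_1\ge\dots\ge\gamma_n\ge0)$ be a partition, and let $R=(R_1,\dots,R_t)$ be the sequence of partitions associated with $(\eta,\gamma)$ (so $R$ is dominant). Then for every partition $\lambda$ with at most $n$ parts and $|\lambda|=|\gamma|$, $$K_{\lambda;R}(q)=\sum_S q^{\mathrm{charge}(S)},$$ where $S$ runs over the set of $R$-catabolizable tableaux of shape $\lambda$.
   Context: Polynomials. Let $\eta=(\eta_1,\dots,\eta_t)$ be a sequence of positive integers with sum $n$ and $\gamma\in\mathbb{Z}^n$. Let $\mathrm{Roots}_\eta=\{(i,j):1\le i\le\eta_1+\dots+\eta_r<j\le n\text{ for some }r\}$, $\rho=(n-1,\dots,1,0)$, $W=S_n$ acting by permuting variables $x_1,\dots,x_n$, $J(f)=\sum_{w\in W}(-1)^w\,wf$ and $\pi(f)=J(x^\rho)^{-1}J(x^\rho f)$ on Laurent polynomials. For a dominant weight $\lambda$ ($\lambda_1\ge\dots\ge\lambda_n$) put $s_\lambda(x)=\pi(x^\lambda)$. Let $B_\eta(x;q)=\prod_{(i,j)\in\mathrm{Roots}_\eta}(1-q\,x_i/x_j)^{-1}$, $H_{\eta,\gamma}(x;q)=\pi(x^\gamma B_\eta(x;q))$ (formal power series in $q$ with Laurent polynomial coefficients), and define $K_{\lambda,\gamma,\eta}(q)$ by $H_{\eta,\gamma}(x;q)=\sum_\lambda K_{\lambda,\gamma,\eta}(q)s_\lambda(x)$, $\lambda$ running over dominant weights. Let $A_i=[\eta_1+\dots+\eta_{i-1}+1,\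 \eta_1+\dots+\eta_i]$ and $R_i=(\gamma_j)_{j\in A_i}$; when all $R_i$ are partitions (zero parts allowed) write $K_{\lambda;R}(q)=K_{\lambda,\gamma,\eta}(q)$ with $R=(R_1,\dots,R_t)$. $R$ is dominant if $\gamma$ is weakly decreasing. Tableaux. English notation; column strict means rows weakly increase and columns strictly increase. The row-reading word is $\cdots w^2w^1$ with $w^i$ the $i$-th row read left to right; content counts occurrences of each letter. $P(u)$ is the unique column strict tableau of partition shape whose row-reading word is Knuth equivalent to $u$ (a tableau inside $P(\cdot)$ stands for its row-reading word). Catabolizability. Let $Y_i$ be the tableau of shape $R_i$ whose $j$-th row is filled with the $j$-th smallest letter of $A_i$. For a (skew) tableau $T$ let $H_r(T)=P(T_nT_s)$, where $T_n$, $T_s$ are the parts of $T$ in rows $\le r$ and in rows $>r$. If $S$ is a column strict tableau of partition shape with $S|_{A_1}=Y_1$, put $\mathrm{cat}_{R_1}(S)=H_{\eta_1}(S-Y_1)$, where $S-Y_1$ is the skew tableau obtained by removing $Y_1$. Recursively: if $R$ is empty the only $R$-catabolizable tableau is the empty one; otherwise a column strict tableau $S$ of partition shape in the alphabet $[n]$ is $R$-catabolizable iff $S|_{A_1}=Y_1$ and $\mathrm{cat}_{R_1}(S)$ is $(R_2,\dots,R_t)$-catabolizable in the alphabet $[\eta_1+1,n]$ (using the same $A_2,\dots,A_t$ and $Y_2,\dots,Y_t$). An $R$-catabolizable tableau has content $\gamma$. Charge. For a word $u$ with content $(1^k)$ put $c_1=0$, $c_i=c_{i-1}$ if $i$ is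 to the left of $i-1$ in $u$, and $c_i=c_{i-1}+1$ if $i$ is to the right; $\mathrm{charge}(u)=\sum c_i$. For a word of partition content, extract a standard subword: scanning from the right end leftwards choose the first 1, then the first 2 to the left of it, etc., wrapping around to the right end whenever there is no $i+1$ to the left of the chosen $i$, stopping when no larger letter exists; erase it and repeat. The charge is the sum of the charges of these standard subwords. The charge of a tableau is the charge of its row-reading word. *)

theory Defs
  imports
    "HOL-Library.Poly_Mapping"
    "HOL-Library.Multiset"
    "HOL-Combinatorics.Permutations"
    "HOL-Computational_Algebra.Formal_Power_Series"
begin

section \<open>Laurent polynomials and the operator \<open>\<pi>\<close>\<close>

text \<open>
  A Laurent polynomial with integer coefficients is a finitely supported function on exponent
  vectors. The variables are \<open>x\<^sub>1, x\<^sub>2, \<dots>\<close> (indices start at 1), and a vector in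
  \<open>\<int>\<^sup>n\<close> is a list of length \<open>n\<close>, so that the coordinate with index \<open>i\<close> is \<open>xs ! (i - 1)\<close>.
\<close>

type_synonym laurent = "(nat \<Rightarrow>\<^sub>0 int) \<Rightarrow>\<^sub>0 int"

definition weight :: "int list \<Rightarrow> (nat \<Rightarrow>\<^sub>0 int)" where
  "weight xs = (\<Sum>i = 1..length xs. Poly_Mapping.single i (xs ! (i - 1)))"

definition x_pow :: "(nat \<Rightarrow>\<^sub>0 int) \<Rightarrow> laurent" where
  "x_pow \<alpha> = Poly_Mapping.single \<alpha> 1"

text \<open>
  A permutation \<open>w\<close> sends \<open>x\<^sub>i\<close> to \<open>x\<^bsub>w(i)\<^esub>\<close>, hence \<open>x\<^sup>\<alpha>\<close> to the monomial with exponent vector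
  \<open>\<alpha> \<circ> w\<^sup>-\<^sup>1\<close>.
\<close>

definition perm_act :: "(nat \<Rightarrow> nat) \<Rightarrow> laurent \<Rightarrow> laurent" where
  "perm_act w f =
     (\<Sum>\<alpha> \<in> Poly_Mapping.keys f.
        Poly_Mapping.single (Poly_Mapping.map_key (inv w) \<alpha>) (Poly_Mapping.lookup f \<alpha>))"

definition J_op :: "nat \<Rightarrow> laurent \<Rightarrow> laurent" where
  "J_op n f = (\<Sum>w | w permutes {1..n}. of_int (sign w) * perm_act w f)"

definition rho :: "nat \<Rightarrow> int list" where
  "rho n = map int (rev [0..<n])"

text \<open>
  The type of Laurent polynomials is an integral domain, so the quotient
  \<open>J(x\<^sup>\<rho>)\<^sup>-\<^sup>1 J(x\<^sup>\<rho> f)\<close> is the unique solution \<open>g\<close> of the equation below.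
\<close>

definition pi_op :: "nat \<Rightarrow> laurent \<Rightarrow> laurent" where
  "pi_op n f = (THE g. J_op n (x_pow (weight (rho n))) * g = J_op n (x_pow (weight (rho n)) * f))"

definition dominant_weight :: "nat \<Rightarrow> int list \<Rightarrow> bool" where
  "dominant_weight n lam \<longleftrightarrow> length lam = n \<and> sorted_wrt (\<ge>) lam"

definition schur :: "nat \<Rightarrow> int list \<Rightarrow> laurent" where
  "schur n lam = pi_op n (x_pow (weight lam))"

section \<open>The polynomials \<open>K\<close>\<close>

definition Roots :: "nat list \<Rightarrow> (nat \<times> nat) set" where
  "Roots \<eta> = {(i, j). \<exists>r \<in> {1..length \<eta>}.
      1 \<le> i \<and> i \<le> sum_list (take r \<eta>) \<and> sum_list (take r \<eta>) < j \<and> j \<le> sum_list \<eta>}"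

definition x_ratio :: "nat \<Rightarrow> nat \<Rightarrow> laurent" where
  "x_ratio i j = x_pow (Poly_Mapping.single i 1 - Poly_Mapping.single j 1)"

text \<open>
  The class-based \<open>inverse\<close> on power series is not available over the ring of Laurent polynomials;
  \<open>fps_right_inverse f y\<close> is the inverse of a series \<open>f\<close> whose constant term has inverse \<open>y\<close>.
\<close>

definition B_series :: "nat list \<Rightarrow> laurent fps" where
  "B_series \<eta> =
     (\<Prod>(i, j) \<in> Roots \<eta>. fps_right_inverse (1 - fps_X * fps_const (x_ratio i j)) 1)"

definition H_series :: "nat list \<Rightarrow> int list \<Rightarrow> laurent fps" where
  "H_series \<eta> \<gamma> =
     Abs_fps (\<lambda>k. pi_op (sum_list \<eta>) (fps_nth (fps_const (x_pow (weight \<gamma>)) * B_series \<eta>) k))"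

text \<open>
  The coefficients of the expansion of a symmetric Laurent polynomial in the basis of the
  \<open>s\<^sub>\<lambda>\<close>. The identity defining \<open>K\<close> is one of power series in \<open>q\<close>,
  i.e. it is read separately for each power of \<open>q\<close>, where the sum over \<open>\<lambda>\<close> is finite.
\<close>

definition schur_coeffs :: "nat \<Rightarrow> laurent \<Rightarrow> (int list \<Rightarrow>\<^sub>0 int)" where
  "schur_coeffs n f = (THE c.
      (\<forall>lam \<in> Poly_Mapping.keys c. dominant_weight n lam) \<and>
      f = (\<Sum>lam \<in> Poly_Mapping.keys c. of_int (Poly_Mapping.lookup c lam) * schur n lam))"

definition K_series :: "nat list \<Rightarrow> int list \<Rightarrow> int list \<Rightarrow> int fps" where
  "K_series \<eta> \<gamma> lam =
     Abs_fps (\<lambda>k. Poly_Mapping.lookup (schur_coeffs (sum_list \<eta>) (fps_nth (H_series \<eta> \<gamma>) k)) lam)"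

text \<open>
  Partitions are weakly decreasing lists of natural numbers, zero parts allowed. In the sequence
  associated with \<open>(\<eta>, \<gamma>)\<close> the \<open>i\<close>-th entry (counting from 0 here) is the subsequence of \<open>\<gamma>\<close>
  with indices in the \<open>i\<close>-th of the consecutive intervals of lengths \<open>\<eta>\<close>.
\<close>

definition assoc_seq :: "nat list \<Rightarrow> nat list \<Rightarrow> nat list list" where
  "assoc_seq \<eta> \<gamma> =
     map (\<lambda>i. map (\<lambda>j. \<gamma> ! (j - 1)) [sum_list (take i \<eta>) + 1..<sum_list (take (Suc i) \<eta>) + 1])
       [0..<length \<eta>]"

definition K_poly :: "nat list \<Rightarrow> nat list list \<Rightarrow> int fps" where
  "K_poly lam R = K_series (map length R) (map int (concat R)) (map int lam)"

section \<open>Tableaux\<close>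

text \<open>
  A (skew) tableau is a partial function on cells \<open>(row, column)\<close>, both counted from 1 in
  English notation.
\<close>

type_synonym tableau = "nat \<times> nat \<rightharpoonup> nat"

definition diagram :: "nat list \<Rightarrow> (nat \<times> nat) set" where
  "diagram \<mu> = {(i, j). 1 \<le> i \<and> i \<le> length \<mu> \<and> 1 \<le> j \<and> j \<le> \<mu> ! (i - 1)}"

definition has_shape :: "tableau \<Rightarrow> nat list \<Rightarrow> bool" where
  "has_shape T \<mu> \<longleftrightarrow> sorted_wrt (\<ge>) \<mu> \<and> dom T = diagram \<mu>"

definition column_strict :: "tableau \<Rightarrow> bool" where
  "column_strict T \<longleftrightarrow>
     (\<forall>i j j' a b. T (i, j) = Some a \<longrightarrow> T (i, j') = Some b \<longrightarrow> j < j' \<longrightarrow> a \<le> b) \<and>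
     (\<forall>i i' j a b. T (i, j) = Some a \<longrightarrow> T (i', j) = Some b \<longrightarrow> i < i' \<longrightarrow> a < b)"

definition row_word :: "tableau \<Rightarrow> nat \<Rightarrow> nat list" where
  "row_word T i = map (\<lambda>j. the (T (i, j))) (sorted_list_of_set {j. (i, j) \<in> dom T})"

definition reading_word :: "tableau \<Rightarrow> nat list" where
  "reading_word T = concat (map (row_word T) (rev (sorted_list_of_set (fst ` dom T))))"

inductive knuth_step :: "nat list \<Rightarrow> nat list \<Rightarrow> bool" where
  "x < y \<Longrightarrow> y \<le> z \<Longrightarrow> knuth_step (u @ [y, z, x] @ v) (u @ [y, x, z] @ v)"
| "x \<le> y \<Longrightarrow> y < z \<Longrightarrow> knuth_step (u @ [x, z, y] @ v) (u @ [z, x, y] @ v)"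

definition knuth_equiv :: "nat list \<Rightarrow> nat list \<Rightarrow> bool" where
  "knuth_equiv = equivclp knuth_step"

definition P_tab :: "nat list \<Rightarrow> tableau" where
  "P_tab u = (THE T. column_strict T \<and> (\<exists>\<mu>. has_shape T \<mu>) \<and> knuth_equiv (reading_word T) u)"

section \<open>Catabolizability\<close>

definition restrict_letters :: "tableau \<Rightarrow> nat set \<Rightarrow> tableau" where
  "restrict_letters T A = T |` {c. \<exists>a \<in> A. T c = Some a}"

text \<open>The tableau of shape \<open>r\<close> on the letters \<open>a + 1, a + 2, \<dots>\<close> with row \<open>j\<close> filled with \<open>a + j\<close>.\<close>

definition Y_tab :: "nat \<Rightarrow> nat list \<Rightarrow> tableau" where
  "Y_tab a r = (\<lambda>(i, j). if (i, j) \<in> diagram r then Some (a + i) else None)"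

definition skew_minus :: "tableau \<Rightarrow> tableau \<Rightarrow> tableau" where
  "skew_minus S Y = S |` (- dom Y)"

definition H_tab :: "nat \<Rightarrow> tableau \<Rightarrow> tableau" where
  "H_tab r T = P_tab (reading_word (T |` {(i, j). i \<le> r}) @ reading_word (T |` {(i, j). r < i}))"

text \<open>
  The parameter \<open>a\<close> counts the letters used up by earlier entries of the sequence: the alphabet
  is the interval from \<open>a + 1\<close> to \<open>a + length (concat R)\<close>, and the letters
  belonging to the first entry of \<open>R\<close> are the smallest ones.
\<close>

fun catabolizable_from :: "nat \<Rightarrow> nat list list \<Rightarrow> tableau \<Rightarrow> bool" where
  "catabolizable_from a [] S \<longleftrightarrow> S = Map.empty"
| "catabolizable_from a (r # R) S \<longleftrightarrow>
     column_strict S \<and> (\<exists>\<mu>. has_shape S \<mu>) \<and> ran S \<subseteq> {a + 1..a + length (concat (r # R))} \<and>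
     restrict_letters S {a + 1..a + length r} = Y_tab a r \<and>
     catabolizable_from (a + length r) R (H_tab (length r) (skew_minus S (Y_tab a r)))"

abbreviation catabolizable :: "nat list list \<Rightarrow> tableau \<Rightarrow> bool" where
  "catabolizable \<equiv> catabolizable_from 0"

section \<open>Charge\<close>

fun charge_index :: "nat list \<Rightarrow> nat \<Rightarrow> nat" where
  "charge_index u 0 = 0"
| "charge_index u (Suc 0) = 0"
| "charge_index u (Suc (Suc i)) =
     (if \<exists>k l. k < l \<and> l < length u \<and> u ! k = Suc (Suc i) \<and> u ! l = Suc i
      then charge_index u (Suc i) else charge_index u (Suc i) + 1)"

definition standard_charge :: "nat list \<Rightarrow> nat" where
  "standard_charge u = (\<Sum>i = 1..length u. charge_index u i)"

text \<open>
  The position chosen for the letter \<open>i\<close>: the last occurrence of \<open>i\<close> before the position chosen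
  for \<open>i - 1\<close>, or the last occurrence altogether if there is none. The value
  for \<open>i = 0\<close> encodes that the search for the letter 1 starts at the right end.
\<close>

fun chosen_pos :: "nat list \<Rightarrow> nat \<Rightarrow> nat" where
  "chosen_pos u 0 = length u"
| "chosen_pos u (Suc i) =
     (let Q = {k. k < length u \<and> u ! k = Suc i}; L = {k \<in> Q. k < chosen_pos u i}
      in Max (if L \<noteq> {} then L else Q))"

definition chosen :: "nat list \<Rightarrow> nat set" where
  "chosen u = chosen_pos u ` {1..Max (set u)}"

definition partition_content :: "nat list \<Rightarrow> bool" where
  "partition_content u \<longleftrightarrow>
     0 \<notin> set u \<and> (\<forall>i \<ge> 1. count (mset u) (Suc i) \<le> count (mset u) i)"

lemma partition_content_one:
  assumes "partition_content u" "u \<noteq> []"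
  shows "1 \<in> set u"
proof -
  have dec: "count (mset u) (Suc i) \<le> count (mset u) 1" for i
  proof (induction i)
    case (Suc i)
    have "count (mset u) (Suc (Suc i)) \<le> count (mset u) (Suc i)"
      using assms(1) unfolding partition_content_def by simp
    with Suc show ?case by linarith
  qed simp
  have "hd u \<in> set u" using assms(2) by simp
  moreover from this have "hd u \<noteq> 0" using assms(1) unfolding partition_content_def by metis
  then obtain i where "hd u = Suc i" using not0_implies_Suc by blast
  ultimately have "0 < count (mset u) (Suc i)" by simp
  with dec[of i] have "0 < count (mset u) 1" by linarith
  then show ?thesis by simp
qed

lemma chosen_decreases:
  assumes "partition_content u" "u \<noteq> []"
  shows "length (nths u (- chosen u)) < length u"
proof -
  have one: "1 \<in> set u" using partition_content_one[OF assms] .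
  define Q where "Q = {k. k < length u \<and> u ! k = Suc 0}"
  have "chosen_pos u 1 = Max Q"
  proof -
    have "{k \<in> Q. k < length u} = Q" by (auto simp: Q_def)
    then show ?thesis by (simp add: Let_def Q_def)
  qed
  moreover have "Q \<noteq> {}" "finite Q"
    using one by (auto simp: Q_def in_set_conv_nth)
  then have "Max Q \<in> Q" by (rule Max_in[rotated])
  ultimately have lt: "chosen_pos u 1 < length u" by (simp add: Q_def)
  have "1 \<le> Max (set u)" using one by (simp add: Max_ge)
  then have "chosen_pos u 1 \<in> chosen u" unfolding chosen_def by force
  then have "{i. i < length u \<and> i \<in> - chosen u} \<subset> {..<length u}" using lt by blast
  then have "card {i. i < length u \<and> i \<in> - chosen u} < card {..<length u}"
    by (rule psubset_card_mono[rotated]) simp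
  then show ?thesis by (simp add: length_nths)
qed

text \<open>Words whose content is not a partition get the default value 0.\<close>

function charge :: "nat list \<Rightarrow> nat" where
  "charge u =
     (if u = [] \<or> \<not> partition_content u then 0
      else standard_charge (nths u (chosen u)) + charge (nths u (- chosen u)))"
  by pat_completeness auto
termination
  by (relation "Wellfounded.measure length") (simp_all add: chosen_decreases)

declare charge.simps [simp del]

section \<open>Well-definedness checks\<close>

lemma B_series_factor:
  "(1 - fps_X * fps_const (x_ratio i j))
     * fps_right_inverse (1 - fps_X * fps_const (x_ratio i j)) 1 = 1"
  by (rule fps_right_inverse) simp

lemma finite_diagram: "finite (diagram \<mu>)"
proof (rule finite_subset)
  show "diagram \<mu> \<subseteq> {1..length \<mu>} \<times> {1..sum_list \<mu>}"
    by (force simp: diagram_def intro: order_trans elem_le_sum_list)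
qed simp

lemma catabolizable_ran:
  "catabolizable_from a R S \<Longrightarrow> ran S \<subseteq> {a + 1..a + length (concat R)}"
  by (cases R) auto

lemma finite_catabolizable: "finite {S. catabolizable R S \<and> has_shape S \<mu>}"
proof (rule finite_subset)
  show "{S. catabolizable R S \<and> has_shape S \<mu>}
      \<subseteq> {S. dom S = diagram \<mu> \<and> ran S \<subseteq> {1..length (concat R)}}"
    using catabolizable_ran[of 0 R] by (auto simp: has_shape_def)
  show "finite {S. dom S = diagram \<mu> \<and> ran S \<subseteq> {1..length (concat R)}}"
    by (rule finite_set_of_finite_maps) (simp_all add: finite_diagram)
qed

end

theory Submission
  imports Defs
begin

text \<open>
  Both sides count fillings: sequences of \<open>n\<close> rows with prescribed content, weighted by the charge
  of their reading word. The crystal operators move one letter between adjacent rows without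
  changing the Knuth class of the reading word, hence the charge. Consequently the weighted
  count \<open>G\<close> of fillings is symmetric in the row sizes, and its alternating sums over dot-translates
  of a partition count tableaux, by a sign-reversing involution.

  On the algebraic side, the coefficient of \<open>s\<^sub>\<lambda>\<close> is an alternating sum of coefficients
  of \<open>x\<^sup>\<gamma> B\<^sub>\<eta>\<close>. The factors of the product \<open>B\<^sub>\<eta>\<close> are removed row by row: expanding the
  factors with a fixed first index raises a row size, and the Pieri rule shows that the
  alternating sums of \<open>G\<close> obey the same recursion. When all factors of one column are gone, the
  smallest letter is eliminated: rotating a letter other than 1 from the end of the word to its
  front lowers the charge by 1, and if all letters 1 stand at the end of the word, then they may
  be dropped and the other letters lowered by 1 without changing the charge.

  On the combinatorial side, \<open>R\<close>-catabolizability for one-row blocks only fixes the content, so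
  for \<open>\<eta> = (m, 1\<^bsup>n-m\<^esup>)\<close> it says that the content is \<open>\<gamma>\<close> and the letters up to \<open>m\<close> form \<open>Y\<^sub>1\<close>.
\<close>

section \<open>Charge\<close>

text \<open>A single coefficient of \<open>x^\<gamma> B\<close> has no relation to a single value of
  \<open>G\<close>; only signed sums agree. This shapes the inductive statement
  \<open>reduces a t\<close>: it compares sums over permutations of the positions a+1..n, and the
  group gains one position each time a column of roots is used up. The rows 1..a stay in the
  fillings, outside the alternated block. Since \<open>G\<close> is symmetric in all n row sizes, a
  row of size k outside the block acts like multiplication by the complete symmetric function h_k,
  and distributing k units over the block is what the geometric series of one row of roots does. The
  Pieri rule would in general need one more row than the block has; it closes up because the n-a
  letters that are left cannot fill a column of n-a+1 cells. Reinserting \<gamma>_i letters i at the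
  start of row i is the other half of the recursion. For one letter this is free: a tableau keeps
  its smallest letter in one row, so the signed sum does not see the condition. For the letters 1..m
  at once it is a genuine condition, and it is the one that defines catabolizability for the first
  block.\<close>

lemma nths_conv_map: "nths xs A = map ((!) xs) (filter (\<lambda>i. i \<in> A) [0..<length xs])"
proof (induction xs arbitrary: A rule: rev_induct)
  case Nil then show ?case by simp
next
  case (snoc x xs)
  have "map ((!) xs) (filter (\<lambda>i. i \<in> A) [0..<length xs])
      = map ((!) (xs @ [x])) (filter (\<lambda>i. i \<in> A) [0..<length xs])"
    by (rule map_cong) (auto simp: nth_append)
  then show ?case using snoc by (auto simp: nths_append)
qed

lemma nths_cong_pos:
  assumes "\<And>i. i < length xs \<Longrightarrow> i \<in> A \<longleftrightarrow> i \<in> B"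
  shows "nths xs A = nths xs B"
  unfolding nths_conv_map using assms by (auto intro!: arg_cong[where f = "map _"] filter_cong)

lemma mset_nths_split: "mset (nths xs A) + mset (nths xs (- A)) = mset xs"
proof -
  have "mset (nths xs A) + mset (nths xs (- A))
      = image_mset ((!) xs) (filter_mset (\<lambda>i. i \<in> A) (mset [0..<length xs])
          + filter_mset (\<lambda>i. \<not> i \<in> A) (mset [0..<length xs]))"
    unfolding nths_conv_map by (simp only: mset_map mset_filter image_mset_union Compl_iff)
  also have "\<dots> = mset (map ((!) xs) [0..<length xs])"
    by (simp only: multiset_partition[symmetric] mset_map)
  finally show ?thesis by (simp add: map_nth)
qed

section \<open>Extraction of standard subwords\<close>

declare chosen_pos.simps(2) [simp del]

text \<open>Relational form of the cyclic search for the letter \<open>i\<close> leftwards from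
  position \<open>p\<close>: \<open>q\<close> is the last occurrence before \<open>p\<close> or, if
  there is none, the last one of all. Stated by comparisons of positions instead of
  \<open>Max\<close>, it can be carried along a rearrangement of the word.\<close>

definition is_next :: "nat list \<Rightarrow> nat \<Rightarrow> nat \<Rightarrow> nat \<Rightarrow> bool" where
  "is_next u i p q \<longleftrightarrow> q < length u \<and> u ! q = i \<and>
     (\<forall>k < length u. u ! k = i \<longrightarrow> (q < p \<and> (k < p \<longrightarrow> k \<le> q)) \<or> (\<not> q < p \<and> \<not> k < p \<and> k \<le> q))"

lemma is_next_unique: "is_next u i p q \<Longrightarrow> is_next u i p q' \<Longrightarrow> q = q'"
proof -
  assume a: "is_next u i p q" "is_next u i p q'"
  have "q' \<le> q" using a by (cases "q < p") (auto simp: is_next_def)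
  moreover have "q \<le> q'" using a by (cases "q' < p") (auto simp: is_next_def)
  ultimately show "q = q'" by simp
qed

lemma is_next_chosen_pos:
  assumes "Suc i \<in> set u"
  shows "is_next u (Suc i) (chosen_pos u i) (chosen_pos u (Suc i))"
proof -
  define Q where "Q = {k. k < length u \<and> u ! k = Suc i}"
  define L where "L = {k \<in> Q. k < chosen_pos u i}"
  have Q: "finite Q" "Q \<noteq> {}" using assms by (auto simp: Q_def in_set_conv_nth)
  then have L: "finite L" by (simp add: L_def)
  have eq: "chosen_pos u (Suc i) = Max (if L \<noteq> {} then L else Q)"
    by (simp only: chosen_pos.simps Let_def L_def Q_def)
  show ?thesis
  proof (cases "L = {}")
    case True
    then have "Max Q \<in> Q" "\<not> Max Q < chosen_pos u i" using Max_in[OF Q] by (auto simp: L_def)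
    moreover have "\<forall>k\<in>Q. k \<le> Max Q" using Q by simp
    ultimately show ?thesis unfolding is_next_def eq using True by (auto simp: Q_def L_def)
  next
    case False
    then have "Max L \<in> L" using Max_in[OF L] by auto
    moreover have "\<forall>k\<in>L. k \<le> Max L" using L by simp
    ultimately show ?thesis unfolding is_next_def eq using False by (auto simp: Q_def L_def)
  qed
qed

text \<open>The outcome of a search depends only on how the occurrences of \<open>i\<close> compare
  with the starting point and with each other. So \<open>\<tau>\<close> may scramble all other
  positions.\<close>

lemma is_next_transfer:
  assumes "is_next u i p q"
    and len: "length u' = length u" and bij: "bij_betw \<tau> {..<length u} {..<length u}"
    and lett: "\<And>k. k < length u \<Longrightarrow> u' ! \<tau> k = u ! k"
    and ord: "\<And>k. k < length u \<Longrightarrow> u ! k = i \<Longrightarrow> \<tau> k < p' \<longleftrightarrow> k < p"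
    and mono: "\<And>k k'. k < length u \<Longrightarrow> k' < length u \<Longrightarrow> u ! k = i \<Longrightarrow> u ! k' = i \<Longrightarrow>
                 \<tau> k \<le> \<tau> k' \<longleftrightarrow> k \<le> k'"
  shows "is_next u' i p' (\<tau> q)"
proof -
  have q: "q < length u" "u ! q = i" using assms(1) by (auto simp: is_next_def)
  have "\<tau> q < length u'" using bij q len by (auto simp: bij_betw_def)
  moreover have "u' ! \<tau> q = i" using q lett by simp
  moreover have "(\<tau> q < p' \<and> (k < p' \<longrightarrow> k \<le> \<tau> q)) \<or> (\<not> \<tau> q < p' \<and> \<not> k < p' \<and> k \<le> \<tau> q)"
    if "k < length u'" "u' ! k = i" for k
  proof -
    have "\<exists>k0 < length u. k = \<tau> k0"
    proof -
      have "k \<in> \<tau> ` {..<length u}" using bij that(1) len by (simp add: bij_betw_def)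
      then show ?thesis by blast
    qed
    then obtain k0 where k0: "k0 < length u" "k = \<tau> k0" by blast
    have "u ! k0 = i" using lett[of k0] k0 that(2) by simp
    have o: "\<tau> k0 < p' \<longleftrightarrow> k0 < p" "\<tau> q < p' \<longleftrightarrow> q < p" "\<tau> k0 \<le> \<tau> q \<longleftrightarrow> k0 \<le> q"
      using ord[of k0] ord[of q] mono[of k0 q] k0 q \<open>u ! k0 = i\<close> by auto
    have "(q < p \<and> (k0 < p \<longrightarrow> k0 \<le> q)) \<or> (\<not> q < p \<and> \<not> k0 < p \<and> k0 \<le> q)"
      using assms(1) k0(1) \<open>u ! k0 = i\<close> by (auto simp: is_next_def)
    then show ?thesis unfolding k0(2) o .
  qed
  ultimately show ?thesis unfolding is_next_def by blast
qed

lemma partition_content_set: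
  assumes "partition_content u" "u \<noteq> []"
  shows "set u = {1..Max (set u)}"
proof
  show "set u \<subseteq> {1..Max (set u)}"
    using assms by (auto simp: partition_content_def Suc_le_eq intro!: Nat.gr0I)
  have step: "i \<in> set u" if "Suc i \<in> set u" "1 \<le> i" for i
  proof -
    have "count (mset u) (Suc i) \<le> count (mset u) i" using assms that by (auto simp: partition_content_def)
    moreover have "count (mset u) (Suc i) > 0" using that by simp
    ultimately have "count (mset u) i > 0" by linarith
    then show ?thesis by simp
  qed
  have "Max (set u) \<in> set u" using assms by simp
  have "Max (set u) - d \<in> set u" if "Max (set u) - d \<ge> 1" for d
    using that
  proof (induction d)
    case 0 then show ?case using \<open>Max (set u) \<in> set u\<close> by simp
  next
    case (Suc d)
    then have "Suc (Max (set u) - Suc d) \<in> set u" by (metis Suc_diff_Suc diff_is_0_eq' nat_le_linear not_less_eq_eq One_nat_def Suc_le_lessD le_SucI zero_less_diff)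
    then show ?case using step Suc.prems by blast
  qed
  then show "{1..Max (set u)} \<subseteq> set u"
    by (metis atLeastAtMost_iff diff_diff_cancel subsetI)
qed

lemma chosen_pos_nth:
  assumes "partition_content u" "1 \<le> i" "i \<le> Max (set u)" "u \<noteq> []"
  shows "chosen_pos u i < length u" "u ! chosen_pos u i = i"
proof -
  obtain i' where i: "i = Suc i'" using assms by (cases i) auto
  have "i \<in> {1..Max (set u)}" using assms by auto
  then have "i \<in> set u" by (simp only: partition_content_set[OF assms(1,4), symmetric])
  then have "is_next u i (chosen_pos u i') (chosen_pos u i)" unfolding i by (rule is_next_chosen_pos)
  then show "chosen_pos u i < length u" "u ! chosen_pos u i = i" by (auto simp: is_next_def)
qed

text \<open>Lets the positions chosen in a rearranged word be guessed: any sequence of successful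
  searches that starts at the right end is the chosen one.\<close>

lemma chosen_pos_eqI:
  assumes "p 0 = length u" "\<And>i. i < K \<Longrightarrow> is_next u (Suc i) (p i) (p (Suc i))"
  shows "i \<le> K \<Longrightarrow> chosen_pos u i = p i"
proof (induction i)
  case 0 then show ?case using assms by simp
next
  case (Suc i)
  then have n: "is_next u (Suc i) (chosen_pos u i) (p (Suc i))" using assms(2)[of i] by simp
  then have "Suc i \<in> set u" unfolding is_next_def by (metis nth_mem)
  then show ?case using is_next_chosen_pos is_next_unique n by blast
qed

text \<open>An ascent \<open>p (j - 1) < p j\<close> means that the search for \<open>j\<close>
  wrapped around the right end. For \<open>p = chosen_pos u\<close> this count is the charge index
  of the letter \<open>i\<close>; the letter 1 never counts because \<open>p 0\<close> is the length
  of the word.\<close>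

definition wraps :: "(nat \<Rightarrow> nat) \<Rightarrow> nat \<Rightarrow> nat" where
  "wraps p i = card {j \<in> {1..i}. p (j - 1) < p j}"

lemma wraps_0: "wraps p 0 = 0"
  by (simp add: wraps_def)

lemma wraps_Suc: "wraps p (Suc i) = wraps p i + (if p i < p (Suc i) then 1 else 0)"
proof -
  have "{j \<in> {1..Suc i}. p (j - 1) < p j}
    = {j \<in> {1..i}. p (j - 1) < p j} \<union> (if p i < p (Suc i) then {Suc i} else {})"
    by (auto simp: le_Suc_eq)
  then show ?thesis unfolding wraps_def by simp
qed

text \<open>Translates the relation of standing to the left in an extracted subword into positions
  of the full word, so that charge indices can be read off without forming the subword.\<close>

lemma ordered_occurrence_nths:
  "(\<exists>k l. k < l \<and> l < length (nths u C) \<and> nths u C ! k = a \<and> nths u C ! l = b) \<longleftrightarrow>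
   (\<exists>p q. p < q \<and> q < length u \<and> p \<in> C \<and> q \<in> C \<and> u ! p = a \<and> u ! q = b)" (is "?L = ?R")
proof -
  define ps where "ps = filter (\<lambda>i. i \<in> C) [0..<length u]"
  have s: "sorted_wrt (<) ps" unfolding ps_def by (intro sorted_wrt_filter) simp
  have set: "set ps = {i. i < length u \<and> i \<in> C}" by (auto simp: ps_def)
  have eq: "nths u C = map ((!) u) ps" by (simp add: nths_conv_map ps_def)
  show ?thesis
  proof
    assume ?L
    then obtain k l where kl: "k < l" "l < length ps" "u ! (ps ! k) = a" "u ! (ps ! l) = b"
      by (auto simp: eq)
    have "ps ! k < ps ! l" using s kl by (simp add: sorted_wrt_iff_nth_less)
    moreover have "ps ! k \<in> set ps" "ps ! l \<in> set ps" using kl by simp_all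
    ultimately show ?R using kl set by blast
  next
    assume ?R
    then obtain p q where pq: "p < q" "p \<in> set ps" "q \<in> set ps" "u ! p = a" "u ! q = b"
      using set by auto
    then obtain k l where kl: "k < length ps" "l < length ps" "ps ! k = p" "ps ! l = q"
      by (metis in_set_conv_nth)
    have "k < l"
      using s kl pq(1) by (metis linorder_neqE_nat not_less_iff_gr_or_eq sorted_wrt_nth_less)
    then have "k < l \<and> l < length (nths u C) \<and> nths u C ! k = a \<and> nths u C ! l = b"
      using kl pq by (auto simp: eq)
    then show ?L by blast
  qed
qed

lemma inj_chosen_pos:
  assumes "partition_content u" "u \<noteq> []"
  shows "inj_on (chosen_pos u) {1..Max (set u)}"
  by (rule inj_onI) (metis assms atLeastAtMost_iff chosen_pos_nth(2))

lemma standard_charge_chosen: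
  assumes "partition_content u" "u \<noteq> []"
  shows "standard_charge (nths u (chosen u)) = (\<Sum>i = 1..Max (set u). wraps (chosen_pos u) i)"
proof -
  let ?K = "Max (set u)" and ?v = "nths u (chosen u)"
  have lt: "chosen_pos u i < length u" "u ! chosen_pos u i = i" if "1 \<le> i" "i \<le> ?K" for i
    using chosen_pos_nth[OF assms(1)] that assms(2) by auto
  have "{i. i < length u \<and> i \<in> chosen u} = chosen u" using lt by (auto simp: chosen_def)
  then have len: "length ?v = ?K"
    using card_image[OF inj_chosen_pos[OF assms]] by (simp add: length_nths chosen_def)
  have mem: "p \<in> chosen u \<and> u ! p = i \<longleftrightarrow> p = chosen_pos u i" if "1 \<le> i" "i \<le> ?K" for p i
    using lt that by (auto simp: chosen_def)
  have "charge_index ?v i = wraps (chosen_pos u) i" if "i \<le> ?K" for i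
    using that
  proof (induction i)
    case 0 then show ?case by (simp add: wraps_0)
  next
    case (Suc i)
    show ?case
    proof (cases i)
      case 0
      then show ?thesis using lt[of 1] Suc.prems by (simp add: wraps_Suc wraps_0)
    next
      case (Suc i')
      have "(\<exists>k l. k < l \<and> l < length ?v \<and> ?v ! k = Suc (Suc i') \<and> ?v ! l = Suc i') \<longleftrightarrow>
            chosen_pos u (Suc (Suc i')) < chosen_pos u (Suc i')"
        unfolding ordered_occurrence_nths
        using mem[of "Suc i'"] mem[of "Suc (Suc i')"] lt[of "Suc i'"] Suc.prems Suc
        by (metis One_nat_def Suc_leD Suc_le_mono zero_le)
      moreover have "chosen_pos u (Suc (Suc i')) \<noteq> chosen_pos u (Suc i')"
        using lt(2)[of "Suc i'"] lt(2)[of "Suc (Suc i')"] Suc.prems Suc by (metis One_nat_def Suc_leD Suc_le_mono n_not_Suc_n zero_le)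
      ultimately show ?thesis using Suc.IH Suc.prems Suc by (simp only: charge_index.simps wraps_Suc) auto
    qed
  qed
  then show ?thesis using len by (simp add: standard_charge_def)
qed

lemma charge_rec:
  assumes "partition_content u" "u \<noteq> []"
  shows "charge u = (\<Sum>i = 1..Max (set u). wraps (chosen_pos u) i) + charge (nths u (- chosen u))"
  using assms standard_charge_chosen by (simp add: charge.simps[of u])

lemma partition_content_mset: "mset u = mset v \<Longrightarrow> partition_content u = partition_content v"
  by (metis partition_content_def set_mset_mset)

lemma charge_not_partition: "\<not> partition_content u \<Longrightarrow> charge u = 0"
  by (simp add: charge.simps)

lemma charge_Nil [simp]: "charge [] = 0"
  by (simp add: charge.simps)

text \<open>Evaluates the first round of the charge of a rearrangement \<open>u'\<close> from a
  guessed sequence \<open>p\<close> of positions. The invariance proofs below use it to compare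
  first rounds.\<close>

lemma charge_sim:
  assumes u: "partition_content u" "u \<noteq> []" and m: "mset u' = mset u"
    and p0: "p 0 = length u'"
    and nx: "\<And>i. i < Max (set u) \<Longrightarrow> is_next u' (Suc i) (p i) (p (Suc i))"
  shows "charge u' = (\<Sum>i = 1..Max (set u). wraps p i) + charge (nths u' (- (p ` {1..Max (set u)})))"
    "chosen u' = p ` {1..Max (set u)}"
proof -
  let ?K = "Max (set u)"
  have s: "set u' = set u" using m mset_eq_setD by blast
  have ne: "u' \<noteq> []" "partition_content u'" using u m partition_content_mset[OF m] by auto
  have eq: "\<And>i. i \<le> ?K \<Longrightarrow> chosen_pos u' i = p i" using chosen_pos_eqI[of p u' ?K] p0 nx by blast
  show ch: "chosen u' = p ` {1..?K}" unfolding chosen_def s by (rule image_cong) (auto simp: eq)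
  have "wraps (chosen_pos u') i = wraps p i" if "i \<le> ?K" for i
  proof -
    have "\<And>j. j \<le> i \<Longrightarrow> chosen_pos u' j = p j" using eq that by simp
    then have "{j \<in> {1..i}. chosen_pos u' (j - 1) < chosen_pos u' j} = {j \<in> {1..i}. p (j - 1) < p j}"
      by auto
    then show ?thesis by (simp add: wraps_def)
  qed
  then show "charge u' = (\<Sum>i = 1..?K. wraps p i) + charge (nths u' (- (p ` {1..?K})))"
    using charge_rec[OF ne(2,1)] ch s by simp
qed

lemma wraps_cong:
  assumes "\<And>j. 1 \<le> j \<Longrightarrow> j \<le> K \<Longrightarrow> p (j - 1) < p j \<longleftrightarrow> p' (j - 1) < p' j"
  shows "(\<Sum>i = 1..K. wraps p i) = (\<Sum>i = 1..K. wraps p' i)"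
proof (rule sum.cong)
  fix i assume "i \<in> {1..K}"
  then have "{j \<in> {1..i}. p (j - 1) < p j} = {j \<in> {1..i}. p' (j - 1) < p' j}"
    using assms by auto
  then show "wraps p i = wraps p' i" by (simp add: wraps_def)
qed simp


section \<open>Invariance of charge under Knuth relations\<close>

text \<open>A Knuth relation exchanges two letters in the presence of a witness. The witness may be
  removed with the first standard subword, so the Knuth relations themselves are not stable under
  the recursion of charge. If the exchanged letters differ by at least 2, \<open>far\<close>
  exchanges them without a witness; if they are \<open>x\<close> and \<open>x + 1\<close>, the
  witness equals one of them, which leaves \<open>zzx\<close> and \<open>xzx\<close>.\<close>

inductive swap_rel :: "nat list \<Rightarrow> nat list \<Rightarrow> bool" where
  far: "a + 2 \<le> b \<or> b + 2 \<le> a \<Longrightarrow> swap_rel (A @ [a, b] @ B) (A @ [b, a] @ B)"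
| zzx: "swap_rel (A @ [Suc x, Suc x, x] @ B) (A @ [Suc x, x, Suc x] @ B)"
| xzx: "swap_rel (A @ [x, Suc x, x] @ B) (A @ [Suc x, x, x] @ B)"

lemma is_next_less: "is_next u i p q \<Longrightarrow> k < p \<Longrightarrow> k < length u \<Longrightarrow> u ! k = i \<Longrightarrow> k \<le> q \<and> q < p"
  unfolding is_next_def by blast

lemma is_next_max: "is_next u i p q \<Longrightarrow> p \<le> q \<Longrightarrow> k < length u \<Longrightarrow> u ! k = i \<Longrightarrow> p \<le> k \<and> k \<le> q"
  unfolding is_next_def by (metis leD le_less_linear)

lemma is_next_chosen:
  assumes "partition_content u" "u \<noteq> []" "i < Max (set u)"
  shows "is_next u (Suc i) (chosen_pos u i) (chosen_pos u (Suc i))"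
proof -
  have "Suc i \<in> {1..Max (set u)}" using assms by auto
  then have "Suc i \<in> set u" by (simp only: partition_content_set[OF assms(1,2), symmetric])
  then show ?thesis by (rule is_next_chosen_pos)
qed

lemma chosen_pos_zero_or_nth:
  assumes "partition_content u" "u \<noteq> []" "i \<le> Max (set u)"
  shows "chosen_pos u i = length u \<and> i = 0 \<or> chosen_pos u i < length u \<and> u ! chosen_pos u i = i \<and> i \<ge> 1"
  using chosen_pos_nth[OF assms(1) _ assms(3,2)] by (cases i) auto

lemma nths_two:
  "nths (A @ [a, b] @ B) (- C) = nths A (- C) @ (if length A \<in> C then [] else [a]) @
     (if Suc (length A) \<in> C then [] else [b]) @ nths B {j. Suc (Suc (j + length A)) \<notin> C}"
  by (simp add: nths_append nths_Cons)

lemma nths_three: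
  "nths (A @ [a, b, c] @ B) (- C) = nths A (- C) @ (if length A \<in> C then [] else [a]) @
     (if Suc (length A) \<in> C then [] else [b]) @ (if Suc (Suc (length A)) \<in> C then [] else [c]) @
     nths B {j. Suc (Suc (Suc (j + length A))) \<notin> C}"
  by (simp add: nths_append nths_Cons)

lemma charge_swap_step:
  assumes u: "partition_content u" "u \<noteq> []" and m: "mset u' = mset u"
    and p0: "p 0 = length u"
    and nx: "\<And>i. i < Max (set u) \<Longrightarrow> is_next u' (Suc i) (p i) (p (Suc i))"
    and fl: "\<And>j. 1 \<le> j \<Longrightarrow> j \<le> Max (set u) \<Longrightarrow> chosen_pos u (j - 1) < chosen_pos u j \<longleftrightarrow> p (j - 1) < p j"
    and rest: "charge (nths u (- chosen u)) = charge (nths u' (- (p ` {1..Max (set u)})))"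
  shows "charge u = charge u'"
proof -
  have "length u' = length u" using m mset_eq_length by blast
  then show ?thesis
    using charge_sim(1)[OF u m, of p] p0 nx charge_rec[OF u] wraps_cong[of "Max (set u)" "chosen_pos u" p] fl rest
    by simp
qed

text \<open>A search runs between consecutive letters and hence never compares the two exchanged
  positions. If one of the letters is chosen in the first round, the remaining words coincide;
  otherwise they are again related by \<open>far\<close>.\<close>

lemma charge_far:
  assumes "a + 2 \<le> b \<or> b + 2 \<le> a" and u: "partition_content (A @ [a, b] @ B)"
    and IH: "\<And>v v'. length v < length (A @ [a, b] @ B) \<Longrightarrow> swap_rel v v' \<Longrightarrow> charge v = charge v'"
  shows "charge (A @ [a, b] @ B) = charge (A @ [b, a] @ B)"
proof -
  define s where "s = length A"
  define u where "u = A @ [a, b] @ B"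
  define u' where "u' = A @ [b, a] @ B"
  define \<tau> where "\<tau> = Transposition.transpose s (Suc s)"
  define p where "p = \<tau> \<circ> chosen_pos u"
  have pu: "partition_content u" "u \<noteq> []" using u by (auto simp: u_def)
  have len: "length u' = length u" "Suc s < length u" by (auto simp: u_def u'_def s_def)
  have bij: "bij_betw \<tau> {..<length u} {..<length u}"
    unfolding \<tau>_def by (rule permutes_imp_bij) (rule permutes_swap_id, use len in auto)
  have t: "\<tau> k = (if k = s then Suc s else if k = Suc s then s else k)" for k
    by (auto simp: \<tau>_def transpose_def)
  have us: "u ! s = a" "u ! Suc s = b" by (auto simp: u_def s_def nth_append)
  have us': "u' ! s = b" "u' ! Suc s = a" by (auto simp: u'_def s_def nth_append)
  have oth: "u' ! k = u ! k" if "k \<noteq> s" "k \<noteq> Suc s" for k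
    using that by (auto simp: u_def u'_def s_def nth_append nth_Cons split: nat.splits)
  have lett: "u' ! \<tau> k = u ! k" for k using us us' oth by (auto simp: t)
  have p0: "p 0 = length u" using len by (simp add: p_def t)
  have z: "chosen_pos u i = length u \<and> i = 0 \<or> chosen_pos u i < length u \<and> u ! chosen_pos u i = i \<and> i \<ge> 1"
    if "i \<le> Max (set u)" for i using chosen_pos_zero_or_nth[OF pu that] .
  have nx: "is_next u' (Suc i) (p i) (p (Suc i))" if "i < Max (set u)" for i
    unfolding p_def o_def
  proof (rule is_next_transfer[OF is_next_chosen[OF pu that] len(1) bij lett])
    fix k assume k: "k < length u" "u ! k = Suc i"
    show "\<tau> k < \<tau> (chosen_pos u i) \<longleftrightarrow> k < chosen_pos u i"
      using z[of i] that assms(1) us k len by (auto simp: t)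
  next
    fix k k' assume k: "u ! k = Suc i" "u ! k' = Suc i"
    show "\<tau> k \<le> \<tau> k' \<longleftrightarrow> k \<le> k'"
      using k us assms(1) by (auto simp: t)
  qed
  have fl: "chosen_pos u (j - 1) < chosen_pos u j \<longleftrightarrow> p (j - 1) < p j"
    if "1 \<le> j" "j \<le> Max (set u)" for j
    using z[of j] z[of "j - 1"] that us len assms(1) by (auto simp: p_def t)
  have C': "p ` {1..Max (set u)} = \<tau> ` chosen u" by (simp add: p_def chosen_def image_comp)
  have inC: "k \<in> \<tau> ` chosen u \<longleftrightarrow> \<tau> k \<in> chosen u" for k
    unfolding \<tau>_def by (rule in_transpose_image_iff)
  have A: "nths A (- (\<tau> ` chosen u)) = nths A (- chosen u)"
    by (rule nths_cong_pos) (auto simp: inC t s_def)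
  have B: "nths B {j. Suc (Suc (j + length A)) \<notin> \<tau> ` chosen u} =
      nths B {j. Suc (Suc (j + length A)) \<notin> chosen u}"
    by (rule nths_cong_pos) (auto simp: inC t s_def)
  have e: "nths u (- chosen u) = nths A (- chosen u) @ (if s \<in> chosen u then [] else [a]) @
     (if Suc s \<in> chosen u then [] else [b]) @ nths B {j. Suc (Suc (j + length A)) \<notin> chosen u}"
    using nths_two[of A a b B "chosen u", folded u_def s_def] unfolding s_def .
  have e': "nths u' (- (p ` {1..Max (set u)})) = nths A (- chosen u) @ (if Suc s \<in> chosen u then [] else [b]) @
     (if s \<in> chosen u then [] else [a]) @ nths B {j. Suc (Suc (j + length A)) \<notin> chosen u}"
    unfolding C' u'_def nths_two A B by (auto simp: inC t s_def)
  have rest: "charge (nths u (- chosen u)) = charge (nths u' (- (p ` {1..Max (set u)})))"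
  proof (cases "s \<in> chosen u \<or> Suc s \<in> chosen u")
    case True
    then show ?thesis unfolding e e' by auto
  next
    case False
    have l: "length (nths u (- chosen u)) < length u" using chosen_decreases[OF pu] .
    have "swap_rel (nths u (- chosen u)) (nths u' (- (p ` {1..Max (set u)})))"
      unfolding e e' using False swap_rel.far[OF assms(1)] by simp
    then show ?thesis using IH l unfolding u_def by metis
  qed
  have "charge u = charge u'"
    by (rule charge_swap_step[OF pu _ p0 nx fl rest]) (auto simp: u_def u'_def)
  then show ?thesis by (simp add: u_def u'_def)
qed


text \<open>In the first round the left \<open>x\<close> is never chosen, and if the right
  \<open>x\<close> is chosen, then so is the \<open>Suc x\<close> before it. Hence the remaining
  word either still contains the whole pattern or has lost the \<open>Suc x\<close>, and in the
  latter case both remaining words agree.\<close>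

lemma charge_xzx:
  assumes u: "partition_content (A @ [x, Suc x, x] @ B)"
    and IH: "\<And>v v'. length v < length (A @ [x, Suc x, x] @ B) \<Longrightarrow> swap_rel v v' \<Longrightarrow> charge v = charge v'"
  shows "charge (A @ [x, Suc x, x] @ B) = charge (A @ [Suc x, x, x] @ B)"
proof -
  define s where "s = length A"
  define u where "u = A @ [x, Suc x, x] @ B"
  define u' where "u' = A @ [Suc x, x, x] @ B"
  define \<tau> where "\<tau> = Transposition.transpose s (Suc s)"
  define p where "p = \<tau> \<circ> chosen_pos u"
  have pu: "partition_content u" "u \<noteq> []" using u by (auto simp: u_def)
  have len: "length u' = length u" "Suc (Suc s) < length u" by (auto simp: u_def u'_def s_def)
  have bij: "bij_betw \<tau> {..<length u} {..<length u}"
    unfolding \<tau>_def by (rule permutes_imp_bij) (rule permutes_swap_id, use len in auto)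
  have t: "\<tau> k = (if k = s then Suc s else if k = Suc s then s else k)" for k
    by (auto simp: \<tau>_def transpose_def)
  have us: "u ! s = x" "u ! Suc s = Suc x" "u ! Suc (Suc s) = x" by (auto simp: u_def s_def nth_append)
  have us': "u' ! s = Suc x" "u' ! Suc s = x" by (auto simp: u'_def s_def nth_append)
  have oth: "u' ! k = u ! k" if "k \<noteq> s" "k \<noteq> Suc s" for k
    using that by (auto simp: u_def u'_def s_def nth_append nth_Cons split: nat.splits)
  have lett: "u' ! \<tau> k = u ! k" for k using us us' oth by (auto simp: t)
  have p0: "p 0 = length u" using len by (simp add: p_def t)
  have z: "chosen_pos u i = length u \<and> i = 0 \<or> chosen_pos u i < length u \<and> u ! chosen_pos u i = i \<and> i \<ge> 1"
    if "i \<le> Max (set u)" for i using chosen_pos_zero_or_nth[OF pu that] .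
  \<comment> \<open>The search for \<open>x\<close> starts at a letter \<open>x - 1\<close> or at
    the right end, so not between the two \<open>x\<close>; the right one is met before the left
    one.\<close>
  have notfirst: "chosen_pos u i \<noteq> s" if i: "i \<le> Max (set u)" for i
  proof
    assume c: "chosen_pos u i = s"
    then have ix: "i = x" "x \<ge> 1" using z[OF i] us len by auto
    then obtain j where j: "i = Suc j" by (cases i) auto
    have n: "is_next u (Suc j) (chosen_pos u j) s" using is_next_chosen[OF pu, of j] i c j by simp
    have "chosen_pos u j \<noteq> Suc s" "chosen_pos u j \<noteq> Suc (Suc s)" using z[of j] us ix j i len by auto
    then show False
      using is_next_less[OF n, of "Suc (Suc s)"] is_next_max[OF n, of "Suc (Suc s)"] us ix j len
      by (cases "chosen_pos u j \<le> s") auto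
  qed
  have nx: "is_next u' (Suc i) (p i) (p (Suc i))" if "i < Max (set u)" for i
    unfolding p_def o_def
  proof (rule is_next_transfer[OF is_next_chosen[OF pu that] len(1) bij lett])
    fix k assume k: "k < length u" "u ! k = Suc i"
    show "\<tau> k < \<tau> (chosen_pos u i) \<longleftrightarrow> k < chosen_pos u i"
      using z[of i] notfirst[of i] that us k len by (auto simp: t)
  next
    fix k k' assume k: "u ! k = Suc i" "u ! k' = Suc i"
    show "\<tau> k \<le> \<tau> k' \<longleftrightarrow> k \<le> k'"
      using k us by (auto simp: t)
  qed
  have fl: "chosen_pos u (j - 1) < chosen_pos u j \<longleftrightarrow> p (j - 1) < p j"
    if "1 \<le> j" "j \<le> Max (set u)" for j
  proof -
    have j: "j - 1 \<le> Max (set u)" using that by simp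
    show ?thesis
      using z[OF that(2)] z[OF j] notfirst[OF that(2)] notfirst[OF j] that us len by (auto simp: p_def t)
  qed
  have C': "p ` {1..Max (set u)} = \<tau> ` chosen u" by (simp add: p_def chosen_def image_comp)
  have inC: "k \<in> \<tau> ` chosen u \<longleftrightarrow> \<tau> k \<in> chosen u" for k
    unfolding \<tau>_def by (rule in_transpose_image_iff)
  have A: "nths A (- (\<tau> ` chosen u)) = nths A (- chosen u)"
    by (rule nths_cong_pos) (auto simp: inC t s_def)
  have B: "nths B {j. Suc (Suc (Suc (j + length A))) \<notin> \<tau> ` chosen u} =
      nths B {j. Suc (Suc (Suc (j + length A))) \<notin> chosen u}"
    by (rule nths_cong_pos) (auto simp: inC t s_def)
  have sC: "s \<notin> chosen u" using notfirst by (force simp: chosen_def)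
  have e: "nths u (- chosen u) = nths A (- chosen u) @ [x] @ (if Suc s \<in> chosen u then [] else [Suc x]) @
     (if Suc (Suc s) \<in> chosen u then [] else [x]) @ nths B {j. Suc (Suc (Suc (j + length A))) \<notin> chosen u}"
    using nths_three[of A x "Suc x" x B "chosen u", folded u_def s_def] sC unfolding s_def by simp
  have e': "nths u' (- (p ` {1..Max (set u)})) = nths A (- chosen u) @ (if Suc s \<in> chosen u then [] else [Suc x]) @
     [x] @ (if Suc (Suc s) \<in> chosen u then [] else [x]) @ nths B {j. Suc (Suc (Suc (j + length A))) \<notin> chosen u}"
    unfolding C' u'_def nths_three A B using sC by (auto simp: inC t s_def)
  \<comment> \<open>The letter directly before the chosen \<open>x\<close> is \<open>Suc x\<close>,
    and this is where the next search ends.\<close>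
  have imp: "Suc s \<in> chosen u" if "Suc (Suc s) \<in> chosen u"
  proof -
    obtain i where i: "1 \<le> i" "i \<le> Max (set u)" "chosen_pos u i = Suc (Suc s)"
      using \<open>Suc (Suc s) \<in> chosen u\<close> by (auto simp: chosen_def)
    then have ix: "i = x" using z[of i] us by simp
    have "Suc x \<in> set u" by (simp add: u_def)
    then have le: "Suc x \<le> Max (set u)" by simp
    then have n: "is_next u (Suc x) (Suc (Suc s)) (chosen_pos u (Suc x))"
      using is_next_chosen[OF pu, of x] i ix by simp
    have "is_next u (Suc x) (Suc (Suc s)) (Suc s)"
      using us len by (auto simp: is_next_def le_Suc_eq less_Suc_eq)
    then have "chosen_pos u (Suc x) = Suc s" using n is_next_unique by blast
    then show ?thesis using le by (force simp: chosen_def)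
  qed
  have rest: "charge (nths u (- chosen u)) = charge (nths u' (- (p ` {1..Max (set u)})))"
  proof (cases "Suc s \<in> chosen u")
    case True
    then show ?thesis unfolding e e' by auto
  next
    case False
    have l: "length (nths u (- chosen u)) < length u" using chosen_decreases[OF pu] .
    have "swap_rel (nths u (- chosen u)) (nths u' (- (p ` {1..Max (set u)})))"
      unfolding e e' using False imp swap_rel.xzx by auto
    then show ?thesis using IH l unfolding u_def by metis
  qed
  have "charge u = charge u'"
    by (rule charge_swap_step[OF pu _ p0 nx fl rest]) (auto simp: u_def u'_def)
  then show ?thesis by (simp add: u_def u'_def)
qed

text \<open>The left \<open>Suc x\<close> is never chosen. If the \<open>x\<close> of the pattern is
  not chosen in the first round, exchanging the last two positions matches the searches. If it is
  chosen, so is the adjacent \<open>Suc x\<close>, and in both words one \<open>Suc x\<close>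
  survives.\<close>

lemma charge_zzx:
  assumes u: "partition_content (A @ [Suc x, Suc x, x] @ B)"
    and IH: "\<And>v v'. length v < length (A @ [Suc x, Suc x, x] @ B) \<Longrightarrow> swap_rel v v' \<Longrightarrow> charge v = charge v'"
  shows "charge (A @ [Suc x, Suc x, x] @ B) = charge (A @ [Suc x, x, Suc x] @ B)"
proof -
  define s where "s = length A"
  define u where "u = A @ [Suc x, Suc x, x] @ B"
  define u' where "u' = A @ [Suc x, x, Suc x] @ B"
  have pu: "partition_content u" "u \<noteq> []" using u by (auto simp: u_def)
  have len: "length u' = length u" "Suc (Suc s) < length u" by (auto simp: u_def u'_def s_def)
  have us: "u ! s = Suc x" "u ! Suc s = Suc x" "u ! Suc (Suc s) = x" by (auto simp: u_def s_def nth_append)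
  have us': "u' ! s = Suc x" "u' ! Suc s = x" "u' ! Suc (Suc s) = Suc x" by (auto simp: u'_def s_def nth_append)
  have oth: "u' ! k = u ! k" if "k \<noteq> s" "k \<noteq> Suc s" "k \<noteq> Suc (Suc s)" for k
    using that by (auto simp: u_def u'_def s_def nth_append nth_Cons split: nat.splits)
  have z: "chosen_pos u i = length u \<and> i = 0 \<or> chosen_pos u i < length u \<and> u ! chosen_pos u i = i \<and> i \<ge> 1"
    if "i \<le> Max (set u)" for i using chosen_pos_zero_or_nth[OF pu that] .
  have "Suc x \<in> set u" by (simp add: u_def)
  then have le: "Suc x \<le> Max (set u)" by simp
  have n: "is_next u (Suc x) (chosen_pos u x) (chosen_pos u (Suc x))"
    using is_next_chosen[OF pu, of x] le by simp
  have "chosen_pos u x \<noteq> s" "chosen_pos u x \<noteq> Suc s" using z[of x] le us len by auto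
  then have nots: "chosen_pos u (Suc x) \<noteq> s"
    using is_next_less[OF n, of "Suc s"] is_next_max[OF n, of "Suc s"] us len
    by (cases "chosen_pos u x \<le> s") auto
  have notfirst: "chosen_pos u i \<noteq> s" if i: "i \<le> Max (set u)" for i
    using nots z[OF i] us len by auto
  have sC: "s \<notin> chosen u" using notfirst by (force simp: chosen_def)
  have e: "nths u (- chosen u) = nths A (- chosen u) @ [Suc x] @ (if Suc s \<in> chosen u then [] else [Suc x]) @
     (if Suc (Suc s) \<in> chosen u then [] else [x]) @ nths B {j. Suc (Suc (Suc (j + length A))) \<notin> chosen u}"
    using nths_three[of A "Suc x" "Suc x" x B "chosen u", folded u_def s_def] sC unfolding s_def by simp
  have "charge u = charge u'"
  proof (cases "chosen_pos u x = Suc (Suc s)")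
    case False
    define \<tau> where "\<tau> = Transposition.transpose (Suc s) (Suc (Suc s))"
    define p where "p = \<tau> \<circ> chosen_pos u"
    have bij: "bij_betw \<tau> {..<length u} {..<length u}"
      unfolding \<tau>_def by (rule permutes_imp_bij) (rule permutes_swap_id, use len in auto)
    have t: "\<tau> k = (if k = Suc s then Suc (Suc s) else if k = Suc (Suc s) then Suc s else k)" for k
      by (auto simp: \<tau>_def transpose_def)
    have lett: "u' ! \<tau> k = u ! k" for k using us us' oth by (cases "k = s") (auto simp: t)
    have p0: "p 0 = length u" using len by (simp add: p_def t)
    have no2: "chosen_pos u i \<noteq> Suc (Suc s)" if i: "i \<le> Max (set u)" for i
      using False z[OF i] us len by auto
    have nx: "is_next u' (Suc i) (p i) (p (Suc i))" if "i < Max (set u)" for i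
      unfolding p_def o_def
    proof (rule is_next_transfer[OF is_next_chosen[OF pu that] len(1) bij lett])
      fix k assume k: "k < length u" "u ! k = Suc i"
      show "\<tau> k < \<tau> (chosen_pos u i) \<longleftrightarrow> k < chosen_pos u i"
        using z[of i] no2[of i] that us k len by (auto simp: t)
    next
      fix k k' assume k: "u ! k = Suc i" "u ! k' = Suc i"
      show "\<tau> k \<le> \<tau> k' \<longleftrightarrow> k \<le> k'"
        using k us by (auto simp: t)
    qed
    have fl: "chosen_pos u (j - 1) < chosen_pos u j \<longleftrightarrow> p (j - 1) < p j"
      if "1 \<le> j" "j \<le> Max (set u)" for j
      using z[of j] z[of "j - 1"] no2[of j] no2[of "j - 1"] that us len by (auto simp: p_def t)
    have C': "p ` {1..Max (set u)} = \<tau> ` chosen u" by (simp add: p_def chosen_def image_comp)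
    have inC: "k \<in> \<tau> ` chosen u \<longleftrightarrow> \<tau> k \<in> chosen u" for k
      unfolding \<tau>_def by (rule in_transpose_image_iff)
    have A: "nths A (- (\<tau> ` chosen u)) = nths A (- chosen u)"
      by (rule nths_cong_pos) (auto simp: inC t s_def)
    have B: "nths B {j. Suc (Suc (Suc (j + length A))) \<notin> \<tau> ` chosen u} =
        nths B {j. Suc (Suc (Suc (j + length A))) \<notin> chosen u}"
      by (rule nths_cong_pos) (auto simp: inC t s_def)
    have s2C: "Suc (Suc s) \<notin> chosen u" using no2 by (force simp: chosen_def)
    have e': "nths u' (- (p ` {1..Max (set u)})) = nths A (- chosen u) @ [Suc x] @
       [x] @ (if Suc s \<in> chosen u then [] else [Suc x]) @ nths B {j. Suc (Suc (Suc (j + length A))) \<notin> chosen u}"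
      unfolding C' u'_def nths_three A B using sC s2C by (auto simp: inC t s_def)
    have rest: "charge (nths u (- chosen u)) = charge (nths u' (- (p ` {1..Max (set u)})))"
    proof (cases "Suc s \<in> chosen u")
      case True
      then show ?thesis unfolding e e' using s2C by auto
    next
      case False
      have l: "length (nths u (- chosen u)) < length u" using chosen_decreases[OF pu] .
      have "swap_rel (nths u (- chosen u)) (nths u' (- (p ` {1..Max (set u)})))"
        unfolding e e' using False s2C swap_rel.zzx by auto
      then show ?thesis using IH l unfolding u_def by metis
    qed
    show ?thesis
      by (rule charge_swap_step[OF pu _ p0 nx fl rest]) (auto simp: u_def u'_def)
  next
    case True
    \<comment> \<open>The chosen pair \<open>Suc x\<close>, \<open>x\<close> occupies the positions
      s+1, s+2 in \<open>u\<close> but s, s+1 in \<open>u'\<close>, so the three positions rotate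
      instead of two being exchanged.\<close>
    define \<tau> where "\<tau> = (\<lambda>k. if k = s then Suc (Suc s) else if k = Suc s then s else if k = Suc (Suc s) then Suc s else k)"
    define \<sigma> where "\<sigma> = (\<lambda>k. if k = s then Suc s else if k = Suc s then Suc (Suc s) else if k = Suc (Suc s) then s else k)"
    define p where "p = \<tau> \<circ> chosen_pos u"
    have inv: "\<sigma> (\<tau> k) = k" "\<tau> (\<sigma> k) = k" for k by (auto simp: \<tau>_def \<sigma>_def)
    have bij: "bij_betw \<tau> {..<length u} {..<length u}"
      by (rule bij_betw_byWitness[where f' = \<sigma>]) (use len in \<open>auto simp: inv\<close>, auto simp: \<tau>_def \<sigma>_def)
    have lett: "u' ! \<tau> k = u ! k" for k using us us' oth by (auto simp: \<tau>_def)
    have p0: "p 0 = length u" using len by (simp add: p_def \<tau>_def)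
    have "is_next u (Suc x) (Suc (Suc s)) (Suc s)"
      using us len by (auto simp: is_next_def le_Suc_eq less_Suc_eq)
    then have cz: "chosen_pos u (Suc x) = Suc s" using n True is_next_unique by metis
    have nx: "is_next u' (Suc i) (p i) (p (Suc i))" if "i < Max (set u)" for i
    \<comment> \<open>\<open>\<tau>\<close> reverses the order of the two letters
      \<open>Suc x\<close>, so the search for \<open>Suc x\<close> cannot be transferred and is
      computed directly.\<close>
    proof (cases "i = x")
      case True
      have "is_next u' (Suc x) (Suc s) s"
        using us' len by (auto simp: is_next_def le_Suc_eq less_Suc_eq)
      then show ?thesis using True \<open>chosen_pos u x = Suc (Suc s)\<close> cz by (simp add: p_def \<tau>_def)
    next
      case False
      show ?thesis unfolding p_def o_def
      proof (rule is_next_transfer[OF is_next_chosen[OF pu that] len(1) bij lett])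
        fix k assume k: "k < length u" "u ! k = Suc i"
        show "\<tau> k < \<tau> (chosen_pos u i) \<longleftrightarrow> k < chosen_pos u i"
          using z[of i] notfirst[of i] that us k len False by (auto simp: \<tau>_def)
      next
        fix k k' assume k: "u ! k = Suc i" "u ! k' = Suc i"
        show "\<tau> k \<le> \<tau> k' \<longleftrightarrow> k \<le> k'"
          using k us False by (auto simp: \<tau>_def)
      qed
    qed
    have fl: "chosen_pos u (j - 1) < chosen_pos u j \<longleftrightarrow> p (j - 1) < p j"
      if "1 \<le> j" "j \<le> Max (set u)" for j
    proof -
      have j: "j - 1 \<le> Max (set u)" using that by simp
      show ?thesis
        using z[OF that(2)] z[OF j] notfirst[OF that(2)] notfirst[OF j] that us len cz True
        by (auto simp: p_def \<tau>_def)
    qed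
    have C': "p ` {1..Max (set u)} = \<tau> ` chosen u" by (simp add: p_def chosen_def image_comp)
    have inC: "k \<in> \<tau> ` chosen u \<longleftrightarrow> \<sigma> k \<in> chosen u" for k by (metis image_iff inv)
    have A: "nths A (- (\<tau> ` chosen u)) = nths A (- chosen u)"
      by (rule nths_cong_pos) (auto simp: inC \<sigma>_def s_def)
    have B: "nths B {j. Suc (Suc (Suc (j + length A))) \<notin> \<tau> ` chosen u} =
        nths B {j. Suc (Suc (Suc (j + length A))) \<notin> chosen u}"
      by (rule nths_cong_pos) (auto simp: inC \<sigma>_def s_def)
    have "x \<ge> 1" using z[of x] True le len by auto
    then have s2C: "Suc s \<in> chosen u" "Suc (Suc s) \<in> chosen u" using True cz le by (force simp: chosen_def)+
    have e': "nths u' (- (p ` {1..Max (set u)})) = nths A (- chosen u) @ [Suc x] @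
       nths B {j. Suc (Suc (Suc (j + length A))) \<notin> chosen u}"
      unfolding C' u'_def nths_three A B using sC s2C by (auto simp: inC \<sigma>_def s_def)
    have rest: "charge (nths u (- chosen u)) = charge (nths u' (- (p ` {1..Max (set u)})))"
      unfolding e e' using s2C by auto
    show ?thesis
      by (rule charge_swap_step[OF pu _ p0 nx fl rest]) (auto simp: u_def u'_def)
  qed
  then show ?thesis by (simp add: u_def u'_def)
qed

lemma charge_swap_rel: "swap_rel u u' \<Longrightarrow> charge u = charge u'"
proof (induction "length u" arbitrary: u u' rule: less_induct)
  case less
  have IH: "\<And>v v'. length v < length u \<Longrightarrow> swap_rel v v' \<Longrightarrow> charge v = charge v'"
    using less.hyps by blast
  have m: "mset u = mset u'" using less.prems by cases auto
  show ?case
  proof (cases "partition_content u")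
    case False
    then show ?thesis using partition_content_mset[OF m] charge_not_partition by metis
  next
    case True
    show ?thesis using less.prems
    proof cases
      case far then show ?thesis using charge_far True IH by auto
    next
      case zzx then show ?thesis using charge_zzx True IH by auto
    next
      case xzx then show ?thesis using charge_xzx True IH by auto
    qed
  qed
qed

lemma charge_knuth_step: "knuth_step u u' \<Longrightarrow> charge u = charge u'"
proof (induction rule: knuth_step.induct)
  case (1 x y z u v)
  show ?case
  proof (cases "z = Suc x")
    case True
    then have "y = Suc x" using 1 by simp
    then show ?thesis using True charge_swap_rel[OF swap_rel.zzx] by simp
  next
    case False
    then have "swap_rel ((u @ [y]) @ [z, x] @ v) ((u @ [y]) @ [x, z] @ v)"
      using 1 by (intro swap_rel.far) auto
    then show ?thesis using charge_swap_rel by fastforce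
  qed
next
  case (2 x y z u v)
  show ?case
  proof (cases "z = Suc x")
    case True
    then have "y = x" using 2 by simp
    then show ?thesis using True charge_swap_rel[OF swap_rel.xzx] by simp
  next
    case False
    then have "swap_rel (u @ [x, z] @ ([y] @ v)) (u @ [z, x] @ ([y] @ v))"
      using 2 by (intro swap_rel.far) auto
    then show ?thesis using charge_swap_rel by fastforce
  qed
qed

lemma charge_knuth_equiv: "knuth_equiv u u' \<Longrightarrow> charge u = charge u'"
  unfolding knuth_equiv_def by (induction rule: equivclp_induct) (auto dest: charge_knuth_step)


section \<open>Rotation of a word and removal of its smallest letter\<close>

lemma mset_nths_chosen:
  assumes u: "partition_content u" "u \<noteq> []"
  shows "mset (nths u (chosen u)) = mset_set {1..Max (set u)}"
proof -
  have lt: "chosen_pos u i < length u" "u ! chosen_pos u i = i" if "i \<in> {1..Max (set u)}" for i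
    using chosen_pos_nth[OF u(1) _ _ u(2)] that by auto
  have inj: "inj_on ((!) u) (chosen u)" by (rule inj_onI) (auto simp: chosen_def lt(2)[simplified])
  have "set (filter (\<lambda>i. i \<in> chosen u) [0..<length u]) = chosen u"
    using lt(1) by (auto simp: chosen_def)
  then have "mset (filter (\<lambda>i. i \<in> chosen u) [0..<length u]) = mset_set (chosen u)"
    by (metis distinct_filter distinct_upt mset_set_set)
  then have "mset (nths u (chosen u)) = image_mset ((!) u) (mset_set (chosen u))"
    unfolding nths_conv_map mset_map by simp
  also have "\<dots> = mset_set ((!) u ` chosen u)" using inj by (rule image_mset_mset_set)
  also have "(!) u ` chosen u = {1..Max (set u)}"
    unfolding chosen_def image_image
    using image_cong[OF refl lt(2), of "{1..Max (set u)}"] by simp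
  finally show ?thesis .
qed

text \<open>One copy of each occurring letter is removed, which keeps the multiplicities weakly
  decreasing. The recursion of charge therefore never leaves the words of partition content.\<close>

lemma partition_content_nths_chosen:
  assumes u: "partition_content u" "u \<noteq> []"
  shows "partition_content (nths u (- chosen u))"
proof -
  let ?K = "Max (set u)"
  have c: "count (mset u) i = (if 1 \<le> i \<and> i \<le> ?K then 1 else 0) + count (mset (nths u (- chosen u))) i" for i
    using arg_cong[OF mset_nths_split[of u "chosen u"], of "\<lambda>M. count M i"] mset_nths_chosen[OF u]
    by (simp add: count_mset_set')
  have zero: "count (mset u) i = 0" if "i > ?K" for i
    using that by (metis List.finite_set Max_ge count_eq_zero_iff linorder_not_le set_mset_mset)
  have le: "count (mset u) (Suc i) \<le> count (mset u) i" if "1 \<le> i" for i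
    using u that by (auto simp: partition_content_def)
  have "count (mset (nths u (- chosen u))) (Suc i) \<le> count (mset (nths u (- chosen u))) i" if "1 \<le> i" for i
  proof (cases "Suc i \<le> ?K")
    case True
    then show ?thesis using that c[of i] c[of "Suc i"] le[of i] by simp
  next
    case False
    then have "count (mset (nths u (- chosen u))) (Suc i) = 0"
      using c[of "Suc i"] zero[of "Suc i"] by (metis add_is_0 not_le)
    then show ?thesis by linarith
  qed
  then show ?thesis using u(1) unfolding partition_content_def by (meson in_set_nthsD)
qed

text \<open>The search is cyclic, so it does not notice that the last letter moves to the front. The
  exception is a search for \<open>x\<close> starting at the right end: it stops at the last letter
  before the rotation but may prefer another \<open>x\<close> afterwards.\<close>

lemma is_next_rotate:
  assumes n: "is_next (w @ [x]) i p q" and p: "p \<le> Suc (length w)" "p \<ge> length w \<Longrightarrow> i \<noteq> x"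
  defines "\<tau> \<equiv> \<lambda>k. if k = length w then 0 else if k < length w then Suc k else k"
  shows "is_next (x # w) i (\<tau> p) (\<tau> q)"
proof -
  have q: "q \<le> length w" "(w @ [x]) ! q = i" using n by (auto simp: is_next_def)
  have all: "(q < p \<and> (k < p \<longrightarrow> k \<le> q)) \<or> (\<not> q < p \<and> \<not> k < p \<and> k \<le> q)"
    if "k < length w" "w ! k = i" for k
    using n that unfolding is_next_def by (auto simp: nth_append)
  have last: "(q < p \<and> (length w < p \<longrightarrow> length w \<le> q)) \<or> (\<not> q < p \<and> \<not> length w < p \<and> length w \<le> q)"
    if "i = x"
    using n that unfolding is_next_def by (auto simp: nth_append)
  have tq: "\<tau> q < length (x # w)" "(x # w) ! \<tau> q = i"
    using q by (auto simp: \<tau>_def nth_append)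
  have "(\<tau> q < \<tau> p \<and> (k < \<tau> p \<longrightarrow> k \<le> \<tau> q)) \<or> (\<not> \<tau> q < \<tau> p \<and> \<not> k < \<tau> p \<and> k \<le> \<tau> q)"
    if k: "k < length (x # w)" "(x # w) ! k = i" for k
  proof (cases k)
    case 0
    then have ix: "i = x" using k by simp
    then have "p < length w" using p by force
    then show ?thesis using last[OF ix] q 0 by (auto simp: \<tau>_def)
  next
    case (Suc k')
    then have k': "k' < length w" "w ! k' = i" using k by auto
    have "q = length w \<Longrightarrow> p < length w" using p(2) q by (force simp: nth_append)
    then show ?thesis using all[OF k'] q p(1) k' Suc by (auto simp: \<tau>_def)
  qed
  then show ?thesis using tq unfolding is_next_def by blast
qed

text \<open>Suppose the last letter is chosen in the first round. The search for \<open>x\<close>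
  wrapped to reach it, and the search for the next letter, if any, did not wrap; at the front of the
  word it is the other way round. Hence only the index of \<open>x\<close> drops, by 1. If the last
  letter is not chosen, the first round is unchanged and the claim passes to the remaining word. The
  letter 1 is excluded because its search starts at the right end.\<close>

lemma charge_rotate:
  assumes "partition_content (w @ [x])" "x \<noteq> 1"
  shows "charge (w @ [x]) = Suc (charge (x # w))"
  using assms
proof (induction "length w" arbitrary: w rule: less_induct)
  case less
  define u where "u = w @ [x]"
  define u' where "u' = x # w"
  define \<tau> where "\<tau> = (\<lambda>k. if k = length w then 0 else if k < length w then Suc k else k)"
  define P where "P = chosen_pos u"
  define p where "p = \<tau> \<circ> P"
  define K where "K = Max (set u)"
  have pu: "partition_content u" "u \<noteq> []" using less.prems by (auto simp: u_def)
  have lu: "length u = Suc (length w)" by (simp add: u_def)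
  have m: "mset u' = mset u" by (simp add: u_def u'_def)
  have ul: "u ! length w = x" by (simp add: u_def)
  have x0: "x \<noteq> 0" using pu by (auto simp: u_def partition_content_def)
  have xK: "x \<le> K" by (simp add: K_def u_def)
  have z: "P i = length u \<and> i = 0 \<or> P i < length u \<and> u ! P i = i \<and> i \<ge> 1" if "i \<le> K" for i
    using chosen_pos_zero_or_nth[OF pu that[unfolded K_def]] by (simp add: P_def)
  have nP: "is_next u (Suc i) (P i) (P (Suc i))" if "i < K" for i
    using is_next_chosen[OF pu that[unfolded K_def]] by (simp add: P_def)
  have nx: "is_next u' (Suc i) (p i) (p (Suc i))" if "i < K" for i
  proof -
    have "P i \<le> Suc (length w)" using z[of i] that lu by auto
    moreover have "Suc i \<noteq> x" if "length w \<le> P i"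
    proof -
      have "P i = length w \<or> P i = Suc (length w)" using that z[of i] \<open>i < K\<close> lu by auto
      then show ?thesis using z[of i] \<open>i < K\<close> lu ul less.prems(2) by auto
    qed
    ultimately show ?thesis
      using is_next_rotate[of w x "Suc i" "P i" "P (Suc i)"] nP[OF that]
      unfolding p_def o_def \<tau>_def u_def u'_def by blast
  qed
  have p0: "p 0 = length u'" using z[of 0] lu by (simp add: p_def \<tau>_def P_def u'_def)
  have sim: "charge u' = (\<Sum>i = 1..K. wraps p i) + charge (nths u' (- (p ` {1..K})))"
    using charge_sim(1)[OF pu m, of p] p0 nx unfolding K_def by blast
  have main: "charge u = (\<Sum>i = 1..K. wraps P i) + charge (nths u (- chosen u))"
    using charge_rec[OF pu] by (simp add: K_def P_def)
  have C': "p ` {1..K} = \<tau> ` chosen u" by (simp add: p_def chosen_def image_comp K_def P_def)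
  have Cle: "chosen u \<subseteq> {..length w}" 
  proof
    fix k assume "k \<in> chosen u"
    then obtain i where "i \<in> {1..K}" "k = P i" by (auto simp: chosen_def K_def P_def)
    then show "k \<in> {..length w}" using z[of i] lu by auto
  qed
  have inC: "0 \<in> \<tau> ` chosen u \<longleftrightarrow> length w \<in> chosen u"
    "j < length w \<Longrightarrow> Suc j \<in> \<tau> ` chosen u \<longleftrightarrow> j \<in> chosen u" for j
    using Cle by (force simp: \<tau>_def)+
  have e: "nths u (- chosen u) = nths w (- chosen u) @ (if length w \<in> chosen u then [] else [x])"
    by (simp add: u_def nths_append)
  have "nths w {j. Suc j \<notin> \<tau> ` chosen u} = nths w (- chosen u)"
    by (rule nths_cong_pos) (simp add: inC)
  then have e': "nths u' (- (p ` {1..K})) = (if length w \<in> chosen u then [] else [x]) @ nths w (- chosen u)"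
    unfolding C' by (simp add: u'_def nths_Cons inC)
  have inch: "length w \<in> chosen u \<longleftrightarrow> P x = length w"
    using z ul xK x0 unfolding chosen_def K_def[symmetric] P_def[symmetric]
    by (force simp: image_iff)
  show ?case
  proof (cases "P x = length w")
    case True
    \<comment> \<open>The counts are cumulative: the wrap lost at \<open>x\<close> is regained at
      \<open>x + 1\<close>, so the difference is confined to \<open>i = x\<close>.\<close>
    have "wraps P i = wraps p i + (if i = x then 1 else 0)" if "i \<le> K" for i
      using that
    proof (induction i)
      case 0 then show ?case using x0 by (simp add: wraps_0)
    next
      case (Suc i)
      have zz: "P i < length u \<longrightarrow> u ! P i = i" "P (Suc i) < length u" "u ! P (Suc i) = Suc i" "P i \<le> length u"
        "P i = length u \<longrightarrow> i = 0"
        using z[of i] z[of "Suc i"] Suc.prems by auto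
      have a: "P (Suc i) = length w \<longleftrightarrow> Suc i = x" "P i = length w \<longleftrightarrow> i = x" using zz True ul lu
        by (auto simp: less_Suc_eq)
      have IH: "wraps P i = wraps p i + (if i = x then 1 else 0)" using Suc by simp
      consider "Suc i = x" | "i = x" | "Suc i \<noteq> x" "i \<noteq> x" by blast
      then show ?case
      proof cases
        case 1
        then have "i \<noteq> 0" using less.prems(2) by auto
        then have "P i < P (Suc i)" "\<not> p i < p (Suc i)" using 1 a zz lu by (auto simp: p_def \<tau>_def)
        then show ?thesis unfolding wraps_Suc using IH 1 by simp
      next
        case 2
        then have "\<not> P i < P (Suc i)" "p i < p (Suc i)" using a zz lu by (auto simp: p_def \<tau>_def)
        then show ?thesis unfolding wraps_Suc using IH 2 by simp
      next
        case 3
        then have "P i \<noteq> length w" "P (Suc i) \<noteq> length w" using a by auto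
        then have "P i < P (Suc i) \<longleftrightarrow> p i < p (Suc i)" using zz lu by (auto simp: p_def \<tau>_def)
        then show ?thesis unfolding wraps_Suc using IH 3 by simp
      qed
    qed
    then have "(\<Sum>i = 1..K. wraps P i) = (\<Sum>i = 1..K. wraps p i + (if i = x then 1 else 0))"
      by (intro sum.cong) auto
    also have "\<dots> = (\<Sum>i = 1..K. wraps p i) + 1" using x0 xK by (simp add: sum.distrib)
    finally show ?thesis using main sim e e' True inch unfolding u_def u'_def by simp
  next
    case False
    have fl: "P (j - 1) < P j \<longleftrightarrow> p (j - 1) < p j" if "1 \<le> j" "j \<le> K" for j
    proof -
      have no: "P i \<noteq> length w" if "i \<le> K" for i using False z[OF that] ul lu by auto
      have j: "j - 1 \<le> K" using that by simp
      show ?thesis using no[OF that(2)] no[OF j] z[OF that(2)] z[OF j] lu that by (auto simp: p_def \<tau>_def)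
    qed
    have s: "(\<Sum>i = 1..K. wraps P i) = (\<Sum>i = 1..K. wraps p i)" by (rule wraps_cong) (rule fl)
    have r: "nths u (- chosen u) = nths w (- chosen u) @ [x]"
      "nths u' (- (p ` {1..K})) = x # nths w (- chosen u)" using e e' False inch by auto
    have "length (nths w (- chosen u)) < length w"
      using chosen_decreases[OF pu] r(1) lu by simp
    then have "charge (nths w (- chosen u) @ [x]) = Suc (charge (x # nths w (- chosen u)))"
      using less.hyps partition_content_nths_chosen[OF pu] less.prems(2) r(1) by metis
    then show ?thesis using main sim s r unfolding u_def u'_def by simp
  qed
qed

text \<open>A search that starts at one of the final letters 1 has all of \<open>w\<close> to its
  left, just like a search from the right end once these letters are deleted. This explains the
  changed starting point.\<close>

lemma is_next_drop_ones:
  assumes n: "is_next (w @ replicate k (1::nat)) (Suc i) p q" and i: "i \<ge> 1"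
  shows "is_next (map (\<lambda>z. z - 1) w) i (if p < length w then p else length w) q"
proof -
  have q: "q < length w + k" "(w @ replicate k (1::nat)) ! q = Suc i" using n by (auto simp: is_next_def)
  then have qw: "q < length w" "w ! q = Suc i" using i by (auto simp: nth_append split: if_splits)
  have "(q < p \<and> (j < p \<longrightarrow> j \<le> q)) \<or> (\<not> q < p \<and> \<not> j < p \<and> j \<le> q)"
    if "j < length w" "w ! j = Suc i" for j
    using n that unfolding is_next_def by (auto simp: nth_append)
  moreover have "w ! j = Suc i \<longleftrightarrow> w ! j - 1 = i" for j using i by auto
  ultimately show ?thesis using qw unfolding is_next_def by auto
qed

text \<open>With all letters 1 at the end, a round chooses the last of them, and the search for 2
  starts to the right of all other letters, as the search for 1 does in the lowered word. So the
  index of each letter \<open>i + 1\<close> equals that of \<open>i\<close> in the lowered word, and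
  each round uses up one letter 1.\<close>

lemma charge_drop_ones:
  assumes "partition_content (w @ replicate k (1::nat))" "1 \<notin> set w"
  shows "charge (w @ replicate k (1::nat)) = charge (map (\<lambda>z. z - 1) w)"
  using assms
proof (induction k arbitrary: w)
  case 0
  then have "w = []" using partition_content_one[of w] by auto
  then show ?case by simp
next
  case (Suc k)
  define u where "u = w @ replicate (Suc k) (1::nat)"
  define v where "v = map (\<lambda>z. z - 1) w"
  define P where "P = chosen_pos u"
  define K where "K = Max (set u)"
  have pu: "partition_content u" "u \<noteq> []" using Suc.prems by (auto simp: u_def)
  have lu: "length u = Suc (length w + k)" by (simp add: u_def)
  have z: "P i = length u \<and> i = 0 \<or> P i < length u \<and> u ! P i = i \<and> i \<ge> 1" if "i \<le> K" for i
    using chosen_pos_zero_or_nth[OF pu that[unfolded K_def]] by (simp add: P_def)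
  have nP: "is_next u (Suc i) (P i) (P (Suc i))" if "i < K" for i
    using is_next_chosen[OF pu that[unfolded K_def]] by (simp add: P_def)
  have K1: "1 \<le> K" by (simp add: u_def K_def)
  have w2: "2 \<le> x" if "x \<in> set w" for x
  proof -
    have "0 \<notin> set w" using pu by (auto simp: u_def partition_content_def)
    then have "x \<noteq> 0" "x \<noteq> 1" using that Suc.prems(2) by metis+
    then show ?thesis by simp
  qed
  have P0: "P 0 = length u" using z[of 0] by simp
  have uend: "u ! j = 1" if "length w \<le> j" "j < length u" for j
    using that by (auto simp: u_def nth_append simp del: replicate_Suc)
  have uw: "u ! j = w ! j" if "j < length w" for j using that by (simp add: u_def nth_append)
  have "is_next u 1 (length u) (length w + k)" using lu uend[of "length w + k"] by (auto simp: is_next_def)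
  then have P1: "P 1 = length w + k" using nP[of 0] K1 P0 is_next_unique by (metis One_nat_def Suc_le_lessD)
  have Pw: "P (Suc i) < length w" if "Suc i \<le> K" "i \<ge> 1" for i
    using z[OF that(1)] uend[of "P (Suc i)"] that by (metis One_nat_def Suc_inject not_less not_one_le_zero old.nat.distinct(2))
  \<comment> \<open>The positions chosen in the lowered word; \<open>Q 0\<close> is its right end
    and stands in for the position of the letter 1.\<close>
  define Q where "Q i = (if i = 0 then length w else P (Suc i))" for i
  have nQ: "is_next v (Suc i) (Q i) (Q (Suc i))" if "i < K - 1" for i
  proof -
    have "is_next v (Suc i) (if P (Suc i) < length w then P (Suc i) else length w) (P (Suc (Suc i)))"
      unfolding v_def by (rule is_next_drop_ones[of _ "Suc k"]) (use nP[of "Suc i"] that in \<open>auto simp: u_def\<close>)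
    moreover have "(if P (Suc i) < length w then P (Suc i) else length w) = Q i"
      using P1 Pw[of i] that by (auto simp: Q_def)
    ultimately show ?thesis by (simp add: Q_def)
  qed
  have fl: "wraps P (Suc i) = wraps Q i" if "i \<le> K - 1" for i
    using that
  proof (induction i)
    case 0 then show ?case using P0 P1 lu by (simp add: wraps_Suc wraps_0)
  next
    case (Suc i)
    have "P (Suc i) < P (Suc (Suc i)) \<longleftrightarrow> Q i < Q (Suc i)"
    proof -
      have "Suc (Suc i) \<le> K" using Suc.prems K1 by simp
      then have "P (Suc (Suc i)) < length w" using Pw[of "Suc i"] by simp
      then show ?thesis using P1 by (auto simp: Q_def)
    qed
    then show ?case using Suc by (simp add: wraps_Suc[of P "Suc i"] wraps_Suc[of Q i])
  qed
  have sumeq: "(\<Sum>i = 1..K. wraps P i) = (\<Sum>i = 1..K - 1. wraps Q i)"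
  proof -
    have "(\<Sum>i = 1..K. wraps P i) = (\<Sum>i = 0..K - 1. wraps P (Suc i))"
      using K1 by (metis One_nat_def Suc_pred' sum.shift_bounds_cl_Suc_ivl Suc_le_lessD)
    also have "\<dots> = (\<Sum>i = 0..K - 1. wraps Q i)" by (rule sum.cong) (auto simp: fl)
    also have "\<dots> = (\<Sum>i = 1..K - 1. wraps Q i)" by (simp add: sum.atLeast_Suc_atMost wraps_0)
    finally show ?thesis .
  qed
  have C: "chosen u = P ` {1..K}" by (simp add: chosen_def P_def K_def)
  have "{1..K} = insert 1 (Suc ` {1..K - 1})" using K1 by (auto simp: image_Suc_atLeastAtMost)
  moreover have "Q ` {1..K - 1} = (\<lambda>i. P (Suc i)) ` {1..K - 1}"
    by (rule image_cong) (auto simp: Q_def)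
  ultimately have C1: "chosen u = insert (length w + k) (Q ` {1..K - 1})"
    unfolding C by (simp only: image_insert image_image P1)
  have Qw: "Q ` {1..K - 1} \<subseteq> {..<length w}" using Pw by (auto simp: Q_def)
  have ru: "nths u (- chosen u) = nths w (- (Q ` {1..K - 1})) @ replicate k (1::nat)"
  proof -
    have "u = w @ replicate k (1::nat) @ [1]" by (simp add: u_def replicate_append_same)
    then have "nths u (- chosen u) = nths w (- chosen u) @ nths (replicate k (1::nat)) {j. j + length w \<notin> chosen u}
       @ (if length w + k \<in> chosen u then [] else [1])"
      by (simp add: nths_append add.commute)
    moreover have "nths w (- chosen u) = nths w (- (Q ` {1..K - 1}))"
      by (rule nths_cong_pos) (auto simp: C1)
    moreover have "nths (replicate k (1::nat)) {j. j + length w \<notin> chosen u} = replicate k (1::nat)"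
      by (rule nths_all) (use Qw in \<open>auto simp: C1\<close>)
    ultimately show ?thesis by (simp add: C1)
  qed
  have main: "charge u = (\<Sum>i = 1..K. wraps P i) + charge (nths u (- chosen u))"
    using charge_rec[OF pu] by (simp add: K_def P_def)
  have IH: "charge (nths u (- chosen u)) = charge (map (\<lambda>z. z - 1) (nths w (- (Q ` {1..K - 1}))))"
    unfolding ru by (rule Suc.IH) (use partition_content_nths_chosen[OF pu] ru Suc.prems(2) in \<open>auto dest: in_set_nthsD\<close>)
  have "charge v = (\<Sum>i = 1..K - 1. wraps Q i) + charge (nths v (- (Q ` {1..K - 1})))"
  proof (cases "w = []")
    case True
    then have "K = 1" by (simp add: K_def u_def set_replicate_conv_if)
    then show ?thesis using True by (simp add: v_def)
  next
    case False
    have cv: "count (mset v) i = count (mset u) (Suc i)" if "1 \<le> i" for i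
    proof -
      have "filter ((=) i) (map (\<lambda>z. z - 1) w) = map (\<lambda>z. z - 1) (filter ((=) (Suc i)) w)"
        unfolding filter_map o_def using that by (intro arg_cong[where f = "map _"] filter_cong) auto
      moreover have cnt: "count (mset xs) y = length (filter ((=) y) xs)" for xs :: "nat list" and y
        by (induction xs) auto
      ultimately have "count (mset v) i = count (mset w) (Suc i)" unfolding v_def cnt by simp
      then show ?thesis using that by (simp add: u_def)
    qed
    have "0 \<notin> set v" using w2 by (force simp: v_def)
    then have pv: "partition_content v" using pu(1) cv by (auto simp: partition_content_def)
    have vn: "v \<noteq> []" using False by (simp add: v_def)
    have Kv: "Max (set v) = K - 1"
    proof -
      have "Max (set w) \<in> set w" using False by simp
      then have "2 \<le> Max (set w)" using w2 by blast
      moreover have "set u = insert 1 (set w)" by (auto simp: u_def)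
      then have "K = max 1 (Max (set w))" unfolding K_def using False by (simp add: Max_insert)
      ultimately have "Max (set w) = K" by simp
      moreover have "Max ((\<lambda>z. z - 1) ` set w) = Max (set w) - 1"
        using False by (intro mono_Max_commute[symmetric]) (auto simp: mono_def)
      ultimately show ?thesis by (simp add: v_def)
    qed
    show ?thesis
      using charge_sim(1)[OF pv vn, of v Q] nQ Kv by (simp add: Q_def v_def)
  qed
  then show ?case using main sumeq IH unfolding u_def[symmetric] v_def[symmetric]
    by (simp add: v_def nths_map)
qed


section \<open>Knuth equivalence\<close>

lemma knuth_equiv_refl [simp, intro]: "knuth_equiv u u"
  by (simp add: knuth_equiv_def equivclp_refl)

lemma knuth_equiv_sym: "knuth_equiv u v \<Longrightarrow> knuth_equiv v u"
  unfolding knuth_equiv_def by (rule equivclp_sym)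

lemma knuth_equiv_trans [trans]: "knuth_equiv u v \<Longrightarrow> knuth_equiv v w \<Longrightarrow> knuth_equiv u w"
  unfolding knuth_equiv_def by (rule equivclp_trans)

lemma knuth_step_imp_equiv: "knuth_step u v \<Longrightarrow> knuth_equiv u v"
  unfolding knuth_equiv_def by (simp add: r_into_equivclp)

lemma knuth_step_context: "knuth_step u v \<Longrightarrow> knuth_step (a @ u @ b) (a @ v @ b)"
proof (induction rule: knuth_step.induct)
  case (1 x y z u v)
  then show ?case using knuth_step.intros(1)[OF 1, of "a @ u" "v @ b"] by simp
next
  case (2 x y z u v)
  then show ?case using knuth_step.intros(2)[OF 2, of "a @ u" "v @ b"] by simp
qed

lemma knuth_equiv_induct [consumes 1, case_names refl step]:
  assumes "knuth_equiv u v" "P u"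
    and "\<And>v w. knuth_equiv u v \<Longrightarrow> knuth_step v w \<or> knuth_step w v \<Longrightarrow> P v \<Longrightarrow> P w"
  shows "P v"
  using assms unfolding knuth_equiv_def by (rule equivclp_induct)

lemma knuth_equiv_context: "knuth_equiv u v \<Longrightarrow> knuth_equiv (a @ u @ b) (a @ v @ b)"
proof (induction rule: knuth_equiv_induct)
  case (step v w)
  then show ?case
    by (meson knuth_equiv_sym knuth_equiv_trans knuth_step_context knuth_step_imp_equiv)
qed simp

lemma knuth_equiv_prefix: "knuth_equiv u v \<Longrightarrow> knuth_equiv (a @ u) (a @ v)"
  using knuth_equiv_context[of u v a "[]"] by simp

lemma knuth_equiv_suffix: "knuth_equiv u v \<Longrightarrow> knuth_equiv (u @ b) (v @ b)"
  using knuth_equiv_context[of u v "[]" b] by simp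

lemma knuth_equiv_Cons: "knuth_equiv u v \<Longrightarrow> knuth_equiv (a # u) (a # v)"
  using knuth_equiv_prefix[of u v "[a]"] by simp

lemma knuth_step_mset: "knuth_step u v \<Longrightarrow> mset u = mset v"
  by (induction rule: knuth_step.induct) auto

lemma knuth_equiv_mset: "knuth_equiv u v \<Longrightarrow> mset u = mset v"
  by (induction rule: knuth_equiv_induct) (auto dest: knuth_step_mset)

lemma knuth_step_map:
  assumes "knuth_step u v" "strict_mono_on (set u) f"
  shows "knuth_step (map f u) (map f v)"
  using assms
proof (induction rule: knuth_step.induct)
  case (1 x y z u v)
  then have "f x < f y" "f y \<le> f z"
    by (auto simp: strict_mono_on_def le_less)
  then show ?case using knuth_step.intros(1)[of "f x" "f y" "f z" "map f u" "map f v"] by simp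
next
  case (2 x y z u v)
  then have "f x \<le> f y" "f y < f z"
    by (auto simp: strict_mono_on_def le_less)
  then show ?case using knuth_step.intros(2)[of "f x" "f y" "f z" "map f u" "map f v"] by simp
qed

lemma knuth_equiv_map:
  assumes "knuth_equiv u v" "strict_mono_on (set u) f"
  shows "knuth_equiv (map f u) (map f v)"
  using assms
proof (induction rule: knuth_equiv_induct)
  case (step v w)
  have "set v = set u" "set w = set u"
    using step.hyps knuth_equiv_mset knuth_step_mset by (metis mset_eq_setD)+
  then show ?case using step knuth_step_map knuth_step_imp_equiv
    by (metis knuth_equiv_sym knuth_equiv_trans)
qed simp

section \<open>Row insertion and slides as Knuth equivalences\<close>

lemma bump_tail:
  assumes "sorted (y # s)" "x < y"
  shows "knuth_equiv (y # s @ [x]) (y # x # s)"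
  using assms
proof (induction s rule: rev_induct)
  case (snoc a s)
  define b where "b = last (y # s)"
  have yb: "y # s = butlast (y # s) @ [b]" by (simp only: b_def append_butlast_last_id list.distinct not_False_eq_True)
  have "b \<in> set (y # s)" by (simp add: b_def)
  then have b: "x < b" "b \<le> a" using snoc.prems by (auto simp: sorted_append)
  have "knuth_step (butlast (y # s) @ [b, a, x] @ []) (butlast (y # s) @ [b, x, a] @ [])"
    using b by (rule knuth_step.intros)
  then have "knuth_equiv ((butlast (y # s) @ [b]) @ [a, x]) ((butlast (y # s) @ [b]) @ [x, a])"
    using knuth_step_imp_equiv by simp
  then have "knuth_equiv ((y # s) @ [a, x]) ((y # s) @ [x, a])" unfolding yb[symmetric] .
  moreover have "knuth_equiv ((y # s @ [x]) @ [a]) ((y # x # s) @ [a])"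
    using snoc by (intro knuth_equiv_suffix) (auto simp: sorted_append)
  ultimately show ?case by (auto intro: knuth_equiv_trans)
qed simp

lemma bump_head:
  assumes "sorted p" "\<forall>a\<in>set p. a \<le> x" "x < y"
  shows "knuth_equiv (p @ [y, x]) (y # p @ [x])"
  using assms
proof (induction p)
  case (Cons a p)
  obtain b q where bq: "p @ [x] = b # q" by (cases "p @ [x]") auto
  then have "b \<in> set (p @ [x])" by simp
  then have b: "a \<le> b" "b < y" using Cons.prems by auto
  have "knuth_step ([] @ [a, y, b] @ q) ([] @ [y, a, b] @ q)" using b by (rule knuth_step.intros)
  then have "knuth_equiv (a # y # p @ [x]) (y # a # p @ [x])" using bq knuth_step_imp_equiv by simp
  moreover have "knuth_equiv (a # (p @ [y, x])) (a # y # p @ [x])"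
    using Cons by (intro knuth_equiv_Cons) auto
  ultimately show ?case by (auto intro: knuth_equiv_trans)
qed simp

text \<open>Schensted insertion of \<open>x\<close> into a row: \<open>y\<close>, the leftmost
  letter exceeding \<open>x\<close>, is replaced by \<open>x\<close> and moves to the front.
  \<open>bump_tail\<close> carries \<open>x\<close> leftwards to \<open>y\<close>, and
  \<open>bump_head\<close> carries \<open>y\<close> out over the letters before it.\<close>

lemma row_bump:
  assumes "sorted (p @ y # s)" "\<forall>a\<in>set p. a \<le> x" "x < y"
  shows "knuth_equiv ((p @ y # s) @ [x]) (y # p @ x # s)"
proof -
  have "knuth_equiv (p @ (y # s @ [x])) (p @ (y # x # s))"
    using assms by (intro knuth_equiv_prefix bump_tail) (auto simp: sorted_append)
  moreover have "knuth_equiv ((p @ [y, x]) @ s) ((y # p @ [x]) @ s)"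
    using assms by (intro knuth_equiv_suffix bump_head) (auto simp: sorted_append)
  ultimately show ?thesis by (auto intro: knuth_equiv_trans)
qed

text \<open>Inserting the letters of \<open>y\<close> one by one into the row \<open>q @ z\<close>
  bumps exactly the letters of \<open>z\<close>, in order, since \<open>q\<close> and the letters
  already inserted are no larger than the next one.\<close>

lemma slide_right:
  assumes "list_all2 (<) y z" "sorted (q @ z)" "sorted (q @ y)"
  shows "knuth_equiv (q @ z @ y) (z @ q @ y)"
  using assms
proof (induction y z arbitrary: q rule: list_all2_induct)
  case Nil then show ?case by simp
next
  case (Cons y1 y z1 z)
  have "knuth_equiv ((q @ z1 # z) @ [y1]) (z1 # q @ y1 # z)"
    using Cons.prems Cons.hyps by (intro row_bump) (auto simp: sorted_append)
  then have "knuth_equiv (q @ (z1 # z) @ y1 # y) (z1 # ((q @ [y1]) @ z @ y))"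
    using knuth_equiv_suffix[of _ _ y] by fastforce
  moreover have "knuth_equiv ((q @ [y1]) @ z @ y) (z @ (q @ [y1]) @ y)"
    using Cons.prems Cons.hyps by (intro Cons.IH) (fastforce simp: sorted_append)+
  ultimately show ?case using knuth_equiv_Cons knuth_equiv_trans by fastforce
qed

text \<open>Columns left of the moving entry are peeled off: inserting \<open>u1\<close> bumps
  \<open>v1\<close> to the front in both words, and what follows is an instance of the induction
  hypothesis. Without such columns it remains to carry \<open>x\<close> past
  \<open>z\<close>.\<close>

lemma slide_up_aux:
  assumes "list_all2 (<) u v" "list_all2 (<) y z" "sorted (v @ x # z)" "sorted (u @ x # y)"
  shows "knuth_equiv (v @ x # z @ u @ y) (v @ z @ u @ x # y)"
  using assms
proof (induction u v rule: list_all2_induct)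
  case Nil
  then show ?case using slide_right[of y z "[x]"] by simp
next
  case (Cons u1 u v1 v)
  have "knuth_equiv (([] @ v1 # v @ x # z) @ [u1]) (v1 # [] @ u1 # v @ x # z)"
    using Cons.prems Cons.hyps by (intro row_bump) auto
  from knuth_equiv_suffix[OF this, of "u @ y"]
  have 1: "knuth_equiv ((v1 # v) @ x # z @ (u1 # u) @ y) (v1 # u1 # (v @ x # z @ u @ y))" by simp
  have 2: "knuth_equiv (v1 # u1 # (v @ x # z @ u @ y)) (v1 # u1 # (v @ z @ u @ x # y))"
    using Cons by (intro knuth_equiv_Cons) auto
  have "knuth_equiv (([] @ v1 # v @ z) @ [u1]) (v1 # [] @ u1 # v @ z)"
    using Cons.prems Cons.hyps by (intro row_bump) (auto simp: sorted_append)
  from knuth_equiv_sym[OF knuth_equiv_suffix[OF this, of "u @ x # y"]]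
  have 3: "knuth_equiv (v1 # u1 # (v @ z @ u @ x # y)) ((v1 # v) @ z @ (u1 # u) @ x # y)" by simp
  show ?case using 1 2 3 knuth_equiv_trans by blast
qed

text \<open>
  A jeu de taquin slide: in the two-row skew tableau with lower row \<open>p x s\<close> and upper row
  \<open>c _ d\<close>, where \<open>c\<close> sits on the right end of \<open>p\<close> and \<open>d\<close> on the left end of \<open>s\<close>, the
  entry \<open>x\<close> moves up into the hole.
\<close>
lemma slide_up:
  assumes "sorted (p @ x # s)" "sorted (c @ x # d)"
    and "length c \<le> length p" "length s \<le> length d"
    and c: "\<And>i. i < length c \<Longrightarrow> c ! i < p ! (i + (length p - length c))"
    and d: "\<And>i. i < length s \<Longrightarrow> d ! i < s ! i"
  shows "knuth_equiv ((p @ x # s) @ c @ d) ((p @ s) @ c @ x # d)"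
proof -
  define p0 v where "p0 = take (length p - length c) p" and "v = drop (length p - length c) p"
  define y y2 where "y = take (length s) d" and "y2 = drop (length s) d"
  have p: "p = p0 @ v" and dd: "d = y @ y2" by (simp_all add: p0_def v_def y_def y2_def)
  have "list_all2 (<) c v" using assms(3) c by (auto simp: list_all2_conv_all_nth v_def add.commute)
  moreover have "list_all2 (<) y s" using assms(4) d by (auto simp: list_all2_conv_all_nth y_def)
  ultimately have "knuth_equiv (v @ x # s @ c @ y) (v @ s @ c @ x # y)"
    using assms(1,2) unfolding p dd by (intro slide_up_aux) (auto simp: sorted_append)
  from knuth_equiv_context[OF this, of p0 y2] show ?thesis by (simp add: p dd)
qed

section \<open>Row insertion\<close>

definition is_bump :: "nat multiset \<Rightarrow> nat \<Rightarrow> nat \<Rightarrow> bool" where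
  "is_bump r x y \<longleftrightarrow> y \<in># r \<and> x < y \<and> (\<forall>z \<in># r. x < z \<longrightarrow> y \<le> z)"

definition no_bump :: "nat multiset \<Rightarrow> nat \<Rightarrow> bool" where
  "no_bump r x \<longleftrightarrow> (\<forall>z \<in># r. z \<le> x)"

text \<open>A list with at most one entry, so that the letters bumped by a word concatenate to the
  word that enters the next row. Rows are multisets, their sorted order being implicit.\<close>

definition bump :: "nat multiset \<Rightarrow> nat \<Rightarrow> nat list" where
  "bump r x = (if no_bump r x then [] else [LEAST y. y \<in># r \<and> x < y])"

definition insert_row :: "nat multiset \<Rightarrow> nat \<Rightarrow> nat multiset" where
  "insert_row r x = add_mset x (r - mset (bump r x))"

fun pass_row :: "nat multiset \<Rightarrow> nat list \<Rightarrow> nat multiset" where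
  "pass_row r [] = r"
| "pass_row r (x # w) = pass_row (insert_row r x) w"

fun pass_bumps :: "nat multiset \<Rightarrow> nat list \<Rightarrow> nat list" where
  "pass_bumps r [] = []"
| "pass_bumps r (x # w) = bump r x @ pass_bumps (insert_row r x) w"

lemma bump_cases:
  obtains (none) "no_bump r x" | (some) y where "is_bump r x y"
proof (cases "no_bump r x")
  case False
  then have ex: "\<exists>y. y \<in># r \<and> x < y" by (auto simp: no_bump_def not_le)
  have "is_bump r x (LEAST y. y \<in># r \<and> x < y)"
    unfolding is_bump_def using LeastI_ex[OF ex] Least_le[of "\<lambda>y. y \<in># r \<and> x < y"] by blast
  then show ?thesis using that by blast
qed (use that in blast)

lemma bump_none: "no_bump r x \<Longrightarrow> bump r x = []" "no_bump r x \<Longrightarrow> insert_row r x = add_mset x r"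
  by (simp_all add: bump_def insert_row_def)

lemma bump_some:
  assumes "is_bump r x y"
  shows "bump r x = [y]" "insert_row r x = add_mset x (r - {#y#})"
proof -
  have "y \<in># r" "\<not> y \<le> x" using assms by (auto simp: is_bump_def)
  then have "\<not> no_bump r x" unfolding no_bump_def by blast
  moreover have "(LEAST y. y \<in># r \<and> x < y) = y"
    using assms by (intro Least_equality) (auto simp: is_bump_def)
  ultimately show "bump r x = [y]" by (simp add: bump_def)
  then show "insert_row r x = add_mset x (r - {#y#})" by (simp add: insert_row_def)
qed

lemma pass_row_append: "pass_row r (u @ v) = pass_row (pass_row r u) v"
  by (induction u arbitrary: r) auto

lemma pass_bumps_append: "pass_bumps r (u @ v) = pass_bumps r u @ pass_bumps (pass_row r u) v"
  by (induction u arbitrary: r) auto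

lemma in_diff_neq: "y \<in># r \<Longrightarrow> y \<noteq> a \<Longrightarrow> y \<in># r - {#a#}"
  by (simp add: in_diff_count)

text \<open>Insertion respects Knuth moves one row at a time: the row ends up the same, and the
  bumped words are again Knuth equivalent. After \<open>y\<close> has been inserted,
  \<open>x\<close> bumps a letter \<open>x' \<le> y\<close>, while \<open>z\<close> bumps, if
  anything, a letter beyond \<open>z\<close>, so the two insertions commute.\<close>

lemma pass_triple1:
  assumes xyz: "x < y" "y \<le> (z::nat)"
  shows "pass_row r [y, z, x] = pass_row r [y, x, z] \<and>
    knuth_equiv (pass_bumps r [y, z, x]) (pass_bumps r [y, x, z])"
proof -
  define r1 where "r1 = insert_row r y"
  have yr1: "y \<in># r1" by (simp add: r1_def insert_row_def)
  obtain x' where x': "is_bump r1 x x'"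
    using yr1 xyz by (cases r1 x rule: bump_cases) (auto simp: no_bump_def)
  have x'y: "x' \<le> y" using x' yr1 xyz by (auto simp: is_bump_def)
  show ?thesis
  proof (cases r1 z rule: bump_cases)
    case none
    have 1: "is_bump (add_mset z r1) x x'" using x' x'y xyz by (auto simp: is_bump_def)
    have 2: "no_bump (add_mset x (r1 - {#x'#})) z"
      using none xyz by (auto simp: no_bump_def dest: in_diffD)
    have "x' \<in># r1" using x' by (simp add: is_bump_def)
    then show ?thesis
      by (simp add: r1_def[symmetric] bump_none[OF none] bump_some[OF x'] bump_some[OF 1] bump_none[OF 2])
  next
    case (some z')
    have ne: "x' \<noteq> z'" "z \<noteq> x'\<or> z = x'" using some x'y xyz by (auto simp: is_bump_def)
    have 1: "is_bump (add_mset z (r1 - {#z'#})) x x'"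
      using x' x'y xyz some ne by (auto simp: is_bump_def in_diff_neq dest: in_diffD)
    have 2: "is_bump (add_mset x (r1 - {#x'#})) z z'"
      using some xyz x'y ne by (auto simp: is_bump_def in_diff_neq dest: in_diffD)
    have mem: "x' \<in># r1" "z' \<in># r1" using x' some by (auto simp: is_bump_def)
    obtain R1 where R1: "r1 = add_mset z' R1" using mem multi_member_split by metis
    then have "x' \<in># R1" using mem ne by simp
    then obtain R where R: "R1 = add_mset x' R" using multi_member_split by metis
    have "add_mset x (add_mset z (r1 - {#z'#}) - {#x'#}) = add_mset z (add_mset x (r1 - {#x'#}) - {#z'#})"
      unfolding R1 R by (simp add: multiset_eq_iff)
    then have rows: "pass_row r [y, z, x] = pass_row r [y, x, z]"
      by (simp add: r1_def[symmetric] bump_some[OF some] bump_some[OF x'] bump_some[OF 1] bump_some[OF 2])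
    \<comment> \<open>The letter bumped by \<open>y\<close> is the witness for exchanging
      \<open>x'\<close> and \<open>z'\<close>. It exists here, since \<open>z\<close> could not bump
      anything if \<open>y\<close> did not.\<close>
    have "knuth_equiv (bump r y @ [z', x']) (bump r y @ [x', z'])"
    proof (cases r y rule: bump_cases)
      case none
      then have "no_bump r1 z" using xyz by (auto simp: r1_def bump_none no_bump_def)
      then show ?thesis using some by (auto simp: is_bump_def no_bump_def)
    next
      case (some y')
      have "x' < y'" using some x'y by (auto simp: is_bump_def)
      moreover have "y' \<le> z'"
      proof -
        have "z' \<in># add_mset y (r - {#y'#})" "z < z'"
          using \<open>is_bump r1 z z'\<close> bump_some[OF some] by (auto simp: r1_def is_bump_def)
        then have "z' \<in># r" "y < z'" using xyz by (auto dest: in_diffD)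
        then show ?thesis using some by (auto simp: is_bump_def)
      qed
      ultimately have "knuth_step ([] @ [y', z', x'] @ []) ([] @ [y', x', z'] @ [])" by (rule knuth_step.intros)
      then show ?thesis using bump_some[OF some] knuth_step_imp_equiv by simp
    qed
    then show ?thesis using rows
      by (simp add: r1_def[symmetric] bump_some[OF some] bump_some[OF x'] bump_some[OF 1] bump_some[OF 2])
  qed
qed

text \<open>Let \<open>x'\<close> be the letter bumped by \<open>x\<close>. If
  \<open>x' \<le> z\<close>, the insertions of \<open>x\<close> and \<open>z\<close> do not
  interfere, and if \<open>z\<close> bumps a letter, the one bumped by \<open>y\<close> is the
  witness. If \<open>x' > z\<close>, the row has no letter that is greater than \<open>x\<close> and
  at most \<open>z\<close>; a \<open>z\<close> inserted before \<open>x\<close> is then bumped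
  again, and the bumped words are equal or related by the other Knuth move.\<close>

lemma pass_triple2:
  assumes xyz: "x \<le> y" "y < (z::nat)"
  shows "pass_row r [x, z, y] = pass_row r [z, x, y] \<and>
    knuth_equiv (pass_bumps r [x, z, y]) (pass_bumps r [z, x, y])"
proof (cases r x rule: bump_cases)
  case none
  have 1: "no_bump (add_mset x r) z" using none xyz by (auto simp: no_bump_def)
  have 2: "is_bump (add_mset z (add_mset x r)) y z" using none xyz by (fastforce simp: no_bump_def is_bump_def)
  have 3: "no_bump r z" using none xyz by (auto simp: no_bump_def)
  have 4: "is_bump (add_mset z r) x z" using none xyz by (fastforce simp: no_bump_def is_bump_def)
  have 5: "no_bump (add_mset x r) y" using none xyz by (auto simp: no_bump_def)
  show ?thesis
    by (simp add: bump_none[OF none] bump_none[OF 1] bump_some[OF 2] bump_none[OF 3] bump_some[OF 4] bump_none[OF 5])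
next
  case (some x')
  note x' = some
  have xr: "x' \<in># r" using some by (simp add: is_bump_def)
  define r1 where "r1 = add_mset x (r - {#x'#})"
  show ?thesis
  proof (cases "x' \<le> z")
    case True
    show ?thesis
    proof (cases r1 z rule: bump_cases)
      case none
      have 1: "no_bump r z" using none True xyz unfolding no_bump_def r1_def
        by (metis in_diff_neq union_iff add_mset_add_single)
      have 2: "is_bump (add_mset z r) x x'" using x' True by (auto simp: is_bump_def)
      have 3: "add_mset x (add_mset z r - {#x'#}) = add_mset z r1"
        using xr by (simp add: r1_def multiset_eq_iff)
      show ?thesis
        by (simp add: bump_some[OF x'] bump_none[OF 1] bump_some[OF 2] 3 r1_def[symmetric] bump_none[OF none])
    next
      case (some z')
      have z'r: "z' \<in># r" "z' \<noteq> x'" "z < z'"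
        using some True xyz by (auto simp: is_bump_def r1_def dest: in_diffD)
      have 1: "is_bump r z z'" using some True xyz z'r unfolding is_bump_def r1_def
        by (metis in_diff_neq union_iff add_mset_add_single not_le)
      have 2: "is_bump (add_mset z (r - {#z'#})) x x'"
        using x' True z'r by (auto simp: is_bump_def in_diff_neq dest: in_diffD)
      have 3: "add_mset x (add_mset z (r - {#z'#}) - {#x'#}) = add_mset z (r1 - {#z'#})"
        using xr z'r xyz by (auto simp: r1_def multiset_eq_iff)
      define r2 where "r2 = add_mset z (r1 - {#z'#})"
      obtain y' where y': "is_bump r2 y y'"
        using xyz by (cases r2 y rule: bump_cases) (auto simp: no_bump_def r2_def)
      have y'z: "y' \<le> z" using y' xyz by (auto simp: is_bump_def r2_def)
      have "y' = z \<or> y' \<in># r" using y' xyz by (auto simp: is_bump_def r2_def r1_def dest!: in_diffD)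
      then have "x' \<le> y'" using x' True y' xyz by (auto simp: is_bump_def)
      then have "knuth_step ([] @ [x', z', y'] @ []) ([] @ [z', x', y'] @ [])"
        using y'z z'r by (intro knuth_step.intros) auto
      then show ?thesis using knuth_step_imp_equiv
        by (simp add: bump_some[OF x'] bump_some[OF 1] bump_some[OF 2] 3 r1_def[symmetric] bump_some[OF some]
          r2_def[symmetric] bump_some[OF y'])
    qed
  next
    case False
    have big: "z < a" if "a \<in># r" "x < a" for a
      using x' False that by (fastforce simp: is_bump_def)
    have 1: "is_bump r z x'" using x' False xyz by (auto simp: is_bump_def)
    have 2: "is_bump (add_mset z (r - {#x'#})) x z"
      using x' False xyz by (auto simp: is_bump_def dest: in_diffD)
    show ?thesis
    proof (cases r1 z rule: bump_cases)
      case none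
      have 3: "is_bump (add_mset z r1) y z"
        using xyz by (auto simp: is_bump_def r1_def less_imp_le big dest!: in_diffD)
      have 4: "no_bump r1 y"
        unfolding no_bump_def
      proof
        fix a assume a: "a \<in># r1"
        then have "a \<le> z" using none by (simp add: no_bump_def)
        then show "a \<le> y" using a x' False xyz by (auto simp: r1_def is_bump_def dest!: in_diffD)
      qed
      show ?thesis
        by (simp add: bump_some[OF x'] bump_some[OF 1] bump_some[OF 2] r1_def[symmetric] bump_none[OF none]
          bump_some[OF 3] bump_none[OF 4])
    next
      case (some w)
      have w: "w \<in># r" "z < w" using some xyz by (auto simp: is_bump_def r1_def dest: in_diffD)
      then have x'w: "x' \<le> w" using x' xyz by (auto simp: is_bump_def)
      have 3: "is_bump (add_mset z (r1 - {#w#})) y z"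
        using xyz by (auto simp: is_bump_def r1_def less_imp_le big dest!: in_diffD)
      have 4: "is_bump r1 y w"
        unfolding is_bump_def
      proof (intro conjI ballI impI)
        show "w \<in># r1" "y < w" using some xyz by (auto simp: is_bump_def)
        fix a assume a: "a \<in># r1" "y < a"
        then have "z < a" using x' False xyz by (auto simp: r1_def is_bump_def dest!: in_diffD)
        then show "w \<le> a" using some a by (auto simp: is_bump_def)
      qed
      have "z < x'" using False by simp
      then have "knuth_step ([] @ [x', w, z] @ []) ([] @ [x', z, w] @ [])" using x'w by (rule knuth_step.intros)
      then show ?thesis using knuth_step_imp_equiv
        by (simp add: bump_some[OF x'] bump_some[OF 1] bump_some[OF 2] r1_def[symmetric] bump_some[OF some]
          bump_some[OF 3] bump_some[OF 4])
    qed
  qed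
qed

lemma pass_knuth_step:
  assumes "knuth_step u v"
  shows "pass_row r u = pass_row r v \<and> knuth_equiv (pass_bumps r u) (pass_bumps r v)"
  using assms
proof cases
  case (1 x y z a b)
  note t = pass_triple1[of x y z "pass_row r a", OF 1(3,4)]
  have "pass_row r u = pass_row r v"
    unfolding 1(1,2) pass_row_append conjunct1[OF t] ..
  moreover have "knuth_equiv (pass_bumps r u) (pass_bumps r v)"
    unfolding 1(1,2) pass_row_append pass_bumps_append conjunct1[OF t]
    using t by (intro knuth_equiv_context) simp
  ultimately show ?thesis ..
next
  case (2 x y z a b)
  note t = pass_triple2[of x y z "pass_row r a", OF 2(3,4)]
  have "pass_row r u = pass_row r v"
    unfolding 2(1,2) pass_row_append conjunct1[OF t] ..
  moreover have "knuth_equiv (pass_bumps r u) (pass_bumps r v)"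
    unfolding 2(1,2) pass_row_append pass_bumps_append conjunct1[OF t]
    using t by (intro knuth_equiv_context) simp
  ultimately show ?thesis ..
qed

lemma pass_knuth_equiv:
  "knuth_equiv u v \<Longrightarrow> pass_row r u = pass_row r v \<and> knuth_equiv (pass_bumps r u) (pass_bumps r v)"
proof (induction rule: knuth_equiv_induct)
  case (step v w)
  then show ?case using pass_knuth_step by (metis knuth_equiv_sym knuth_equiv_trans)
qed simp

lemma pass_sorted:
  assumes "sorted w"
  shows "pass_row {#} w = mset w \<and> pass_bumps {#} w = []"
  using assms
proof (induction w rule: rev_induct)
  case (snoc x w)
  then have "pass_row {#} w = mset w" "pass_bumps {#} w = []" "no_bump (mset w) x"
    by (auto simp: sorted_append no_bump_def)
  then show ?case by (simp add: pass_row_append pass_bumps_append bump_none)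
qed simp

text \<open>Column by column, the j-th letter of \<open>a\<close> bumps the j-th letter of
  \<open>b\<close>, and the letters of \<open>a\<close> beyond the end of \<open>b\<close> are
  appended. The prefix \<open>q\<close> holds the letters already inserted.\<close>

lemma pass_strict_aux:
  assumes "sorted (q @ a)" "sorted (q @ b)" "length b \<le> length a" "\<forall>j < length b. a ! j < b ! j"
  shows "pass_row (mset (q @ b)) a = mset (q @ a) \<and> pass_bumps (mset (q @ b)) a = b"
  using assms
proof (induction a arbitrary: q b)
  case Nil then show ?case by simp
next
  case (Cons x a)
  show ?case
  proof (cases b)
    case Nil
    have nb: "no_bump (mset q) x" using Cons.prems by (auto simp: sorted_append no_bump_def)
    have "pass_row (mset ((q @ [x]) @ [])) a = mset ((q @ [x]) @ a) \<and> pass_bumps (mset ((q @ [x]) @ [])) a = []"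
      using Cons.prems by (intro Cons.IH) (auto simp: sorted_append)
    then show ?thesis using Nil nb by (simp add: bump_none)
  next
    case (Cons y b')
    have xy: "x < y" using Cons.prems(4) Cons by force
    have nb: "is_bump (mset (q @ b)) x y"
      using Cons.prems(1,2) xy Cons by (auto simp: sorted_append is_bump_def)
    have e: "add_mset x (mset (q @ b) - {#y#}) = mset ((q @ [x]) @ b')" using Cons by simp
    have "pass_row (mset ((q @ [x]) @ b')) a = mset ((q @ [x]) @ a) \<and> pass_bumps (mset ((q @ [x]) @ b')) a = b'"
    proof (rule Cons.IH)
      show "\<forall>j<length b'. a ! j < b' ! j" using Cons.prems(4) Cons by force
      show "sorted ((q @ [x]) @ b')" using Cons.prems(1,2) xy Cons by (fastforce simp: sorted_append)
    qed (use Cons.prems Cons in \<open>auto simp: sorted_append\<close>)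
    then show ?thesis unfolding pass_row.simps pass_bumps.simps bump_some[OF nb] e using Cons by simp
  qed
qed

lemma pass_strict:
  assumes "sorted a" "sorted b" "length b \<le> length a" "\<forall>j < length b. a ! j < b ! j"
  shows "pass_row (mset b) a = mset a \<and> pass_bumps (mset b) a = b"
  using pass_strict_aux[of "[]" a b] assms by simp


section \<open>Crystal operators on sequences of rows\<close>

definition word :: "nat \<Rightarrow> nat \<Rightarrow> (nat \<Rightarrow> nat multiset) \<Rightarrow> nat list" where
  "word lo hi rs = concat (map (\<lambda>i. sorted_list_of_multiset (rs i)) (rev [lo..<Suc hi]))"

text \<open>Let each letter of the lower row \<open>r2\<close> be paired, as far as possible, with a
  smaller letter of the upper row \<open>r1\<close>. The maximum of this function over
  \<open>v\<close> is the number of letters of \<open>r2\<close> left without a partner; the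
  function is nowhere positive exactly when the two rows form strict columns.\<close>

definition excess :: "nat multiset \<Rightarrow> nat multiset \<Rightarrow> nat \<Rightarrow> int" where
  "excess r1 r2 v = int (size {#z \<in># r2. z \<le> v#}) - int (size {#z \<in># r1. z < v#})"

definition max_excess :: "nat multiset \<Rightarrow> nat multiset \<Rightarrow> int" where
  "max_excess r1 r2 = Max (range (excess r1 r2))"

lemma finite_range_excess: "finite (range (excess r1 r2))"
proof (rule finite_subset)
  have "excess r1 r2 v \<in> {- int (size r1)..int (size r2)}" for v
    using size_filter_mset_lesseq[of "\<lambda>z. z < v" r1] size_filter_mset_lesseq[of "\<lambda>z. z \<le> v" r2]
    unfolding excess_def atLeastAtMost_iff by linarith
  then show "range (excess r1 r2) \<subseteq> {- int (size r1)..int (size r2)}" by blast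
qed simp

lemma excess_le_max: "excess r1 r2 v \<le> max_excess r1 r2"
  unfolding max_excess_def by (simp add: finite_range_excess)

lemma max_excess_attained: "\<exists>v. excess r1 r2 v = max_excess r1 r2"
proof -
  have "max_excess r1 r2 \<in> range (excess r1 r2)"
    unfolding max_excess_def by (rule Max_in) (auto simp: finite_range_excess)
  then show ?thesis by auto
qed

lemma max_excess_eqI: "excess r1 r2 x = M \<Longrightarrow> (\<And>v. excess r1 r2 v \<le> M) \<Longrightarrow> max_excess r1 r2 = M"
  by (metis antisym excess_le_max max_excess_attained)

lemma max_excess_nonneg: "0 \<le> max_excess r1 r2"
  using excess_le_max[of r1 r2 0] by (simp add: excess_def)

lemma size_filter_le_Suc: "size {#z \<in># M. z \<le> Suc v#} = size {#z \<in># M. z \<le> v#} + count M (Suc v)"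
  by (induction M) auto

lemma size_filter_less_Suc: "size {#z \<in># M. z < Suc v#} = size {#z \<in># M. z < v#} + count M v"
  by (induction M) auto

lemma excess_Suc: "excess r1 r2 (Suc v) = excess r1 r2 v + int (count r2 (Suc v)) - int (count r1 v)"
  unfolding excess_def size_filter_le_Suc size_filter_less_Suc by simp

lemma excess_eventually: "\<exists>N. \<forall>v \<ge> N. excess r1 r2 v = int (size r2) - int (size r1)"
proof -
  obtain N where N: "\<forall>z \<in> set_mset r1 \<union> set_mset r2. z < N"
    using finite_nat_set_iff_bounded[of "set_mset r1 \<union> set_mset r2"] by auto
  have "{#z \<in># r2. z \<le> v#} = r2" "{#z \<in># r1. z < v#} = r1" if "v \<ge> N" for v
    using N that by (auto simp: filter_mset_eq_conv) (meson UnI1 UnI2 less_le_trans less_imp_le)+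
  then have "\<forall>v \<ge> N. excess r1 r2 v = int (size r2) - int (size r1)" by (simp add: excess_def)
  then show ?thesis by blast
qed

lemma max_excess_ge_diff: "int (size r2) - int (size r1) \<le> max_excess r1 r2"
  using excess_eventually excess_le_max by (metis order_refl)

text \<open>The letter that the raising operator moves up; \<open>last_max\<close> is the one that
  the lowering operator moves down.\<close>

definition first_max :: "nat multiset \<Rightarrow> nat multiset \<Rightarrow> nat" where
  "first_max r1 r2 = (LEAST v. excess r1 r2 v = max_excess r1 r2)"

definition last_max :: "nat multiset \<Rightarrow> nat multiset \<Rightarrow> nat" where
  "last_max r1 r2 = (GREATEST v. excess r1 r2 v = max_excess r1 r2)"

lemma excess_first_max: "excess r1 r2 (first_max r1 r2) = max_excess r1 r2"
  unfolding first_max_def by (rule LeastI_ex) (rule max_excess_attained)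

lemma excess_before_first_max: "v < first_max r1 r2 \<Longrightarrow> excess r1 r2 v < max_excess r1 r2"
  using not_less_Least[of v "\<lambda>v. excess r1 r2 v = max_excess r1 r2"] excess_le_max[of r1 r2 v]
  unfolding first_max_def by linarith

lemma first_max_eqI:
  "excess r1 r2 x = max_excess r1 r2 \<Longrightarrow> (\<And>v. v < x \<Longrightarrow> excess r1 r2 v < max_excess r1 r2) \<Longrightarrow> first_max r1 r2 = x"
  by (metis excess_before_first_max excess_first_max less_irrefl linorder_neqE_nat)

text \<open>For large \<open>v\<close> the excess is the difference of the row sizes. The hypothesis
  says that the maximum is not attained there, so that there is a last place where it is.\<close>

lemma last_max_props:
  assumes "int (size r2) - int (size r1) < max_excess r1 r2"
  shows "excess r1 r2 (last_max r1 r2) = max_excess r1 r2"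
    and "v > last_max r1 r2 \<Longrightarrow> excess r1 r2 v < max_excess r1 r2"
proof -
  obtain N where N: "\<forall>v \<ge> N. excess r1 r2 v = int (size r2) - int (size r1)"
    using excess_eventually by blast
  then have b: "v \<le> N" if "excess r1 r2 v = max_excess r1 r2" for v
    using assms that by (metis less_irrefl nat_le_linear)
  show 1: "excess r1 r2 (last_max r1 r2) = max_excess r1 r2"
    unfolding last_max_def
    by (rule GreatestI_ex_nat[where b = N]) (use b max_excess_attained in auto)
  show "excess r1 r2 v < max_excess r1 r2" if "v > last_max r1 r2"
  proof -
    have "excess r1 r2 v \<noteq> max_excess r1 r2"
      using Greatest_le_nat[of "\<lambda>v. excess r1 r2 v = max_excess r1 r2" v N] b that
      unfolding last_max_def by auto
    then show ?thesis using excess_le_max[of r1 r2 v] by linarith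
  qed
qed

lemma last_max_eqI:
  assumes "excess r1 r2 x = max_excess r1 r2" "\<And>v. v > x \<Longrightarrow> excess r1 r2 v < max_excess r1 r2"
  shows "last_max r1 r2 = x"
  unfolding last_max_def
proof (rule Greatest_equality)
  show "excess r1 r2 x = max_excess r1 r2" by fact
  show "y \<le> x" if "excess r1 r2 y = max_excess r1 r2" for y
    using assms(2)[of y] that by (metis less_irrefl not_less)
qed

lemma first_max_in:
  assumes "1 \<le> max_excess r1 r2"
  shows "first_max r1 r2 \<in># r2"
proof (cases "first_max r1 r2")
  case 0
  then have "excess r1 r2 0 \<ge> 1" using excess_first_max[of r1 r2] assms by simp
  then have "size {#z \<in># r2. z \<le> 0#} \<noteq> 0" unfolding excess_def by linarith
  then have "{#z \<in># r2. z \<le> 0#} \<noteq> {#}" unfolding size_eq_0_iff_empty .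
  then obtain z where "z \<in># {#z \<in># r2. z \<le> 0#}" using multiset_nonemptyE by blast
  then show ?thesis using 0 by auto
next
  case (Suc v)
  have "excess r1 r2 v < excess r1 r2 (Suc v)"
    using excess_before_first_max[of v r1 r2] excess_first_max[of r1 r2] Suc by simp
  then have "count r2 (Suc v) > 0" unfolding excess_Suc by linarith
  then show ?thesis using Suc by simp
qed

lemma last_max_in:
  assumes "int (size r2) - int (size r1) < max_excess r1 r2"
  shows "last_max r1 r2 \<in># r1"
proof -
  have "excess r1 r2 (Suc (last_max r1 r2)) < excess r1 r2 (last_max r1 r2)"
    using last_max_props[OF assms] by simp
  then have "count r1 (last_max r1 r2) > 0" unfolding excess_Suc by linarith
  then show ?thesis by simp
qed

lemma excess_move:
  "excess (add_mset x r1) r2 v = excess r1 (add_mset x r2) v - (if x \<le> v then 1 else 0) - (if x < v then 1 else 0)"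
  by (simp add: excess_def)

text \<open>Moving \<open>x\<close> up decreases the excess by 1 at \<open>x\<close> and by 2 beyond
  it. So the maximum drops by 1 and is now attained last at \<open>x\<close>, which is why lowering
  undoes raising.\<close>

lemma raise_pair:
  assumes m: "1 \<le> max_excess r1 r2" and x: "x = first_max r1 r2"
  defines "r1' \<equiv> add_mset x r1" and "r2' \<equiv> r2 - {#x#}"
  shows "max_excess r1' r2' = max_excess r1 r2 - 1" "last_max r1' r2' = x"
    "excess r1' r2' v = excess r1 r2 v - (if x \<le> v then 1 else 0) - (if x < v then 1 else 0)"
proof -
  have r2: "r2 = add_mset x r2'" using first_max_in[OF m] x by (simp add: r2'_def)
  have e: "excess r1' r2' v = excess r1 r2 v - (if x \<le> v then 1 else 0) - (if x < v then 1 else 0)" for v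
    unfolding r1'_def r2 by (rule excess_move)
  then show "excess r1' r2' v = excess r1 r2 v - (if x \<le> v then 1 else 0) - (if x < v then 1 else 0)" .
  have ex: "excess r1' r2' x = max_excess r1 r2 - 1" using e excess_first_max x by simp
  have "excess r1' r2' v \<le> max_excess r1 r2 - 1" for v
    using e[of v] excess_before_first_max[of v r1 r2] excess_le_max[of r1 r2 v] x by (auto split: if_splits)
  then show M: "max_excess r1' r2' = max_excess r1 r2 - 1" using ex by (rule max_excess_eqI[rotated])
  show "last_max r1' r2' = x"
  proof (rule last_max_eqI)
    show "excess r1' r2' x = max_excess r1' r2'" using ex M by simp
    show "excess r1' r2' v < max_excess r1' r2'" if "x < v" for v
      using that e[of v] excess_le_max[of r1 r2 v] M by auto
  qed
qed

lemma lower_pair: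
  assumes m: "int (size r2) - int (size r1) < max_excess r1 r2" and x: "x = last_max r1 r2"
  defines "r1' \<equiv> r1 - {#x#}" and "r2' \<equiv> add_mset x r2"
  shows "max_excess r1' r2' = max_excess r1 r2 + 1" "first_max r1' r2' = x"
proof -
  have r1: "r1 = add_mset x r1'" using last_max_in[OF m] x by (simp add: r1'_def)
  have e: "excess r1' r2' v = excess r1 r2 v + (if x \<le> v then 1 else 0) + (if x < v then 1 else 0)" for v
    using excess_move[of x r1' r2 v] r1 by (simp add: r2'_def)
  have ex: "excess r1' r2' x = max_excess r1 r2 + 1" using e last_max_props(1)[OF m] x by simp
  have "excess r1' r2' v \<le> max_excess r1 r2 + 1" for v
    using e[of v] last_max_props(2)[OF m, of v] excess_le_max[of r1 r2 v] x by (auto split: if_splits)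
  then show M: "max_excess r1' r2' = max_excess r1 r2 + 1" using ex by (rule max_excess_eqI[rotated])
  show "first_max r1' r2' = x"
  proof (rule first_max_eqI)
    show "excess r1' r2' x = max_excess r1' r2'" using ex M by simp
    show "excess r1' r2' v < max_excess r1' r2'" if "v < x" for v
      using that e[of v] excess_le_max[of r1 r2 v] M by auto
  qed
qed

lemma sorted_filter_greater:
  assumes "sorted (xs :: nat list)" "k \<le> length (filter (\<lambda>z. w < z) xs)" "1 \<le> k"
  shows "k \<le> length xs \<and> w < xs ! (length xs - k)"
proof -
  have kl: "k \<le> length xs" using assms(2) length_filter_le[of "\<lambda>z. w < z" xs] by linarith
  have "w < xs ! (length xs - k)"
  proof (rule ccontr)
    assume a: "\<not> w < xs ! (length xs - k)"
    have "{i. i < length xs \<and> w < xs ! i} \<subseteq> {Suc (length xs - k)..<length xs}"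
    proof
      fix i assume i: "i \<in> {i. i < length xs \<and> w < xs ! i}"
      have "length xs - k < length xs" using assms(3) kl by linarith
      then have "\<not> i \<le> length xs - k"
        using sorted_nth_mono[OF assms(1), of i "length xs - k"] i a assms(3) kl by auto
      then show "i \<in> {Suc (length xs - k)..<length xs}" using i by auto
    qed
    then have "card {i. i < length xs \<and> w < xs ! i} \<le> k - 1"
      using card_mono[of "{Suc (length xs - k)..<length xs}"] kl assms(3) by force
    then show False using assms by (simp add: length_filter_conv_card)
  qed
  then show ?thesis using kl by simp
qed

lemma sorted_filter_ge:
  assumes "sorted (xs :: nat list)" "i < length xs"
  shows "length xs - i \<le> length (filter (\<lambda>z. xs ! i \<le> z) xs)"
proof -
  have "{i..<length xs} \<subseteq> {j. j < length xs \<and> xs ! i \<le> xs ! j}"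
    using sorted_nth_mono[OF assms(1)] by auto
  then have "card {i..<length xs} \<le> card {j. j < length xs \<and> xs ! i \<le> xs ! j}"
    by (rule card_mono[rotated]) simp
  then show ?thesis by (simp add: length_filter_conv_card)
qed

lemma sorted_filter_less:
  assumes "sorted (xs :: nat list)" "k < length (filter (\<lambda>z. z < w) xs)"
  shows "k < length xs \<and> xs ! k < w"
proof -
  have kl: "k < length xs" using assms(2) length_filter_le[of "\<lambda>z. z < w" xs] by linarith
  have "xs ! k < w"
  proof (rule ccontr)
    assume a: "\<not> xs ! k < w"
    have "{i. i < length xs \<and> xs ! i < w} \<subseteq> {..<k}"
    proof
      fix i assume i: "i \<in> {i. i < length xs \<and> xs ! i < w}"
      then show "i \<in> {..<k}" using sorted_nth_mono[OF assms(1), of k i] a by (auto simp: not_less[symmetric])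
    qed
    then have "card {i. i < length xs \<and> xs ! i < w} \<le> k" using card_mono[of "{..<k}"] by force
    then show False using assms by (simp add: length_filter_conv_card)
  qed
  then show ?thesis using kl by simp
qed

lemma sorted_filter_le:
  assumes "sorted (xs :: nat list)" "i < length xs"
  shows "i < length (filter (\<lambda>z. z \<le> xs ! i) xs)"
proof -
  have "{..i} \<subseteq> {j. j < length xs \<and> xs ! j \<le> xs ! i}"
    using sorted_nth_mono[OF assms(1)] assms(2) by auto
  then have "card {..i} \<le> card {j. j < length xs \<and> xs ! j \<le> xs ! i}"
    by (rule card_mono[rotated]) simp
  then show ?thesis by (simp add: length_filter_conv_card)
qed

lemma length_sorted_list_of_multiset: "length (sorted_list_of_multiset M) = size M"
  by (metis mset_sorted_list_of_multiset size_mset)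

lemma length_filter_sorted_list_of_multiset:
  "length (filter P (sorted_list_of_multiset M)) = size (filter_mset P M)"
  by (metis mset_filter mset_sorted_list_of_multiset size_mset)

lemma sorted_list_of_multiset_eqI: "sorted xs \<Longrightarrow> mset xs = M \<Longrightarrow> sorted_list_of_multiset M = xs"
  by (metis sorted_list_of_multiset_mset sorted_sort_id)

text \<open>The move is a slide of \<open>x\<close> into the row above, which is split at the place
  where \<open>x\<close> will stand. The strictness required by \<open>slide_up\<close> comes from
  the choice of \<open>x\<close> as the first maximum of the excess.\<close>

lemma knuth_raise_pair:
  assumes m: "1 \<le> max_excess r1 r2" and x: "x = first_max r1 r2"
  shows "knuth_equiv (sorted_list_of_multiset r2 @ sorted_list_of_multiset r1)
    (sorted_list_of_multiset (r2 - {#x#}) @ sorted_list_of_multiset (add_mset x r1))"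
proof -
  define p where "p = sorted_list_of_multiset ({#z \<in># r2. z \<le> x#} - {#x#})"
  define s where "s = sorted_list_of_multiset {#z \<in># r2. x < z#}"
  define c where "c = sorted_list_of_multiset {#z \<in># r1. z < x#}"
  define d where "d = sorted_list_of_multiset {#z \<in># r1. x \<le> z#}"
  have xr: "x \<in># r2" using first_max_in[OF m] x by simp
  have split2: "{#z \<in># r2. z \<le> x#} + {#z \<in># r2. x < z#} = r2"
    by (simp add: multiset_partition[of r2 "\<lambda>z. z \<le> x", symmetric] not_le[symmetric])
  have split1: "{#z \<in># r1. z < x#} + {#z \<in># r1. x \<le> z#} = r1"
    by (simp add: multiset_partition[of r1 "\<lambda>z. z < x", symmetric] not_less[symmetric])
  obtain P where P: "{#z \<in># r2. z \<le> x#} = add_mset x P"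
    using xr by (metis (mono_tags, lifting) insert_DiffM mem_Collect_eq order_refl set_mset_filter)
  have pP: "p = sorted_list_of_multiset P" by (simp add: p_def P)
  have ms: "mset p = P" "mset s = {#z \<in># r2. x < z#}" "mset c = {#z \<in># r1. z < x#}" "mset d = {#z \<in># r1. x \<le> z#}"
    by (simp_all add: pP s_def c_def d_def)
  have sets: "\<forall>z \<in> set p. z \<le> x" "\<forall>z \<in> set s. x < z" "\<forall>z \<in> set c. z < x" "\<forall>z \<in> set d. x \<le> z"
    by (auto simp: p_def s_def c_def d_def dest: in_diffD)
  have so: "sorted p" "sorted s" "sorted c" "sorted d" by (simp_all add: p_def s_def c_def d_def)
  have "sorted (p @ x # s)" using so sets by (fastforce simp: sorted_append)
  moreover have "mset (p @ x # s) = r2" using split2 P ms by simp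
  ultimately have w2: "sorted_list_of_multiset r2 = p @ x # s" by (rule sorted_list_of_multiset_eqI)
  have "sorted (c @ x # d)" using so sets by (fastforce simp: sorted_append)
  have r1': "sorted_list_of_multiset (add_mset x r1) = c @ x # d"
    by (rule sorted_list_of_multiset_eqI) (use \<open>sorted (c @ x # d)\<close> ms split1 in auto)
  have r1: "sorted_list_of_multiset r1 = c @ d"
    by (rule sorted_list_of_multiset_eqI) (use \<open>sorted (c @ x # d)\<close> ms split1 in \<open>auto simp: sorted_append\<close>)
  have r2': "sorted_list_of_multiset (r2 - {#x#}) = p @ s"
    by (rule sorted_list_of_multiset_eqI)
       (use \<open>sorted (p @ x # s)\<close> \<open>mset (p @ x # s) = r2\<close> in \<open>auto simp: sorted_append\<close>)
  have excx: "excess r1 r2 x = int (length p) + 1 - int (length c)"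
    using P ms by (simp add: excess_def flip: size_mset)
  have M: "max_excess r1 r2 = int (length p) + 1 - int (length c)" using excx excess_first_max x by simp
  \<comment> \<open>Before \<open>x\<close> the excess is strictly below its value at
    \<open>x\<close>; this pairs the letters of \<open>c\<close> with larger letters at the right
    end of \<open>p\<close>.\<close>
  have low: "length (filter (\<lambda>z. w \<le> z) c) \<le> length (filter (\<lambda>z. w < z) p)" if "w < x" for w
  proof -
    have "{#z \<in># r2. z \<le> w#} = {#z \<in># {#z \<in># r2. z \<le> x#}. z \<le> w#}"
      using that by (auto simp: filter_filter_mset intro!: filter_mset_cong)
    then have 1: "size {#z \<in># r2. z \<le> w#} = length (filter (\<lambda>z. z \<le> w) p)"
      using that P ms(1) by (metis (no_types, lifting) filter_mset_add_mset leD mset_filter size_mset)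
    have "{#z \<in># r1. z < w#} = {#z \<in># {#z \<in># r1. z < x#}. z < w#}"
      using that by (auto simp: filter_filter_mset intro!: filter_mset_cong)
    then have 2: "size {#z \<in># r1. z < w#} = length (filter (\<lambda>z. z < w) c)"
      using ms(3) by (metis mset_filter size_mset)
    have "excess r1 r2 w < max_excess r1 r2" using that x excess_before_first_max by simp
    then have "int (length (filter (\<lambda>z. z \<le> w) p)) - int (length (filter (\<lambda>z. z < w) c))
       < int (length p) + 1 - int (length c)" unfolding M excess_def 1 2 .
    moreover have "length (filter (\<lambda>z. z \<le> w) p) + length (filter (\<lambda>z. w < z) p) = length p"
      using sum_length_filter_compl[of "\<lambda>z. z \<le> w" p] by (simp add: not_le)
    moreover have "length (filter (\<lambda>z. z < w) c) + length (filter (\<lambda>z. w \<le> z) c) = length c"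
      using sum_length_filter_compl[of "\<lambda>z. z < w" c] by (simp add: not_less)
    ultimately show ?thesis by linarith
  qed
  \<comment> \<open>Beyond \<open>x\<close> the excess does not exceed its value at
    \<open>x\<close>; this pairs the letters of \<open>s\<close> with smaller letters at the left
    end of \<open>d\<close>.\<close>
  have high: "length (filter (\<lambda>z. z \<le> w) s) \<le> length (filter (\<lambda>z. z < w) d)" if "x < w" for w
  proof -
    have "{#z \<in># r2. z \<le> w#} = {#z \<in># {#z \<in># r2. z \<le> x#}. z \<le> w#} + {#z \<in># {#z \<in># r2. x < z#}. z \<le> w#}"
      by (subst split2[symmetric]) simp
    also have "{#z \<in># {#z \<in># r2. z \<le> x#}. z \<le> w#} = add_mset x P"
      using that by (auto simp: P[symmetric] filter_filter_mset intro!: filter_mset_cong)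
    finally have 1: "size {#z \<in># r2. z \<le> w#} = length p + 1 + length (filter (\<lambda>z. z \<le> w) s)"
      using ms(1,2) by (metis Suc_eq_plus1 mset_filter size_add_mset size_mset size_union)
    have "{#z \<in># r1. z < w#} = {#z \<in># {#z \<in># r1. z < x#}. z < w#} + {#z \<in># {#z \<in># r1. x \<le> z#}. z < w#}"
      by (subst split1[symmetric]) simp
    also have "{#z \<in># {#z \<in># r1. z < x#}. z < w#} = {#z \<in># r1. z < x#}"
      using that by (auto simp: filter_filter_mset intro!: filter_mset_cong)
    finally have 2: "size {#z \<in># r1. z < w#} = length c + length (filter (\<lambda>z. z < w) d)"
      using ms(3,4) by (metis mset_filter size_mset size_union)
    have "excess r1 r2 w \<le> max_excess r1 r2" by (rule excess_le_max)
    then show ?thesis unfolding M excess_def 1 2 by simp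
  qed
  have cc: "length c \<le> length p \<and> c ! i < p ! (i + (length p - length c))" if i: "i < length c" for i
  proof -
    have "c ! i \<in> set c" using i by simp
    then have "c ! i < x" using sets by blast
    then have "length c - i \<le> length (filter (\<lambda>z. c ! i < z) p)"
      using low sorted_filter_ge[OF so(3) i] by (meson le_trans)
    then have g: "length c - i \<le> length p" "c ! i < p ! (length p - (length c - i))"
      using sorted_filter_greater[OF so(1), of "length c - i" "c ! i"] i by linarith+
    moreover have "length c \<le> length p"
    proof -
      have "0 < length c" using i by linarith
      then have "c ! 0 \<in> set c" by simp
      then have "c ! 0 < x" using sets by blast
      then have "length c - 0 \<le> length (filter (\<lambda>z. c ! 0 < z) p)"
        using low sorted_filter_ge[OF so(3) \<open>0 < length c\<close>] by (meson le_trans)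
      then show ?thesis
        using sorted_filter_greater[OF so(1), of "length c" "c ! 0"] \<open>0 < length c\<close> by linarith
    qed
    moreover have "length p - (length c - i) = i + (length p - length c)" using calculation i by simp
    ultimately show ?thesis by simp
  qed
  have dd: "i < length d \<and> d ! i < s ! i" if i: "i < length s" for i
  proof -
    have "s ! i \<in> set s" using i by simp
    then have "x < s ! i" using sets by blast
    then have "i < length (filter (\<lambda>z. z < s ! i) d)"
      using high[of "s ! i"] sorted_filter_le[OF so(2) i] by linarith
    then show ?thesis using sorted_filter_less[OF so(4)] by blast
  qed
  have "length c \<le> length p" using cc by (cases c) auto
  moreover have "length s \<le> length d" using dd by (meson not_le less_irrefl)
  ultimately show ?thesis unfolding w2 r1 r2' r1'
    using slide_up[OF \<open>sorted (p @ x # s)\<close> \<open>sorted (c @ x # d)\<close>] cc dd by blast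
qed


section \<open>Weighted sums over fillings with prescribed row sizes\<close>

text \<open>The shifted action: \<open>\<beta> + \<rho>\<close> is permuted and \<rho> is subtracted
  again. Only differences of entries of \<rho> enter, so the number of variables does not
  appear.\<close>

definition dot :: "(nat \<Rightarrow> nat) \<Rightarrow> (nat \<Rightarrow> int) \<Rightarrow> nat \<Rightarrow> int" where
  "dot w \<beta> i = \<beta> (w i) + int i - int (w i)"

lemma dot_comp: "dot (w \<circ> u) \<beta> = dot u (dot w \<beta>)"
  by (rule ext) (simp add: dot_def)

lemma dot_id [simp]: "dot id \<beta> = \<beta>"
  by (rule ext) (simp add: dot_def)

text \<open>Row sizes are integers because dot-translates may have negative entries; such vectors
  simply have no fillings. Rows outside 1..n are fixed to be empty, so that each filling is
  represented by one function.\<close>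

definition fillings :: "nat \<Rightarrow> nat multiset \<Rightarrow> (nat \<Rightarrow> int) \<Rightarrow> (nat \<Rightarrow> nat multiset) set" where
  "fillings n C \<beta> = {rs. (\<forall>i. i \<notin> {1..n} \<longrightarrow> rs i = {#}) \<and>
     (\<forall>i \<in> {1..n}. int (size (rs i)) = \<beta> i) \<and> (\<Sum>i = 1..n. rs i) = C}"

lemma finite_submultisets: "finite {M. M \<subseteq># C}"
proof (induction C)
  case (add x C)
  have "{M. M \<subseteq># add_mset x C} \<subseteq> {M. M \<subseteq># C} \<union> add_mset x ` {M. M \<subseteq># C}"
  proof
    fix M assume M: "M \<in> {M. M \<subseteq># add_mset x C}"
    show "M \<in> {M. M \<subseteq># C} \<union> add_mset x ` {M. M \<subseteq># C}"
    proof (cases "x \<in># M")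
      case True
      then obtain N where "M = add_mset x N" using multi_member_split by metis
      then show ?thesis using M by auto
    next
      case False
      then have "M \<subseteq># C" using M by (metis Diff_eq_empty_iff_mset diff_single_trivial mem_Collect_eq subset_eq_diff_conv add_mset_add_single)
      then show ?thesis by simp
    qed
  qed
  then show ?case using add finite_subset by blast
qed simp

lemma finite_fillings: "finite (fillings n C \<beta>)"
proof (rule finite_subset)
  show "fillings n C \<beta> \<subseteq>
    {rs. \<forall>i. (i \<in> {1..n} \<longrightarrow> rs i \<in> {M. M \<subseteq># C}) \<and> (i \<notin> {1..n} \<longrightarrow> rs i = {#})}"
  proof
    fix rs assume rs: "rs \<in> fillings n C \<beta>"
    have "rs i \<subseteq># C" if "i \<in> {1..n}" for i
    proof -
      have "(\<Sum>i = 1..n. rs i) = rs i + (\<Sum>j \<in> {1..n} - {i}. rs j)" using that by (intro sum.remove) auto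
      moreover have "(\<Sum>i = 1..n. rs i) = C" using rs by (simp add: fillings_def)
      ultimately show ?thesis by (metis mset_subset_eq_add_left)
    qed
    then show "rs \<in> {rs. \<forall>i. (i \<in> {1..n} \<longrightarrow> rs i \<in> {M. M \<subseteq># C}) \<and> (i \<notin> {1..n} \<longrightarrow> rs i = {#})}"
      using rs by (auto simp: fillings_def)
  qed
qed (rule finite_set_of_finite_funs; simp add: finite_submultisets)

lemma fillings_cong: "(\<And>i. i \<in> {1..n} \<Longrightarrow> \<beta> i = \<beta>' i) \<Longrightarrow> fillings n C \<beta> = fillings n C \<beta>'"
  unfolding fillings_def by auto

abbreviation row_max_excess :: "nat \<Rightarrow> (nat \<Rightarrow> nat multiset) \<Rightarrow> int" where
  "row_max_excess i rs \<equiv> max_excess (rs i) (rs (Suc i))"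

definition raise :: "nat \<Rightarrow> (nat \<Rightarrow> nat multiset) \<Rightarrow> nat \<Rightarrow> nat multiset" where
  "raise i rs = (let x = first_max (rs i) (rs (Suc i)) in
     rs(i := add_mset x (rs i), Suc i := rs (Suc i) - {#x#}))"

definition lower :: "nat \<Rightarrow> (nat \<Rightarrow> nat multiset) \<Rightarrow> nat \<Rightarrow> nat multiset" where
  "lower i rs = (let x = last_max (rs i) (rs (Suc i)) in
     rs(i := rs i - {#x#}, Suc i := add_mset x (rs (Suc i))))"

lemma sum_mset_two:
  fixes g :: "nat \<Rightarrow> 'a::comm_monoid_add"
  assumes "1 \<le> i" "i < n"
  shows "(\<Sum>j = 1..n. g j) = g i + g (Suc i) + (\<Sum>j \<in> {1..n} - {i, Suc i}. g j)"
proof -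
  have "(\<Sum>j = 1..n. g j) = g i + (\<Sum>j \<in> {1..n} - {i}. g j)"
    using assms by (intro sum.remove) auto
  also have "(\<Sum>j \<in> {1..n} - {i}. g j) = g (Suc i) + (\<Sum>j \<in> {1..n} - {i} - {Suc i}. g j)"
    using assms by (intro sum.remove) auto
  also have "{1..n} - {i} - {Suc i} = {1..n} - {i, Suc i}" by auto
  finally show ?thesis by (simp add: add.assoc)
qed

lemma fillings_two_rows:
  assumes i: "1 \<le> i" "i < n" and rs: "rs \<in> fillings n C \<beta>"
    and u: "A + B = rs i + rs (Suc i)"
  shows "rs(i := A, Suc i := B) \<in> fillings n C (\<beta>(i := int (size A), Suc i := int (size B)))"
proof -
  have "(\<Sum>j = 1..n. (rs(i := A, Suc i := B)) j) = A + B + (\<Sum>j \<in> {1..n} - {i, Suc i}. rs j)"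
    unfolding sum_mset_two[OF i] by (auto intro: sum.cong)
  also have "\<dots> = (\<Sum>j = 1..n. rs j)" unfolding sum_mset_two[OF i] u ..
  finally show ?thesis using rs i by (auto simp: fillings_def)
qed

lemma raise_fillings:
  assumes i: "1 \<le> i" "i < n" and rs: "rs \<in> fillings n C \<beta>" and m: "1 \<le> row_max_excess i rs"
  shows "raise i rs \<in> fillings n C (\<beta>(i := \<beta> i + 1, Suc i := \<beta> (Suc i) - 1))"
proof -
  define x where "x = first_max (rs i) (rs (Suc i))"
  have x: "x \<in># rs (Suc i)" using first_max_in[OF m] by (simp add: x_def)
  then have "0 < size (rs (Suc i))" by (metis size_eq_0_iff_empty empty_iff set_mset_empty gr0I)
  then have "int (size (add_mset x (rs i))) = \<beta> i + 1" "int (size (rs (Suc i) - {#x#})) = \<beta> (Suc i) - 1"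
    using rs i x by (auto simp: fillings_def size_Diff_singleton of_nat_diff)
  then show ?thesis
    using fillings_two_rows[OF i rs, of "add_mset x (rs i)" "rs (Suc i) - {#x#}"] x
    by (simp add: raise_def x_def[symmetric] Let_def add.commute)
qed

lemma lower_fillings:
  assumes i: "1 \<le> i" "i < n" and rs: "rs \<in> fillings n C \<beta>"
    and m: "int (size (rs (Suc i))) - int (size (rs i)) < row_max_excess i rs"
  shows "lower i rs \<in> fillings n C (\<beta>(i := \<beta> i - 1, Suc i := \<beta> (Suc i) + 1))"
proof -
  define x where "x = last_max (rs i) (rs (Suc i))"
  have x: "x \<in># rs i" using last_max_in[OF m] by (simp add: x_def)
  then have "0 < size (rs i)" by (metis size_eq_0_iff_empty empty_iff set_mset_empty gr0I)
  then have "int (size (add_mset x (rs (Suc i)))) = \<beta> (Suc i) + 1" "int (size (rs i - {#x#})) = \<beta> i - 1"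
    using rs i x by (auto simp: fillings_def size_Diff_singleton of_nat_diff)
  then show ?thesis
    using fillings_two_rows[OF i rs, of "rs i - {#x#}" "add_mset x (rs (Suc i))"] x
    by (simp add: lower_def x_def[symmetric] Let_def add.commute)
qed

lemma max_excess_raise: "1 \<le> row_max_excess i rs \<Longrightarrow> row_max_excess i (raise i rs) = row_max_excess i rs - 1"
  using raise_pair(1)[OF _ refl] by (simp add: raise_def Let_def)

lemma max_excess_lower:
  "int (size (rs (Suc i))) - int (size (rs i)) < row_max_excess i rs \<Longrightarrow>
   row_max_excess i (lower i rs) = row_max_excess i rs + 1"
  using lower_pair(1)[OF _ refl] by (simp add: lower_def Let_def)

lemma lower_raise:
  assumes "1 \<le> row_max_excess i rs"
  shows "lower i (raise i rs) = rs"
proof -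
  define x where "x = first_max (rs i) (rs (Suc i))"
  have "x \<in># rs (Suc i)" using first_max_in[OF assms] by (simp add: x_def)
  moreover have "last_max (add_mset x (rs i)) (rs (Suc i) - {#x#}) = x"
    using raise_pair(2)[OF assms x_def] .
  ultimately show ?thesis
    by (auto simp: lower_def raise_def x_def[symmetric] Let_def fun_eq_iff)
qed

lemma raise_lower:
  assumes "int (size (rs (Suc i))) - int (size (rs i)) < row_max_excess i rs"
  shows "raise i (lower i rs) = rs"
proof -
  define x where "x = last_max (rs i) (rs (Suc i))"
  have "x \<in># rs i" using last_max_in[OF assms] by (simp add: x_def)
  moreover have "first_max (rs i - {#x#}) (add_mset x (rs (Suc i))) = x"
    using lower_pair(2)[OF assms x_def] .
  ultimately show ?thesis
    by (auto simp: lower_def raise_def x_def[symmetric] Let_def fun_eq_iff)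
qed

text \<open>Raising is a bijection that lowers the threshold on the maximal excess by one. The bound
  on \<open>a\<close> says that after the move the maximum exceeds the difference of the row sizes,
  so that lowering is defined on the whole target.\<close>

lemma sum_raise:
  fixes f :: "(nat \<Rightarrow> nat multiset) \<Rightarrow> 'a::comm_monoid_add"
  assumes i: "1 \<le> i" "i < n" and a: "0 \<le> a" "\<beta> (Suc i) - \<beta> i - 2 < a"
    and Q: "\<And>rs. a + 1 \<le> row_max_excess i rs \<Longrightarrow> Q (raise i rs) \<longleftrightarrow> Q rs"
    and f: "\<And>rs \<beta>. rs \<in> fillings n C \<beta> \<Longrightarrow> 1 \<le> row_max_excess i rs \<Longrightarrow> f (raise i rs) = f rs"
  shows "(\<Sum>rs | rs \<in> fillings n C \<beta> \<and> a + 1 \<le> row_max_excess i rs \<and> Q rs. f rs) =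
    (\<Sum>rs | rs \<in> fillings n C (\<beta>(i := \<beta> i + 1, Suc i := \<beta> (Suc i) - 1)) \<and> a \<le> row_max_excess i rs \<and> Q rs. f rs)"
    (is "sum f ?A = sum f ?B")
proof (rule sum.reindex_bij_witness[where i = "lower i" and j = "raise i"])
  fix rs assume rs: "rs \<in> ?A"
  then show "lower i (raise i rs) = rs" using a lower_raise by simp
  show "raise i rs \<in> ?B" using rs a raise_fillings[OF i] max_excess_raise Q by auto
  show "f (raise i rs) = f rs" using rs a f by auto
next
  fix rs assume rs: "rs \<in> ?B"
  then have s: "int (size (rs i)) = \<beta> i + 1" "int (size (rs (Suc i))) = \<beta> (Suc i) - 1"
    using i by (auto simp: fillings_def)
  then have m: "int (size (rs (Suc i))) - int (size (rs i)) < row_max_excess i rs" using a rs by simp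
  show "raise i (lower i rs) = rs" using raise_lower[OF m] .
  have "lower i rs \<in> fillings n C \<beta>" using lower_fillings[OF i _ m] rs by fastforce
  moreover have "a + 1 \<le> row_max_excess i (lower i rs)" using max_excess_lower[OF m] rs by simp
  moreover have "Q (lower i rs)" using Q[OF calculation(2)] raise_lower[OF m] rs by simp
  ultimately show "lower i rs \<in> ?A" by simp
qed

text \<open>Raise \<open>d\<close> times, the threshold falling from \<open>a + d\<close> to
  \<open>a\<close>. At the start \<open>a + d\<close> is the difference of the two row sizes, and
  the maximal excess is never below that, so there the thresholds \<open>a\<close> and
  \<open>a + d\<close> select the same fillings.\<close>

lemma sum_swap_up:
  fixes f :: "(nat \<Rightarrow> nat multiset) \<Rightarrow> 'a::comm_monoid_add"
  assumes i: "1 \<le> i" "i < n" and a: "0 \<le> a"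
    and Q: "\<And>rs. a + 1 \<le> row_max_excess i rs \<Longrightarrow> Q (raise i rs) \<longleftrightarrow> Q rs"
    and f: "\<And>rs \<beta>. rs \<in> fillings n C \<beta> \<Longrightarrow> 1 \<le> row_max_excess i rs \<Longrightarrow> f (raise i rs) = f rs"
    and le: "\<beta> i + a \<le> \<beta> (Suc i)"
  shows "(\<Sum>rs | rs \<in> fillings n C \<beta> \<and> a \<le> row_max_excess i rs \<and> Q rs. f rs) =
    (\<Sum>rs | rs \<in> fillings n C (\<beta>(i := \<beta> (Suc i) - a, Suc i := \<beta> i + a)) \<and> a \<le> row_max_excess i rs \<and> Q rs. f rs)"
proof -
  define d where "d = nat (\<beta> (Suc i) - \<beta> i - a)"
  have d: "int d = \<beta> (Suc i) - \<beta> i - a" using le by (simp add: d_def)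
  define b where "b j = \<beta>(i := \<beta> i + int j, Suc i := \<beta> (Suc i) - int j)" for j
  define S where "S j = (\<Sum>rs | rs \<in> fillings n C (b j) \<and> a + int d - int j \<le> row_max_excess i rs \<and> Q rs. f rs)" for j
  have step: "S j = S (Suc j)" if "j < d" for j
  proof -
    have eq: "(b j)(i := b j i + 1, Suc i := b j (Suc i) - 1) = b (Suc j)" by (auto simp: b_def)
    have al: "a + int d - int (Suc j) + 1 = a + int d - int j" by simp
    have "a + int d - int (Suc j) \<ge> a" using that by simp
    then show ?thesis
      using sum_raise[OF i, where a = "a + int d - int (Suc j)" and \<beta> = "b j" and Q = Q and f = f and C = C] a d Q f that
      unfolding S_def eq al by (auto simp: b_def)
  qed
  have "S 0 = S j" if "j \<le> d" for j using that by (induction j) (auto simp: step)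
  then have "S 0 = S d" by simp
  moreover have "S 0 = (\<Sum>rs | rs \<in> fillings n C \<beta> \<and> a \<le> row_max_excess i rs \<and> Q rs. f rs)"
  proof -
    have "a + int d - int 0 \<le> row_max_excess i rs \<longleftrightarrow> a \<le> row_max_excess i rs" if "rs \<in> fillings n C (b 0)" for rs
    proof -
      have "int (size (rs i)) = \<beta> i" "int (size (rs (Suc i))) = \<beta> (Suc i)"
        using that i by (auto simp: fillings_def b_def)
      then show ?thesis using max_excess_ge_diff[of "rs (Suc i)" "rs i"] d by auto
    qed
    moreover have "b 0 = \<beta>" by (simp add: b_def)
    ultimately show ?thesis unfolding S_def by (intro sum.cong) auto
  qed
  moreover have "b d = \<beta>(i := \<beta> (Suc i) - a, Suc i := \<beta> i + a)" using d by (auto simp: b_def)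
  ultimately show ?thesis by (simp add: S_def)
qed

text \<open>With \<open>a = 0\<close> two adjacent row sizes are exchanged, which gives the symmetry
  of the weighted count. With \<open>a = 1\<close> the new sizes are the dot-translate by the
  adjacent transposition, which gives the cancellation in signed sums.\<close>

lemma sum_swap:
  fixes f :: "(nat \<Rightarrow> nat multiset) \<Rightarrow> 'a::comm_monoid_add"
  assumes i: "1 \<le> i" "i < n" and a: "0 \<le> a"
    and Q: "\<And>rs. a + 1 \<le> row_max_excess i rs \<Longrightarrow> Q (raise i rs) \<longleftrightarrow> Q rs"
    and f: "\<And>rs \<beta>. rs \<in> fillings n C \<beta> \<Longrightarrow> 1 \<le> row_max_excess i rs \<Longrightarrow> f (raise i rs) = f rs"
  shows "(\<Sum>rs | rs \<in> fillings n C \<beta> \<and> a \<le> row_max_excess i rs \<and> Q rs. f rs) =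
    (\<Sum>rs | rs \<in> fillings n C (\<beta>(i := \<beta> (Suc i) - a, Suc i := \<beta> i + a)) \<and> a \<le> row_max_excess i rs \<and> Q rs. f rs)"
proof (cases "\<beta> i + a \<le> \<beta> (Suc i)")
  case True
  then show ?thesis using sum_swap_up[where f = f and Q = Q] assms by blast
next
  case False
  define \<beta>' where "\<beta>' = \<beta>(i := \<beta> (Suc i) - a, Suc i := \<beta> i + a)"
  have "\<beta>' i + a \<le> \<beta>' (Suc i)" using False a by (auto simp: \<beta>'_def)
  moreover have "\<beta>'(i := \<beta>' (Suc i) - a, Suc i := \<beta>' i + a) = \<beta>" by (auto simp: \<beta>'_def)
  ultimately show ?thesis
    using sum_swap_up[where f = f and Q = Q and \<beta> = \<beta>' and C = C, OF i a Q f, simplified] unfolding \<beta>'_def[symmetric] by simp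
qed

lemma word_split:
  assumes "lo \<le> k" "k \<le> Suc hi"
  shows "word lo hi rs = word k hi rs @ concat (map (\<lambda>i. sorted_list_of_multiset (rs i)) (rev [lo..<k]))"
proof -
  have "[lo..<Suc hi] = [lo..<k] @ [k..<Suc hi]" using assms by (metis le_Suc_ex upt_add_eq_append)
  then show ?thesis by (simp add: word_def del: upt_Suc)
qed

lemma word_cong: "(\<And>i. lo \<le> i \<Longrightarrow> i \<le> hi \<Longrightarrow> rs i = rs' i) \<Longrightarrow> word lo hi rs = word lo hi rs'"
  unfolding word_def by (intro arg_cong[where f = concat] map_cong) auto

lemma word_two_rows:
  assumes "1 \<le> i" "i < n"
  shows "word 1 n rs = word (Suc (Suc i)) n rs @
    (sorted_list_of_multiset (rs (Suc i)) @ sorted_list_of_multiset (rs i)) @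
    concat (map (\<lambda>i. sorted_list_of_multiset (rs i)) (rev [1..<i]))"
proof -
  have "[1..<Suc (Suc i)] = [1..<i] @ [i, Suc i]" using assms by simp
  then show ?thesis using assms by (subst word_split[of 1 "Suc (Suc i)"]) (auto simp del: upt_Suc)
qed

lemma knuth_raise:
  assumes "1 \<le> i" "i < n" "1 \<le> row_max_excess i rs"
  shows "knuth_equiv (word 1 n rs) (word 1 n (raise i rs))"
proof -
  define x where "x = first_max (rs i) (rs (Suc i))"
  have 1: "word (Suc (Suc i)) n (raise i rs) = word (Suc (Suc i)) n rs"
    by (rule word_cong) (auto simp: raise_def Let_def)
  have 2: "concat (map (\<lambda>j. sorted_list_of_multiset (raise i rs j)) (rev [1..<i])) =
    concat (map (\<lambda>i. sorted_list_of_multiset (rs i)) (rev [1..<i]))"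
    by (intro arg_cong[where f = concat] map_cong) (auto simp: raise_def Let_def)
  have 3: "raise i rs i = add_mset x (rs i)" "raise i rs (Suc i) = rs (Suc i) - {#x#}"
    by (auto simp: raise_def Let_def x_def)
  show ?thesis unfolding word_two_rows[OF assms(1,2)] 1 2 3
    by (intro knuth_equiv_context knuth_raise_pair assms(3)) (simp add: x_def)
qed

lemma excess_raise:
  assumes m: "1 \<le> row_max_excess i rs" and x: "x = first_max (rs i) (rs (Suc i))"
  shows "excess (raise i rs j) (raise i rs (Suc j)) v = excess (rs j) (rs (Suc j)) v +
    (if j = i then - (if x \<le> v then 1 else 0) - (if x < v then 1 else 0)
     else if Suc j = i then (if x \<le> v then 1 else 0)
     else if j = Suc i then (if x < v then 1 else 0) else 0)"
proof -
  have r: "raise i rs k = (if k = i then add_mset x (rs i) else if k = Suc i then rs (Suc i) - {#x#} else rs k)" for k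
    by (simp add: raise_def x Let_def)
  obtain R where R: "rs (Suc i) = add_mset x R"
    using first_max_in[OF m] x multi_member_split by metis
  consider "j = i" | "Suc j = i" | "j = Suc i" | "j \<noteq> i" "Suc j \<noteq> i" "j \<noteq> Suc i" by blast
  then show ?thesis
  proof cases
    case 1
    then show ?thesis using raise_pair(3)[OF m x, of v] by (simp add: r)
  next
    case 2
    then show ?thesis by (auto simp: r excess_def)
  next
    case 3
    then show ?thesis by (auto simp: r excess_def R)
  next
    case 4
    then show ?thesis by (simp add: r)
  qed
qed

section \<open>The sign-reversing involution\<close>

definition lattice_rows :: "nat \<Rightarrow> nat \<Rightarrow> (nat \<Rightarrow> nat multiset) \<Rightarrow> bool" where
  "lattice_rows lo hi rs \<longleftrightarrow> (\<forall>i v. lo \<le> i \<longrightarrow> i < hi \<longrightarrow> excess (rs i) (rs (Suc i)) v \<le> 0)"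

text \<open>
  The first violation of the lattice condition, where value \<open>v\<close> in row \<open>i\<close> is read before all
  larger values and before the same value in higher rows.
\<close>
definition violation :: "nat \<Rightarrow> nat \<Rightarrow> (nat \<Rightarrow> nat multiset) \<Rightarrow> nat \<Rightarrow> nat \<Rightarrow> bool" where
  "violation lo hi rs v i \<longleftrightarrow> lo \<le> i \<and> i < hi \<and> 1 \<le> excess (rs i) (rs (Suc i)) v \<and>
     (\<forall>u j. u < v \<longrightarrow> lo \<le> j \<longrightarrow> j < hi \<longrightarrow> excess (rs j) (rs (Suc j)) u \<le> 0) \<and>
     (\<forall>j. i < j \<longrightarrow> j < hi \<longrightarrow> excess (rs j) (rs (Suc j)) v \<le> 0)"

lemma violation_unique:
  assumes "violation lo hi rs v i" "violation lo hi rs v' i'"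
  shows "v = v' \<and> i = i'"
proof -
  have "v = v'" using assms unfolding violation_def by (metis not_one_le_zero order_trans linorder_neqE_nat)
  moreover have "i = i'" using assms calculation unfolding violation_def
    by (metis not_one_le_zero order_trans linorder_neqE_nat)
  ultimately show ?thesis by simp
qed

lemma violation_exists:
  assumes "\<not> lattice_rows lo hi rs"
  shows "\<exists>v i. violation lo hi rs v i"
proof -
  define P where "P v i \<longleftrightarrow> lo \<le> i \<and> i < hi \<and> 1 \<le> excess (rs i) (rs (Suc i)) v" for v i
  define v where "v = (LEAST v. \<exists>i. P v i)"
  have nP: "excess (rs j) (rs (Suc j)) u \<le> 0" if "\<not> P u j" "lo \<le> j" "j < hi" for u j
    using that by (auto simp: P_def)
  then have "\<exists>v i. P v i" using assms unfolding lattice_rows_def by blast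
  then have ex: "\<exists>i. P v i" unfolding v_def by (rule LeastI_ex)
  have least: "\<not> P u j" if "u < v" for u j using not_less_Least[of u "\<lambda>v. \<exists>i. P v i"] that by (auto simp: v_def)
  define i where "i = (GREATEST i. P v i)"
  have b: "j \<le> hi" if "P v j" for j using that by (simp add: P_def)
  have "P v i" unfolding i_def by (rule GreatestI_ex_nat[OF ex b])
  moreover have "\<not> P v j" if "i < j" for j
    using Greatest_le_nat[of "P v" j hi] b that by (auto simp: i_def)
  ultimately have "violation lo hi rs v i"
    using least nP unfolding violation_def P_def[of v i] by (meson P_def less_imp_le order_trans)
  then show ?thesis by blast
qed

lemma violation_not_lattice: "violation lo hi rs v i \<Longrightarrow> \<not> lattice_rows lo hi rs"
  unfolding violation_def lattice_rows_def by (metis not_one_le_zero order_trans)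

lemma violation_first_max:
  assumes "violation lo hi rs v i"
  shows "v \<le> first_max (rs i) (rs (Suc i))" "1 \<le> row_max_excess i rs"
proof -
  have e: "1 \<le> excess (rs i) (rs (Suc i)) v" using assms by (simp add: violation_def)
  then show m: "1 \<le> row_max_excess i rs" using excess_le_max[of "rs i" "rs (Suc i)" v] by simp
  then have "\<not> excess (rs i) (rs (Suc i)) (first_max (rs i) (rs (Suc i))) \<le> 0"
    using excess_first_max[of "rs i" "rs (Suc i)"] by simp
  then show "v \<le> first_max (rs i) (rs (Suc i))"
    using assms unfolding violation_def by (meson not_le)
qed

text \<open>The letter \<open>x\<close> moved by raising is at least \<open>v\<close>, so below
  \<open>v\<close> nothing changes, and at \<open>v\<close> only the excess of row \<open>i\<close>
  or row \<open>i - 1\<close> over the next row can change. That of row \<open>i\<close> stays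
  positive at \<open>v\<close>: if \<open>v = x\<close>, it was a maximum of at least 2. That of row
  \<open>i - 1\<close> is not inspected at \<open>v\<close>, which is the reason for the order in
  which violations are read.\<close>

lemma violation_raise:
  assumes m: "2 \<le> row_max_excess i rs"
  shows "violation lo hi (raise i rs) v i \<longleftrightarrow> violation lo hi rs v i"
proof -
  define x where "x = first_max (rs i) (rs (Suc i))"
  have m1: "1 \<le> row_max_excess i rs" using m by simp
  note e = excess_raise[OF m1 x_def]
  have mx: "row_max_excess i (raise i rs) = row_max_excess i rs - 1" by (rule max_excess_raise[OF m1])
  have ex: "excess (rs i) (rs (Suc i)) x = row_max_excess i rs" by (simp add: x_def excess_first_max)
  show ?thesis
  proof
    assume V: "violation lo hi rs v i"
    have vx: "v \<le> x" using violation_first_max[OF V] by (simp add: x_def)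
    show "violation lo hi (raise i rs) v i"
      unfolding violation_def e
    proof (intro conjI allI impI)
      show "lo \<le> i" "i < hi" using V by (auto simp: violation_def)
      show "1 \<le> excess (rs i) (rs (Suc i)) v + (if i = i then - (if x \<le> v then 1 else 0) - (if x < v then 1 else 0)
        else if Suc i = i then if x \<le> v then 1 else 0 else if i = Suc i then if x < v then 1 else 0 else 0)"
      proof (cases "v = x")
        case True
        then show ?thesis using m ex by simp
      next
        case False
        then show ?thesis using V vx by (simp add: violation_def)
      qed
    next
      fix u j assume "u < v" "lo \<le> j" "j < hi"
      then show "excess (rs j) (rs (Suc j)) u + (if j = i then - (if x \<le> u then 1 else 0) - (if x < u then 1 else 0)
        else if Suc j = i then if x \<le> u then 1 else 0 else if j = Suc i then if x < u then 1 else 0 else 0) \<le> 0"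
        using V vx by (auto simp: violation_def)
    next
      fix j assume "i < j" "j < hi"
      then show "excess (rs j) (rs (Suc j)) v + (if j = i then - (if x \<le> v then 1 else 0) - (if x < v then 1 else 0)
        else if Suc j = i then if x \<le> v then 1 else 0 else if j = Suc i then if x < v then 1 else 0 else 0) \<le> 0"
        using V vx by (auto simp: violation_def)
    qed
  next
    assume V: "violation lo hi (raise i rs) v i"
    have "1 \<le> excess (raise i rs i) (raise i rs (Suc i)) x"
      using e[of i x] ex m by simp
    then have vx: "v \<le> x" using V unfolding violation_def by (meson leD le_less_linear not_one_le_zero order_trans)
    have V': "lo \<le> i" "i < hi" "1 \<le> excess (raise i rs i) (raise i rs (Suc i)) v"
      "\<And>u j. u < v \<Longrightarrow> lo \<le> j \<Longrightarrow> j < hi \<Longrightarrow> excess (raise i rs j) (raise i rs (Suc j)) u \<le> 0"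
      "\<And>j. i < j \<Longrightarrow> j < hi \<Longrightarrow> excess (raise i rs j) (raise i rs (Suc j)) v \<le> 0"
      using V unfolding violation_def by blast+
    show "violation lo hi rs v i"
      unfolding violation_def
    proof (intro conjI allI impI)
      show "lo \<le> i" "i < hi" by fact+
      show "1 \<le> excess (rs i) (rs (Suc i)) v" using V'(3) unfolding e by (auto split: if_splits)
    next
      fix u j assume "u < v" "lo \<le> j" "j < hi"
      then show "excess (rs j) (rs (Suc j)) u \<le> 0"
        using V'(4)[of u j] vx unfolding e by (auto split: if_splits)
    next
      fix j assume "i < j" "j < hi"
      then show "excess (rs j) (rs (Suc j)) v \<le> 0"
        using V'(5)[of j] vx unfolding e by (auto split: if_splits)
    qed
  qed
qed

lemma lattice_rows_sizes:
  assumes "lattice_rows lo hi rs" "lo \<le> i" "i < hi"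
  shows "size (rs (Suc i)) \<le> size (rs i)"
proof -
  obtain N where "excess (rs i) (rs (Suc i)) N = int (size (rs (Suc i))) - int (size (rs i))"
    using excess_eventually by blast
  moreover have "excess (rs i) (rs (Suc i)) N \<le> 0" using assms by (simp add: lattice_rows_def)
  ultimately show ?thesis by linarith
qed

lemma permutes_increasing_id:
  assumes w: "w permutes {lo..hi}" and inc: "\<And>i. lo \<le> i \<Longrightarrow> i < hi \<Longrightarrow> w i < w (Suc i)"
  shows "w = id"
proof -
  have mem: "w i \<in> {lo..hi}" if "i \<in> {lo..hi}" for i using w that permutes_in_image by metis
  have ge: "i \<le> w i" if "lo \<le> i" "i \<le> hi" for i
    using that
  proof (induction i rule: dec_induct)
    case base
    then show ?case using mem[of lo] by auto
  next
    case (step k)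
    then show ?case using inc[of k] by simp
  qed
  have le: "w i \<le> i" if "i \<le> hi" "lo \<le> i" for i
    using that
  proof (induction i rule: inc_induct)
    case base
    then show ?case using mem[of hi] by auto
  next
    case (step k)
    then show ?case using inc[of k] by simp
  qed
  show ?thesis
  proof
    fix i show "w i = id i"
      using ge[of i] le[of i] permutes_not_in[OF w, of i] by (cases "i \<in> {lo..hi}") auto
  qed
qed

lemma eq_uminus_self_fps: "x = - x \<Longrightarrow> x = (0 :: int fps)"
  by (simp add: fps_eq_iff)

text \<open>Fillings that violate the lattice condition are grouped by their first violation. For a
  violation in row \<open>i\<close> the weighted count is unchanged when the row sizes are replaced
  by their dot-translate under the transposition of \<open>i\<close> and \<open>i + 1\<close>, so
  the terms of \<open>w\<close> and \<open>w \<circ> s\<close> cancel. \<open>Q\<close> is any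
  further condition that survives the moves involved.\<close>

lemma signed_sum_lattice:
  fixes f :: "(nat \<Rightarrow> nat multiset) \<Rightarrow> int fps"
  assumes lo: "1 \<le> lo" "hi \<le> n"
    and dec: "\<And>i. lo \<le> i \<Longrightarrow> i < hi \<Longrightarrow> \<beta> (Suc i) \<le> \<beta> i"
    and f: "\<And>rs i \<beta>. rs \<in> fillings n C \<beta> \<Longrightarrow> lo \<le> i \<Longrightarrow> i < hi \<Longrightarrow> 1 \<le> row_max_excess i rs \<Longrightarrow> f (raise i rs) = f rs"
    and Q: "\<And>rs v i. violation lo hi rs v i \<Longrightarrow> 2 \<le> row_max_excess i rs \<Longrightarrow> Q (raise i rs) \<longleftrightarrow> Q rs"
  shows "(\<Sum>w | w permutes {lo..hi}. of_int (sign w) * (\<Sum>rs | rs \<in> fillings n C (dot w \<beta>) \<and> Q rs. f rs)) =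
    (\<Sum>rs | rs \<in> fillings n C \<beta> \<and> Q rs \<and> lattice_rows lo hi rs. f rs)"
proof -
  let ?W = "{w. w permutes {lo..hi}}"
  have finW: "finite ?W" by (rule finite_permutations) simp
  define A where "A w = {rs. rs \<in> fillings n C (dot w \<beta>) \<and> Q rs \<and> lattice_rows lo hi rs}" for w
  define V where "V w = {rs. rs \<in> fillings n C (dot w \<beta>) \<and> Q rs \<and> \<not> lattice_rows lo hi rs}" for w
  define ty where "ty rs = (SOME t. violation lo hi rs (fst t) (snd t))" for rs
  have ty: "violation lo hi rs (fst (ty rs)) (snd (ty rs))" if nl: "\<not> lattice_rows lo hi rs" for rs
  proof -
    obtain v i where "violation lo hi rs v i" using violation_exists[OF nl] by blast
    then show ?thesis unfolding ty_def by (intro someI[of "\<lambda>t. violation lo hi rs (fst t) (snd t)" "(v, i)"]) simp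
  qed
  have tyeq: "ty rs = (v, i) \<longleftrightarrow> violation lo hi rs v i" if "\<not> lattice_rows lo hi rs" for rs v i
  proof
    assume "ty rs = (v, i)"
    then show "violation lo hi rs v i" using ty[OF that] by simp
  next
    assume "violation lo hi rs v i"
    then show "ty rs = (v, i)" using violation_unique[OF ty[OF that]] by (auto intro: prod_eqI)
  qed
  have fin: "finite (A w)" "finite (V w)" for w
    unfolding A_def V_def by (rule finite_subset[OF _ finite_fillings[of n C "dot w \<beta>"]]; auto)+
  define T where "T = ty ` (\<Union>w \<in> ?W. V w)"
  have finT: "finite T" unfolding T_def using fin finW by blast
  have split: "(\<Sum>rs | rs \<in> fillings n C (dot w \<beta>) \<and> Q rs. f rs) = sum f (A w) + sum f (V w)" for w
  proof -
    have "{rs. rs \<in> fillings n C (dot w \<beta>) \<and> Q rs} = A w \<union> V w" by (auto simp: A_def V_def)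
    then show ?thesis using sum.union_disjoint[OF fin[of w], of f] by (auto simp: A_def V_def)
  qed
  have Vt: "sum f (V w) = (\<Sum>t \<in> T. sum f {rs \<in> V w. ty rs = t})" if "w \<in> ?W" for w
    using that by (intro sum.group[symmetric] fin finT) (auto simp: T_def)
  \<comment> \<open>A lattice filling has weakly decreasing row sizes. The numbers
    \<open>\<beta> i - i\<close> decrease strictly, so a dot-translate of \<open>\<beta>\<close> by
    \<open>w\<close> is weakly decreasing only if \<open>w\<close> is increasing.\<close>
  have Aempty: "A w = {}" if w: "w permutes {lo..hi}" "w \<noteq> id" for w
  proof (rule ccontr)
    assume "A w \<noteq> {}"
    then obtain rs where rs: "rs \<in> fillings n C (dot w \<beta>)" "lattice_rows lo hi rs" by (auto simp: A_def)
    have "w i < w (Suc i)" if i: "lo \<le> i" "i < hi" for i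
    proof -
      have "int (size (rs i)) = dot w \<beta> i" "int (size (rs (Suc i))) = dot w \<beta> (Suc i)"
        using rs(1) i lo by (auto simp: fillings_def)
      then have d: "dot w \<beta> (Suc i) \<le> dot w \<beta> i" using lattice_rows_sizes[OF rs(2) i] by linarith
      have mono: "\<beta> b \<le> \<beta> a" if "lo \<le> a" "a \<le> b" "b \<le> hi" for a b
        using that(2,3,1)
      proof (induction b rule: dec_induct)
        case (step k) then show ?case using dec[of k] by auto
      qed simp
      have "w i \<in> {lo..hi}" "w (Suc i) \<in> {lo..hi}" using w i permutes_in_image[OF w(1)] by auto
      then have "w (Suc i) \<le> w i \<Longrightarrow> \<beta> (w i) \<le> \<beta> (w (Suc i))" using mono by auto
      then show ?thesis using d by (cases "w (Suc i) \<le> w i") (auto simp: dot_def)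
    qed
    then show False using permutes_increasing_id w by blast
  qed
  have Vzero: "(\<Sum>w \<in> ?W. of_int (sign w) * sum f {rs \<in> V w. ty rs = t}) = 0" if tT: "t \<in> T" for t
  proof -
    obtain v i where t: "t = (v, i)" by (cases t)
    obtain rs where "\<not> lattice_rows lo hi rs" "ty rs = t" using tT by (auto simp: T_def V_def)
    then have "violation lo hi rs v i" using tyeq t by blast
    then have i: "lo \<le> i" "i < hi" by (auto simp: violation_def)
    define X where "X \<beta> = (\<Sum>rs | rs \<in> fillings n C \<beta> \<and> 1 \<le> row_max_excess i rs \<and> (Q rs \<and> violation lo hi rs v i). f rs)" for \<beta>
    have X: "sum f {rs \<in> V w. ty rs = t} = X (dot w \<beta>)" for w
    proof -
      have "{rs \<in> V w. ty rs = t} = {rs. rs \<in> fillings n C (dot w \<beta>) \<and> 1 \<le> row_max_excess i rs \<and> (Q rs \<and> violation lo hi rs v i)}"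
        using tyeq violation_not_lattice violation_first_max(2) unfolding V_def t by blast
      then show ?thesis by (simp add: X_def)
    qed
    define s where "s = Transposition.transpose i (Suc i)"
    have s: "s permutes {lo..hi}" unfolding s_def using i by (intro permutes_swap_id) auto
    have Xs: "X (dot s \<beta>') = X \<beta>'" for \<beta>'
    proof -
      have "dot s \<beta>' = \<beta>'(i := \<beta>' (Suc i) - 1, Suc i := \<beta>' i + 1)"
        by (auto simp: dot_def s_def fun_eq_iff transpose_def)
      moreover have "Q (raise i rs) \<and> violation lo hi (raise i rs) v i \<longleftrightarrow> Q rs \<and> violation lo hi rs v i"
        if "2 \<le> row_max_excess i rs" for rs
        using Q violation_raise[OF that, of lo hi v] that by blast
      ultimately show ?thesis
        unfolding X_def using sum_swap[where i = i and n = n and a = 1 and Q = "\<lambda>rs. Q rs \<and> violation lo hi rs v i" and f = f and C = C and \<beta> = \<beta>'] i lo f by simp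
    qed
    have sgn: "sign (w \<circ> s) = - sign w" if "w permutes {lo..hi}" for w
    proof -
      have "permutation w" "permutation s" using that s permutation_permutes by blast+
      then show ?thesis by (simp add: sign_compose s_def sign_swap_id)
    qed
    have "(\<Sum>w \<in> ?W. of_int (sign w) * X (dot w \<beta>)) = (\<Sum>w \<in> ?W. of_int (sign (w \<circ> s)) * X (dot (w \<circ> s) \<beta>))"
      by (rule sum_permutations_compose_right[OF s])
    also have "\<dots> = (\<Sum>w \<in> ?W. - (of_int (sign w) * X (dot w \<beta>)))"
      by (rule sum.cong) (auto simp: sgn dot_comp Xs)
    also have "\<dots> = - (\<Sum>w \<in> ?W. of_int (sign w) * X (dot w \<beta>))" by (rule sum_negf)
    finally show ?thesis unfolding X by (rule eq_uminus_self_fps)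
  qed
  have "(\<Sum>w \<in> ?W. of_int (sign w) * sum f (V w)) = (\<Sum>w \<in> ?W. \<Sum>t \<in> T. of_int (sign w) * sum f {rs \<in> V w. ty rs = t})"
    by (rule sum.cong) (auto simp: Vt sum_distrib_left)
  also have "\<dots> = (\<Sum>t \<in> T. \<Sum>w \<in> ?W. of_int (sign w) * sum f {rs \<in> V w. ty rs = t})" by (rule sum.swap)
  also have "\<dots> = 0" using Vzero by simp
  finally have V0: "(\<Sum>w \<in> ?W. of_int (sign w) * sum f (V w)) = 0" .
  have "(\<Sum>w \<in> ?W. of_int (sign w) * sum f (A w)) = (\<Sum>w \<in> ?W. if w = id then sum f (A id) else 0)"
    by (rule sum.cong) (auto simp: Aempty)
  also have "\<dots> = sum f (A id)" using finW permutes_id by simp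
  finally have "(\<Sum>w \<in> ?W. of_int (sign w) * (\<Sum>rs | rs \<in> fillings n C (dot w \<beta>) \<and> Q rs. f rs)) = sum f (A id)"
    unfolding split distrib_left sum.distrib V0 by simp
  then show ?thesis by (simp add: A_def)
qed


section \<open>Pieri rule\<close>

lemma permutes_sign_compose:
  assumes "finite S" "u permutes S" "w permutes S"
  shows "sign (u \<circ> w) = sign u * sign w"
  using assms by (meson permutation_permutes sign_compose)

lemma symmetric_transpose:
  fixes \<Phi> :: "(nat \<Rightarrow> int) \<Rightarrow> 'a"
  assumes adj: "\<And>\<beta> i. 1 \<le> i \<Longrightarrow> i < n \<Longrightarrow> \<Phi> (\<beta> \<circ> Transposition.transpose i (Suc i)) = \<Phi> \<beta>"
  shows "1 \<le> a \<Longrightarrow> a + d < n \<Longrightarrow> \<Phi> (\<beta> \<circ> Transposition.transpose a (Suc (a + d))) = \<Phi> \<beta>"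
proof (induction d arbitrary: \<beta>)
  case 0
  then show ?case unfolding add_0_right by (intro adj) auto
next
  case (Suc d)
  let ?s = "Transposition.transpose (Suc (a + d)) (Suc (Suc (a + d)))"
  let ?t = "Transposition.transpose a (Suc (a + d))"
  have e: "Transposition.transpose a (Suc (a + Suc d)) = ?s \<circ> ?t \<circ> ?s"
    by (auto simp: transpose_def fun_eq_iff)
  have "\<Phi> (\<beta> \<circ> Transposition.transpose a (Suc (a + Suc d))) = \<Phi> (((\<beta> \<circ> ?s) \<circ> ?t) \<circ> ?s)"
    unfolding e comp_assoc ..
  also have "\<dots> = \<Phi> ((\<beta> \<circ> ?s) \<circ> ?t)" using Suc.prems by (intro adj) auto
  also have "\<dots> = \<Phi> (\<beta> \<circ> ?s)" by (rule Suc.IH) (use Suc.prems in auto)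
  also have "\<dots> = \<Phi> \<beta>" using Suc.prems by (intro adj) auto
  finally show ?case .
qed

lemma symmetric_permutes:
  fixes \<Phi> :: "(nat \<Rightarrow> int) \<Rightarrow> 'a"
  assumes adj: "\<And>\<beta> i. 1 \<le> i \<Longrightarrow> i < n \<Longrightarrow> \<Phi> (\<beta> \<circ> Transposition.transpose i (Suc i)) = \<Phi> \<beta>"
    and w: "w permutes {1..n}"
  shows "\<Phi> (\<beta> \<circ> w) = \<Phi> \<beta>"
proof -
  have less: "\<Phi> (\<beta> \<circ> Transposition.transpose a b) = \<Phi> \<beta>" if "1 \<le> a" "a < b" "b \<le> n" for a b \<beta>
    using symmetric_transpose[of n \<Phi> a "b - a - 1" \<beta>, OF adj] that by simp
  have t: "\<Phi> (\<beta> \<circ> Transposition.transpose a b) = \<Phi> \<beta>" if "a \<in> {1..n}" "b \<in> {1..n}" "a \<noteq> b" for a b \<beta>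
    using that less[of a b] less[of b a] transpose_commute[of a b] by (cases "a < b") auto
  show ?thesis using w finite_atLeastAtMost[of 1 n]
  proof (induction arbitrary: \<beta> rule: permutes_induct)
    case id then show ?case by simp
  next
    case (swap a b p)
    then show ?case using t[of a b] unfolding comp_assoc[symmetric] by metis
  qed
qed

section \<open>Splitting an alternating sum over one more position\<close>

definition shift_cycle :: "nat \<Rightarrow> nat \<Rightarrow> nat \<Rightarrow> nat" where
  "shift_cycle p q v = (if q \<le> v \<and> v \<le> p then Suc v else if v = Suc p then q else v)"

lemma shift_cycle_props:
  assumes "1 \<le> q" "q \<le> Suc p"
  shows "shift_cycle p q permutes {1..Suc p} \<and> sign (shift_cycle p q) = (- 1) ^ (Suc p - q)"
  using assms(2,1)
proof (induction q rule: inc_induct)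
  case base
  have e: "shift_cycle p (Suc p) = id" by (auto simp: shift_cycle_def fun_eq_iff)
  show ?case unfolding e by (intro conjI permutes_id) simp
next
  case (step q)
  have e: "shift_cycle p q = shift_cycle p (Suc q) \<circ> Transposition.transpose q (Suc p)"
    using step by (auto simp: shift_cycle_def fun_eq_iff transpose_def)
  have t: "Transposition.transpose q (Suc p) permutes {1..Suc p}" using step by (intro permutes_swap_id) auto
  have IH: "shift_cycle p (Suc q) permutes {1..Suc p}" "sign (shift_cycle p (Suc q)) = (- 1) ^ (Suc p - Suc q)"
    using step by auto
  have pq: "Suc p - q = Suc (Suc p - Suc q)" using step by simp
  have "sign (shift_cycle p q) = sign (shift_cycle p (Suc q)) * sign (Transposition.transpose q (Suc p))"
    unfolding e by (rule permutes_sign_compose[OF _ IH(1) t]) simp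
  also have "\<dots> = (- 1) ^ (Suc p - q)" unfolding IH(2) pq using step by (simp add: sign_swap_id)
  finally show ?case by (rule conjI[OF permutes_compose[OF t IH(1), folded e]])
qed

text \<open>Exponents in the expansion of a Vandermonde determinant in p variables times the product
  of the factors 1 - x_i / x_(p+1): each value in \<open>S\<close> is raised by 1, and the exponent
  of x_(p+1), initially p+1, pays for it.\<close>

definition bump_set :: "nat \<Rightarrow> nat set \<Rightarrow> nat \<Rightarrow> int" where
  "bump_set p S v = (if v = Suc p then int (Suc p) - int (card S) else int v + (if v \<in> S then 1 else 0))"

text \<open>The values \<open>j\<close> and \<open>j + 1\<close> are both sent to
  \<open>j + 1\<close>, so exchanging them in \<open>w\<close> flips the sign and changes nothing
  else.\<close>

lemma alternating_sum_bump_zero: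
  fixes \<Psi> :: "(nat \<Rightarrow> int) \<Rightarrow> int fps"
  assumes "j \<in> S" "Suc j \<notin> S" "1 \<le> j" "j < p"
  shows "(\<Sum>w | w permutes {1..p}. of_int (sign w) * \<Psi> (bump_set p S \<circ> w)) = 0"
proof -
  define s where "s = Transposition.transpose j (Suc j)"
  have s: "s permutes {1..p}" unfolding s_def using assms by (intro permutes_swap_id) auto
  have e: "bump_set p S \<circ> s = bump_set p S"
    using assms by (auto simp: bump_set_def s_def transpose_def fun_eq_iff)
  have "(\<Sum>w | w permutes {1..p}. of_int (sign w) * \<Psi> (bump_set p S \<circ> w))
    = (\<Sum>w | w permutes {1..p}. of_int (sign (s \<circ> w)) * \<Psi> (bump_set p S \<circ> (s \<circ> w)))"
    by (rule setum_permutations_compose_left[OF s])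
  also have "\<dots> = (\<Sum>w | w permutes {1..p}. - (of_int (sign w) * \<Psi> (bump_set p S \<circ> w)))"
  proof (rule sum.cong[OF refl])
    fix w assume "w \<in> {w. w permutes {1..p}}"
    then have "sign (s \<circ> w) = sign s * sign w" using s by (intro permutes_sign_compose[of "{1..p}"]) auto
    also have "\<dots> = - sign w" by (simp add: s_def sign_swap_id)
    finally have sg: "sign (s \<circ> w) = - sign w" .
    show "of_int (sign (s \<circ> w)) * \<Psi> (bump_set p S \<circ> (s \<circ> w)) = - (of_int (sign w) * \<Psi> (bump_set p S \<circ> w))"
      unfolding sg comp_assoc[symmetric] e by simp
  qed
  also have "\<dots> = - (\<Sum>w | w permutes {1..p}. of_int (sign w) * \<Psi> (bump_set p S \<circ> w))" by (rule sum_negf)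
  finally show ?thesis by (rule eq_uminus_self_fps)
qed

lemma upper_sets:
  assumes "S \<subseteq> {1..p}" "\<forall>j. j \<in> S \<longrightarrow> 1 \<le> j \<longrightarrow> j < p \<longrightarrow> Suc j \<in> S"
  shows "\<exists>q. 1 \<le> q \<and> q \<le> Suc p \<and> S = {q..p}"
proof (cases "S = {}")
  case True then show ?thesis by (intro exI[of _ "Suc p"]) auto
next
  case False
  have fin: "finite S" using assms(1) finite_subset by blast
  define q where "q = Min S"
  have q: "q \<in> S" using False fin by (simp add: q_def)
  have "k \<in> S" if "q \<le> k" "k \<le> p" for k
    using that
  proof (induction k rule: dec_induct)
    case base show ?case using q .
  next
    case (step k)
    then have "k \<in> S" "k < p" by auto
    moreover have "1 \<le> k" using \<open>k \<in> S\<close> assms(1) by auto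
    ultimately show ?case using assms(2) by blast
  qed
  moreover have "q \<le> k" if "k \<in> S" for k using that fin by (simp add: q_def)
  ultimately have "S = {q..p}" using assms(1) by auto
  then show ?thesis using q assms(1) by (intro exI[of _ q]) auto
qed

text \<open>Up to a power of x_(p+1), the Vandermonde determinant in p+1 variables is that in p
  variables times the product of the 1 - x_i / x_(p+1); here an arbitrary \<open>\<Psi>\<close>
  replaces the monomials. All \<open>S\<close> but the upper intervals \<open>{q..p}\<close>
  contribute 0. For these the raised vector is a cycle with sign \<open>(- 1) ^ card S\<close>, and
  the cycles represent the cosets of the permutations of 1..p.\<close>

lemma alternating_sum_split:
  fixes \<Psi> :: "(nat \<Rightarrow> int) \<Rightarrow> int fps"
  shows "(\<Sum>w | w permutes {1..Suc p}. of_int (sign w) * \<Psi> (int \<circ> w)) =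
    (\<Sum>S \<in> Pow {1..p}. (- 1) ^ card S * (\<Sum>w | w permutes {1..p}. of_int (sign w) * \<Psi> (bump_set p S \<circ> w)))"
    (is "?L = ?R")
proof -
  have ins: "{1..Suc p} = insert (Suc p) {1..p}" by auto
  have g: "bump_set p {q..p} = int \<circ> shift_cycle p q" if "q \<le> Suc p" for q
    using that by (auto simp: bump_set_def shift_cycle_def fun_eq_iff)
  define F where "F S = (- 1) ^ card S * (\<Sum>w | w permutes {1..p}. of_int (sign w) * \<Psi> (bump_set p S \<circ> w))" for S
  have "?R = sum F ((\<lambda>q. {q..p}) ` {1..Suc p})"
    unfolding F_def[symmetric]
  proof (rule sum.mono_neutral_right)
    show "\<forall>S \<in> Pow {1..p} - (\<lambda>q. {q..p}) ` {1..Suc p}. F S = 0"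
    proof
      fix S assume S: "S \<in> Pow {1..p} - (\<lambda>q. {q..p}) ` {1..Suc p}"
      then have "\<not> (\<forall>j. j \<in> S \<longrightarrow> 1 \<le> j \<longrightarrow> j < p \<longrightarrow> Suc j \<in> S)"
        using upper_sets[of S p] by (metis DiffD1 DiffD2 PowD atLeastAtMost_iff imageI)
      then obtain j where "j \<in> S" "Suc j \<notin> S" "1 \<le> j" "j < p" by blast
      then show "F S = 0" unfolding F_def
        by (subst alternating_sum_bump_zero[where j = j]) (assumption+, simp)
    qed
  qed auto
  also have "\<dots> = (\<Sum>q \<in> {1..Suc p}. F {q..p})"
  proof (rule sum.reindex_cong[OF _ refl refl])
    show "inj_on (\<lambda>q. {q..p}) {1..Suc p}"
    proof (rule inj_onI)
      fix x y assume a: "x \<in> {1..Suc p}" "y \<in> {1..Suc p}" "{x..p} = {y..p}"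
      then have "Suc p - x = Suc p - y" by (metis card_atLeastAtMost)
      then show "x = y" using a by auto
    qed
  qed
  also have "\<dots> = (\<Sum>q \<in> {1..Suc p}. \<Sum>w | w permutes {1..p}.
      of_int (sign (Transposition.transpose (Suc p) q \<circ> w)) * \<Psi> (int \<circ> (Transposition.transpose (Suc p) q \<circ> w)))"
  proof (rule sum.cong[OF refl])
    fix q assume q: "q \<in> {1..Suc p}"
    define t where "t = Transposition.transpose (Suc p) q"
    \<comment> \<open>\<open>t\<close> and the cycle send p+1 to the same value \<open>q\<close>, so
      they differ by a permutation \<open>\<kappa>\<close> of 1..p, which is absorbed by the sum
      over \<open>w\<close>.\<close>
    define \<kappa> where "\<kappa> = t \<circ> shift_cycle p q"
    have t: "t permutes {1..Suc p}" unfolding t_def using q by (intro permutes_swap_id) auto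
    have sc: "shift_cycle p q permutes {1..Suc p}" "sign (shift_cycle p q) = (- 1) ^ (Suc p - q)"
      using shift_cycle_props q by auto
    have \<kappa>1: "\<kappa> permutes {1..Suc p}" unfolding \<kappa>_def by (rule permutes_compose[OF sc(1) t])
    have "\<kappa> (Suc p) = Suc p" by (simp add: \<kappa>_def t_def shift_cycle_def)
    then have "\<kappa> permutes {1..p}" using \<kappa>1 permutes_superset[OF \<kappa>1, of "{1..p}"] by (auto simp: le_Suc_eq)
    have tk: "t \<circ> \<kappa> = shift_cycle p q" by (auto simp: \<kappa>_def t_def fun_eq_iff)
    have sub: "w permutes {1..Suc p}" if "w permutes {1..p}" for w using that by (rule permutes_subset) auto
    have "(\<Sum>w | w permutes {1..p}. of_int (sign (t \<circ> w)) * \<Psi> (int \<circ> (t \<circ> w))) =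
       (\<Sum>w | w permutes {1..p}. of_int (sign (t \<circ> (\<kappa> \<circ> w))) * \<Psi> (int \<circ> (t \<circ> (\<kappa> \<circ> w))))"
      by (rule setum_permutations_compose_left[OF \<open>\<kappa> permutes {1..p}\<close>])
    also have "\<dots> = (\<Sum>w | w permutes {1..p}. (- 1) ^ card {q..p} * (of_int (sign w) * \<Psi> (bump_set p {q..p} \<circ> w)))"
    proof (rule sum.cong[OF refl])
      fix w assume "w \<in> {w. w permutes {1..p}}"
      then have w: "w permutes {1..Suc p}" using sub by simp
      have tkw: "t \<circ> (\<kappa> \<circ> w) = shift_cycle p q \<circ> w" by (simp add: comp_assoc[symmetric] tk)
      have sg: "sign (shift_cycle p q \<circ> w) = (- 1) ^ (Suc p - q) * sign w"
        using permutes_sign_compose[OF _ sc(1) w] sc(2) by simp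
      have "bump_set p {q..p} \<circ> w = int \<circ> (shift_cycle p q \<circ> w)" using g q by (simp add: comp_assoc)
      then show "of_int (sign (t \<circ> (\<kappa> \<circ> w))) * \<Psi> (int \<circ> (t \<circ> (\<kappa> \<circ> w))) =
         (- 1) ^ card {q..p} * (of_int (sign w) * \<Psi> (bump_set p {q..p} \<circ> w))"
        unfolding tkw sg by simp
    qed
    finally show "F {q..p} = (\<Sum>w | w permutes {1..p}.
      of_int (sign (Transposition.transpose (Suc p) q \<circ> w)) * \<Psi> (int \<circ> (Transposition.transpose (Suc p) q \<circ> w)))"
      unfolding F_def t_def by (simp add: sum_distrib_left)
  qed
  also have "\<dots> = ?L"
    unfolding ins by (subst sum_over_permutations_insert) auto
  finally show ?thesis by simp
qed

definition comps :: "nat set \<Rightarrow> nat \<Rightarrow> (nat \<Rightarrow> nat) set" where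
  "comps J k = {c. (\<forall>i. i \<notin> J \<longrightarrow> c i = 0) \<and> sum c J = k}"

lemma finite_comps: "finite J \<Longrightarrow> finite (comps J k)"
proof (rule finite_subset)
  assume J: "finite J"
  show "comps J k \<subseteq> {c. \<forall>i. (i \<in> J \<longrightarrow> c i \<in> {..k}) \<and> (i \<notin> J \<longrightarrow> c i = 0)}"
    using J by (auto simp: comps_def intro: member_le_sum)
  show "finite {c. \<forall>i. (i \<in> J \<longrightarrow> c i \<in> {..k}) \<and> (i \<notin> J \<longrightarrow> c i = 0)}"
    by (rule finite_set_of_finite_funs[OF J]) simp
qed

text \<open>Coefficient form of the fact that h_k in p+1 variables, times the product of the 1 - x_i
  / x_(p+1), is x_(p+1)^k up to terms with a negative exponent of x_(p+1). Here \<open>e\<close>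
  collects the exponents of the first p variables, and the second argument of \<open>T\<close> is
  that of the last.\<close>

lemma alternating_comps:
  fixes T :: "(nat \<Rightarrow> nat) \<Rightarrow> int \<Rightarrow> int fps" and p k :: nat
  assumes neg: "\<And>e d. d < 0 \<Longrightarrow> T e d = 0"
  defines "e \<equiv> \<lambda>c S i. if i \<in> {1..p} then c i + (if i \<in> S then 1 else 0) else (0 :: nat)"
  shows "(\<Sum>c \<in> comps {1..Suc p} k. \<Sum>S \<in> Pow {1..p}. (- 1) ^ card S * T (e c S) (int (c (Suc p)) - int (card S))) = T (\<lambda>_. 0) (int k)"
proof -
  let ?A = "comps {1..Suc p} k \<times> Pow {1..p}"
  have finA: "finite ?A" by (simp add: finite_comps)
  define t where "t x = (- 1) ^ card (snd x) * T (e (fst x) (snd x)) (int (fst x (Suc p)) - int (card (snd x)))" for x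
  define B where "B = {x \<in> ?A. card (snd x) \<le> fst x (Suc p) \<and> e (fst x) (snd x) \<noteq> (\<lambda>_. 0)}"
  define z where "z = ((\<lambda>i. if i = Suc p then k else 0) :: nat \<Rightarrow> nat, {} :: nat set)"
  have zA: "z \<in> ?A" by (auto simp: z_def comps_def)
  have zero: "t x = 0" if x: "x \<in> ?A" "x \<notin> B" "x \<noteq> z" for x
  proof (cases "card (snd x) \<le> fst x (Suc p)")
    case False
    then show ?thesis using neg by (simp add: t_def)
  next
    case True
    then have e0: "e (fst x) (snd x) = (\<lambda>_. 0)" using x by (auto simp: B_def)
    have "fst x i = 0 \<and> i \<notin> snd x" if "i \<in> {1..p}" for i
      using fun_cong[OF e0, of i] that by (auto simp: e_def split: if_splits)
    moreover have "snd x \<subseteq> {1..p}" "(\<Sum>i = 1..Suc p. fst x i) = k" "\<forall>i. i \<notin> {1..Suc p} \<longrightarrow> fst x i = 0"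
      using x(1) by (auto simp: comps_def)
    ultimately have "snd x = {}" "fst x (Suc p) = k" "fst x = (\<lambda>i. if i = Suc p then k else 0)"
      by (auto simp: fun_eq_iff le_Suc_eq)
    then have "x = z" by (auto simp: z_def intro: prod_eqI)
    then show ?thesis using x by simp
  qed
  \<comment> \<open>The involution toggles in \<open>S\<close> the least index with nonzero
    \<open>e\<close> and moves one unit of \<open>c\<close> between that index and p+1. It keeps
    \<open>e\<close> and the last exponent and flips the sign; among the terms that can be nonzero,
    only the one with \<open>e\<close> = 0 has no partner.\<close>
  define j where "j x = (LEAST i. e (fst x) (snd x) i \<noteq> 0)" for x
  define \<phi> where "\<phi> x = (if j x \<in> snd x
      then ((fst x)(j x := fst x (j x) + 1, Suc p := fst x (Suc p) - 1), snd x - {j x})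
      else ((fst x)(j x := fst x (j x) - 1, Suc p := fst x (Suc p) + 1), insert (j x) (snd x)))" for x
  have \<phi>: "\<phi> x \<in> B \<and> \<phi> (\<phi> x) = x \<and> t (\<phi> x) = - t x" if x: "x \<in> B" for x
  proof -
    obtain c S where cS: "x = (c, S)" by (cases x)
    have S: "S \<subseteq> {1..p}" "finite S" using x by (auto simp: B_def cS finite_subset)
    have c: "\<forall>i. i \<notin> {1..Suc p} \<longrightarrow> c i = 0" "(\<Sum>i = 1..Suc p. c i) = k" "card S \<le> c (Suc p)"
      using x by (auto simp: B_def cS comps_def)
    have "\<exists>i. e c S i \<noteq> 0" using x by (auto simp: B_def cS)
    then have ej: "e c S (j x) \<noteq> 0" unfolding j_def cS by (auto intro: LeastI_ex)
    then have jp: "j x \<in> {1..p}" by (auto simp: e_def split: if_splits)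
    define i where "i = j x"
    have ip: "i \<in> {1..p}" "i \<noteq> Suc p" using jp by (auto simp: i_def)
    have ksum: "k = c i + c (Suc p) + (\<Sum>l \<in> {1..p} - {i}. c l)"
      using c(2) ip sum.remove[of "{1..p}" i c] by simp
    have ph: "\<exists>c' S'. \<phi> x = (c', S') \<and> S' \<subseteq> {1..p} \<and> e c' S' = e c S \<and> (i \<in> S' \<longleftrightarrow> i \<notin> S) \<and>
       (\<forall>i. i \<notin> {1..Suc p} \<longrightarrow> c' i = 0) \<and> (\<Sum>i = 1..Suc p. c' i) = k \<and> card S' \<le> c' (Suc p) \<and>
       int (c' (Suc p)) - int (card S') = int (c (Suc p)) - int (card S) \<and>
       (- 1 :: int fps) ^ card S' = - ((- 1) ^ card S) \<and>
       (if i \<in> S' then (c'(i := c' i + 1, Suc p := c' (Suc p) - 1), S' - {i})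
        else (c'(i := c' i - 1, Suc p := c' (Suc p) + 1), insert i S')) = (c, S)"
    proof (cases "i \<in> S")
      case True
      define c' S' where "c' = c(i := c i + 1, Suc p := c (Suc p) - 1)" and "S' = S - {i}"
      have card: "card S = Suc (card S')" unfolding S'_def using True S(2) by (metis card_Suc_Diff1)
      have "\<phi> x = (c', S')" using True by (simp add: \<phi>_def i_def cS c'_def S'_def)
      moreover have "e c' S' = e c S" using ip True by (auto simp: e_def fun_eq_iff c'_def S'_def)
      moreover have "(\<Sum>i = 1..Suc p. c' i) = k"
      proof -
        have "(\<Sum>l \<in> {1..p} - {i}. c' l) = (\<Sum>l \<in> {1..p} - {i}. c l)" by (rule sum.cong) (auto simp: c'_def)
        then show ?thesis using ksum ip sum.remove[of "{1..p}" i c'] c(3) card by (simp add: c'_def)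
      qed
      moreover have "S' \<subseteq> {1..p}" "i \<in> S' \<longleftrightarrow> i \<notin> S" using S True by (auto simp: S'_def)
      moreover have "\<forall>l. l \<notin> {1..Suc p} \<longrightarrow> c' l = 0" using c ip by (auto simp: c'_def)
      moreover have "card S' \<le> c' (Suc p)" "int (c' (Suc p)) - int (card S') = int (c (Suc p)) - int (card S)"
        using c(3) card unfolding c'_def by (simp_all add: of_nat_diff)
      moreover have "(- 1 :: int fps) ^ card S' = - ((- 1) ^ card S)" unfolding card by simp
      moreover have "(if i \<in> S' then (c'(i := c' i + 1, Suc p := c' (Suc p) - 1), S' - {i})
        else (c'(i := c' i - 1, Suc p := c' (Suc p) + 1), insert i S')) = (c, S)"
      proof -
        have "c (Suc p) \<ge> 1" using c(3) card by linarith
        then have "c'(i := c' i - 1, Suc p := c' (Suc p) + 1) = c" using ip by (simp add: c'_def fun_eq_iff)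
        moreover have "insert i S' = S" "i \<notin> S'" unfolding S'_def using True by (simp_all add: insert_absorb)
        ultimately show ?thesis by simp
      qed
      ultimately show ?thesis by blast
    next
      case False
      define c' S' where "c' = c(i := c i - 1, Suc p := c (Suc p) + 1)" and "S' = insert i S"
      have ci: "c i > 0" using ej False ip by (auto simp: e_def i_def split: if_splits)
      have card: "card S' = Suc (card S)" using False S by (simp add: S'_def)
      have "\<phi> x = (c', S')" using False by (simp add: \<phi>_def i_def cS c'_def S'_def)
      moreover have "e c' S' = e c S" using ip False ci by (auto simp: e_def fun_eq_iff c'_def S'_def)
      moreover have "(\<Sum>i = 1..Suc p. c' i) = k"
      proof -
        have "(\<Sum>l \<in> {1..p} - {i}. c' l) = (\<Sum>l \<in> {1..p} - {i}. c l)" by (rule sum.cong) (auto simp: c'_def)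
        then show ?thesis using ksum ip sum.remove[of "{1..p}" i c'] ci by (simp add: c'_def)
      qed
      moreover have "S' \<subseteq> {1..p}" "i \<in> S' \<longleftrightarrow> i \<notin> S" using S False ip by (auto simp: S'_def)
      moreover have "\<forall>l. l \<notin> {1..Suc p} \<longrightarrow> c' l = 0" using c ip by (auto simp: c'_def)
      moreover have "card S' \<le> c' (Suc p)" "int (c' (Suc p)) - int (card S') = int (c (Suc p)) - int (card S)"
        using c(3) card by (auto simp: c'_def)
      moreover have "(- 1 :: int fps) ^ card S' = - ((- 1) ^ card S)" unfolding card by simp
      moreover have "(if i \<in> S' then (c'(i := c' i + 1, Suc p := c' (Suc p) - 1), S' - {i})
        else (c'(i := c' i - 1, Suc p := c' (Suc p) + 1), insert i S')) = (c, S)"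
      proof -
        have "c'(i := c' i + 1, Suc p := c' (Suc p) - 1) = c" using ip ci by (simp add: c'_def fun_eq_iff)
        moreover have "S' - {i} = S" "i \<in> S'" unfolding S'_def using False by simp_all
        ultimately show ?thesis by simp
      qed
      ultimately show ?thesis by blast
    qed
    then obtain c' S' where c'S': "\<phi> x = (c', S')" "S' \<subseteq> {1..p}" "e c' S' = e c S" "i \<in> S' \<longleftrightarrow> i \<notin> S"
       "\<forall>i. i \<notin> {1..Suc p} \<longrightarrow> c' i = 0" "(\<Sum>i = 1..Suc p. c' i) = k" "card S' \<le> c' (Suc p)"
       "int (c' (Suc p)) - int (card S') = int (c (Suc p)) - int (card S)"
       "(- 1 :: int fps) ^ card S' = - ((- 1) ^ card S)"
       "(if i \<in> S' then (c'(i := c' i + 1, Suc p := c' (Suc p) - 1), S' - {i})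
        else (c'(i := c' i - 1, Suc p := c' (Suc p) + 1), insert i S')) = (c, S)" by blast
    have ji: "j (c', S') = i" using c'S'(3) by (simp add: j_def i_def cS)
    have "\<phi> x \<in> B" using c'S' x by (auto simp: B_def comps_def cS)
    moreover have "\<phi> (c', S') = (if i \<in> S' then (c'(i := c' i + 1, Suc p := c' (Suc p) - 1), S' - {i})
        else (c'(i := c' i - 1, Suc p := c' (Suc p) + 1), insert i S'))"
      unfolding \<phi>_def fst_conv snd_conv ji ..
    then have "\<phi> (c', S') = x" unfolding c'S'(10) cS .
    then have "\<phi> (\<phi> x) = x" by (simp only: c'S'(1))
    moreover have "t (\<phi> x) = - t x"
    proof -
      have "t (c', S') = - t (c, S)" unfolding t_def fst_conv snd_conv c'S'(3,8,9) by simp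
      then show ?thesis by (simp only: c'S'(1)) (simp only: cS)
    qed
    ultimately show ?thesis by blast
  qed
  have "sum t B = (\<Sum>x \<in> B. - t x)"
    by (rule sum.reindex_bij_witness[where i = \<phi> and j = \<phi>]) (use \<phi> in auto)
  then have B0: "sum t B = 0" by (simp add: sum_negf eq_uminus_self_fps)
  have zB: "z \<notin> B" by (auto simp: B_def z_def e_def)
  have "(\<Sum>c \<in> comps {1..Suc p} k. \<Sum>S \<in> Pow {1..p}. (- 1) ^ card S * T (e c S) (int (c (Suc p)) - int (card S))) = sum t ?A"
    by (simp add: sum.cartesian_product t_def case_prod_beta)
  also have "\<dots> = sum t (insert z B)"
    by (rule sum.mono_neutral_right) (use finA zero zA in \<open>auto simp: B_def\<close>)
  also have "\<dots> = t z" using zB B0 finite_subset[OF _ finA, of B] by (simp add: B_def)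
  also have "t z = T (\<lambda>_. 0) (int k)"
  proof -
    have "e (fst z) (snd z) = (\<lambda>_. 0)" by (auto simp: e_def z_def fun_eq_iff)
    then show ?thesis by (simp add: t_def) (simp add: z_def)
  qed
  finally show ?thesis .
qed

text \<open>Replaces \<open>dot w \<beta>\<close> by a rearrangement in which \<open>w\<close>
  permutes only the shifts, as in a Jacobi-Trudi determinant. In this form the splitting of an
  alternating sum applies.\<close>

lemma signed_dot_sum:
  fixes \<Phi> :: "(nat \<Rightarrow> int) \<Rightarrow> int fps"
  assumes sym: "\<And>\<beta> w. w permutes {1..n} \<Longrightarrow> \<Phi> (\<beta> \<circ> w) = \<Phi> \<beta>" and p: "p \<le> n"
  shows "(\<Sum>w | w permutes {1..p}. of_int (sign w) * \<Phi> (dot w \<beta>)) =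
    (\<Sum>w | w permutes {1..p}. of_int (sign w) * \<Phi> (\<lambda>i. \<beta> i - int i + int (w i)))"
proof -
  have "(\<Sum>w | w permutes {1..p}. of_int (sign w) * \<Phi> (dot w \<beta>)) =
     (\<Sum>w | w permutes {1..p}. of_int (sign (inv w)) * \<Phi> (dot (inv w) \<beta>))"
    by (rule sum_permutations_inverse)
  also have "\<dots> = (\<Sum>w | w permutes {1..p}. of_int (sign w) * \<Phi> (\<lambda>i. \<beta> i - int i + int (w i)))"
  proof (rule sum.cong[OF refl])
    fix w assume "w \<in> {w. w permutes {1..p}}"
    then have w: "w permutes {1..p}" by simp
    have wn: "w permutes {1..n}" using w by (rule permutes_subset) (use p in auto)
    have "sign (inv w) = sign w" using w by (meson finite_atLeastAtMost permutation_permutes sign_inverse)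
    moreover have "dot (inv w) \<beta> \<circ> w = (\<lambda>i. \<beta> i - int i + int (w i))"
      using permutes_inverses(2)[OF w] by (auto simp: dot_def fun_eq_iff)
    ultimately show "of_int (sign (inv w)) * \<Phi> (dot (inv w) \<beta>) = of_int (sign w) * \<Phi> (\<lambda>i. \<beta> i - int i + int (w i))"
      using sym[OF wn, of "dot (inv w) \<beta>"] by simp
  qed
  finally show ?thesis .
qed

text \<open>The Pieri rule as a sum over all compositions \<open>c\<close>, with no restriction to
  horizontal strips. Multiplication by h_k in general creates a row N+1; \<open>vanish\<close>
  removes these terms, and the bound on \<open>\<beta>\<close> puts them within its reach.\<close>

lemma pieri:
  fixes \<Phi> :: "(nat \<Rightarrow> int) \<Rightarrow> int fps"
  assumes sym: "\<And>\<beta> w. w permutes {1..n} \<Longrightarrow> \<Phi> (\<beta> \<circ> w) = \<Phi> \<beta>"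
    and neg: "\<And>\<beta> i. i \<in> {1..n} \<Longrightarrow> \<beta> i < 0 \<Longrightarrow> \<Phi> \<beta> = 0"
    and N: "N < n"
    and vanish: "\<And>\<beta>. (\<And>i. i \<in> {1..Suc N} \<Longrightarrow> 0 < \<beta> i + int (Suc N) - int i) \<Longrightarrow>
       (\<Sum>w | w permutes {1..Suc N}. of_int (sign w) * \<Phi> (dot w \<beta>)) = 0"
    and \<beta>: "\<And>i. i \<in> {1..N} \<Longrightarrow> 0 \<le> \<beta> i + int N - int i"
  shows "(\<Sum>w | w permutes {1..N}. of_int (sign w) * \<Phi> (dot w (\<beta>(Suc N := int k)))) =
    (\<Sum>c \<in> comps {1..N} k. \<Sum>w | w permutes {1..N}. of_int (sign w) * \<Phi> (dot w ((\<lambda>i. \<beta> i + int (c i))(Suc N := 0))))"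
proof -
  \<comment> \<open>The entry at N+1 starts from 0, so afterwards it is what \<open>c\<close> adds
    there.\<close>
  define b where "b c = (\<lambda>i. (\<beta>(Suc N := 0)) i + int (c i))" for c :: "nat \<Rightarrow> nat"
  define s where "s \<beta> = (\<Sum>w | w permutes {1..Suc N}. of_int (sign w) * \<Phi> (dot w \<beta>))" for \<beta>
  define e where "e c S i = (if i \<in> {1..N} then c i + (if i \<in> S then 1 else 0) else (0 :: nat))" for c and S :: "nat set" and i
  define \<Theta> where "\<Theta> w e d = \<Phi> (\<lambda>i. if i = Suc N then d else \<beta> i - int i + int (w i) + int (e i))"
    for w :: "nat \<Rightarrow> nat" and e :: "nat \<Rightarrow> nat" and d
  have s1: "s (b c) = (\<Sum>w | w permutes {1..N}. of_int (sign w) * (\<Sum>S \<in> Pow {1..N}. (- 1) ^ card S * \<Theta> w (e c S) (int (c (Suc N)) - int (card S))))"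
    if c: "c \<in> comps {1..Suc N} k" for c
  proof -
    have "s (b c) = (\<Sum>w | w permutes {1..Suc N}. of_int (sign w) * \<Phi> (\<lambda>i. b c i - int i + int (w i)))"
      unfolding s_def by (rule signed_dot_sum[OF sym]) (use N in auto)
    also have "\<dots> = (\<Sum>w | w permutes {1..Suc N}. of_int (sign w) * (\<lambda>u. \<Phi> (\<lambda>i. b c i - int i + u i)) (int \<circ> w))"
      by simp
    also have "\<dots> = (\<Sum>S \<in> Pow {1..N}. (- 1) ^ card S * (\<Sum>w | w permutes {1..N}. of_int (sign w) *
         (\<lambda>u. \<Phi> (\<lambda>i. b c i - int i + u i)) (bump_set N S \<circ> w)))"
      by (rule alternating_sum_split)
    also have "\<dots> = (\<Sum>S \<in> Pow {1..N}. \<Sum>w | w permutes {1..N}. of_int (sign w) * ((- 1) ^ card S *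
         \<Phi> (\<lambda>i. b c i - int i + bump_set N S (w i))))"
      by (simp add: sum_distrib_left mult.left_commute)
    also have "\<dots> = (\<Sum>w | w permutes {1..N}. \<Sum>S \<in> Pow {1..N}. of_int (sign w) * ((- 1) ^ card S *
         \<Phi> (\<lambda>i. b c i - int i + bump_set N S (w i))))"
      by (rule sum.swap)
    also have "\<dots> = (\<Sum>w | w permutes {1..N}. \<Sum>S \<in> Pow {1..N}. of_int (sign w) * ((- 1) ^ card S *
         \<Theta> w (e c S) (int (c (Suc N)) - int (card S))))"
    proof (rule sum.cong[OF refl])
      fix w assume "w \<in> {w. w permutes {1..N}}"
      then have w: "w permutes {1..N}" by simp
      show "(\<Sum>S \<in> Pow {1..N}. of_int (sign w) * ((- 1) ^ card S * \<Phi> (\<lambda>i. b c i - int i + bump_set N S (w i)))) =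
        (\<Sum>S \<in> Pow {1..N}. of_int (sign w) * ((- 1) ^ card S * \<Theta> w (e c S) (int (c (Suc N)) - int (card S))))"
      \<comment> \<open>\<open>bump_set\<close> selects values of \<open>w\<close>, whereas
        \<open>e\<close> is indexed by positions; preimages under \<open>w\<close> translate between
        the two.\<close>
      proof (rule sum.reindex_bij_witness[where i = "\<lambda>S. w ` S" and j = "\<lambda>S. w -` S"])
        fix S assume S: "S \<in> Pow {1..N}"
        show "w ` (w -` S) = S" using permutes_surj[OF w] by (simp add: surj_image_vimage_eq)
        show "w -` S \<in> Pow {1..N}" using S permutes_vimage[OF w] by auto
        show "w -` (w ` S) = S" using permutes_inj[OF w] by (simp add: inj_vimage_image_eq)
        show "w ` S \<in> Pow {1..N}" using S permutes_image[OF w] by auto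
        have card: "card (w -` S) = card S"
          using permutes_bij[OF w] by (metis bij_betw_def card_vimage_inj subset_UNIV)
        have wN: "w (Suc N) = Suc N" using w by (simp add: permutes_not_in)
        have wi: "w i = Suc N \<longleftrightarrow> i = Suc N" for i using permutes_inj[OF w] wN by (metis injD)
        have out: "w i = i" "c i = 0" "i \<notin> S" if "i \<notin> {1..N}" "i \<noteq> Suc N" for i
          using that w c S by (auto simp: permutes_not_in comps_def)
        have "(\<lambda>i. b c i - int i + bump_set N S (w i)) =
          (\<lambda>i. if i = Suc N then int (c (Suc N)) - int (card (w -` S)) else \<beta> i - int i + int (w i) + int (e c (w -` S) i))"
          using out by (auto simp: fun_eq_iff b_def bump_set_def wN wi e_def card)
        note eq = this
        show "of_int (sign w) * ((- 1) ^ card (w -` S) * \<Theta> w (e c (w -` S)) (int (c (Suc N)) - int (card (w -` S)))) =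
          of_int (sign w) * ((- 1) ^ card S * \<Phi> (\<lambda>i. b c i - int i + bump_set N S (w i)))"
          unfolding \<Theta>_def eq card ..
      qed
    qed
    finally show ?thesis by (simp add: sum_distrib_left)
  qed
  have \<Theta>neg: "\<Theta> w e d = 0" if "d < 0" for w e d
    unfolding \<Theta>_def by (rule neg[of "Suc N"]) (use N that in auto)
  have "(\<Sum>c \<in> comps {1..Suc N} k. s (b c)) = (\<Sum>c \<in> comps {1..Suc N} k. \<Sum>w | w permutes {1..N}. of_int (sign w) *
      (\<Sum>S \<in> Pow {1..N}. (- 1) ^ card S * \<Theta> w (e c S) (int (c (Suc N)) - int (card S))))"
    by (rule sum.cong) (auto simp: s1)
  also have "\<dots> = (\<Sum>w | w permutes {1..N}. of_int (sign w) * (\<Sum>c \<in> comps {1..Suc N} k.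
      \<Sum>S \<in> Pow {1..N}. (- 1) ^ card S * \<Theta> w (e c S) (int (c (Suc N)) - int (card S))))"
    by (subst sum.swap) (simp add: sum_distrib_left)
  also have "\<dots> = (\<Sum>w | w permutes {1..N}. of_int (sign w) * \<Theta> w (\<lambda>_. 0) (int k))"
    unfolding e_def by (subst alternating_comps[OF \<Theta>neg]) auto
  also have "\<dots> = (\<Sum>w | w permutes {1..N}. of_int (sign w) * \<Phi> (\<lambda>i. (\<beta>(Suc N := int k)) i - int i + int (w i)))"
  proof (rule sum.cong[OF refl])
    fix w assume "w \<in> {w. w permutes {1..N}}"
    then have "w (Suc N) = Suc N" by (simp add: permutes_not_in)
    then have "(\<lambda>i. if i = Suc N then int k else \<beta> i - int i + int (w i) + int 0) = (\<lambda>i. (\<beta>(Suc N := int k)) i - int i + int (w i))"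
      by (auto simp: fun_eq_iff)
    then show "of_int (sign w) * \<Theta> w (\<lambda>_. 0) (int k) = of_int (sign w) * \<Phi> (\<lambda>i. (\<beta>(Suc N := int k)) i - int i + int (w i))"
      by (simp add: \<Theta>_def)
  qed
  also have "\<dots> = (\<Sum>w | w permutes {1..N}. of_int (sign w) * \<Phi> (dot w (\<beta>(Suc N := int k))))"
    by (rule signed_dot_sum[OF sym, symmetric]) (use N in auto)
  finally have A: "(\<Sum>c \<in> comps {1..Suc N} k. s (b c)) = (\<Sum>w | w permutes {1..N}. of_int (sign w) * \<Phi> (dot w (\<beta>(Suc N := int k))))" .
  have sub: "comps {1..N} k \<subseteq> comps {1..Suc N} k" by (auto simp: comps_def le_Suc_eq)
  have "(\<Sum>c \<in> comps {1..Suc N} k. s (b c)) = (\<Sum>c \<in> comps {1..N} k. s (b c))"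
  proof (rule sum.mono_neutral_right[OF finite_comps sub])
    \<comment> \<open>If something is added in position N+1, the entry there is positive. The other
      shifted entries are positive by the bound on \<open>\<beta>\<close>, so \<open>vanish\<close>
      applies.\<close>
    show "\<forall>c \<in> comps {1..Suc N} k - comps {1..N} k. s (b c) = 0"
    proof
      fix c assume c: "c \<in> comps {1..Suc N} k - comps {1..N} k"
      then have "c (Suc N) > 0" by (auto simp: comps_def le_Suc_eq)
      then have "0 < b c i + int (Suc N) - int i" if "i \<in> {1..Suc N}" for i
        using that \<beta>[of i] by (cases "i = Suc N") (auto simp: b_def)
      then show "s (b c) = 0" unfolding s_def by (rule vanish)
    qed
  qed simp
  also have "\<dots> = (\<Sum>c \<in> comps {1..N} k. \<Sum>w | w permutes {1..N}. of_int (sign w) * \<Phi> (dot w ((\<lambda>i. \<beta> i + int (c i))(Suc N := 0))))"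
  proof (rule sum.cong[OF refl])
    fix c assume c: "c \<in> comps {1..N} k"
    then have bc: "b c = (\<lambda>i. \<beta> i + int (c i))(Suc N := 0)" by (auto simp: b_def comps_def fun_eq_iff)
    \<comment> \<open>With entry 0 in position N+1, a permutation that moves N+1 produces the
      negative entry \<open>i - (N + 1)\<close> at some earlier position \<open>i\<close>, so only
      permutations of 1..N contribute.\<close>
    have "s (b c) = (\<Sum>w | w permutes {1..N}. of_int (sign w) * \<Phi> (dot w (b c)))"
      unfolding s_def
    proof (rule sum.mono_neutral_right)
      show "finite {w. w permutes {1..Suc N}}" by (simp add: finite_permutations)
      show "{w. w permutes {1..N}} \<subseteq> {w. w permutes {1..Suc N}}" by (auto elim: permutes_subset)
      show "\<forall>w \<in> {w. w permutes {1..Suc N}} - {w. w permutes {1..N}}. of_int (sign w) * \<Phi> (dot w (b c)) = 0"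
      proof
        fix w assume "w \<in> {w. w permutes {1..Suc N}} - {w. w permutes {1..N}}"
        then have w: "w permutes {1..Suc N}" "\<not> w permutes {1..N}" by auto
        have "w (Suc N) \<noteq> Suc N"
        proof
          assume "w (Suc N) = Suc N"
          then have "w permutes {1..N}" using permutes_superset[OF w(1), of "{1..N}"] by (auto simp: le_Suc_eq)
          then show False using w by simp
        qed
        define i where "i = inv w (Suc N)"
        have wi: "w i = Suc N" unfolding i_def using permutes_inverses(1)[OF w(1)] by simp
        have "i \<in> {1..Suc N}" using wi permutes_in_image[OF w(1), of i] by simp
        moreover have "i \<noteq> Suc N" using wi \<open>w (Suc N) \<noteq> Suc N\<close> by auto
        ultimately have "dot w (b c) i < 0" "i \<in> {1..n}" using N by (auto simp: dot_def wi bc)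
        then have "\<Phi> (dot w (b c)) = 0" by (intro neg) auto
        then show "of_int (sign w) * \<Phi> (dot w (b c)) = 0" by simp
      qed
    qed
    then show "s (b c) = (\<Sum>w | w permutes {1..N}. of_int (sign w) * \<Phi> (dot w ((\<lambda>i. \<beta> i + int (c i))(Suc N := 0))))"
      unfolding bc .
  qed
  finally show ?thesis using A by simp
qed


section \<open>Laurent polynomials\<close>

text \<open>Exponent vectors as restrictions of total functions to 1..n, so that permutations act by
  composition.\<close>

definition expo :: "nat \<Rightarrow> (nat \<Rightarrow> int) \<Rightarrow> (nat \<Rightarrow>\<^sub>0 int)" where
  "expo n \<beta> = (\<Sum>i = 1..n. Poly_Mapping.single i (\<beta> i))"

lemma lookup_expo: "Poly_Mapping.lookup (expo n \<beta>) i = (if i \<in> {1..n} then \<beta> i else 0)"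
  unfolding expo_def lookup_sum lookup_single by (simp add: when_def)

lemma expo_cong: "(\<And>i. i \<in> {1..n} \<Longrightarrow> \<beta> i = \<beta>' i) \<Longrightarrow> expo n \<beta> = expo n \<beta>'"
  unfolding expo_def by (intro sum.cong) auto

lemma expo_eq_iff: "expo n \<beta> = expo n \<beta>' \<longleftrightarrow> (\<forall>i \<in> {1..n}. \<beta> i = \<beta>' i)"
  by (metis expo_cong lookup_expo)

lemma expo_add: "expo n \<beta> + expo n \<beta>' = expo n (\<lambda>i. \<beta> i + \<beta>' i)"
  by (rule poly_mapping_eqI) (simp add: lookup_add lookup_expo)

lemma expo_diff: "expo n \<beta> - expo n \<beta>' = expo n (\<lambda>i. \<beta> i - \<beta>' i)"
  by (rule poly_mapping_eqI) (simp add: lookup_minus lookup_expo)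

lemma expo_lookup: "Poly_Mapping.keys \<alpha> \<subseteq> {1..n} \<Longrightarrow> expo n (Poly_Mapping.lookup \<alpha>) = \<alpha>"
  by (rule poly_mapping_eqI) (auto simp: lookup_expo in_keys_iff)

lemma keys_expo: "Poly_Mapping.keys (expo n \<beta>) \<subseteq> {1..n}"
  by (auto simp: in_keys_iff lookup_expo split: if_splits)

lemma lookup_map_key: "inj w \<Longrightarrow> Poly_Mapping.lookup (Poly_Mapping.map_key w \<alpha>) i = Poly_Mapping.lookup \<alpha> (w i)"
  by (simp add: map_key.rep_eq)

lemma map_key_expo:
  assumes "w permutes {1..n}"
  shows "Poly_Mapping.map_key w (expo n \<beta>) = expo n (\<beta> \<circ> w)"
  using permutes_in_image[OF assms]
  by (intro poly_mapping_eqI) (auto simp: lookup_map_key[OF permutes_inj[OF assms]] lookup_expo)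

lemma weight_expo: "weight xs = expo (length xs) (\<lambda>i. xs ! (i - 1))"
  by (simp add: weight_def expo_def)

definition rho_fun :: "nat \<Rightarrow> nat \<Rightarrow> int" where
  "rho_fun n i = int n - int i"

lemma weight_rho: "weight (rho n) = expo n (rho_fun n)"
proof -
  have "rho n ! (i - 1) = rho_fun n i" if "i \<in> {1..n}" for i
    using that by (auto simp: rho_def rev_nth rho_fun_def of_nat_diff)
  then show ?thesis unfolding weight_expo by (simp add: rho_def expo_eq_iff)
qed

lemma laurent_expansion: "f = (\<Sum>\<alpha> \<in> Poly_Mapping.keys f. Poly_Mapping.single \<alpha> (Poly_Mapping.lookup f \<alpha>))"
proof (rule poly_mapping_eqI)
  fix k
  show "Poly_Mapping.lookup f k = Poly_Mapping.lookup (\<Sum>\<alpha> \<in> Poly_Mapping.keys f. Poly_Mapping.single \<alpha> (Poly_Mapping.lookup f \<alpha>)) k"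
    by (cases "k \<in> Poly_Mapping.keys f") (auto simp: lookup_sum lookup_single when_def in_keys_iff)
qed

lemma lookup_x_pow_mult:
  fixes f :: laurent
  shows "Poly_Mapping.lookup (x_pow \<delta> * f) \<alpha> = Poly_Mapping.lookup f (\<alpha> - \<delta>)"
proof -
  have s: "Poly_Mapping.lookup (x_pow \<delta> * Poly_Mapping.single \<beta> c) \<alpha> = Poly_Mapping.lookup (Poly_Mapping.single \<beta> c) (\<alpha> - \<delta>)"
    for \<beta> and c :: int
    by (auto simp: x_pow_def mult_single lookup_single when_def algebra_simps)
  show ?thesis
    by (subst (1 2) laurent_expansion[of f]) (simp add: sum_distrib_left lookup_sum s)
qed

lemma x_pow_mult: "x_pow \<alpha> * x_pow \<beta> = x_pow (\<alpha> + \<beta>)"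
  by (simp add: x_pow_def mult_single)

lemma x_pow_0: "x_pow 0 = 1"
  by (simp add: x_pow_def)

lemma lookup_of_int_mult: "Poly_Mapping.lookup (of_int k * f :: laurent) \<alpha> = k * Poly_Mapping.lookup f \<alpha>"
proof -
  have nat: "Poly_Mapping.lookup (of_nat m * f :: laurent) \<alpha> = int m * Poly_Mapping.lookup f \<alpha>" for m
    by (induction m) (auto simp: lookup_add algebra_simps)
  show ?thesis
  proof (cases "k \<ge> 0")
    case True
    then have "k = int (nat k)" by simp
    then show ?thesis using nat[of "nat k"] by (metis of_int_of_nat_eq)
  next
    case False
    then have "k = - int (nat (- k))" by simp
    then have "(of_int k * f :: laurent) = - (of_nat (nat (- k)) * f)"
      by (metis mult_minus_left of_int_minus of_int_of_nat_eq)
    then show ?thesis using nat[of "nat (- k)"] False by simp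
  qed
qed

lemma lookup_perm_act:
  assumes w: "w permutes S"
  shows "Poly_Mapping.lookup (perm_act w f) \<alpha> = Poly_Mapping.lookup f (Poly_Mapping.map_key w \<alpha>)"
proof -
  have e: "Poly_Mapping.map_key (inv w) \<beta> = \<alpha> \<longleftrightarrow> \<beta> = Poly_Mapping.map_key w \<alpha>" for \<beta> :: "nat \<Rightarrow>\<^sub>0 int"
  proof -
    have i: "inj w" "inj (inv w)" using permutes_inj[OF w] permutes_inj[OF permutes_inv[OF w]] by auto
    have "Poly_Mapping.map_key w (Poly_Mapping.map_key (inv w) \<beta>) = \<beta>" for \<beta> :: "nat \<Rightarrow>\<^sub>0 int"
      using i permutes_inverses[OF w] by (intro poly_mapping_eqI) (simp add: lookup_map_key)
    moreover have "Poly_Mapping.map_key (inv w) (Poly_Mapping.map_key w \<beta>) = \<beta>" for \<beta> :: "nat \<Rightarrow>\<^sub>0 int"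
      using i permutes_inverses[OF w] by (intro poly_mapping_eqI) (simp add: lookup_map_key)
    ultimately show ?thesis by metis
  qed
  show ?thesis
    unfolding perm_act_def lookup_sum lookup_single e when_def
    by (cases "Poly_Mapping.map_key w \<alpha> \<in> Poly_Mapping.keys f") (auto simp: in_keys_iff)
qed

lemma lookup_J_op:
  "Poly_Mapping.lookup (J_op n f) \<alpha> = (\<Sum>w | w permutes {1..n}. sign w * Poly_Mapping.lookup f (Poly_Mapping.map_key w \<alpha>))"
  unfolding J_op_def lookup_sum by (rule sum.cong) (auto simp: lookup_of_int_mult lookup_perm_act)

definition alternant :: "nat \<Rightarrow> (nat \<Rightarrow> int) \<Rightarrow> laurent" where
  "alternant n \<beta> = (\<Sum>w | w permutes {1..n}. of_int (sign w) * x_pow (expo n (\<beta> \<circ> w)))"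

lemma sign_inv_permutes: "w permutes {1..n :: nat} \<Longrightarrow> sign (inv w) = sign w"
  by (meson finite_atLeastAtMost permutation_permutes sign_inverse)

lemma perm_act_x_pow_expo:
  assumes "w permutes {1..n}"
  shows "perm_act w (x_pow (expo n \<beta>)) = x_pow (expo n (\<beta> \<circ> inv w))"
  by (simp add: perm_act_def x_pow_def map_key_expo[OF permutes_inv[OF assms]])

lemma J_op_x_pow: "J_op n (x_pow (expo n \<beta>)) = alternant n \<beta>"
proof -
  have "J_op n (x_pow (expo n \<beta>)) = (\<Sum>w | w permutes {1..n}. of_int (sign w) * x_pow (expo n (\<beta> \<circ> inv w)))"
    unfolding J_op_def by (rule sum.cong) (auto simp: perm_act_x_pow_expo)
  also have "\<dots> = (\<Sum>w | w permutes {1..n}. of_int (sign (inv w)) * x_pow (expo n (\<beta> \<circ> inv (inv w))))"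
    by (rule sum_permutations_inverse)
  also have "\<dots> = alternant n \<beta>"
    unfolding alternant_def by (rule sum.cong) (auto simp: sign_inv_permutes permutes_inv_inv)
  finally show ?thesis .
qed

lemma alternant_cong:
  assumes "\<And>i. i \<in> {1..n} \<Longrightarrow> \<beta> i = \<beta>' i"
  shows "alternant n \<beta> = alternant n \<beta>'"
  unfolding alternant_def
proof (rule sum.cong[OF refl])
  fix w assume "w \<in> {w. w permutes {1..n}}"
  then have w: "w permutes {1..n}" by simp
  have "expo n (\<beta> \<circ> w) = expo n (\<beta>' \<circ> w)"
  proof (rule expo_cong)
    fix i assume "i \<in> {1..n}"
    then have "w i \<in> {1..n}" by (simp only: permutes_in_image[OF w])
    then show "(\<beta> \<circ> w) i = (\<beta>' \<circ> w) i" using assms[of "w i"] by simp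
  qed
  then show "of_int (sign w) * x_pow (expo n (\<beta> \<circ> w)) = of_int (sign w) * x_pow (expo n (\<beta>' \<circ> w))" by simp
qed

lemma alternant_permute:
  assumes u: "u permutes {1..n}"
  shows "alternant n (\<beta> \<circ> u) = of_int (sign u) * alternant n \<beta>"
proof -
  have "of_int (sign u) * alternant n \<beta> = of_int (sign u) * (\<Sum>w | w permutes {1..n}. of_int (sign (u \<circ> w)) * x_pow (expo n (\<beta> \<circ> (u \<circ> w))))"
    unfolding alternant_def by (subst setum_permutations_compose_left[OF u]) simp
  also have "\<dots> = (\<Sum>w | w permutes {1..n}. of_int (sign w) * x_pow (expo n (\<beta> \<circ> u \<circ> w)))"
    unfolding sum_distrib_left
  proof (rule sum.cong[OF refl])
    fix w assume "w \<in> {w. w permutes {1..n}}"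
    then have "sign (u \<circ> w) = sign u * sign w" using u by (intro permutes_sign_compose[of "{1..n}"]) auto
    then have "(of_int (sign u) * of_int (sign (u \<circ> w)) :: laurent) = of_int (sign w)"
      by (metis mult.assoc mult_1 of_int_mult sign_idempotent)
    then show "of_int (sign u) * (of_int (sign (u \<circ> w)) * x_pow (expo n (\<beta> \<circ> (u \<circ> w)))) = of_int (sign w) * x_pow (expo n (\<beta> \<circ> u \<circ> w))"
      unfolding comp_assoc[symmetric] mult.assoc[symmetric] by simp
  qed
  finally show ?thesis by (simp add: alternant_def)
qed

lemma eq_uminus_self_laurent: "x = - x \<Longrightarrow> x = (0 :: laurent)"
  by (metis add.inverse_inverse add_eq_0_iff2 lookup_uminus poly_mapping_eqI lookup_zero equal_neg_zero)

lemma alternant_eq_0: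
  assumes "i \<in> {1..n}" "j \<in> {1..n}" "i \<noteq> j" "\<beta> i = \<beta> j"
  shows "alternant n \<beta> = 0"
proof -
  define s where "s = Transposition.transpose i j"
  have "s permutes {1..n}" unfolding s_def using assms by (intro permutes_swap_id) auto
  moreover have "\<beta> \<circ> s = \<beta>" using assms by (auto simp: s_def transpose_def fun_eq_iff)
  ultimately have "alternant n \<beta> = - alternant n \<beta>"
    using alternant_permute[of s n \<beta>] assms by (simp add: s_def sign_swap_id)
  then show ?thesis by (rule eq_uminus_self_laurent)
qed

lemma lookup_alternant:
  "Poly_Mapping.lookup (alternant n \<beta>) \<alpha> = (\<Sum>w | w permutes {1..n}. if \<alpha> = expo n (\<beta> \<circ> w) then sign w else 0)"
  unfolding alternant_def lookup_sum lookup_of_int_mult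
  by (rule sum.cong) (auto simp: x_pow_def lookup_single when_def)

section \<open>Sorting by permutations\<close>

lemma sum_two:
  fixes g :: "nat \<Rightarrow> 'a::comm_monoid_add"
  assumes "lo \<le> i" "i < hi"
  shows "(\<Sum>j = lo..hi. g j) = g i + g (Suc i) + (\<Sum>j \<in> {lo..hi} - {i, Suc i}. g j)"
proof -
  have "(\<Sum>j = lo..hi. g j) = g i + (\<Sum>j \<in> {lo..hi} - {i}. g j)"
    using assms by (intro sum.remove) auto
  also have "(\<Sum>j \<in> {lo..hi} - {i}. g j) = g (Suc i) + (\<Sum>j \<in> {lo..hi} - {i} - {Suc i}. g j)"
    using assms by (intro sum.remove) auto
  also have "{lo..hi} - {i} - {Suc i} = {lo..hi} - {i, Suc i}" by auto
  finally show ?thesis by (simp add: add.assoc)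
qed

text \<open>A minimizer of the sum of \<open>i * g (w i)\<close> over the finite group will do:
  exchanging the two values at an ascent would make the sum smaller.\<close>

lemma sorting_permutation:
  fixes g :: "nat \<Rightarrow> int"
  shows "\<exists>w. w permutes {lo..hi} \<and> (\<forall>i. lo \<le> i \<longrightarrow> i < hi \<longrightarrow> g (w (Suc i)) \<le> g (w i))"
proof -
  define f where "f w = (\<Sum>i = lo..hi. int i * g (w i))" for w
  let ?W = "{w. w permutes {lo..hi}}"
  have "id \<in> ?W" by (simp only: mem_Collect_eq permutes_id)
  then have fin: "finite ?W" "?W \<noteq> {}" by (auto simp only: finite_permutations finite_atLeastAtMost)
  define m where "m = Min (f ` ?W)"
  have "m \<in> f ` ?W" unfolding m_def using fin by (intro Min_in) auto
  then obtain w where w: "w permutes {lo..hi}" "f w = m" by auto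
  have min: "f w \<le> f u" if "u permutes {lo..hi}" for u
    unfolding w(2) m_def using fin that by simp
  have "g (w (Suc i)) \<le> g (w i)" if i: "lo \<le> i" "i < hi" for i
  proof -
    define s where "s = Transposition.transpose i (Suc i)"
    have "s permutes {lo..hi}" unfolding s_def using i by (intro permutes_swap_id) auto
    then have "(w \<circ> s) permutes {lo..hi}" using w by (intro permutes_compose)
    then have "f w \<le> f (w \<circ> s)" by (rule min)
    moreover have "(\<Sum>j \<in> {lo..hi} - {i, Suc i}. int j * g ((w \<circ> s) j)) = (\<Sum>j \<in> {lo..hi} - {i, Suc i}. int j * g (w j))"
      by (rule sum.cong) (auto simp: s_def)
    ultimately show ?thesis unfolding f_def sum_two[OF i] by (simp add: s_def algebra_simps)
  qed
  then show ?thesis using w by blast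
qed

section \<open>Divisibility of alternants by the Vandermonde determinant\<close>

definition ind :: "nat set \<Rightarrow> nat \<Rightarrow> int" where
  "ind S i = (if i \<in> S then 1 else 0)"

definition elem_sym :: "nat \<Rightarrow> nat \<Rightarrow> laurent" where
  "elem_sym n k = (\<Sum>S | S \<subseteq> {1..n} \<and> card S = k. x_pow (expo n (ind S)))"

text \<open>Since e_k is symmetric, the subsets can be renamed by \<open>w\<close> in the term of
  each \<open>w\<close>, so that the factor is permuted together with the monomial.\<close>

lemma alternant_mult_elem_sym:
  "alternant n \<beta> * elem_sym n k = (\<Sum>S | S \<subseteq> {1..n} \<and> card S = k. alternant n (\<lambda>i. \<beta> i + ind S i))"
proof -
  let ?P = "{S. S \<subseteq> {1..n} \<and> card S = k}"
  have "alternant n \<beta> * elem_sym n k =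
    (\<Sum>w | w permutes {1..n}. \<Sum>S \<in> ?P. of_int (sign w) * x_pow (expo n (\<lambda>i. \<beta> (w i) + ind S i)))"
    unfolding alternant_def elem_sym_def sum_product
    by (intro sum.cong refl) (simp add: mult.assoc x_pow_mult expo_add)
  also have "\<dots> = (\<Sum>w | w permutes {1..n}. \<Sum>S \<in> ?P. of_int (sign w) * x_pow (expo n ((\<lambda>i. \<beta> i + ind S i) \<circ> w)))"
  proof (rule sum.cong[OF refl])
    fix w assume "w \<in> {w. w permutes {1..n}}"
    then have w: "w permutes {1..n}" by simp
    have cv: "card (w -` S) = card S" for S
      using permutes_bij[OF w] by (metis bij_betw_def card_vimage_inj subset_UNIV)
    have ci: "card (w ` S) = card S" for S
      using permutes_inj[OF w] by (meson card_image inj_on_subset subset_UNIV)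
    show "(\<Sum>S \<in> ?P. of_int (sign w) * x_pow (expo n (\<lambda>i. \<beta> (w i) + ind S i))) =
      (\<Sum>S \<in> ?P. of_int (sign w) * x_pow (expo n ((\<lambda>i. \<beta> i + ind S i) \<circ> w)))"
    proof (rule sum.reindex_bij_witness[where i = "\<lambda>S. w -` S" and j = "\<lambda>S. w ` S"])
      fix S assume S: "S \<in> ?P"
      show "w -` (w ` S) = S" using permutes_inj[OF w] by (simp add: inj_vimage_image_eq)
      show "w ` S \<in> ?P" using S permutes_image[OF w] ci by auto
      show "w ` (w -` S) = S" using permutes_surj[OF w] by (simp add: surj_image_vimage_eq)
      show "w -` S \<in> ?P" using S permutes_vimage[OF w] cv by auto
      have "(\<lambda>i. \<beta> i + ind (w ` S) i) \<circ> w = (\<lambda>i. \<beta> (w i) + ind S i)"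
        using permutes_inj[OF w] by (auto simp: ind_def fun_eq_iff inj_image_mem_iff)
      then show "of_int (sign w) * x_pow (expo n ((\<lambda>i. \<beta> i + ind (w ` S) i) \<circ> w)) =
         of_int (sign w) * x_pow (expo n (\<lambda>i. \<beta> (w i) + ind S i))" by simp
    qed
  qed
  also have "\<dots> = (\<Sum>S \<in> ?P. alternant n (\<lambda>i. \<beta> i + ind S i))"
    unfolding alternant_def by (rule sum.swap)
  finally show ?thesis .
qed

lemma sum_initial_segment_max:
  fixes \<mu> :: "nat \<Rightarrow> nat"
  assumes dec: "\<And>i j. 1 \<le> i \<Longrightarrow> i < j \<Longrightarrow> j \<le> n \<Longrightarrow> \<mu> j < \<mu> i"
    and S: "S \<subseteq> {1..n}" "card S = k" "S \<noteq> {1..k}" and k: "k \<le> n"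
  shows "sum \<mu> S < sum \<mu> {1..k}"
proof -
  let ?K = "{1..k}"
  have fin: "finite S" using S finite_subset by blast
  have "card (S - ?K) = card (?K - S)"
    using card_Diff_subset_Int[of S ?K] card_Diff_subset_Int[of ?K S] S fin by (simp add: Int_commute)
  moreover have "S - ?K \<noteq> {}"
  proof
    assume "S - ?K = {}"
    then have "S = ?K" using card_subset_eq[of ?K S] S(2) by auto
    then show False using S by simp
  qed
  ultimately have c: "card (S - ?K) = card (?K - S)" "card (S - ?K) > 0" using fin by auto
  have "?K - S \<noteq> {}" using c by (metis card.empty less_irrefl)
  then have k1: "1 \<le> k" by auto
  have "sum \<mu> (S - ?K) < of_nat (card (S - ?K)) * \<mu> k"
  proof (rule sum_bounded_above_strict)
    fix i assume "i \<in> S - ?K"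
    then show "\<mu> i < \<mu> k" using dec[of k i] S k1 by auto
  qed (use c in simp)
  also have "\<dots> \<le> sum \<mu> (?K - S)"
    unfolding c(1)
  proof (rule sum_bounded_below)
    fix i assume "i \<in> ?K - S"
    then show "\<mu> k \<le> \<mu> i" using dec[of i k] k by (cases "i = k") auto
  qed
  finally have "sum \<mu> (S - ?K) < sum \<mu> (?K - S)" .
  moreover have "sum \<mu> S = sum \<mu> (S \<inter> ?K) + sum \<mu> (S - ?K)" using sum.Int_Diff[OF fin] .
  moreover have "sum \<mu> ?K = sum \<mu> (?K \<inter> S) + sum \<mu> (?K - S)" by (rule sum.Int_Diff) simp
  ultimately show ?thesis by (simp add: Int_commute)
qed

text \<open>Needed because \<open>pi_op\<close> is a quotient given by a definite description. Write
  the decreasing rearrangement \<open>a\<close> of \<open>\<beta>\<close> as \<open>\<mu>\<close>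
  plus the indicator of 1..k, with \<open>\<mu>\<close> still strictly decreasing. The product of
  the alternant of \<open>\<mu>\<close> and e_k contains the alternant of \<open>a\<close>; all its
  other terms have the same sum of entries but a smaller sum of squares, and \<open>\<mu>\<close>
  itself has a smaller sum. This is the order of the induction.\<close>

lemma alternant_dvd_nat: "alternant n (rho_fun n) dvd alternant n (\<lambda>i. int (\<beta> i))"
proof (induction \<beta> rule: wf_induct[OF wf_measures[of "[\<lambda>\<beta>. \<Sum>i = 1..n. \<beta> i, \<lambda>\<beta>. \<Sum>i = 1..n. (\<beta> i)\<^sup>2]"]])
  case (1 \<beta>)
  let ?D = "alternant n (rho_fun n)"
  have IH: "?D dvd alternant n (\<lambda>i. int (\<beta>' i))"
    if "(\<Sum>i = 1..n. \<beta>' i) < (\<Sum>i = 1..n. \<beta> i) \<or>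
        (\<Sum>i = 1..n. \<beta>' i) = (\<Sum>i = 1..n. \<beta> i) \<and> (\<Sum>i = 1..n. (\<beta>' i)\<^sup>2) < (\<Sum>i = 1..n. (\<beta> i)\<^sup>2)" for \<beta>' :: "nat \<Rightarrow> nat"
    using 1 that by auto
  show ?case
  proof (cases "inj_on \<beta> {1..n}")
    case False
    then obtain i j where "i \<in> {1..n}" "j \<in> {1..n}" "i \<noteq> j" "\<beta> i = \<beta> j" by (auto simp: inj_on_def)
    then have "alternant n (\<lambda>i. int (\<beta> i)) = 0" by (intro alternant_eq_0[of i n j]) simp_all
    then show ?thesis by simp
  next
    case True
    obtain w where w: "w permutes {1..n}" "\<And>i. 1 \<le> i \<Longrightarrow> i < n \<Longrightarrow> \<beta> (w (Suc i)) \<le> \<beta> (w i)"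
      using sorting_permutation[of 1 n "\<lambda>i. int (\<beta> i)"] by auto
    define a where "a = \<beta> \<circ> w"
    have a1: "a (Suc i) < a i" if "1 \<le> i" "i < n" for i
    proof -
      have "w i \<in> {1..n}" "w (Suc i) \<in> {1..n}" using permutes_in_image[OF w(1)] that by auto
      moreover have "w i \<noteq> w (Suc i)" using permutes_inj[OF w(1)] by (metis injD n_not_Suc_n)
      ultimately have "\<beta> (w i) \<noteq> \<beta> (w (Suc i))" using inj_onD[OF True] by metis
      then show ?thesis using w(2)[OF that] by (simp add: a_def)
    qed
    have sums: "(\<Sum>i = 1..n. a i) = (\<Sum>i = 1..n. \<beta> i)" "(\<Sum>i = 1..n. (a i)\<^sup>2) = (\<Sum>i = 1..n. (\<beta> i)\<^sup>2)"
      using sum.permute[OF w(1), of \<beta>] sum.permute[OF w(1), of "\<lambda>i. (\<beta> i)\<^sup>2"] by (auto simp: a_def o_def)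
    have "?D dvd alternant n (\<lambda>i. int (a i))"
    \<comment> \<open>\<open>k\<close> is a place where \<open>a\<close> falls by at least 2, or
      \<open>n\<close> if the last entry is positive, so that 1 can be subtracted from the first
      \<open>k\<close> entries without losing strictness. If there is no such place,
      \<open>a\<close> agrees with \<rho>.\<close>
    proof (cases "\<exists>k. 1 \<le> k \<and> k \<le> n \<and> (if k = n then 1 \<le> a n else a (Suc k) + 2 \<le> a k)")
      case False
      have "int (a i) = rho_fun n i" if "i \<in> {1..n}" for i
      proof -
        have "1 \<le> i" "i \<le> n" using that by auto
        from this(2,1) show ?thesis
        proof (induction i rule: inc_induct)
          case base
          then have "\<not> 1 \<le> a n" using False by auto
          then show ?case by (simp add: rho_fun_def)
        next
          case (step k)
          have "\<not> a (Suc k) + 2 \<le> a k"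
          proof
            assume "a (Suc k) + 2 \<le> a k"
            then have "1 \<le> k \<and> k \<le> n \<and> (if k = n then 1 \<le> a n else a (Suc k) + 2 \<le> a k)" using step by simp
            then show False using False by blast
          qed
          then have "a k = Suc (a (Suc k))" using a1[of k] step by simp
          then show ?case using step by (simp add: rho_fun_def)
        qed
      qed
      then have "alternant n (\<lambda>i. int (a i)) = ?D" by (rule alternant_cong)
      then show ?thesis by simp
    next
      case True
      then obtain k where k: "1 \<le> k" "k \<le> n" "if k = n then 1 \<le> a n else a (Suc k) + 2 \<le> a k" by blast
      have amono: "a j < a i" if "1 \<le> i" "Suc i \<le> j" "j \<le> n" for i j
        using that(2,3,1)
      proof (induction j rule: dec_induct)
        case base
        then show ?case using a1[of i] by simp
      next
        case (step j)
        then show ?case using a1[of j] by simp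
      qed
      have amono': "a j \<le> a i" if "1 \<le> i" "i \<le> j" "j \<le> n" for i j
        using amono[of i j] that by (cases "i = j") auto
      have pos: "1 \<le> a i" if "1 \<le> i" "i \<le> k" for i
        using amono'[of i k] k that by (auto split: if_splits)
      define \<mu> where "\<mu> i = (if i \<in> {1..k} then a i - 1 else a i)" for i
      have a\<mu>: "a i = \<mu> i + (if i \<in> {1..k} then 1 else 0)" for i using pos[of i] by (auto simp: \<mu>_def)
      have \<mu>dec: "\<mu> j < \<mu> i" if ij: "1 \<le> i" "i < j" "j \<le> n" for i j
      proof -
        have aij: "a j < a i" using amono[of i j] ij by simp
        consider "j \<le> k" | "i \<le> k" "k < j" | "k < i" by linarith
        then show ?thesis
        proof cases
          case 1
          then show ?thesis using aij ij pos[of j] pos[of i] by (simp add: \<mu>_def)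
        next
          case 2
          then have "a j \<le> a (Suc k)" "a (Suc k) + 2 \<le> a k" "a k \<le> a i"
            using amono'[of "Suc k" j] amono'[of i k] k ij by auto
          then show ?thesis using 2 ij by (simp add: \<mu>_def)
        next
          case 3
          then show ?thesis using aij ij by (simp add: \<mu>_def)
        qed
      qed
      have sumS: "(\<Sum>i = 1..n. \<mu> i + (if i \<in> S then 1 else 0)) = (\<Sum>i = 1..n. \<mu> i) + card S"
        "(\<Sum>i = 1..n. (\<mu> i + (if i \<in> S then 1 else 0))\<^sup>2) = (\<Sum>i = 1..n. (\<mu> i)\<^sup>2) + 2 * sum \<mu> S + card S"
        if S: "S \<subseteq> {1..n}" for S
      proof -
        have r: "(\<Sum>i = 1..n. if i \<in> S then g i else 0) = sum g S" for g :: "nat \<Rightarrow> nat"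
          using sum.inter_restrict[of "{1..n}" g S] S by (simp add: Int_absorb1)
        show "(\<Sum>i = 1..n. \<mu> i + (if i \<in> S then 1 else 0)) = (\<Sum>i = 1..n. \<mu> i) + card S"
          unfolding sum.distrib r by simp
        have "(\<Sum>i = 1..n. (\<mu> i + (if i \<in> S then 1 else 0))\<^sup>2) = (\<Sum>i = 1..n. (\<mu> i)\<^sup>2 + (if i \<in> S then 2 * \<mu> i + 1 else 0))"
          by (rule sum.cong) (auto simp: power2_eq_square)
        also have "\<dots> = (\<Sum>i = 1..n. (\<mu> i)\<^sup>2) + (\<Sum>i \<in> S. 2 * \<mu> i + 1)"
          unfolding sum.distrib r ..
        finally show "(\<Sum>i = 1..n. (\<mu> i + (if i \<in> S then 1 else 0))\<^sup>2) = (\<Sum>i = 1..n. (\<mu> i)\<^sup>2) + 2 * sum \<mu> S + card S"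
          unfolding sum.distrib sum_distrib_left[symmetric] by simp
      qed
      let ?P = "{S. S \<subseteq> {1..n} \<and> card S = k}"
      have K: "{1..k} \<in> ?P" using k by auto
      have finP: "finite ?P" by (rule finite_subset[of _ "Pow {1..n}"]) auto
      have suma: "(\<Sum>i = 1..n. a i) = (\<Sum>i = 1..n. \<mu> i) + k"
        "(\<Sum>i = 1..n. (a i)\<^sup>2) = (\<Sum>i = 1..n. (\<mu> i)\<^sup>2) + 2 * sum \<mu> {1..k} + k"
      proof -
        have sub: "{1..k} \<subseteq> {1..n}" and ck: "card {1..k} = k" using k by auto
        show "(\<Sum>i = 1..n. a i) = (\<Sum>i = 1..n. \<mu> i) + k"
          "(\<Sum>i = 1..n. (a i)\<^sup>2) = (\<Sum>i = 1..n. (\<mu> i)\<^sup>2) + 2 * sum \<mu> {1..k} + k"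
          using sumS[OF sub] by (simp_all only: a\<mu>[symmetric] ck)
      qed
      have D\<mu>: "?D dvd alternant n (\<lambda>i. int (\<mu> i))" using suma(1) k sums(1) by (intro IH) simp
      have DS: "?D dvd alternant n (\<lambda>i. int (\<mu> i) + ind S i)" if S: "S \<in> ?P - {{1..k}}" for S
      proof -
        have "sum \<mu> S < sum \<mu> {1..k}"
          using S k \<mu>dec by (intro sum_initial_segment_max[of n \<mu> S k]) auto
        then have "?D dvd alternant n (\<lambda>i. int (\<mu> i + (if i \<in> S then 1 else 0)))"
          using sumS[of S] S suma sums by (intro IH) auto
        also have "(\<lambda>i. int (\<mu> i + (if i \<in> S then 1 else 0))) = (\<lambda>i. int (\<mu> i) + ind S i)"
          by (auto simp: ind_def fun_eq_iff)
        finally show ?thesis .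
      qed
      have "alternant n (\<lambda>i. int (\<mu> i)) * elem_sym n k =
        alternant n (\<lambda>i. int (\<mu> i) + ind {1..k} i) + (\<Sum>S \<in> ?P - {{1..k}}. alternant n (\<lambda>i. int (\<mu> i) + ind S i))"
        unfolding alternant_mult_elem_sym using finP K by (rule sum.remove)
      moreover have "(\<lambda>i. int (\<mu> i) + ind {1..k} i) = (\<lambda>i. int (a i))"
        unfolding a\<mu> by (auto simp: ind_def fun_eq_iff)
      ultimately have "alternant n (\<lambda>i. int (a i)) = alternant n (\<lambda>i. int (\<mu> i)) * elem_sym n k
         - (\<Sum>S \<in> ?P - {{1..k}}. alternant n (\<lambda>i. int (\<mu> i) + ind S i))" by simp
      moreover have "?D dvd (\<Sum>S \<in> ?P - {{1..k}}. alternant n (\<lambda>i. int (\<mu> i) + ind S i))"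
        by (rule dvd_sum) (rule DS)
      ultimately show ?thesis using dvd_mult2[OF D\<mu>, of "elem_sym n k"] by (simp only: dvd_diff)
    qed
    moreover have "alternant n (\<lambda>i. int (a i)) = of_int (sign w) * alternant n (\<lambda>i. int (\<beta> i))"
      using alternant_permute[OF w(1), of "\<lambda>i. int (\<beta> i)"] by (simp add: a_def o_def)
    ultimately have "?D dvd of_int (sign w) * (of_int (sign w) * alternant n (\<lambda>i. int (\<beta> i)))" by simp
    moreover have "of_int (sign w) * (of_int (sign w) * alternant n (\<lambda>i. int (\<beta> i))) = alternant n (\<lambda>i. int (\<beta> i))"
      by (simp only: mult.assoc[symmetric] of_int_mult[symmetric] sign_idempotent) simp
    ultimately show ?thesis by simp
  qed
qed

text \<open>A constant shift multiplies the alternant by a monomial, which is a unit, so negative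
  exponents reduce to natural ones.\<close>

lemma alternant_dvd: "alternant n (rho_fun n) dvd alternant n \<beta>"
proof -
  define c where "c = (\<Sum>i = 1..n. \<bar>\<beta> i\<bar>)"
  have nn: "0 \<le> \<beta> i + c" if "i \<in> {1..n}" for i
  proof -
    have "\<bar>\<beta> i\<bar> \<le> c" unfolding c_def using that by (intro member_le_sum) auto
    then show ?thesis by linarith
  qed
  have "alternant n (\<lambda>i. \<beta> i + c) = x_pow (expo n (\<lambda>_. c)) * alternant n \<beta>"
    unfolding alternant_def sum_distrib_left
    by (rule sum.cong) (auto simp: mult.left_commute x_pow_mult expo_add intro!: arg_cong[where f = x_pow] expo_cong)
  then have "x_pow (expo n (\<lambda>_. - c)) * alternant n (\<lambda>i. \<beta> i + c) = (x_pow (expo n (\<lambda>_. - c)) * x_pow (expo n (\<lambda>_. c))) * alternant n \<beta>"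
    by (simp only: mult.assoc)
  also have "x_pow (expo n (\<lambda>_. - c)) * x_pow (expo n (\<lambda>_. c)) = 1"
    unfolding x_pow_mult expo_add by (simp add: x_pow_0[symmetric]) (simp add: expo_def)
  finally have e: "alternant n \<beta> = x_pow (expo n (\<lambda>_. - c)) * alternant n (\<lambda>i. \<beta> i + c)" by simp
  have "alternant n (\<lambda>i. \<beta> i + c) = alternant n (\<lambda>i. int (nat (\<beta> i + c)))"
    by (rule alternant_cong) (use nn in simp)
  then show ?thesis unfolding e using alternant_dvd_nat[of n "\<lambda>i. nat (\<beta> i + c)"] by (simp add: dvd_mult)
qed

definition strict_dec :: "nat \<Rightarrow> (nat \<Rightarrow> int) \<Rightarrow> bool" where
  "strict_dec n \<beta> \<longleftrightarrow> (\<forall>i. 1 \<le> i \<longrightarrow> i < n \<longrightarrow> \<beta> (Suc i) < \<beta> i)"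

lemma strict_dec_less:
  assumes "strict_dec n \<beta>" "1 \<le> i" "Suc i \<le> j" "j \<le> n"
  shows "\<beta> j < \<beta> i"
  using assms(3,4,2)
proof (induction j rule: dec_induct)
  case base
  then show ?case using assms(1) by (simp add: strict_dec_def)
next
  case (step j)
  then show ?case using assms(1) unfolding strict_dec_def by (metis Suc_leD Suc_le_lessD le_trans less_trans le_SucI)
qed

text \<open>The alternant of a strictly decreasing vector contains exactly one strictly decreasing
  exponent, its own. This is what makes the coefficients in the Schur basis unique.\<close>

lemma lookup_alternant_strict:
  assumes l: "strict_dec n l" and m: "strict_dec n m"
  shows "Poly_Mapping.lookup (alternant n l) (expo n m) = (if \<forall>i \<in> {1..n}. l i = m i then 1 else 0)"
proof -
  have idw: "w = id" if w: "w permutes {1..n}" and e: "expo n m = expo n (l \<circ> w)" for w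
  proof (rule permutes_increasing_id[OF w])
    fix i assume i: "1 \<le> i" "i < n"
    have mi: "m j = l (w j)" if "j \<in> {1..n}" for j using e that by (auto simp: expo_eq_iff)
    have win: "w i \<in> {1..n}" "w (Suc i) \<in> {1..n}" using permutes_in_image[OF w] i by auto
    have "m (Suc i) < m i" using m i by (simp add: strict_dec_def)
    then have "l (w (Suc i)) < l (w i)" using mi i by simp
    then have "w (Suc i) \<noteq> w i" "\<not> Suc (w (Suc i)) \<le> w i"
      using strict_dec_less[OF l, of "w (Suc i)" "w i"] win by auto
    then show "w i < w (Suc i)" by linarith
  qed
  have "Poly_Mapping.lookup (alternant n l) (expo n m) =
     (\<Sum>w | w permutes {1..n}. if w = id then (if expo n m = expo n l then 1 else 0) else 0)"
    unfolding lookup_alternant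
  proof (rule sum.cong[OF refl])
    fix w assume "w \<in> {w. w permutes {1..n}}"
    then show "(if expo n m = expo n (l \<circ> w) then sign w else 0) = (if w = id then if expo n m = expo n l then 1 else 0 else 0)"
      using idw[of w] by (cases "w = id") auto
  qed
  also have "\<dots> = (if expo n m = expo n l then 1 else 0)"
    using permutes_id[of "{1..n}"] by (simp add: finite_permutations)
  finally show ?thesis by (auto simp: expo_eq_iff)
qed

lemma strict_dec_rho: "strict_dec n (rho_fun n)"
  by (simp add: strict_dec_def rho_fun_def)

lemma alternant_rho_neq_0: "alternant n (rho_fun n) \<noteq> 0"
  using lookup_alternant_strict[OF strict_dec_rho strict_dec_rho, of n] by auto

section \<open>The quotient by the Vandermonde determinant and coefficients in the Schur
  basis\<close>

text \<open>Only the variables x_1, ..., x_n occur. The type allows arbitrary indices, on which the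
  permutations of 1..n do not act.\<close>

definition supported :: "nat \<Rightarrow> laurent \<Rightarrow> bool" where
  "supported n F \<longleftrightarrow> (\<forall>\<alpha> \<in> Poly_Mapping.keys F. Poly_Mapping.keys \<alpha> \<subseteq> {1..n})"

lemma J_op_sum: "J_op n (sum f A) = (\<Sum>a \<in> A. J_op n (f a))"
  by (rule poly_mapping_eqI) (simp add: lookup_J_op lookup_sum sum_distrib_left sum.swap[of _ A])

lemma J_op_of_int: "J_op n (of_int k * f) = of_int k * J_op n f"
  by (rule poly_mapping_eqI)
     (simp add: lookup_J_op lookup_of_int_mult sum_distrib_left mult.left_commute)

lemma single_conv_x_pow: "Poly_Mapping.single \<alpha> c = of_int c * x_pow \<alpha>"
  by (rule poly_mapping_eqI) (simp add: lookup_of_int_mult x_pow_def lookup_single when_def)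

lemma J_op_expansion:
  assumes "supported n F"
  shows "J_op n (x_pow (expo n (rho_fun n)) * F) =
    (\<Sum>\<alpha> \<in> Poly_Mapping.keys F. of_int (Poly_Mapping.lookup F \<alpha>) * alternant n (\<lambda>i. rho_fun n i + Poly_Mapping.lookup \<alpha> i))"
proof -
  have "x_pow (expo n (rho_fun n)) * F =
     (\<Sum>\<alpha> \<in> Poly_Mapping.keys F. of_int (Poly_Mapping.lookup F \<alpha>) * x_pow (expo n (\<lambda>i. rho_fun n i + Poly_Mapping.lookup \<alpha> i)))"
  proof -
    have "x_pow (expo n (rho_fun n)) * F = (\<Sum>\<alpha> \<in> Poly_Mapping.keys F. x_pow (expo n (rho_fun n)) * (of_int (Poly_Mapping.lookup F \<alpha>) * x_pow \<alpha>))"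
      by (subst laurent_expansion[of F]) (simp add: single_conv_x_pow sum_distrib_left)
    also have "\<dots> = (\<Sum>\<alpha> \<in> Poly_Mapping.keys F. of_int (Poly_Mapping.lookup F \<alpha>) * x_pow (expo n (\<lambda>i. rho_fun n i + Poly_Mapping.lookup \<alpha> i)))"
    proof (rule sum.cong[OF refl])
      fix \<alpha> assume "\<alpha> \<in> Poly_Mapping.keys F"
      then have "expo n (Poly_Mapping.lookup \<alpha>) = \<alpha>" using assms by (intro expo_lookup) (auto simp: supported_def)
      then have "expo n (\<lambda>i. rho_fun n i + Poly_Mapping.lookup \<alpha> i) = expo n (rho_fun n) + \<alpha>"
        using expo_add[of n "rho_fun n" "Poly_Mapping.lookup \<alpha>"] by simp
      then show "x_pow (expo n (rho_fun n)) * (of_int (Poly_Mapping.lookup F \<alpha>) * x_pow \<alpha>) =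
        of_int (Poly_Mapping.lookup F \<alpha>) * x_pow (expo n (\<lambda>i. rho_fun n i + Poly_Mapping.lookup \<alpha> i))"
        by (simp add: mult.left_commute x_pow_mult)
    qed
    finally show ?thesis .
  qed
  then show ?thesis by (simp add: J_op_sum J_op_of_int J_op_x_pow)
qed

text \<open>Existence of the quotient is the divisibility of alternants, uniqueness is cancellation
  in an integral domain.\<close>

lemma pi_op_eq:
  assumes "supported n F"
  shows "alternant n (rho_fun n) * pi_op n F = J_op n (x_pow (expo n (rho_fun n)) * F)"
proof -
  have "alternant n (rho_fun n) dvd J_op n (x_pow (expo n (rho_fun n)) * F)"
    unfolding J_op_expansion[OF assms] by (intro dvd_sum dvd_mult alternant_dvd)
  then obtain g where g: "alternant n (rho_fun n) * g = J_op n (x_pow (expo n (rho_fun n)) * F)"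
    unfolding dvd_def by metis
  have "g' = g" if "alternant n (rho_fun n) * g' = J_op n (x_pow (expo n (rho_fun n)) * F)" for g'
    using alternant_rho_neq_0[of n] that g by (metis mult_cancel_left)
  then show ?thesis unfolding pi_op_def weight_rho J_op_x_pow by (rule theI[where P = "\<lambda>g. alternant n (rho_fun n) * g = J_op n (x_pow (expo n (rho_fun n)) * F)", OF g])
qed

lemma supported_x_pow: "supported n (x_pow (expo n \<beta>))"
  using keys_expo by (simp add: supported_def x_pow_def)

lemma schur_eq:
  assumes "length lam = n"
  shows "alternant n (rho_fun n) * schur n lam = alternant n (\<lambda>i. rho_fun n i + lam ! (i - 1))"
  unfolding schur_def weight_expo assms pi_op_eq[OF supported_x_pow] x_pow_mult expo_add J_op_x_pow ..

lemma dominant_strict_dec: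
  "dominant_weight n lam \<Longrightarrow> strict_dec n (\<lambda>i. rho_fun n i + lam ! (i - 1))"
  unfolding strict_dec_def
proof (intro allI impI)
  fix i assume l: "dominant_weight n lam" and i: "1 \<le> i" "i < n"
  then have "lam ! (i - 1) \<ge> lam ! i"
    unfolding dominant_weight_def by (auto intro: sorted_wrt_nth_less)
  then show "rho_fun n (Suc i) + lam ! (Suc i - 1) < rho_fun n i + lam ! (i - 1)"
    by (simp add: rho_fun_def)
qed

lemma lookup_alternant_dominant:
  assumes "dominant_weight n lam" "dominant_weight n mu"
  shows "Poly_Mapping.lookup (alternant n (\<lambda>i. rho_fun n i + lam ! (i - 1))) (expo n (\<lambda>i. rho_fun n i + mu ! (i - 1)))
    = (if lam = mu then 1 else 0)"
proof -
  have "lam = mu" if e: "\<forall>i \<in> {1..n}. rho_fun n i + lam ! (i - 1) = rho_fun n i + mu ! (i - 1)"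
  proof (rule nth_equalityI)
    show "length lam = length mu" using assms by (simp add: dominant_weight_def)
    show "lam ! i = mu ! i" if "i < length lam" for i
      using bspec[OF e, of "Suc i"] that assms by (simp add: dominant_weight_def)
  qed
  then show ?thesis
    unfolding lookup_alternant_strict[OF dominant_strict_dec[OF assms(1)] dominant_strict_dec[OF assms(2)]] by auto
qed

lemma lookup_J_op_permute:
  assumes u: "u permutes {1..n}"
  shows "Poly_Mapping.lookup (J_op n f) (expo n (\<beta> \<circ> u)) = sign u * Poly_Mapping.lookup (J_op n f) (expo n \<beta>)"
proof -
  have "sign u * Poly_Mapping.lookup (J_op n f) (expo n \<beta>) =
    sign u * (\<Sum>w | w permutes {1..n}. sign (u \<circ> w) * Poly_Mapping.lookup f (Poly_Mapping.map_key (u \<circ> w) (expo n \<beta>)))"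
    unfolding lookup_J_op by (subst setum_permutations_compose_left[OF u]) simp
  also have "\<dots> = (\<Sum>w | w permutes {1..n}. sign w * Poly_Mapping.lookup f (Poly_Mapping.map_key w (expo n (\<beta> \<circ> u))))"
    unfolding sum_distrib_left
  proof (rule sum.cong[OF refl])
    fix w assume "w \<in> {w. w permutes {1..n}}"
    then have w: "w permutes {1..n}" by simp
    have "sign (u \<circ> w) = sign u * sign w" using u w by (intro permutes_sign_compose[of "{1..n}"]) auto
    then have "sign u * sign (u \<circ> w) = sign w" by (metis mult.assoc mult_1 sign_idempotent)
    moreover have "Poly_Mapping.map_key (u \<circ> w) (expo n \<beta>) = Poly_Mapping.map_key w (expo n (\<beta> \<circ> u))"
      using map_key_expo[OF permutes_compose[OF w u]] map_key_expo[OF w] by (simp add: comp_assoc)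
    ultimately show "sign u * (sign (u \<circ> w) * Poly_Mapping.lookup f (Poly_Mapping.map_key (u \<circ> w) (expo n \<beta>))) =
      sign w * Poly_Mapping.lookup f (Poly_Mapping.map_key w (expo n (\<beta> \<circ> u)))"
      by (simp only: mult.assoc[symmetric])
  qed
  finally show ?thesis by (simp add: lookup_J_op)
qed

lemma lookup_J_op_eq_0:
  assumes "i \<in> {1..n}" "j \<in> {1..n}" "i \<noteq> j" "\<beta> i = \<beta> j"
  shows "Poly_Mapping.lookup (J_op n f) (expo n \<beta>) = 0"
proof -
  define s where "s = Transposition.transpose i j"
  have s: "s permutes {1..n}" unfolding s_def using assms by (intro permutes_swap_id) auto
  have "\<beta> \<circ> s = \<beta>" using assms by (auto simp: s_def transpose_def fun_eq_iff)
  then show ?thesis using lookup_J_op_permute[OF s, of f \<beta>] assms by (simp add: s_def sign_swap_id)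
qed

lemma lookup_J_op_unsupported:
  assumes "supported n f" "\<not> Poly_Mapping.keys \<alpha> \<subseteq> {1..n}"
  shows "Poly_Mapping.lookup (J_op n f) \<alpha> = 0"
proof -
  have "Poly_Mapping.lookup f (Poly_Mapping.map_key w \<alpha>) = 0" if w: "w permutes {1..n}" for w
  proof (rule ccontr)
    assume "Poly_Mapping.lookup f (Poly_Mapping.map_key w \<alpha>) \<noteq> 0"
    then have sub: "Poly_Mapping.keys (Poly_Mapping.map_key w \<alpha>) \<subseteq> {1..n}"
      using assms(1) by (auto simp: supported_def in_keys_iff)
    obtain i where "i \<in> Poly_Mapping.keys \<alpha>" "i \<notin> {1..n}" using assms(2) by blast
    then have i: "Poly_Mapping.lookup \<alpha> i \<noteq> 0" "i \<notin> {1..n}" by (simp_all add: in_keys_iff)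
    then have "w i = i" using w by (simp add: permutes_not_in)
    then have "i \<in> Poly_Mapping.keys (Poly_Mapping.map_key w \<alpha>)"
      using i(1) lookup_map_key[OF permutes_inj[OF w], of \<alpha> i] by (simp add: in_keys_iff)
    then show False using sub i by blast
  qed
  then show ?thesis by (simp add: lookup_J_op)
qed

lemma supported_x_pow_mult:
  assumes "supported n f"
  shows "supported n (x_pow (expo n \<beta>) * f)"
  unfolding supported_def
proof
  fix \<alpha> assume "\<alpha> \<in> Poly_Mapping.keys (x_pow (expo n \<beta>) * f)"
  then have "Poly_Mapping.keys (\<alpha> - expo n \<beta>) \<subseteq> {1..n}"
    using assms by (auto simp: supported_def in_keys_iff lookup_x_pow_mult)
  then show "Poly_Mapping.keys \<alpha> \<subseteq> {1..n}" using keys_expo[of n \<beta>]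
    by (auto simp: in_keys_iff lookup_minus lookup_expo split: if_splits)
qed

lemma strict_dec_cases:
  assumes "inj_on \<beta> {1..n}"
  shows "\<exists>u. u permutes {1..n} \<and> strict_dec n (\<beta> \<circ> u)"
proof -
  obtain w where w: "w permutes {1..n}" "\<forall>i. 1 \<le> i \<longrightarrow> i < n \<longrightarrow> \<beta> (w (Suc i)) \<le> \<beta> (w i)"
    using sorting_permutation[of 1 n \<beta>] by blast
  have "\<beta> (w (Suc i)) < \<beta> (w i)" if i: "1 \<le> i" "i < n" for i
  proof -
    have "w i \<in> {1..n}" "w (Suc i) \<in> {1..n}" using permutes_in_image[OF w(1)] i by auto
    moreover have "w i \<noteq> w (Suc i)" using permutes_inj[OF w(1)] by (metis injD n_not_Suc_n)
    ultimately have "\<beta> (w i) \<noteq> \<beta> (w (Suc i))" using inj_onD[OF assms] by metis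
    then show ?thesis using w(2) i by (simp add: order_less_le)
  qed
  then show ?thesis using w(1) by (auto simp: strict_dec_def)
qed

text \<open>An antisymmetric Laurent polynomial is determined by its coefficients at strictly
  decreasing exponents: those with a repeated entry vanish, and the others agree up to sign with
  that at their decreasing rearrangement. Subtracting \<rho> from a strictly decreasing vector gives
  a dominant weight.\<close>

lemma J_op_eqI:
  assumes sup: "supported n f" "supported n g"
    and eq: "\<And>lam. dominant_weight n lam \<Longrightarrow>
       Poly_Mapping.lookup (J_op n f) (expo n (\<lambda>i. rho_fun n i + lam ! (i - 1))) =
       Poly_Mapping.lookup (J_op n g) (expo n (\<lambda>i. rho_fun n i + lam ! (i - 1)))"
  shows "J_op n f = J_op n g"
proof (rule poly_mapping_eqI)
  fix \<alpha>
  show "Poly_Mapping.lookup (J_op n f) \<alpha> = Poly_Mapping.lookup (J_op n g) \<alpha>"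
  proof (cases "Poly_Mapping.keys \<alpha> \<subseteq> {1..n}")
    case False
    then show ?thesis using lookup_J_op_unsupported sup by metis
  next
    case True
    define \<beta> where "\<beta> = Poly_Mapping.lookup \<alpha>"
    have \<alpha>: "\<alpha> = expo n \<beta>" using expo_lookup[OF True] by (simp add: \<beta>_def)
    show ?thesis
    proof (cases "inj_on \<beta> {1..n}")
      case False
      then obtain i j where "i \<in> {1..n}" "j \<in> {1..n}" "i \<noteq> j" "\<beta> i = \<beta> j" by (auto simp: inj_on_def)
      then show ?thesis unfolding \<alpha> using lookup_J_op_eq_0 by metis
    next
      case True
      obtain u where u: "u permutes {1..n}" "strict_dec n (\<beta> \<circ> u)" using strict_dec_cases[OF True] by blast
      define lam where "lam = map (\<lambda>i. (\<beta> \<circ> u) i - rho_fun n i) [1..<Suc n]"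
      have nth: "lam ! (i - 1) = (\<beta> \<circ> u) i - rho_fun n i" if "i \<in> {1..n}" for i
      proof -
        have "i - 1 < n" "Suc (i - 1) = i" using that by auto
        then show ?thesis by (simp add: lam_def del: upt_Suc)
      qed
      have "(\<beta> \<circ> u) j - rho_fun n j \<le> (\<beta> \<circ> u) i - rho_fun n i" if "1 \<le> i" "i \<le> j" "j \<le> n" for i j
        using that(2,3,1)
      proof (induction j rule: dec_induct)
        case (step j)
        then have "(\<beta> \<circ> u) (Suc j) < (\<beta> \<circ> u) j" using u(2) by (simp add: strict_dec_def)
        then show ?case using step by (simp add: rho_fun_def)
      qed simp
      then have "dominant_weight n lam"
        unfolding dominant_weight_def lam_def
        by (auto simp: sorted_wrt_iff_nth_less simp del: upt_Suc)
      moreover have "expo n (\<lambda>i. rho_fun n i + lam ! (i - 1)) = expo n (\<beta> \<circ> u)"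
        by (rule expo_cong) (use nth in auto)
      ultimately have "Poly_Mapping.lookup (J_op n f) (expo n (\<beta> \<circ> u)) = Poly_Mapping.lookup (J_op n g) (expo n (\<beta> \<circ> u))"
        using eq by metis
      then show ?thesis unfolding \<alpha> lookup_J_op_permute[OF u(1)] by simp
    qed
  qed
qed

text \<open>Multiplication by the Vandermonde determinant turns Schur functions into alternants,
  each of which contains one strictly decreasing exponent. The coefficient at \<open>mu\<close> +
  \<rho> therefore isolates that of \<open>schur n mu\<close>.\<close>

lemma schur_coeffs_unique:
  assumes F: "supported n F" and c: "\<forall>lam \<in> Poly_Mapping.keys c. dominant_weight n lam"
    and eq: "pi_op n F = (\<Sum>lam \<in> Poly_Mapping.keys c. of_int (Poly_Mapping.lookup c lam) * schur n lam)"
    and mu: "dominant_weight n mu"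
  shows "Poly_Mapping.lookup c mu = Poly_Mapping.lookup (J_op n (x_pow (expo n (rho_fun n)) * F)) (expo n (\<lambda>i. rho_fun n i + mu ! (i - 1)))"
proof -
  have "J_op n (x_pow (expo n (rho_fun n)) * F) =
     (\<Sum>lam \<in> Poly_Mapping.keys c. of_int (Poly_Mapping.lookup c lam) * (alternant n (rho_fun n) * schur n lam))"
    unfolding pi_op_eq[OF F, symmetric] eq by (simp add: sum_distrib_left mult.left_commute)
  also have "\<dots> = (\<Sum>lam \<in> Poly_Mapping.keys c. of_int (Poly_Mapping.lookup c lam) * alternant n (\<lambda>i. rho_fun n i + lam ! (i - 1)))"
    using c by (intro sum.cong) (auto simp: schur_eq dominant_weight_def)
  finally have "Poly_Mapping.lookup (J_op n (x_pow (expo n (rho_fun n)) * F)) (expo n (\<lambda>i. rho_fun n i + mu ! (i - 1)))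
     = (\<Sum>lam \<in> Poly_Mapping.keys c. Poly_Mapping.lookup c lam *
         Poly_Mapping.lookup (alternant n (\<lambda>i. rho_fun n i + lam ! (i - 1))) (expo n (\<lambda>i. rho_fun n i + mu ! (i - 1))))"
    by (simp only: lookup_sum lookup_of_int_mult)
  also have "\<dots> = (\<Sum>lam \<in> Poly_Mapping.keys c. if lam = mu then Poly_Mapping.lookup c lam else 0)"
  proof (rule sum.cong[OF refl])
    fix lam assume "lam \<in> Poly_Mapping.keys c"
    then have "dominant_weight n lam" using c by blast
    then show "Poly_Mapping.lookup c lam * Poly_Mapping.lookup (alternant n (\<lambda>i. rho_fun n i + lam ! (i - 1))) (expo n (\<lambda>i. rho_fun n i + mu ! (i - 1)))
      = (if lam = mu then Poly_Mapping.lookup c lam else 0)"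
      by (subst lookup_alternant_dominant[OF _ mu]) auto
  qed
  also have "\<dots> = Poly_Mapping.lookup c mu" by (auto simp: in_keys_iff)
  finally show ?thesis by simp
qed

lemma schur_coeffs_exist:
  assumes F: "supported n F"
  shows "\<exists>c. (\<forall>lam \<in> Poly_Mapping.keys c. dominant_weight n lam) \<and>
    pi_op n F = (\<Sum>lam \<in> Poly_Mapping.keys c. of_int (Poly_Mapping.lookup c lam) * schur n lam)"
proof -
  define G where "G = J_op n (x_pow (expo n (rho_fun n)) * F)"
  define h where "h lam = expo n (\<lambda>i. rho_fun n i + lam ! (i - 1))" for lam :: "int list"
  define A where "A = {lam. dominant_weight n lam \<and> h lam \<in> Poly_Mapping.keys G}"
  have inj: "inj_on h A"
  proof (rule inj_onI)
    fix l m assume lm: "l \<in> A" "m \<in> A" "h l = h m"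
    show "l = m"
    proof (rule nth_equalityI)
      show "length l = length m" using lm by (simp add: A_def dominant_weight_def)
      show "l ! i = m ! i" if "i < length l" for i
        using lm that unfolding h_def expo_eq_iff by (auto simp: A_def dominant_weight_def dest!: bspec[of _ _ "Suc i"])
    qed
  qed
  have "h ` A \<subseteq> Poly_Mapping.keys G" by (auto simp: A_def)
  then have finA: "finite A" using inj by (meson finite_keys finite_subset finite_imageD)
  define c where "c = (\<Sum>lam \<in> A. Poly_Mapping.single lam (Poly_Mapping.lookup G (h lam)))"
  have lc: "Poly_Mapping.lookup c lam = (if lam \<in> A then Poly_Mapping.lookup G (h lam) else 0)" for lam
    unfolding c_def lookup_sum lookup_single when_def using finA by simp
  have keys: "Poly_Mapping.keys c = A" by (auto simp: in_keys_iff lc A_def split: if_splits)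
  have cG: "Poly_Mapping.lookup c lam = Poly_Mapping.lookup G (h lam)" if "dominant_weight n lam" for lam
    using lc that by (auto simp: A_def in_keys_iff)
  have dom: "\<forall>lam \<in> Poly_Mapping.keys c. dominant_weight n lam" unfolding keys by (simp add: A_def)
  \<comment> \<open>\<open>f\<close> keeps one monomial of each alternant, so that the required
    combination of alternants is an antisymmetrization and can be compared with \<open>G\<close> by
    \<open>J_op_eqI\<close>.\<close>
  define f where "f = (\<Sum>lam \<in> A. of_int (Poly_Mapping.lookup c lam) * x_pow (h lam))"
  have supf: "supported n f"
    unfolding supported_def f_def
  proof
    fix \<alpha> assume "\<alpha> \<in> Poly_Mapping.keys (\<Sum>lam \<in> A. of_int (Poly_Mapping.lookup c lam) * x_pow (h lam))"
    then have "(\<Sum>lam \<in> A. Poly_Mapping.lookup c lam * Poly_Mapping.lookup (x_pow (h lam)) \<alpha>) \<noteq> 0"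
      by (simp add: in_keys_iff lookup_sum lookup_of_int_mult)
    then obtain lam where "Poly_Mapping.lookup c lam * Poly_Mapping.lookup (x_pow (h lam)) \<alpha> \<noteq> 0"
      by (rule sum.not_neutral_contains_not_neutral)
    then have "Poly_Mapping.lookup (x_pow (h lam)) \<alpha> \<noteq> 0" by simp
    then have "\<alpha> = h lam" by (auto simp: x_pow_def lookup_single when_def split: if_splits)
    then show "Poly_Mapping.keys \<alpha> \<subseteq> {1..n}" using keys_expo by (simp add: h_def)
  qed
  have Jf: "J_op n f = (\<Sum>lam \<in> A. of_int (Poly_Mapping.lookup c lam) * alternant n (\<lambda>i. rho_fun n i + lam ! (i - 1)))"
    unfolding f_def J_op_sum J_op_of_int h_def J_op_x_pow ..
  have "G = J_op n f"
    unfolding G_def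
  proof (rule J_op_eqI[OF supported_x_pow_mult[OF F] supf])
    fix mu assume mu: "dominant_weight n mu"
    have "Poly_Mapping.lookup (J_op n f) (h mu) = (\<Sum>lam \<in> A. if lam = mu then Poly_Mapping.lookup c lam else 0)"
      unfolding Jf lookup_sum lookup_of_int_mult h_def
    proof (rule sum.cong[OF refl])
      fix lam assume "lam \<in> A"
      then have "dominant_weight n lam" by (simp add: A_def)
      then show "Poly_Mapping.lookup c lam * Poly_Mapping.lookup (alternant n (\<lambda>i. rho_fun n i + lam ! (i - 1))) (expo n (\<lambda>i. rho_fun n i + mu ! (i - 1)))
        = (if lam = mu then Poly_Mapping.lookup c lam else 0)"
        by (subst lookup_alternant_dominant[OF _ mu]) auto
    qed
    also have "\<dots> = Poly_Mapping.lookup c mu" using finA lc by simp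
    finally show "Poly_Mapping.lookup (J_op n (x_pow (expo n (rho_fun n)) * F)) (expo n (\<lambda>i. rho_fun n i + mu ! (i - 1))) =
       Poly_Mapping.lookup (J_op n f) (expo n (\<lambda>i. rho_fun n i + mu ! (i - 1)))"
      using cG[OF mu] by (simp add: h_def G_def)
  qed
  then have "alternant n (rho_fun n) * pi_op n F =
    alternant n (rho_fun n) * (\<Sum>lam \<in> A. of_int (Poly_Mapping.lookup c lam) * schur n lam)"
    unfolding pi_op_eq[OF F] G_def[symmetric] sum_distrib_left
  proof -
    assume "G = J_op n f"
    also have "\<dots> = (\<Sum>lam \<in> A. alternant n (rho_fun n) * (of_int (Poly_Mapping.lookup c lam) * schur n lam))"
      unfolding Jf
    proof (rule sum.cong[OF refl])
      fix lam assume "lam \<in> A"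
      then have "length lam = n" by (simp add: A_def dominant_weight_def)
      then show "of_int (Poly_Mapping.lookup c lam) * alternant n (\<lambda>i. rho_fun n i + lam ! (i - 1)) =
        alternant n (rho_fun n) * (of_int (Poly_Mapping.lookup c lam) * schur n lam)"
        by (simp only: schur_eq[symmetric] mult.left_commute)
    qed
    finally show "G = (\<Sum>lam \<in> A. alternant n (rho_fun n) * (of_int (Poly_Mapping.lookup c lam) * schur n lam))" .
  qed
  then have "pi_op n F = (\<Sum>lam \<in> A. of_int (Poly_Mapping.lookup c lam) * schur n lam)"
    using alternant_rho_neq_0[of n] by simp
  then show ?thesis using dom keys by metis
qed

text \<open>Removes the operator \<open>pi_op\<close> from the problem: what remains are signed sums
  of plain coefficients at the dot-translates of \<open>lam\<close>.\<close>

lemma lookup_schur_coeffs: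
  assumes F: "supported n F" and lam: "dominant_weight n lam"
  shows "Poly_Mapping.lookup (schur_coeffs n (pi_op n F)) lam =
    (\<Sum>w | w permutes {1..n}. sign w * Poly_Mapping.lookup F (expo n (dot w (\<lambda>i. lam ! (i - 1)))))"
proof -
  let ?P = "\<lambda>c. (\<forall>lam \<in> Poly_Mapping.keys c. dominant_weight n lam) \<and>
    pi_op n F = (\<Sum>lam \<in> Poly_Mapping.keys c. of_int (Poly_Mapping.lookup c lam) * schur n lam)"
  have "\<exists>!c. ?P c"
  proof (rule ex_ex1I)
    show "\<exists>c. ?P c" by (rule schur_coeffs_exist[OF F])
    show "c = c'" if "?P c" "?P c'" for c c'
    proof (rule poly_mapping_eqI)
      fix mu show "Poly_Mapping.lookup c mu = Poly_Mapping.lookup c' mu"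
      proof (cases "dominant_weight n mu")
        case True
        then show ?thesis using schur_coeffs_unique[OF F, of c mu] schur_coeffs_unique[OF F, of c' mu] that by simp
      next
        case False
        then show ?thesis using that by (metis in_keys_iff)
      qed
    qed
  qed
  then have P: "?P (schur_coeffs n (pi_op n F))" unfolding schur_coeffs_def by (rule theI')
  then have "Poly_Mapping.lookup (schur_coeffs n (pi_op n F)) lam =
     Poly_Mapping.lookup (J_op n (x_pow (expo n (rho_fun n)) * F)) (expo n (\<lambda>i. rho_fun n i + lam ! (i - 1)))"
    using schur_coeffs_unique[OF F _ _ lam] by blast
  also have "\<dots> = (\<Sum>w | w permutes {1..n}. sign w * Poly_Mapping.lookup F (expo n (dot w (\<lambda>i. lam ! (i - 1)))))"
    unfolding lookup_J_op lookup_x_pow_mult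
  proof (rule sum.cong[OF refl])
    fix w assume "w \<in> {w. w permutes {1..n}}"
    then have w: "w permutes {1..n}" by simp
    have "Poly_Mapping.map_key w (expo n (\<lambda>i. rho_fun n i + lam ! (i - 1))) - expo n (rho_fun n) =
       expo n (dot w (\<lambda>i. lam ! (i - 1)))"
      unfolding map_key_expo[OF w] expo_diff by (rule expo_cong) (simp add: dot_def rho_fun_def)
    then show "sign w * Poly_Mapping.lookup F (Poly_Mapping.map_key w (expo n (\<lambda>i. rho_fun n i + lam ! (i - 1))) - expo n (rho_fun n)) =
      sign w * Poly_Mapping.lookup F (expo n (dot w (\<lambda>i. lam ! (i - 1))))" by simp
  qed
  finally show ?thesis .
qed


section \<open>The series \<open>B\<close>\<close>

definition geom :: "nat \<Rightarrow> nat \<Rightarrow> laurent fps" where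
  "geom i j = fps_right_inverse (1 - fps_X * fps_const (x_ratio i j)) 1"

text \<open>Collects the coefficients of one monomial over all powers of q into a single power
  series, so that the recursion takes place in \<open>int fps\<close>.\<close>

definition coeffs_at :: "nat \<Rightarrow> laurent fps \<Rightarrow> (nat \<Rightarrow> int) \<Rightarrow> int fps" where
  "coeffs_at n f \<beta> = Abs_fps (\<lambda>k. Poly_Mapping.lookup (fps_nth f k) (expo n \<beta>))"

lemma coeffs_at_cong: "(\<And>i. i \<in> {1..n} \<Longrightarrow> \<beta> i = \<beta>' i) \<Longrightarrow> coeffs_at n f \<beta> = coeffs_at n f \<beta>'"
  unfolding coeffs_at_def using expo_cong by metis

lemma x_ratio_expo: "i \<in> {1..n} \<Longrightarrow> j \<in> {1..n} \<Longrightarrow> x_ratio i j = x_pow (expo n (\<lambda>l. ind {i} l - ind {j} l))"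
  unfolding x_ratio_def
  by (intro arg_cong[where f = x_pow] poly_mapping_eqI)
     (auto simp: lookup_expo lookup_minus lookup_single when_def ind_def)

text \<open>The product of the geometric series of all roots (i, j) with j in \<open>J\<close>: the
  coefficient of q^k is x_i^k times the sum of the inverses of all monomials of degree k in the
  x_j.\<close>

definition row_series :: "nat \<Rightarrow> nat set \<Rightarrow> nat \<Rightarrow> laurent fps" where
  "row_series n J i = Abs_fps (\<lambda>k. \<Sum>c \<in> comps J k. x_pow (expo n (\<lambda>l. int k * ind {i} l - int (c l))))"

lemma comps_insert:
  assumes J: "finite J" "j \<notin> J"
  shows "comps (insert j J) (Suc k) = comps J (Suc k) \<union> (\<lambda>c. c(j := Suc (c j))) ` comps (insert j J) k"
    (is "?L = ?A \<union> ?B")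
proof
  have upd: "(\<Sum>i \<in> J. if i = j then x else c i) = sum c J" for c :: "nat \<Rightarrow> nat" and x
    using J by (intro sum.cong) auto
  show "?L \<subseteq> ?A \<union> ?B"
  proof
    fix c assume c: "c \<in> ?L"
    show "c \<in> ?A \<union> ?B"
    proof (cases "c j")
      case 0
      have "c i = 0" if "i \<notin> J" for i
        using that 0 c by (cases "i = j") (auto simp: comps_def)
      then show ?thesis using 0 c J by (simp add: comps_def)
    next
      case (Suc x)
      have "c = (c(j := x))(j := Suc ((c(j := x)) j))" using Suc by auto
      moreover have "c(j := x) \<in> comps (insert j J) k" using c J Suc by (auto simp: comps_def upd)
      ultimately show ?thesis by blast
    qed
  qed
  show "?A \<union> ?B \<subseteq> ?L" using J by (auto simp: comps_def upd)
qed

lemma comps_0: "finite J \<Longrightarrow> comps J 0 = {\<lambda>_. 0}"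
  by (auto simp: comps_def fun_eq_iff)

lemma row_series_insert:
  assumes J: "finite J" "j \<notin> J" and i: "i \<in> {1..n}" and j: "j \<in> {1..n}"
  shows "(1 - fps_X * fps_const (x_ratio i j)) * row_series n (insert j J) i = row_series n J i"
proof (rule fps_ext)
  fix k
  show "fps_nth ((1 - fps_X * fps_const (x_ratio i j)) * row_series n (insert j J) i) k = fps_nth (row_series n J i) k"
  proof (cases k)
    case 0
    then show ?thesis using J by (simp add: row_series_def comps_0 left_diff_distrib mult.assoc)
  next
    case (Suc k')
    let ?e = "\<lambda>k c. x_pow (expo n (\<lambda>l. int k * ind {i} l - int (c l)))"
    let ?u = "\<lambda>c :: nat \<Rightarrow> nat. c(j := Suc (c j))"
    have inj: "inj_on ?u (comps (insert j J) k')"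
      by (rule inj_onI) (metis fun_upd_triv fun_upd_upd fun_upd_same nat.inject)
    have disj: "comps J k \<inter> ?u ` comps (insert j J) k' = {}" using J by (auto simp: comps_def)
    have "(\<Sum>c \<in> comps (insert j J) k. ?e k c) = (\<Sum>c \<in> comps J k. ?e k c) + (\<Sum>c \<in> ?u ` comps (insert j J) k'. ?e k c)"
      unfolding Suc comps_insert[OF J] using disj J Suc by (intro sum.union_disjoint) (auto simp: finite_comps)
    also have "(\<Sum>c \<in> ?u ` comps (insert j J) k'. ?e k c) = (\<Sum>c \<in> comps (insert j J) k'. ?e k (?u c))"
      using inj by (rule sum.reindex[unfolded o_def])
    also have "\<dots> = (\<Sum>c \<in> comps (insert j J) k'. x_ratio i j * ?e k' c)"
      unfolding x_ratio_expo[OF i j] x_pow_mult expo_add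
      by (intro sum.cong arg_cong[where f = x_pow] expo_cong refl) (auto simp: Suc ind_def algebra_simps)
    also have "\<dots> = x_ratio i j * (\<Sum>c \<in> comps (insert j J) k'. ?e k' c)" by (simp add: sum_distrib_left)
    finally have "fps_nth (row_series n (insert j J) i) k = fps_nth (row_series n J i) k + x_ratio i j * fps_nth (row_series n (insert j J) i) k'"
      by (simp add: row_series_def)
    then show ?thesis using Suc by (simp add: left_diff_distrib mult.assoc)
  qed
qed

lemma geom_inverse: "(1 - fps_X * fps_const (x_ratio i j)) * geom i j = 1"
  unfolding geom_def by (rule B_series_factor)

lemma prod_geom_row:
  assumes "finite J" "J \<subseteq> {1..n}" "i \<in> {1..n}"
  shows "(\<Prod>j \<in> J. geom i j) = row_series n J i"
  using assms(1,2)
proof (induction J)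
  case empty
  have "comps {} k = (if k = 0 then {\<lambda>_. 0} else {})" for k by (auto simp: comps_def fun_eq_iff)
  then have "row_series n {} i = 1"
    by (intro fps_ext) (auto simp: row_series_def x_pow_0[symmetric] expo_def)
  then show ?case by simp
next
  case (insert j J)
  let ?a = "1 - fps_X * fps_const (x_ratio i j)"
  have "(\<Prod>j \<in> insert j J. geom i j) = geom i j * row_series n J i" using insert by simp
  also have "\<dots> = geom i j * (?a * row_series n (insert j J) i)"
    using row_series_insert[of J j i n] insert assms(3) by simp
  also have "\<dots> = (?a * geom i j) * row_series n (insert j J) i" by (simp only: mult_ac)
  finally show ?case by (simp add: geom_inverse)
qed

text \<open>Every monomial of every coefficient has exponent \<open>v\<close> in the variable
  \<open>l\<close>. A variable not touched by the remaining factors keeps its exponent, and this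
  determines the degree taken from the series of a row.\<close>

definition exponent_fixed :: "nat \<Rightarrow> int \<Rightarrow> laurent fps \<Rightarrow> bool" where
  "exponent_fixed l v f \<longleftrightarrow> (\<forall>k. \<forall>\<alpha> \<in> Poly_Mapping.keys (fps_nth f k). Poly_Mapping.lookup \<alpha> l = v)"

lemma exponent_fixed_mult:
  assumes "exponent_fixed l v f" "exponent_fixed l v' g"
  shows "exponent_fixed l (v + v') (f * g)"
  unfolding exponent_fixed_def
proof (intro allI ballI)
  fix k \<alpha> assume "\<alpha> \<in> Poly_Mapping.keys (fps_nth (f * g) k)"
  then have "\<alpha> \<in> Poly_Mapping.keys (\<Sum>i = 0..k. fps_nth f i * fps_nth g (k - i))" by (simp add: fps_mult_nth)
  then obtain i where "\<alpha> \<in> Poly_Mapping.keys (fps_nth f i * fps_nth g (k - i))" 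
    using keys_sum[of "\<lambda>i. fps_nth f i * fps_nth g (k - i)" "{0..k}"] by blast
  then obtain a b where "\<alpha> = a + b" "a \<in> Poly_Mapping.keys (fps_nth f i)" "b \<in> Poly_Mapping.keys (fps_nth g (k - i))"
    using keys_mult[of "fps_nth f i" "fps_nth g (k - i)"] by blast
  then show "Poly_Mapping.lookup \<alpha> l = v + v'" using assms by (simp add: exponent_fixed_def lookup_add)
qed

lemma exponent_fixed_1: "exponent_fixed l 0 1"
  by (auto simp: exponent_fixed_def)

lemma exponent_fixed_prod:
  "(\<And>x. x \<in> S \<Longrightarrow> exponent_fixed l 0 (f x)) \<Longrightarrow> exponent_fixed l 0 (prod f S)"
proof (induction S rule: infinite_finite_induct)
  case (insert x S)
  then show ?case using exponent_fixed_mult[of l 0 "f x" 0 "prod f S"] by simp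
qed (auto simp: exponent_fixed_1)

lemma exponent_fixed_geom:
  assumes "i \<in> {1..n}" "j \<in> {1..n}" "l \<noteq> i" "l \<noteq> j"
  shows "exponent_fixed l 0 (geom i j)"
proof -
  have g: "geom i j = row_series n {j} i" using prod_geom_row[of "{j}" n i] assms by simp
  show ?thesis
    unfolding exponent_fixed_def
  proof (intro allI ballI)
    fix k \<alpha> assume "\<alpha> \<in> Poly_Mapping.keys (fps_nth (geom i j) k)"
    then have "\<alpha> \<in> Poly_Mapping.keys (\<Sum>c \<in> comps {j} k. x_pow (expo n (\<lambda>l. int k * ind {i} l - int (c l))))"
      by (simp add: g row_series_def)
    then obtain c where "c \<in> comps {j} k" "\<alpha> = expo n (\<lambda>l. int k * ind {i} l - int (c l))"
      using keys_sum by (fastforce simp: x_pow_def)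
    then show "Poly_Mapping.lookup \<alpha> l = 0" using assms by (auto simp: lookup_expo ind_def comps_def)
  qed
qed

lemma exponent_fixed_const: "exponent_fixed l (Poly_Mapping.lookup \<alpha> l) (fps_const (x_pow \<alpha>))"
  by (auto simp: exponent_fixed_def x_pow_def fps_const_def split: if_splits)

lemma coeffs_at_eq_0:
  assumes "exponent_fixed l v f" "l \<in> {1..n}" "\<beta> l \<noteq> v"
  shows "coeffs_at n f \<beta> = 0"
proof (rule fps_ext)
  fix k
  have "expo n \<beta> \<notin> Poly_Mapping.keys (fps_nth f k)"
  proof
    assume "expo n \<beta> \<in> Poly_Mapping.keys (fps_nth f k)"
    with assms(1) have "Poly_Mapping.lookup (expo n \<beta>) l = v" by (simp add: exponent_fixed_def)
    then show False using assms(2,3) by (simp add: lookup_expo)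
  qed
  then show "fps_nth (coeffs_at n f \<beta>) k = fps_nth 0 k" by (simp add: coeffs_at_def in_keys_iff)
qed

text \<open>The row series supplies x_i^k and \<open>f\<close> supplies x_i^v, so the exponent of
  x_i forces \<open>k = \<beta> i - v\<close>, and only one degree of the row series
  contributes.\<close>

lemma coeffs_at_row:
  assumes fx: "exponent_fixed i v f" and i: "i \<in> {1..n}" "i \<notin> J" and J: "finite J"
  shows "coeffs_at n (row_series n J i * f) \<beta> =
    (if v \<le> \<beta> i then fps_X ^ nat (\<beta> i - v) *
       (\<Sum>c \<in> comps J (nat (\<beta> i - v)). coeffs_at n f (\<lambda>l. if l = i then v else \<beta> l + int (c l))) else 0)"
proof (rule fps_ext)
  fix d
  have zero: "Poly_Mapping.lookup (fps_nth f e) (expo n \<beta>') = 0" if "\<beta>' i \<noteq> v" for e \<beta>'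
    using arg_cong[OF coeffs_at_eq_0[of i v f n \<beta>', OF fx i(1) that], of "\<lambda>F. fps_nth F e"] by (simp add: coeffs_at_def)
  have "fps_nth (coeffs_at n (row_series n J i * f) \<beta>) d =
    (\<Sum>k = 0..d. \<Sum>c \<in> comps J k. Poly_Mapping.lookup (fps_nth f (d - k)) (expo n (\<lambda>l. \<beta> l - (int k * ind {i} l - int (c l)))))"
    by (simp add: coeffs_at_def fps_mult_nth row_series_def sum_distrib_right lookup_sum lookup_x_pow_mult expo_diff)
  also have "\<dots> = (\<Sum>k = 0..d. if \<beta> i - int k = v then \<Sum>c \<in> comps J k. Poly_Mapping.lookup (fps_nth f (d - k)) (expo n (\<lambda>l. if l = i then v else \<beta> l + int (c l))) else 0)"
  proof (rule sum.cong[OF refl])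
    fix k
    show "(\<Sum>c \<in> comps J k. Poly_Mapping.lookup (fps_nth f (d - k)) (expo n (\<lambda>l. \<beta> l - (int k * ind {i} l - int (c l))))) =
      (if \<beta> i - int k = v then \<Sum>c \<in> comps J k. Poly_Mapping.lookup (fps_nth f (d - k)) (expo n (\<lambda>l. if l = i then v else \<beta> l + int (c l))) else 0)"
    proof (cases "\<beta> i - int k = v")
      case True
      have "(\<lambda>l. \<beta> l - (int k * ind {i} l - int (c l))) = (\<lambda>l. if l = i then v else \<beta> l + int (c l))" if "c \<in> comps J k" for c
        using that True i(2) by (auto simp: fun_eq_iff ind_def comps_def)
      then show ?thesis using True by (auto intro!: sum.cong)
    next
      case False
      have "Poly_Mapping.lookup (fps_nth f (d - k)) (expo n (\<lambda>l. \<beta> l - (int k * ind {i} l - int (c l)))) = 0" if "c \<in> comps J k" for c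
        by (rule zero) (use that False i(2) in \<open>auto simp: ind_def comps_def\<close>)
      then show ?thesis using False by simp
    qed
  qed
  also have "\<dots> = (if v \<le> \<beta> i \<and> nat (\<beta> i - v) \<le> d then \<Sum>c \<in> comps J (nat (\<beta> i - v)). Poly_Mapping.lookup (fps_nth f (d - nat (\<beta> i - v))) (expo n (\<lambda>l. if l = i then v else \<beta> l + int (c l))) else 0)"
  proof (cases "v \<le> \<beta> i")
    case True
    then have "\<beta> i - int k = v \<longleftrightarrow> k = nat (\<beta> i - v)" for k by auto
    then show ?thesis using True by simp
  next
    case False
    then show ?thesis by (simp add: sum.neutral)
  qed
  also have "\<dots> = fps_nth (if v \<le> \<beta> i then fps_X ^ nat (\<beta> i - v) *
       (\<Sum>c \<in> comps J (nat (\<beta> i - v)). coeffs_at n f (\<lambda>l. if l = i then v else \<beta> l + int (c l))) else 0) d"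
    by (simp add: fps_X_power_mult_nth fps_sum_nth coeffs_at_def)
  finally show "fps_nth (coeffs_at n (row_series n J i * f) \<beta>) d = \<dots>" .
qed

section \<open>Removing the roots row by row\<close>

text \<open>The roots that remain in the columns beyond \<open>a\<close> when rows 1..t have been
  removed. For t = 0 and a = m these are all roots for (m, 1, ..., 1). The parameters (a, a) and
  (a+1, a) describe the same set, since row a+1 has its leftmost root in column a+2.\<close>

definition root_set :: "nat \<Rightarrow> nat \<Rightarrow> nat \<Rightarrow> (nat \<times> nat) set" where
  "root_set n a t = {(i, j). t < i \<and> i < j \<and> a < j \<and> j \<le> n}"

definition root_series :: "nat \<Rightarrow> (nat \<Rightarrow> int) \<Rightarrow> nat \<Rightarrow> nat \<Rightarrow> laurent fps" where
  "root_series n g a t = fps_const (x_pow (expo n g)) * (\<Prod>(i, j) \<in> root_set n a t. geom i j)"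

lemma finite_root_set: "finite (root_set n a t)"
  by (rule finite_subset[of _ "{..n} \<times> {..n}"]) (auto simp: root_set_def)

lemma exponent_fixed_root_series:
  assumes "l \<le> t" "t \<le> a" "l \<in> {1..n}"
  shows "exponent_fixed l (g l) (root_series n g a t)"
proof -
  have "exponent_fixed l 0 (\<Prod>(i, j) \<in> root_set n a t. geom i j)"
    by (rule exponent_fixed_prod) (use assms in \<open>auto simp: root_set_def intro!: exponent_fixed_geom[of _ n]\<close>)
  then show ?thesis
    using exponent_fixed_mult[OF exponent_fixed_const[of l "expo n g"]] assms
    unfolding root_series_def by (fastforce simp: lookup_expo)
qed

lemma supported_root_series: "supported n (fps_nth (root_series n g a t) k)"
proof -
  have "exponent_fixed l 0 (root_series n g a t)" if l: "l \<notin> {1..n}" for l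
  proof -
    have "exponent_fixed l 0 (\<Prod>(i, j) \<in> root_set n a t. geom i j)"
      by (rule exponent_fixed_prod) (use l in \<open>auto simp: root_set_def intro!: exponent_fixed_geom[of _ n]\<close>)
    then show ?thesis
      using exponent_fixed_mult[OF exponent_fixed_const[of l "expo n g"]] l
      unfolding root_series_def by (fastforce simp: lookup_expo)
  qed
  then show ?thesis unfolding supported_def exponent_fixed_def by (metis in_keys_iff subsetI)
qed

lemma root_series_step:
  assumes "t < a" "a \<le> n"
  shows "root_series n g a t = row_series n {Suc a..n} (Suc t) * root_series n g a (Suc t)"
proof -
  have "root_set n a t = {Suc t} \<times> {Suc a..n} \<union> root_set n a (Suc t)"
    using assms by (auto simp: root_set_def)
  moreover have "{Suc t} \<times> {Suc a..n} \<inter> root_set n a (Suc t) = {}" by (auto simp: root_set_def)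
  ultimately have "(\<Prod>(i, j) \<in> root_set n a t. geom i j) =
     (\<Prod>(i, j) \<in> {Suc t} \<times> {Suc a..n}. geom i j) * (\<Prod>(i, j) \<in> root_set n a (Suc t). geom i j)"
    by (simp add: prod.union_disjoint finite_root_set)
  also have "(\<Prod>(i, j) \<in> {Suc t} \<times> {Suc a..n}. geom i j) = (\<Prod>j \<in> {Suc a..n}. geom (Suc t) j)"
    by (simp flip: prod.cartesian_product)
  also have "\<dots> = row_series n {Suc a..n} (Suc t)" using assms by (intro prod_geom_row) auto
  finally show ?thesis by (simp add: root_series_def mult_ac)
qed

lemma coeffs_at_root_series_step:
  assumes "t < a" "a \<le> n"
  shows "coeffs_at n (root_series n g a t) \<beta> =
    (if g (Suc t) \<le> \<beta> (Suc t) then fps_X ^ nat (\<beta> (Suc t) - g (Suc t)) *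
       (\<Sum>c \<in> comps {Suc a..n} (nat (\<beta> (Suc t) - g (Suc t))).
          coeffs_at n (root_series n g a (Suc t)) (\<lambda>l. if l = Suc t then g (Suc t) else \<beta> l + int (c l))) else 0)"
proof -
  have "exponent_fixed (Suc t) (g (Suc t)) (root_series n g a (Suc t))"
    using assms by (intro exponent_fixed_root_series) auto
  then show ?thesis
    unfolding root_series_step[OF assms]
    using assms coeffs_at_row[of "Suc t" "g (Suc t)" "root_series n g a (Suc t)" n "{Suc a..n}" \<beta>] by simp
qed

lemma root_series_Suc: "root_series n g a a = root_series n g (Suc a) a"
proof -
  have "root_set n a a = root_set n (Suc a) a" by (auto simp: root_set_def)
  then show ?thesis by (simp add: root_series_def)
qed

lemma coeffs_at_root_series_n:
  "coeffs_at n (root_series n g n n) \<beta> = (if \<forall>i \<in> {1..n}. \<beta> i = g i then 1 else 0)"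
proof -
  have "root_set n n n = {}" by (auto simp: root_set_def)
  then have e: "root_series n g n n = fps_const (x_pow (expo n g))" by (simp add: root_series_def)
  show ?thesis
    unfolding e by (rule fps_ext) (auto simp: coeffs_at_def x_pow_def lookup_single when_def expo_eq_iff)
qed

lemma Roots_hook:
  assumes "1 \<le> m" "m \<le> n"
  shows "Roots (m # replicate (n - m) 1) = root_set n m 0"
proof -
  let ?\<eta> = "m # replicate (n - m) (1::nat)"
  have tk: "sum_list (take r ?\<eta>) = m + (r - 1)" if "1 \<le> r" "r \<le> Suc (n - m)" for r
    using that by (cases r) (auto simp: sum_list_replicate min_def)
  have tot: "sum_list ?\<eta> = n" using assms by (simp add: sum_list_replicate)
  show ?thesis
  proof (intro set_eqI iffI)
    fix x assume "x \<in> Roots ?\<eta>"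
    then obtain i j r where x: "x = (i, j)" "1 \<le> r" "r \<le> Suc (n - m)" "1 \<le> i" "i \<le> sum_list (take r ?\<eta>)" "sum_list (take r ?\<eta>) < j" "j \<le> n"
      unfolding Roots_def tot by auto
    then show "x \<in> root_set n m 0" using tk[of r] by (auto simp: root_set_def)
  next
    fix x assume "x \<in> root_set n m 0"
    then obtain i j where x: "x = (i, j)" "0 < i" "i < j" "m < j" "j \<le> n" by (auto simp: root_set_def)
    define r where "r = j - m"
    have r: "1 \<le> r" "r \<le> Suc (n - m)" "r \<in> {1..length ?\<eta>}" using x by (auto simp: r_def)
    have "i \<le> sum_list (take r ?\<eta>)" "sum_list (take r ?\<eta>) < j" unfolding tk[OF r(1,2)] using x by (auto simp: r_def)
    then show "x \<in> Roots ?\<eta>" unfolding Roots_def tot using x r(3) by auto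
  qed
qed

lemma K_series_eq:
  assumes m: "1 \<le> m" "m \<le> n" and \<gamma>: "length \<gamma> = n" and lam: "dominant_weight n lam"
  shows "K_series (m # replicate (n - m) 1) \<gamma> lam =
    (\<Sum>w | w permutes {1..n}. of_int (sign w) * coeffs_at n (root_series n (\<lambda>i. \<gamma> ! (i - 1)) m 0) (dot w (\<lambda>i. lam ! (i - 1))))"
proof (rule fps_ext)
  fix k
  let ?f = "root_series n (\<lambda>i. \<gamma> ! (i - 1)) m 0"
  have tot: "sum_list (m # replicate (n - m) 1) = n" using m by (simp add: sum_list_replicate)
  have f: "fps_const (x_pow (weight \<gamma>)) * B_series (m # replicate (n - m) 1) = ?f"
    unfolding B_series_def Roots_hook[OF m] root_series_def weight_expo \<gamma> geom_def ..
  have "fps_nth (K_series (m # replicate (n - m) 1) \<gamma> lam) k =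
     Poly_Mapping.lookup (schur_coeffs n (pi_op n (fps_nth ?f k))) lam"
    unfolding K_series_def H_series_def tot f by simp
  also have "\<dots> = (\<Sum>w | w permutes {1..n}. sign w * Poly_Mapping.lookup (fps_nth ?f k) (expo n (dot w (\<lambda>i. lam ! (i - 1)))))"
    by (rule lookup_schur_coeffs[OF supported_root_series lam])
  also have "\<dots> = fps_nth (\<Sum>w | w permutes {1..n}. of_int (sign w) * coeffs_at n ?f (dot w (\<lambda>i. lam ! (i - 1)))) k"
    unfolding fps_sum_nth by (rule sum.cong) (auto simp: coeffs_at_def fps_of_int[symmetric])
  finally show "fps_nth (K_series (m # replicate (n - m) 1) \<gamma> lam) k = \<dots>" .
qed


section \<open>Alternating sums over blocks of positions\<close>

lemma dot_not_in: "w permutes S \<Longrightarrow> i \<notin> S \<Longrightarrow> dot w \<beta> i = \<beta> i"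
  by (simp add: dot_def permutes_not_in)

definition antisymmetric_dot :: "nat \<Rightarrow> nat \<Rightarrow> ((nat \<Rightarrow> int) \<Rightarrow> int fps) \<Rightarrow> bool" where
  "antisymmetric_dot lo hi A \<longleftrightarrow> (\<forall>u \<beta>. u permutes {lo..hi} \<longrightarrow> A (dot u \<beta>) = of_int (sign u) * A \<beta>)"

lemma antisymmetric_dot_sum:
  "antisymmetric_dot lo hi (\<lambda>\<beta>. \<Sum>w | w permutes {lo..hi}. of_int (sign w) * \<Psi> (dot w \<beta>))"
  unfolding antisymmetric_dot_def
proof (intro allI impI)
  fix u \<beta> assume u: "u permutes {lo..hi}"
  have "(\<Sum>w | w permutes {lo..hi}. of_int (sign w) * \<Psi> (dot w \<beta>)) =
     (\<Sum>w | w permutes {lo..hi}. of_int (sign (u \<circ> w)) * \<Psi> (dot (u \<circ> w) \<beta>))"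
    by (rule setum_permutations_compose_left[OF u])
  also have "\<dots> = of_int (sign u) * (\<Sum>w | w permutes {lo..hi}. of_int (sign w) * \<Psi> (dot w (dot u \<beta>)))"
    unfolding sum_distrib_left
    by (rule sum.cong[OF refl]) (simp add: permutes_sign_compose[OF _ u] dot_comp mult.assoc)
  finally have e: "(\<Sum>w | w permutes {lo..hi}. of_int (sign w) * \<Psi> (dot w \<beta>)) =
      of_int (sign u) * (\<Sum>w | w permutes {lo..hi}. of_int (sign w) * \<Psi> (dot w (dot u \<beta>)))" .
  have "of_int (sign u) * of_int (sign u) = (1 :: int fps)"
    unfolding of_int_mult[symmetric] by simp
  then show "(\<Sum>w | w permutes {lo..hi}. of_int (sign w) * \<Psi> (dot w (dot u \<beta>))) =
      of_int (sign u) * (\<Sum>w | w permutes {lo..hi}. of_int (sign w) * \<Psi> (dot w \<beta>))"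
    unfolding e by (simp add: mult.assoc[symmetric])
qed

text \<open>Some \<open>dot\<close>-translate of \<open>\<beta>\<close> is either weakly decreasing or fixed by an adjacent transposition.\<close>
lemma antisymmetric_dot_eqI:
  assumes A: "antisymmetric_dot lo hi A" and B: "antisymmetric_dot lo hi B"
    and P: "P \<beta>" "\<And>u \<beta>. u permutes {lo..hi} \<Longrightarrow> P \<beta> \<Longrightarrow> P (dot u \<beta>)"
    and eq: "\<And>\<beta>. P \<beta> \<Longrightarrow> (\<And>i. lo \<le> i \<Longrightarrow> i < hi \<Longrightarrow> \<beta> (Suc i) \<le> \<beta> i) \<Longrightarrow> A \<beta> = B \<beta>"
  shows "A \<beta> = B \<beta>"
proof -
  obtain u where u: "u permutes {lo..hi}"
    and dec: "\<And>i. lo \<le> i \<Longrightarrow> i < hi \<Longrightarrow> \<beta> (u (Suc i)) - int (u (Suc i)) \<le> \<beta> (u i) - int (u i)"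
    using sorting_permutation[of lo hi "\<lambda>i. \<beta> i - int i"] by auto
  have "A (dot u \<beta>) = B (dot u \<beta>)"
  proof (cases "\<exists>i. lo \<le> i \<and> i < hi \<and> \<beta> (u (Suc i)) - int (u (Suc i)) = \<beta> (u i) - int (u i)")
    case True
    then obtain i where i: "lo \<le> i" "i < hi" "\<beta> (u (Suc i)) - int (u (Suc i)) = \<beta> (u i) - int (u i)" by blast
    define s where "s = Transposition.transpose i (Suc i)"
    have s: "s permutes {lo..hi}" "sign s = - 1"
      using i by (auto simp: s_def sign_swap_id intro!: permutes_swap_id)
    have f: "dot s (dot u \<beta>) = dot u \<beta>"
      using i by (auto simp: dot_def fun_eq_iff s_def transpose_def)
    have zero: "C (dot u \<beta>) = 0" if C: "antisymmetric_dot lo hi C" for C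
    proof -
      have "C (dot s (dot u \<beta>)) = of_int (sign s) * C (dot u \<beta>)" using C s by (auto simp: antisymmetric_dot_def)
      then show ?thesis unfolding f s(2) by (intro eq_uminus_self_fps) simp
    qed
    show ?thesis by (simp add: zero[OF A] zero[OF B])
  next
    case False
    show ?thesis
    proof (rule eq)
      show "P (dot u \<beta>)" using P u by blast
      fix i assume i: "lo \<le> i" "i < hi"
      then have "\<beta> (u (Suc i)) - int (u (Suc i)) < \<beta> (u i) - int (u i)" using False dec[of i] by fastforce
      then show "dot u \<beta> (Suc i) \<le> dot u \<beta> i" by (simp add: dot_def)
    qed
  qed
  then have "of_int (sign u) * (of_int (sign u) * A \<beta>) = of_int (sign u) * (of_int (sign u) * B \<beta>)"
    using A B u by (simp add: antisymmetric_dot_def)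
  then show ?thesis by (simp add: mult.assoc[symmetric] of_int_mult[symmetric] del: of_int_mult)
qed

text \<open>Averaging over the cosets of a subgroup, without choosing representatives.\<close>
lemma signed_sum_subgroup:
  fixes F F' :: "(nat \<Rightarrow> int) \<Rightarrow> int fps"
  assumes sub: "{lo'..hi} \<subseteq> {lo..hi}"
    and P: "P \<beta>" "\<And>u \<beta>. u permutes {lo..hi} \<Longrightarrow> P \<beta> \<Longrightarrow> P (dot u \<beta>)"
    and eq: "\<And>\<beta>. P \<beta> \<Longrightarrow> (\<Sum>v | v permutes {lo'..hi}. of_int (sign v) * F (dot v \<beta>)) = (\<Sum>v | v permutes {lo'..hi}. of_int (sign v) * F' (dot v \<beta>))"
  shows "(\<Sum>w | w permutes {lo..hi}. of_int (sign w) * F (dot w \<beta>)) = (\<Sum>w | w permutes {lo..hi}. of_int (sign w) * F' (dot w \<beta>))"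
proof -
  let ?V = "{v. v permutes {lo'..hi}}" and ?W = "{w. w permutes {lo..hi}}"
  \<comment> \<open>Each element of \<open>?W\<close> arises as a product \<open>w \<circ> v\<close>
    from exactly \<open>card ?V\<close> pairs, and this factor can be cancelled in
    \<open>int fps\<close>.\<close>
  have avg: "of_nat (card ?V) * (\<Sum>w \<in> ?W. of_int (sign w) * H (dot w \<beta>)) =
     (\<Sum>w \<in> ?W. of_int (sign w) * (\<Sum>v \<in> ?V. of_int (sign v) * H (dot v (dot w \<beta>))))" for H :: "(nat \<Rightarrow> int) \<Rightarrow> int fps"
  proof -
    have "(\<Sum>w \<in> ?W. of_int (sign w) * (\<Sum>v \<in> ?V. of_int (sign v) * H (dot v (dot w \<beta>)))) =
       (\<Sum>w \<in> ?W. \<Sum>v \<in> ?V. of_int (sign (w \<circ> v)) * H (dot (w \<circ> v) \<beta>))"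
      unfolding sum_distrib_left
    proof (intro sum.cong refl)
      fix w v assume w: "w \<in> ?W" and v: "v \<in> ?V"
      have v': "v permutes {lo..hi}" using v sub permutes_subset by blast
      show "of_int (sign w) * (of_int (sign v) * H (dot v (dot w \<beta>))) = of_int (sign (w \<circ> v)) * H (dot (w \<circ> v) \<beta>)"
        using permutes_sign_compose[OF _ _ v', of w] w by (simp add: dot_comp mult.assoc)
    qed
    also have "\<dots> = (\<Sum>v \<in> ?V. \<Sum>w \<in> ?W. of_int (sign (w \<circ> v)) * H (dot (w \<circ> v) \<beta>))" by (rule sum.swap)
    also have "\<dots> = (\<Sum>v \<in> ?V. \<Sum>w \<in> ?W. of_int (sign w) * H (dot w \<beta>))"
    proof (rule sum.cong[OF refl])
      fix v assume v: "v \<in> ?V"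
      have v': "v permutes {lo..hi}" using v sub permutes_subset by blast
      show "(\<Sum>w \<in> ?W. of_int (sign (w \<circ> v)) * H (dot (w \<circ> v) \<beta>)) = (\<Sum>w \<in> ?W. of_int (sign w) * H (dot w \<beta>))"
        by (rule sum_permutations_compose_right[OF v', symmetric])
    qed
    finally show ?thesis by simp
  qed
  have "of_nat (card ?V) * (\<Sum>w \<in> ?W. of_int (sign w) * F (dot w \<beta>)) = of_nat (card ?V) * (\<Sum>w \<in> ?W. of_int (sign w) * F' (dot w \<beta>))"
    unfolding avg
    by (rule sum.cong[OF refl]) (use P in \<open>simp add: eq\<close>)
  moreover have "card ?V \<noteq> 0" by (simp add: card_permutations[OF refl])
  ultimately show ?thesis by simp
qed

section \<open>The Pieri rule for a block of final positions\<close>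

lemma permutes_conjugate:
  assumes \<tau>: "bij \<tau>" and w: "w permutes S"
  shows "\<tau> \<circ> w \<circ> inv \<tau> permutes \<tau> ` S"
  unfolding permutes_altdef
proof (intro conjI subsetI)
  have i: "\<And>x. inv \<tau> (\<tau> x) = x" "\<And>x. \<tau> (inv \<tau> x) = x" using \<tau> by (auto simp: bij_is_inj bij_is_surj surj_f_inv_f)
  have "bij_betw \<tau> S (\<tau> ` S)" using \<tau> by (metis bij_betw_def inj_on_subset subset_UNIV bij_is_inj)
  moreover have "bij_betw (inv \<tau>) (\<tau> ` S) S" using calculation i by (intro bij_betw_byWitness[where f' = \<tau>]) auto
  ultimately show "bij_betw (\<tau> \<circ> w \<circ> inv \<tau>) (\<tau> ` S) (\<tau> ` S)"
    using permutes_imp_bij[OF w] bij_betw_trans by (metis comp_assoc)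
  fix x assume "x \<in> {x. (\<tau> \<circ> w \<circ> inv \<tau>) x \<noteq> x}"
  then have "w (inv \<tau> x) \<noteq> inv \<tau> x" using i by auto
  then have "inv \<tau> x \<in> S" using w permutes_not_in by metis
  then show "x \<in> \<tau> ` S" using i by (metis image_eqI)
qed

text \<open>Cyclic shift of positions: the initial positions 1..n-a go to the final block a+1..n,
  the remaining ones to 1..a.\<close>

definition rotation :: "nat \<Rightarrow> nat \<Rightarrow> nat \<Rightarrow> nat" where
  "rotation n a i = (if i \<in> {1..n} then if i \<le> n - a then i + a else i - (n - a) else i)"

lemma rotation_permutes:
  assumes "a \<le> n"
  shows "rotation n a permutes {1..n}"
proof (rule bij_imp_permutes)
  show "bij_betw (rotation n a) {1..n} {1..n}"
    by (rule bij_betw_byWitness[where f' = "\<lambda>i. if a < i then i - a else i + (n - a)"])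
      (use assms in \<open>auto simp: rotation_def\<close>)
qed (auto simp: rotation_def)

text \<open>For symmetric \<open>\<Phi>\<close> the alternated block may be moved by a permutation
  \<open>\<tau>\<close> of the positions. On the block \<open>\<tau>\<close> is a translation,
  because the dot action involves differences of positions.\<close>

lemma signed_sum_transport:
  fixes \<Phi> :: "(nat \<Rightarrow> int) \<Rightarrow> int fps"
  assumes sym: "\<And>\<beta> w. w permutes {1..n} \<Longrightarrow> \<Phi> (\<beta> \<circ> w) = \<Phi> \<beta>"
    and \<tau>: "\<tau> permutes {1..n}" "\<And>i. i \<in> {1..N} \<Longrightarrow> \<tau> i = i + a" and N: "N = n - a" "a \<le> n"
  shows "(\<Sum>w | w permutes {Suc a..n}. of_int (sign w) * \<Phi> (dot w \<beta>)) =
    (\<Sum>w | w permutes {1..N}. of_int (sign w) * \<Phi> (dot w (\<beta> \<circ> \<tau>)))"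
proof -
  have bij: "bij \<tau>" and bij': "bij (inv \<tau>)" using \<tau>(1) by (auto intro: permutes_bij bij_imp_bij_inv)
  have i: "\<And>x. inv \<tau> (\<tau> x) = x" "\<And>x. \<tau> (inv \<tau> x) = x" using permutes_inverses[OF \<tau>(1)] by auto
  have ii: "inv (inv \<tau>) = \<tau>" using bij by (rule inv_inv_eq)
  have im: "\<tau> ` {1..N} = {Suc a..n}"
  proof -
    have "\<tau> ` {1..N} = (\<lambda>i. i + a) ` {1..N}" using \<tau>(2) by (intro image_cong) auto
    also have "\<dots> = {Suc a..n}" using N by (simp add: image_add_atLeastAtMost')
    finally show ?thesis .
  qed
  have im': "inv \<tau> ` {Suc a..n} = {1..N}" unfolding im[symmetric] image_image i by simp
  show ?thesis
  proof (rule sum.reindex_bij_witness[where i = "\<lambda>w. \<tau> \<circ> w \<circ> inv \<tau>" and j = "\<lambda>w. inv \<tau> \<circ> w \<circ> \<tau>"])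
    fix w assume "w \<in> {w. w permutes {Suc a..n}}"
    then have w: "w permutes {Suc a..n}" by simp
    define v where "v = inv \<tau> \<circ> w \<circ> \<tau>"
    have v: "v permutes {1..N}" using permutes_conjugate[OF bij' w] by (simp add: im' ii v_def)
    show "\<tau> \<circ> (inv \<tau> \<circ> w \<circ> \<tau>) \<circ> inv \<tau> = w" using i by (auto simp: fun_eq_iff)
    show "inv \<tau> \<circ> w \<circ> \<tau> \<in> {w. w permutes {1..N}}" using v by (simp add: v_def)
    have p: "permutation \<tau>" "permutation w" using \<tau>(1) w by (auto intro: permutes_imp_permutation[rotated])
    have p': "permutation (inv \<tau>)" using p(1) by (rule permutation_inverse)
    have "sign v = sign (inv \<tau>) * sign w * sign \<tau>"
      unfolding v_def using p p' by (simp add: sign_compose permutation_compose)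
    also have "\<dots> = sign w" using p by (simp add: sign_inverse)
    finally have sgn: "sign v = sign w" .
    have tv: "\<tau> (v x) = w (\<tau> x)" for x by (simp add: v_def i)
    have "dot w \<beta> \<circ> \<tau> = dot v (\<beta> \<circ> \<tau>)"
    proof
      fix x
      show "(dot w \<beta> \<circ> \<tau>) x = dot v (\<beta> \<circ> \<tau>) x"
      proof (cases "x \<in> {1..N}")
        case True
        then have "v x \<in> {1..N}" using permutes_in_image[OF v] by simp
        then have "w (\<tau> x) = v x + a" "\<tau> x = x + a" using tv[of x] \<tau>(2) True by auto
        then show ?thesis using tv[of x] by (simp add: dot_def)
      next
        case False
        then have "v x = x" using v permutes_not_in by metis
        then show ?thesis using tv[of x] by (simp add: dot_def)
      qed
    qed
    then have "\<Phi> (dot w \<beta>) = \<Phi> (dot v (\<beta> \<circ> \<tau>))" using sym[OF \<tau>(1), of "dot w \<beta>"] by simp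
    then show "of_int (sign (inv \<tau> \<circ> w \<circ> \<tau>)) * \<Phi> (dot (inv \<tau> \<circ> w \<circ> \<tau>) (\<beta> \<circ> \<tau>)) = of_int (sign w) * \<Phi> (dot w \<beta>)"
      unfolding v_def[symmetric] sgn by simp
  next
    fix w assume "w \<in> {w. w permutes {1..N}}"
    then have w: "w permutes {1..N}" by simp
    show "inv \<tau> \<circ> (\<tau> \<circ> w \<circ> inv \<tau>) \<circ> \<tau> = w" using i by (auto simp: fun_eq_iff)
    show "\<tau> \<circ> w \<circ> inv \<tau> \<in> {w. w permutes {Suc a..n}}" using permutes_conjugate[OF bij w] unfolding im by simp
  qed
qed

lemma pieri_block:
  fixes \<Phi> :: "(nat \<Rightarrow> int) \<Rightarrow> int fps"
  assumes sym: "\<And>\<beta> w. w permutes {1..n} \<Longrightarrow> \<Phi> (\<beta> \<circ> w) = \<Phi> \<beta>"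
    and neg: "\<And>\<beta> i. i \<in> {1..n} \<Longrightarrow> \<beta> i < 0 \<Longrightarrow> \<Phi> \<beta> = 0"
    and s: "s \<in> {1..a}" "a \<le> n" and N: "N = n - a"
    and vanish: "\<And>\<beta>. (\<And>i. i \<in> {1..Suc N} \<Longrightarrow> 0 < \<beta> i + int (Suc N) - int i) \<Longrightarrow>
       (\<Sum>w | w permutes {1..Suc N}. of_int (sign w) * \<Phi> (dot w \<beta>)) = 0"
    and \<beta>: "\<And>i. i \<in> {Suc a..n} \<Longrightarrow> 0 \<le> \<beta> i + int n - int i" and k: "\<beta> s = int k"
  shows "(\<Sum>w | w permutes {Suc a..n}. of_int (sign w) * \<Phi> (dot w \<beta>)) =
    (\<Sum>c \<in> comps {Suc a..n} k. \<Sum>w | w permutes {Suc a..n}. of_int (sign w) * \<Phi> (dot w ((\<lambda>i. \<beta> i + int (c i))(s := 0))))"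
proof -
  \<comment> \<open>Sends the block 1..N of \<open>pieri\<close> to a+1..n and its extra position
    N+1 to \<open>s\<close>: the rotation takes N+1 to 1, which is exchanged with
    \<open>s\<close>.\<close>
  define \<tau> where "\<tau> = Transposition.transpose 1 s \<circ> rotation n a"
  have \<tau>: "\<tau> permutes {1..n}"
    unfolding \<tau>_def using s by (intro permutes_compose rotation_permutes permutes_swap_id) auto
  have \<tau>s: "\<tau> (Suc N) = s" using s N by (auto simp: \<tau>_def rotation_def)
  have \<tau>N: "\<tau> i = i + a" if "i \<in> {1..N}" for i
    using that s N by (auto simp: \<tau>_def rotation_def transpose_def)
  have Nn: "N < n" using s N by auto
  have inj: "\<tau> x = \<tau> y \<longleftrightarrow> x = y" for x y using permutes_inj[OF \<tau>] by (auto dest: injD)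
  have im: "\<tau> ` {1..N} = {Suc a..n}"
  proof -
    have "\<tau> ` {1..N} = (\<lambda>i. i + a) ` {1..N}" using \<tau>N by (intro image_cong) auto
    also have "\<dots> = {Suc a..n}" using N s by (simp add: image_add_atLeastAtMost')
    finally show ?thesis .
  qed
  have upd: "(f(s := x)) \<circ> \<tau> = (f \<circ> \<tau>)(Suc N := x)" for f :: "nat \<Rightarrow> int" and x
    using \<tau>s inj by (auto simp: fun_eq_iff)
  note tr = signed_sum_transport[of n \<Phi> \<tau> N a, OF sym \<tau> \<tau>N N s(2)]
  have "(\<Sum>w | w permutes {Suc a..n}. of_int (sign w) * \<Phi> (dot w \<beta>)) =
    (\<Sum>w | w permutes {1..N}. of_int (sign w) * \<Phi> (dot w (\<beta> \<circ> \<tau>)))" by (rule tr)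
  also have "\<beta> \<circ> \<tau> = (\<beta> \<circ> \<tau>)(Suc N := int k)" using \<tau>s k by (auto simp: fun_eq_iff)
  also have "(\<Sum>w | w permutes {1..N}. of_int (sign w) * \<Phi> (dot w ((\<beta> \<circ> \<tau>)(Suc N := int k)))) =
    (\<Sum>c\<in>comps {1..N} k. \<Sum>w | w permutes {1..N}. of_int (sign w) * \<Phi> (dot w ((\<lambda>i. (\<beta> \<circ> \<tau>) i + int (c i))(Suc N := 0))))"
  proof (rule pieri[of n \<Phi> N "\<beta> \<circ> \<tau>" k, OF sym neg Nn vanish])
    fix i assume i: "i \<in> {1..N}"
    then have "i + a \<in> {Suc a..n}" "int N = int n - int a" using N s by (auto simp: of_nat_diff)
    then show "0 \<le> (\<beta> \<circ> \<tau>) i + int N - int i" using \<beta>[of "i + a"] \<tau>N[OF i] by simp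
  qed
  also have "\<dots> = (\<Sum>c \<in> comps {Suc a..n} k. \<Sum>w | w permutes {1..N}. of_int (sign w) * \<Phi> (dot w (((\<lambda>i. \<beta> i + int (c i))(s := 0)) \<circ> \<tau>)))"
  proof (rule sum.reindex_bij_witness[where i = "\<lambda>c. c \<circ> \<tau>" and j = "\<lambda>c. c \<circ> inv \<tau>"])
    have i: "\<And>x. inv \<tau> (\<tau> x) = x" "\<And>x. \<tau> (inv \<tau> x) = x" using permutes_inverses[OF \<tau>] by auto
    have sm: "sum (c \<circ> \<tau>) {1..N} = sum c {Suc a..n}" for c :: "nat \<Rightarrow> nat"
      unfolding im[symmetric] by (rule sum.reindex[symmetric]) (auto simp: inj_on_def inj)
    have mem: "x \<in> {1..N} \<longleftrightarrow> \<tau> x \<in> {Suc a..n}" for x by (simp only: im[symmetric] inj_image_mem_iff[OF permutes_inj[OF \<tau>]])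
    fix c :: "nat \<Rightarrow> nat"
    show "c \<circ> inv \<tau> \<circ> \<tau> = c" "c \<circ> \<tau> \<circ> inv \<tau> = c" using i by (auto simp: fun_eq_iff)
    show "c \<circ> inv \<tau> \<in> comps {Suc a..n} k" if "c \<in> comps {1..N} k"
    proof -
      have "sum (c \<circ> inv \<tau>) {Suc a..n} = k"
        using that sm[of "c \<circ> inv \<tau>"] by (simp add: comps_def comp_def i)
      moreover have "(c \<circ> inv \<tau>) x = 0" if "x \<notin> {Suc a..n}" for x
        using that mem[of "inv \<tau> x"] \<open>c \<in> comps {1..N} k\<close> by (simp add: i comps_def del: atLeastAtMost_iff)
      ultimately show ?thesis unfolding comps_def by blast
    qed
    show "c \<circ> \<tau> \<in> comps {1..N} k" if "c \<in> comps {Suc a..n} k"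
      using that sm[of c] mem by (simp add: comps_def del: atLeastAtMost_iff)
    have "((\<lambda>i. \<beta> i + int ((c \<circ> inv \<tau>) i))(s := 0)) \<circ> \<tau> = (\<lambda>i. (\<beta> \<circ> \<tau>) i + int (c i))(Suc N := 0)"
      unfolding upd by (auto simp: fun_eq_iff i)
    then show "(\<Sum>w | w permutes {1..N}. of_int (sign w) * \<Phi> (dot w (((\<lambda>i. \<beta> i + int ((c \<circ> inv \<tau>) i))(s := 0)) \<circ> \<tau>))) =
      (\<Sum>w | w permutes {1..N}. of_int (sign w) * \<Phi> (dot w ((\<lambda>i. (\<beta> \<circ> \<tau>) i + int (c i))(Suc N := 0))))" by simp
  qed
  also have "\<dots> = (\<Sum>c \<in> comps {Suc a..n} k. \<Sum>w | w permutes {Suc a..n}. of_int (sign w) * \<Phi> (dot w ((\<lambda>i. \<beta> i + int (c i))(s := 0))))"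
    by (rule sum.cong[OF refl]) (rule tr[symmetric])
  finally show ?thesis .
qed


section \<open>Charge-weighted fillings\<close>

lemma mset_word: "mset (word lo hi rs) = (\<Sum>i = lo..hi. rs i)"
proof -
  have "mset (word lo hi rs) = sum_list (map rs [lo..<Suc hi])"
    unfolding word_def by (simp add: mset_concat comp_def rev_map[symmetric] del: upt_Suc)
  also have "\<dots> = (\<Sum>i = lo..hi. rs i)"
    by (simp add: sum_list_distinct_conv_sum_set atLeastLessThanSuc_atLeastAtMost del: upt_Suc)
  finally show ?thesis .
qed

lemma fillings_mset_word: "rs \<in> fillings n C \<beta> \<Longrightarrow> mset (word 1 n rs) = C"
  by (simp add: mset_word fillings_def)

lemma fillings_letters:
  assumes "rs \<in> fillings n C \<beta>" "z \<in># rs i"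
  shows "z \<in># C"
proof -
  have "i \<in> {1..n}" using assms by (metis (mono_tags, lifting) empty_iff fillings_def mem_Collect_eq set_mset_empty)
  then have "rs i \<subseteq># (\<Sum>i = 1..n. rs i)" by (metis finite_atLeastAtMost mset_subset_eq_add_left sum.remove)
  then show ?thesis using assms by (auto simp: fillings_def dest: mset_subset_eqD)
qed

lemma word_rows_empty: "(\<And>i. lo \<le> i \<Longrightarrow> i \<le> hi \<Longrightarrow> rs i = {#}) \<Longrightarrow> word lo hi rs = []"
  by (auto simp: word_def)

lemma word_snoc: "lo \<le> hi \<Longrightarrow> word lo hi rs = word (Suc lo) hi rs @ sorted_list_of_multiset (rs lo)"
  using word_split[of lo "Suc lo" hi rs] by simp

lemma word_Cons: "lo \<le> Suc hi \<Longrightarrow> word lo (Suc hi) rs = sorted_list_of_multiset (rs (Suc hi)) @ word lo hi rs"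
  by (simp add: word_def)

lemma word_concat: "lo \<le> Suc k \<Longrightarrow> k \<le> hi \<Longrightarrow> word lo hi rs = word (Suc k) hi rs @ word lo k rs"
  using word_split[of lo "Suc k" hi rs] by (simp add: word_def del: upt_Suc)

lemma word_shift: "word (lo + d) (hi + d) rs = word lo hi (\<lambda>i. rs (i + d))"
proof -
  have "[lo + d..<Suc (hi + d)] = map (\<lambda>i. i + d) [lo..<Suc hi]" by (intro nth_equalityI) (auto simp del: upt_Suc)
  then show ?thesis by (simp add: word_def rev_map comp_def del: upt_Suc)
qed

lemma charge_rotate_many:
  assumes "partition_content (w @ x)" "1 \<notin> set x"
  shows "charge (w @ x) = length x + charge (x @ w)"
  using assms
proof (induction x arbitrary: w rule: rev_induct)
  case (snoc y x)
  have "charge ((w @ x) @ [y]) = Suc (charge (y # w @ x))" using snoc.prems by (intro charge_rotate) auto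
  moreover have "partition_content ((y # w) @ x)"
    using snoc.prems partition_content_mset[of "w @ x @ [y]" "(y # w) @ x"] by simp
  then have "charge ((y # w) @ x) = length x + charge (x @ y # w)" using snoc.prems by (intro snoc.IH) auto
  ultimately show ?case by simp
qed simp

lemma charge_strip_row:
  assumes pc: "partition_content (w @ replicate k 1 @ x)" and "1 \<notin> set w" "1 \<notin> set x"
  shows "charge (w @ replicate k 1 @ x) = length x + charge (map (\<lambda>z. z - 1) (x @ w))"
proof -
  have "charge ((w @ replicate k 1) @ x) = length x + charge (x @ w @ replicate k 1)"
    using assms by (intro charge_rotate_many) auto
  moreover have "partition_content ((x @ w) @ replicate k 1)"
    using pc partition_content_mset[of "w @ replicate k 1 @ x" "(x @ w) @ replicate k 1"] by simp
  then have "charge ((x @ w) @ replicate k 1) = charge (map (\<lambda>z. z - 1) (x @ w))"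
    using assms by (intro charge_drop_ones) auto
  ultimately show ?thesis by simp
qed

text \<open>Columns increase strictly, so each step down raises the least possible letter by
  1.\<close>

lemma lattice_rows_letters:
  assumes lat: "lattice_rows lo hi rs" and lo: "\<And>z. z \<in># rs lo \<Longrightarrow> b + lo \<le> z"
    and i: "lo \<le> i" "i \<le> hi" and z: "z \<in># rs i"
  shows "b + i \<le> z"
  using i z
proof (induction i arbitrary: z rule: dec_induct)
  case base then show ?case using lo by blast
next
  case (step i)
  show ?case
  proof (rule ccontr)
    assume "\<not> b + Suc i \<le> z"
    then have "z \<in># {#z \<in># rs (Suc i). z \<le> b + i#}" using step.prems by simp
    then have pos: "0 < size {#z \<in># rs (Suc i). z \<le> b + i#}" by (metis empty_iff set_mset_empty size_eq_0_iff_empty not_gr_zero)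
    have "set_mset {#z \<in># rs i. z < b + i#} = {}" using step by fastforce
    then have sz: "size {#z \<in># rs i. z < b + i#} = 0" by (simp only: set_mset_eq_empty_iff size_empty)
    have "excess (rs i) (rs (Suc i)) (b + i) \<le> 0" using lat step by (simp add: lattice_rows_def)
    then show False using pos sz by (simp only: excess_def)
  qed
qed

lemma word_rotation:
  assumes "m \<le> n"
  shows "word 1 n (us \<circ> rotation n m) = word 1 m us @ word (Suc m) n us"
proof -
  have "word 1 n (us \<circ> rotation n m) = word (1 + (n - m)) (m + (n - m)) (us \<circ> rotation n m) @ word 1 (n - m) (us \<circ> rotation n m)"
    using word_concat[of 1 "n - m" n "us \<circ> rotation n m"] assms by simp
  also have "word (1 + (n - m)) (m + (n - m)) (us \<circ> rotation n m) = word 1 m us"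
    unfolding word_shift using assms by (intro word_cong) (auto simp: rotation_def)
  also have "word 1 (n - m) (us \<circ> rotation n m) = word 1 (n - m) (\<lambda>i. us (i + m))"
    using assms by (intro word_cong) (auto simp: rotation_def)
  also have "\<dots> = word (Suc m) n us" using word_shift[of 1 m "n - m" us] assms by simp
  finally show ?thesis .
qed

lemma fillings_permute:
  assumes w: "w permutes {1..n}" and rs: "rs \<in> fillings n C \<beta>"
  shows "rs \<circ> w \<in> fillings n C (\<beta> \<circ> w)"
proof -
  have m: "w i \<in> {1..n} \<longleftrightarrow> i \<in> {1..n}" for i using permutes_in_image[OF w] .
  have "(\<Sum>i = 1..n. (rs \<circ> w) i) = C"
    using rs sum.permute[OF w, of rs] by (simp add: fillings_def)
  moreover have "\<forall>i. i \<notin> {1..n} \<longrightarrow> (rs \<circ> w) i = {#}" using rs m by (simp add: fillings_def del: atLeastAtMost_iff)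
  moreover have "\<forall>i \<in> {1..n}. int (size ((rs \<circ> w) i)) = (\<beta> \<circ> w) i" using rs m by (simp add: fillings_def del: atLeastAtMost_iff)
  ultimately show ?thesis by (simp add: fillings_def)
qed

locale partition_function =
  fixes n :: nat and \<gamma> :: "nat \<Rightarrow> nat"
  assumes decreasing: "1 \<le> i \<Longrightarrow> i < n \<Longrightarrow> \<gamma> (Suc i) \<le> \<gamma> i"
begin

text \<open>The letters that are left when 1..a have been eliminated. Letters keep their names in
  fillings; only in \<open>weighted\<close> the word is lowered by \<open>a\<close>, so that its
  content is a partition.\<close>

definition content :: "nat \<Rightarrow> nat multiset" where
  "content a = (\<Sum>i = Suc a..n. replicate_mset (\<gamma> i) i)"

lemma count_content: "count (content a) z = (if a < z \<and> z \<le> n then \<gamma> z else 0)"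
proof -
  have "count (content a) z = (\<Sum>i = Suc a..n. if i = z then \<gamma> i else 0)"
    by (simp add: content_def count_sum)
  also have "\<dots> = (if z \<in> {Suc a..n} then \<gamma> z else 0)" by (rule sum.delta) simp
  finally show ?thesis by auto
qed

lemma in_content: "z \<in># content a \<Longrightarrow> a < z \<and> z \<le> n"
  using count_content[of a z] by (metis count_eq_zero_iff)

lemma partition_content_shift:
  assumes "mset w = content a"
  shows "partition_content (map (\<lambda>z. z - a) w)"
proof -
  have w: "a < z" if "z \<in> set w" for z using that in_content[of z a] assms by (metis set_mset_mset)
  have "count (mset (map (\<lambda>z. z - a) w)) j = count (mset w) (j + a)" if "1 \<le> j" for j
  proof -
    have "count (mset (map (\<lambda>z. z - a) w)) j = size {#z \<in># mset w. z - a = j#}"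
      by (induction w) auto
    also have "{#z \<in># mset w. z - a = j#} = {#z \<in># mset w. z = j + a#}"
      using w that by (intro filter_mset_cong refl) auto
    also have "size {#z \<in># mset w. z = j + a#} = count (mset w) (j + a)" by (simp add: filter_eq_replicate_mset)
    finally show ?thesis .
  qed
  then have "count (mset (map (\<lambda>z. z - a) w)) j = (if 1 \<le> j \<and> j + a \<le> n then \<gamma> (j + a) else 0)" if "1 \<le> j" for j
    using that by (auto simp: assms count_content)
  moreover have "\<gamma> (Suc (j + a)) \<le> \<gamma> (j + a)" if "1 \<le> j" "Suc (j + a) \<le> n" for j
    using decreasing[of "j + a"] that by auto
  moreover have "0 \<notin> set (map (\<lambda>z. z - a) w)" using w by fastforce
  ultimately show ?thesis unfolding partition_content_def by auto
qed

definition weighted :: "nat \<Rightarrow> (nat \<Rightarrow> nat multiset) \<Rightarrow> int fps" where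
  "weighted a rs = fps_X ^ charge (map (\<lambda>z. z - a) (word 1 n rs))"

lemma weighted_raise:
  assumes rs: "rs \<in> fillings n (content a) \<beta>" and i: "1 \<le> i" "i < n" and m: "1 \<le> row_max_excess i rs"
  shows "weighted a (raise i rs) = weighted a rs"
proof -
  have "a < z" if "z \<in> set (word 1 n rs)" for z
    using that fillings_mset_word[OF rs] in_content by (metis set_mset_mset)
  then have "strict_mono_on (set (word 1 n rs)) (\<lambda>z. z - a)"
    by (intro strict_mono_onI) (auto intro: diff_less_mono less_imp_le)
  then have "knuth_equiv (map (\<lambda>z. z - a) (word 1 n rs)) (map (\<lambda>z. z - a) (word 1 n (raise i rs)))"
    using knuth_raise[OF i m] knuth_equiv_map by blast
  then show ?thesis unfolding weighted_def using charge_knuth_equiv by metis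
qed

text \<open>The conjunct \<open>True\<close> is the trivial instance of the side condition
  \<open>Q\<close> of \<open>sum_swap\<close> and \<open>signed_sum_lattice\<close>.\<close>

definition G :: "nat \<Rightarrow> (nat \<Rightarrow> int) \<Rightarrow> int fps" where
  "G a \<beta> = (\<Sum>rs | rs \<in> fillings n (content a) \<beta> \<and> True. weighted a rs)"

lemma G_cong: "(\<And>i. i \<in> {1..n} \<Longrightarrow> \<beta> i = \<beta>' i) \<Longrightarrow> G a \<beta> = G a \<beta>'"
  unfolding G_def using fillings_cong[of n \<beta> \<beta>' "content a"] by simp

lemma G_permute:
  assumes "w permutes {1..n}"
  shows "G a (\<beta> \<circ> w) = G a \<beta>"
proof (rule symmetric_permutes[OF _ assms])
  fix \<beta> :: "nat \<Rightarrow> int" and i assume i: "1 \<le> i" "i < n"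
  have t: "\<beta> \<circ> Transposition.transpose i (Suc i) = \<beta>(i := \<beta> (Suc i) - 0, Suc i := \<beta> i + 0)"
    by (auto simp: fun_eq_iff transpose_def)
  show "G a (\<beta> \<circ> Transposition.transpose i (Suc i)) = G a \<beta>"
    unfolding t G_def
    using sum_swap[where n = n and i = i and a = 0 and Q = "\<lambda>_. True" and f = "weighted a" and C = "content a" and \<beta> = \<beta>, OF i]
      weighted_raise[OF _ i] by (simp add: max_excess_nonneg)
qed

lemma G_neg: "i \<in> {1..n} \<Longrightarrow> \<beta> i < 0 \<Longrightarrow> G a \<beta> = 0"
proof -
  assume i: "i \<in> {1..n}" "\<beta> i < 0"
  have "fillings n (content a) \<beta> = {}"
  proof (rule ccontr)
    assume "fillings n (content a) \<beta> \<noteq> {}"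
    then obtain rs where "rs \<in> fillings n (content a) \<beta>" by blast
    then have "int (size (rs i)) = \<beta> i" using i(1) by (simp add: fillings_def)
    then show False using i(2) by simp
  qed
  then show ?thesis by (simp add: G_def)
qed

lemma fillings_letter:
  "rs \<in> fillings n (content a) \<beta> \<Longrightarrow> z \<in># rs i \<Longrightarrow> a < z \<and> z \<le> n"
  using fillings_letters in_content by blast

text \<open>The letters up to \<open>m\<close> form a left-justified block with \<gamma>_i copies of
  i in row i, for a < i \<le> m. For a = 0 this becomes the condition on the first block of a
  catabolizable tableau; the case m = a+1 drives the recursion.\<close>

definition frozen :: "nat \<Rightarrow> nat \<Rightarrow> (nat \<Rightarrow> nat multiset) \<Rightarrow> bool" where
  "frozen a m rs \<longleftrightarrow> (\<forall>i \<in> {1..n}. {#z \<in># rs i. z \<le> m#} = (if a < i \<and> i \<le> m then replicate_mset (\<gamma> i) i else {#}))"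

lemma frozen_excess:
  assumes fr: "frozen a m rs" and i: "a < i" "i < n" and p: "p \<le> m"
  shows "excess (rs i) (rs (Suc i)) p \<le> 0"
proof -
  have sub: "{#z \<in># rs j. z \<le> p#} = {#z \<in># {#z \<in># rs j. z \<le> m#}. z \<le> p#}"
     "{#z \<in># rs j. z < p#} = {#z \<in># {#z \<in># rs j. z \<le> m#}. z < p#}" for j
    using p unfolding filter_filter_mset by (auto intro!: filter_mset_cong)
  have r: "{#z \<in># rs j. z \<le> m#} = (if a < j \<and> j \<le> m then replicate_mset (\<gamma> j) j else {#})" if "j \<in> {1..n}" for j
    using fr that by (simp add: frozen_def)
  have rp: "{#z \<in># replicate_mset k j. P z#} = (if P j then replicate_mset k j else {#})" for k j and P :: "nat \<Rightarrow> bool"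
    by (induction k) auto
  show ?thesis
  proof (cases "Suc i \<le> p")
    case True
    then show ?thesis unfolding excess_def sub using i p decreasing[of i] by (simp add: r rp)
  next
    case False
    then show ?thesis unfolding excess_def sub using i p by (simp add: r rp)
  qed
qed

text \<open>Frozen letters alone form strict columns, so up to \<open>m\<close> the excess is not
  positive. The letter moved by raising is a value of positive excess before the move and, as the
  maximum was at least 2, also after it. So this letter exceeds \<open>m\<close> as soon as one of
  the two fillings is frozen.\<close>

lemma frozen_raise:
  assumes i: "a < i" "i < n" and m: "2 \<le> row_max_excess i rs"
  shows "frozen a m (raise i rs) \<longleftrightarrow> frozen a m rs"
proof -
  define x where "x = first_max (rs i) (rs (Suc i))"
  have m1: "1 \<le> row_max_excess i rs" using m by simp
  have ex: "excess (rs i) (rs (Suc i)) x = row_max_excess i rs" unfolding x_def by (rule excess_first_max)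
  have ex': "excess (raise i rs i) (raise i rs (Suc i)) x = row_max_excess i rs - 1"
    using excess_raise[OF m1 x_def, of i x] ex by simp
  show ?thesis
  proof (cases "x \<le> m")
    case True
    then show ?thesis using frozen_excess[OF _ i True] ex ex' m by fastforce
  next
    case False
    have "{#z \<in># raise i rs j. z \<le> m#} = {#z \<in># rs j. z \<le> m#}" for j
      using False by (simp add: raise_def Let_def x_def[symmetric] filter_diff_mset)
    then show ?thesis by (simp add: frozen_def)
  qed
qed

lemma content_Suc: "k < n \<Longrightarrow> content k = replicate_mset (\<gamma> (Suc k)) (Suc k) + content (Suc k)"
  unfolding content_def by (simp add: sum.atLeast_Suc_atMost)

text \<open>
  The frozen letters are removed one value at a time: the letters above the frozen ones of
  row \<open>k + 1\<close> rotate to the front of the word, each contributing 1, and then the smallest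
  letter stands at the end of the word.
\<close>
lemma charge_frozen:
  assumes rs: "rs \<in> fillings n (content a) \<beta>" and fr: "frozen a m rs" and am: "a \<le> m" "m \<le> n"
    and e: "\<And>i. i \<in> {1..a} \<Longrightarrow> rs i = {#}" and us: "us = (\<lambda>i. {#z \<in># rs i. m < z#})"
  shows "a \<le> k \<Longrightarrow> k \<le> m \<Longrightarrow> mset (word (Suc a) k us @ word (Suc k) n rs) = content k \<and>
    charge (map (\<lambda>z. z - a) (word 1 n rs)) =
      (\<Sum>i = Suc a..k. size (us i)) + charge (map (\<lambda>z. z - k) (word (Suc a) k us @ word (Suc k) n rs))"
proof (induction k rule: dec_induct)
  case base
  have "word 1 a rs = []" using e by (intro word_rows_empty) auto
  then have w: "word 1 n rs = word (Suc a) n rs" using word_concat[of 1 a n rs] am by simp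
  show ?case using fillings_mset_word[OF rs] unfolding w by (simp add: word_def[of "Suc a" a])
next
  case (step k)
  define V where "V = word (Suc a) k us @ word (Suc (Suc k)) n rs"
  define U where "U = sorted_list_of_multiset (us (Suc k))"
  have k: "Suc k \<in> {1..n}" "a < Suc k" "Suc k \<le> m" "k < n" using step am by auto
  have "rs (Suc k) = {#z \<in># rs (Suc k). z \<le> m#} + us (Suc k)"
    unfolding us by (subst multiset_partition[of _ "\<lambda>z. z \<le> m"]) (simp add: not_le)
  also have "{#z \<in># rs (Suc k). z \<le> m#} = replicate_mset (\<gamma> (Suc k)) (Suc k)"
    using fr k by (simp add: frozen_def)
  finally have row: "rs (Suc k) = replicate_mset (\<gamma> (Suc k)) (Suc k) + us (Suc k)" .
  have um: "m < z" if "z \<in># us i" for z i using that by (simp add: us)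
  have "sorted_list_of_multiset (rs (Suc k)) = replicate (\<gamma> (Suc k)) (Suc k) @ U"
  proof (rule sorted_list_of_multiset_eqI)
    show "sorted (replicate (\<gamma> (Suc k)) (Suc k) @ U)"
      using um[of _ "Suc k"] k by (auto simp: sorted_append U_def less_imp_le intro: order_trans[of _ m])
    show "mset (replicate (\<gamma> (Suc k)) (Suc k) @ U) = rs (Suc k)" by (simp add: U_def row)
  qed
  then have w: "word (Suc a) k us @ word (Suc k) n rs = V @ replicate (\<gamma> (Suc k)) (Suc k) @ U"
    using k by (simp add: V_def word_snoc)
  have w': "word (Suc a) (Suc k) us @ word (Suc (Suc k)) n rs = U @ V"
    using step by (simp add: V_def U_def word_Cons)
  have IH: "mset (V @ replicate (\<gamma> (Suc k)) (Suc k) @ U) = content k"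
    "charge (map (\<lambda>z. z - a) (word 1 n rs)) = (\<Sum>i = Suc a..k. size (us i)) + charge (map (\<lambda>z. z - k) (V @ replicate (\<gamma> (Suc k)) (Suc k) @ U))"
    using step.IH step.prems unfolding w by auto
  have gt: "k < z" if "z \<in> set (U @ V)" for z
  proof -
    have "z \<in># content k" using that unfolding IH(1)[symmetric] by auto
    then show ?thesis using in_content by blast
  qed
  have "Suc k \<notin># rs i" if "Suc k < i" "i \<le> n" for i
  proof
    assume "Suc k \<in># rs i"
    then have "Suc k \<in># {#z \<in># rs i. z \<le> m#}" using k by simp
    also have "{#z \<in># rs i. z \<le> m#} = (if a < i \<and> i \<le> m then replicate_mset (\<gamma> i) i else {#})"
      using fr that by (simp add: frozen_def)
    finally show False using that by (auto split: if_splits)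
  qed
  moreover have "Suc k \<notin># us i" for i using um[of "Suc k" i] k by auto
  ultimately have no: "Suc k \<notin> set (U @ V)"
    unfolding U_def V_def word_def by (auto simp del: upt_Suc)
  have no1: "1 \<notin> set (map (\<lambda>z. z - k) V)" "1 \<notin> set (map (\<lambda>z. z - k) U)"
  proof -
    have "z - k \<noteq> 1" if "z \<in> set (U @ V)" for z
    proof
      assume "z - k = 1"
      then have "z = Suc k" using gt[OF that] by simp
      then show False using no that by blast
    qed
    then have "1 \<notin> (\<lambda>z. z - k) ` set (U @ V)" by (metis imageE)
    then show "1 \<notin> set (map (\<lambda>z. z - k) V)" "1 \<notin> set (map (\<lambda>z. z - k) U)" by (simp_all add: image_Un)
  qed
  have pc: "partition_content (map (\<lambda>z. z - k) V @ replicate (\<gamma> (Suc k)) 1 @ map (\<lambda>z. z - k) U)"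
    using partition_content_shift[OF IH(1)] by simp
  have "charge (map (\<lambda>z. z - k) (V @ replicate (\<gamma> (Suc k)) (Suc k) @ U)) = length (map (\<lambda>z. z - k) U) + charge (map (\<lambda>z. z - 1) (map (\<lambda>z. z - k) U @ map (\<lambda>z. z - k) V))"
    using charge_strip_row[OF pc no1] by simp
  also have "map (\<lambda>z. z - 1) (map (\<lambda>z. z - k) U @ map (\<lambda>z. z - k) V) = map (\<lambda>z. z - Suc k) (U @ V)" by simp
  also have "length (map (\<lambda>z. z - k) U) = size (us (Suc k))" by (simp add: U_def flip: size_mset)
  finally have c: "charge (map (\<lambda>z. z - k) (V @ replicate (\<gamma> (Suc k)) (Suc k) @ U)) = size (us (Suc k)) + charge (map (\<lambda>z. z - Suc k) (U @ V))" .
  have "mset (U @ V) = content (Suc k)" using IH(1) unfolding content_Suc[OF k(4)] by (simp add: ac_simps)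
  then show ?case unfolding w' IH(2) c using step by simp
qed

lemma frozen_sum:
  assumes am: "a \<le> m" "m \<le> n" and z: "\<And>i. i \<in> {1..a} \<Longrightarrow> \<beta> i = 0"
  defines "\<beta>' \<equiv> \<lambda>i. if a < i \<and> i \<le> m then \<beta> i - int (\<gamma> i) else \<beta> i"
  shows "(\<Sum>rs | rs \<in> fillings n (content a) \<beta> \<and> frozen a m rs. weighted a rs) =
    fps_X ^ nat (\<Sum>i = Suc a..m. \<beta> i - int (\<gamma> i)) * G m \<beta>'"
proof -
  define \<rho> where "\<rho> = rotation n m"
  define fr where "fr i = (if a < i \<and> i \<le> m then replicate_mset (\<gamma> i) i else {#})" for i
  define up where "up rs = (\<lambda>i. {#z \<in># rs i. m < z#})" for rs :: "nat \<Rightarrow> nat multiset"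
  have \<rho>: "\<rho> permutes {1..n}" unfolding \<rho>_def by (rule rotation_permutes[OF am(2)])
  have split: "rs i = fr i + up rs i" if "frozen a m rs" "i \<in> {1..n}" for rs i
  proof -
    have "rs i = {#z \<in># rs i. z \<le> m#} + up rs i"
      unfolding up_def by (subst multiset_partition[of _ "\<lambda>z. z \<le> m"]) (simp add: not_le)
    then show ?thesis using that by (simp add: frozen_def fr_def)
  qed
  have fr_count: "count (fr i) z = (if i = z then if a < z \<and> z \<le> m then \<gamma> z else 0 else 0)" for i z
    by (auto simp: fr_def)
  have fr_sum: "(\<Sum>i = 1..n. fr i) + content m = content a"
  proof (rule multiset_eqI)
    fix z
    have "count (\<Sum>i = 1..n. fr i) z = (if z \<in> {1..n} then if a < z \<and> z \<le> m then \<gamma> z else 0 else 0)"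
      unfolding count_sum fr_count by (rule sum.delta) simp
    then show "count ((\<Sum>i = 1..n. fr i) + content m) z = count (content a) z"
      using am by (auto simp: count_content)
  qed
  have up_fr: "{#z \<in># fr i. m < z#} = {#}" "{#z \<in># fr i. z \<le> m#} = fr i" for i
    by (auto simp: fr_def filter_mset_eq_conv not_less intro!: multiset_eqI)
  have up_mem: "up rs \<in> fillings n (content m) \<beta>'" if rs: "rs \<in> fillings n (content a) \<beta>" "frozen a m rs" for rs
  proof -
    have "(\<Sum>i = 1..n. fr i) + (\<Sum>i = 1..n. up rs i) = (\<Sum>i = 1..n. rs i)"
      unfolding sum.distrib[symmetric] using split[OF rs(2)] by simp
    also have "\<dots> = content a" using rs by (simp add: fillings_def)
    finally have "(\<Sum>i = 1..n. up rs i) = content m" unfolding fr_sum[symmetric] by simp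
    moreover have "int (size (up rs i)) = \<beta>' i" if i: "i \<in> {1..n}" for i
    proof -
      have "int (size (rs i)) = \<beta> i" using rs i by (simp add: fillings_def)
      then show ?thesis unfolding split[OF rs(2) i] by (auto simp: fr_def \<beta>'_def)
    qed
    moreover have "up rs i = {#}" if "i \<notin> {1..n}" for i using rs that by (simp add: fillings_def up_def)
    ultimately show ?thesis by (simp add: fillings_def)
  qed
  have down_mem: "(\<lambda>i. fr i + us i) \<in> fillings n (content a) \<beta> \<and> frozen a m (\<lambda>i. fr i + us i) \<and> up (\<lambda>i. fr i + us i) = us"
    if us: "us \<in> fillings n (content m) \<beta>'" for us
  proof -
    have gt: "m < z" if "z \<in># us i" for z i using fillings_letter[OF us that] by simp
    then have ge: "{#z \<in># us i. z \<le> m#} = {#}" "{#z \<in># us i. m < z#} = us i" for i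
      by (auto simp: filter_mset_eq_conv intro!: multiset_eqI) (metis leD)+
    have "(\<Sum>i = 1..n. fr i + us i) = content a"
      unfolding sum.distrib using us fr_sum by (simp add: fillings_def)
    moreover have "int (size (fr i + us i)) = \<beta> i" if "i \<in> {1..n}" for i
    proof -
      have "int (size (us i)) = \<beta>' i" using us that by (simp add: fillings_def)
      then show ?thesis by (auto simp: fr_def \<beta>'_def)
    qed
    moreover have "fr i + us i = {#}" if "i \<notin> {1..n}" for i
      using us that am by (auto simp: fillings_def fr_def)
    moreover have "frozen a m (\<lambda>i. fr i + us i)" by (simp add: frozen_def ge up_fr) (simp add: fr_def)
    moreover have "up (\<lambda>i. fr i + us i) = us" by (simp add: up_def ge up_fr)
    ultimately show ?thesis by (simp add: fillings_def)
  qed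
  have "(\<Sum>rs | rs \<in> fillings n (content a) \<beta> \<and> frozen a m rs. weighted a rs) =
    (\<Sum>us \<in> fillings n (content m) \<beta>'. fps_X ^ nat (\<Sum>i = Suc a..m. \<beta> i - int (\<gamma> i)) * weighted m (us \<circ> \<rho>))"
  proof (rule sum.reindex_bij_witness[where i = "\<lambda>us i. fr i + us i" and j = up])
    fix us assume us: "us \<in> fillings n (content m) \<beta>'"
    show "up (\<lambda>i. fr i + us i) = us" "(\<lambda>i. fr i + us i) \<in> {rs. rs \<in> fillings n (content a) \<beta> \<and> frozen a m rs}"
      using down_mem[OF us] by auto
  next
    fix rs assume "rs \<in> {rs. rs \<in> fillings n (content a) \<beta> \<and> frozen a m rs}"
    then have rs: "rs \<in> fillings n (content a) \<beta>" "frozen a m rs" by auto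
    show mem: "up rs \<in> fillings n (content m) \<beta>'" by (rule up_mem[OF rs])
    show "(\<lambda>i. fr i + up rs i) = rs"
    proof
      fix i show "fr i + up rs i = rs i"
        using split[OF rs(2), of i] rs(1) am by (cases "i \<in> {1..n}") (auto simp: fillings_def fr_def up_def)
    qed
    have e: "rs i = {#}" if "i \<in> {1..a}" for i
    proof -
      have "int (size (rs i)) = 0" using rs(1) z[OF that] that am by (simp add: fillings_def)
      then show ?thesis by simp
    qed
    have "rs i = up rs i" if "Suc m \<le> i" "i \<le> n" for i
      using split[OF rs(2), of i] that by (simp add: fr_def)
    then have w1: "word (Suc m) n rs = word (Suc m) n (up rs)" by (rule word_cong)
    have "word 1 a (up rs) = []" using e by (intro word_rows_empty) (simp add: up_def)
    then have w2: "word 1 m (up rs) = word (Suc a) m (up rs)" using word_concat[of 1 a m "up rs"] am by simp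
    have "int (\<Sum>i = Suc a..m. size (up rs i)) = (\<Sum>i = Suc a..m. \<beta> i - int (\<gamma> i))"
      unfolding of_nat_sum
    proof (rule sum.cong[OF refl])
      fix i assume "i \<in> {Suc a..m}"
      then show "int (size (up rs i)) = \<beta> i - int (\<gamma> i)" using mem am by (simp add: fillings_def \<beta>'_def)
    qed
    then have ex: "(\<Sum>i = Suc a..m. size (up rs i)) = nat (\<Sum>i = Suc a..m. \<beta> i - int (\<gamma> i))" by (metis nat_int)
    have "charge (map (\<lambda>z. z - a) (word 1 n rs)) = (\<Sum>i = Suc a..m. size (up rs i)) +
      charge (map (\<lambda>z. z - m) (word (Suc a) m (up rs) @ word (Suc m) n rs))"
      using charge_frozen[OF rs am e up_def, of m] am by simp
    also have "word (Suc a) m (up rs) @ word (Suc m) n rs = word 1 n (up rs \<circ> \<rho>)"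
      unfolding \<rho>_def word_rotation[OF am(2)] w1 w2 ..
    finally show "fps_X ^ nat (\<Sum>i = Suc a..m. \<beta> i - int (\<gamma> i)) * weighted m (up rs \<circ> \<rho>) = weighted a rs"
      unfolding weighted_def ex by (simp add: power_add)
  qed
  also have "\<dots> = fps_X ^ nat (\<Sum>i = Suc a..m. \<beta> i - int (\<gamma> i)) * (\<Sum>us \<in> fillings n (content m) \<beta>'. weighted m (us \<circ> \<rho>))"
    by (simp add: sum_distrib_left)
  also have "(\<Sum>us \<in> fillings n (content m) \<beta>'. weighted m (us \<circ> \<rho>)) = (\<Sum>us \<in> fillings n (content m) (\<beta>' \<circ> \<rho>). weighted m us)"
  proof (rule sum.reindex_bij_witness[where i = "\<lambda>us. us \<circ> inv \<rho>" and j = "\<lambda>us. us \<circ> \<rho>"])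
    have i: "\<And>x. inv \<rho> (\<rho> x) = x" "\<And>x. \<rho> (inv \<rho> x) = x" using permutes_inverses[OF \<rho>] by auto
    fix us :: "nat \<Rightarrow> nat multiset"
    show "us \<circ> \<rho> \<circ> inv \<rho> = us" "us \<circ> inv \<rho> \<circ> \<rho> = us" using i by (auto simp: fun_eq_iff)
    show "us \<circ> \<rho> \<in> fillings n (content m) (\<beta>' \<circ> \<rho>)" if "us \<in> fillings n (content m) \<beta>'"
      using fillings_permute[OF \<rho> that] .
    have "\<beta>' \<circ> \<rho> \<circ> inv \<rho> = \<beta>'" using i by (auto simp: fun_eq_iff)
    then show "us \<circ> inv \<rho> \<in> fillings n (content m) \<beta>'" if "us \<in> fillings n (content m) (\<beta>' \<circ> \<rho>)"
      using fillings_permute[OF permutes_inv[OF \<rho>] that] by simp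
  qed simp
  also have "\<dots> = G m \<beta>'" using G_permute[OF \<rho>, of m \<beta>'] by (simp add: G_def)
  finally show ?thesis .
qed

end


section \<open>Elimination of the roots\<close>

context partition_function begin

text \<open>For decreasing \<open>\<beta>\<close> the signed sum counts lattice fillings. A nonempty
  row N+1 of such a filling forces a letter of at least a+N+1, which exceeds n. The hypothesis on
  \<open>\<beta>\<close> is stable under the dot action, and at i = N+1 it says that this row is
  nonempty.\<close>

lemma G_alternating_vanish:
  assumes a: "1 \<le> a" "a \<le> n" and N: "N = n - a" and \<beta>: "\<And>i. i \<in> {1..Suc N} \<Longrightarrow> 0 < \<beta> i + int (Suc N) - int i"
  shows "(\<Sum>w | w permutes {1..Suc N}. of_int (sign w) * G a (dot w \<beta>)) = 0"
proof (rule antisymmetric_dot_eqI[where A = "\<lambda>\<beta>. \<Sum>w | w permutes {1..Suc N}. of_int (sign w) * G a (dot w \<beta>)" and B = "\<lambda>_. 0"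
      and lo = 1 and hi = "Suc N" and P = "\<lambda>\<beta>. \<forall>i \<in> {1..Suc N}. 0 < \<beta> i + int (Suc N) - int i"])
  show "antisymmetric_dot 1 (Suc N) (\<lambda>\<beta>. \<Sum>w | w permutes {1..Suc N}. of_int (sign w) * G a (dot w \<beta>))"
    by (rule antisymmetric_dot_sum)
  show "antisymmetric_dot 1 (Suc N) (\<lambda>_. 0)" by (simp add: antisymmetric_dot_def)
  show "\<forall>i \<in> {1..Suc N}. 0 < \<beta> i + int (Suc N) - int i" using \<beta> by blast
  show "\<forall>i \<in> {1..Suc N}. 0 < dot u \<beta> i + int (Suc N) - int i"
    if u: "u permutes {1..Suc N}" and \<beta>: "\<forall>i \<in> {1..Suc N}. 0 < \<beta> i + int (Suc N) - int i" for u \<beta>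
  proof
    fix i assume "i \<in> {1..Suc N}"
    then have "u i \<in> {1..Suc N}" using permutes_in_image[OF u] by simp
    then have "0 < \<beta> (u i) + int (Suc N) - int (u i)" using \<beta> by blast
    then show "0 < dot u \<beta> i + int (Suc N) - int i" by (simp add: dot_def)
  qed
next
  fix \<beta> :: "nat \<Rightarrow> int"
  assume \<beta>: "\<forall>i \<in> {1..Suc N}. 0 < \<beta> i + int (Suc N) - int i"
    and dec: "\<And>i. 1 \<le> i \<Longrightarrow> i < Suc N \<Longrightarrow> \<beta> (Suc i) \<le> \<beta> i"
  have "(\<Sum>w | w permutes {1..Suc N}. of_int (sign w) * G a (dot w \<beta>)) =
    (\<Sum>rs | rs \<in> fillings n (content a) \<beta> \<and> True \<and> lattice_rows 1 (Suc N) rs. weighted a rs)"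
    unfolding G_def using a N dec weighted_raise by (intro signed_sum_lattice) auto
  also have "{rs. rs \<in> fillings n (content a) \<beta> \<and> True \<and> lattice_rows 1 (Suc N) rs} = {}"
  proof -
    have False if rs: "rs \<in> fillings n (content a) \<beta>" and lat: "lattice_rows 1 (Suc N) rs" for rs
    proof -
      have "int (size (rs (Suc N))) = \<beta> (Suc N)" using rs a N by (simp add: fillings_def)
      moreover have "0 < \<beta> (Suc N)" using \<beta>[rule_format, of "Suc N"] by simp
      ultimately have "rs (Suc N) \<noteq> {#}" by auto
      then obtain z where z: "z \<in># rs (Suc N)" by blast
      have "a + Suc N \<le> z"
        using lattice_rows_letters[OF lat _ _ _ z, of a] fillings_letter[OF rs, of _ 1] by fastforce
      moreover have "z \<le> n" using fillings_letter[OF rs z] by simp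
      ultimately show False using N a by simp
    qed
    then show ?thesis by blast
  qed
  finally show "(\<Sum>w | w permutes {1..Suc N}. of_int (sign w) * G a (dot w \<beta>)) = 0" by simp
qed

text \<open>The expected value when the rows t+1..a of roots are expanded: row i has to give away
  \<open>\<beta> i - \<gamma> i\<close> units, each with a factor q, and becomes a row of that size
  in \<open>G\<close>.\<close>

definition shifted :: "nat \<Rightarrow> nat \<Rightarrow> (nat \<Rightarrow> int) \<Rightarrow> int fps" where
  "shifted a t \<beta> = fps_X ^ nat (\<Sum>i = Suc t..a. \<beta> i - int (\<gamma> i)) * G a (\<lambda>i. if i \<le> a then \<beta> i - int (\<gamma> i) else \<beta> i)"

abbreviation series :: "nat \<Rightarrow> nat \<Rightarrow> laurent fps" where
  "series a t \<equiv> root_series n (\<lambda>i. int (\<gamma> i)) a t"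

text \<open>The inductive statement. The first \<open>t\<close> entries must equal \<gamma>, because
  no remaining root involves the variables x_1, ..., x_t. The bound on the block is what the Pieri
  rule requires, and it is stable under the dot action.\<close>

definition reduces :: "nat \<Rightarrow> nat \<Rightarrow> bool" where
  "reduces a t \<longleftrightarrow> (\<forall>\<beta>. (\<forall>i \<in> {Suc a..n}. 0 \<le> \<beta> i + int n - int i) \<longrightarrow>
     (\<Sum>w | w permutes {Suc a..n}. of_int (sign w) * coeffs_at n (series a t) (dot w \<beta>)) =
     (if \<forall>i \<in> {1..t}. \<beta> i = int (\<gamma> i) then \<Sum>w | w permutes {Suc a..n}. of_int (sign w) * shifted a t (dot w \<beta>) else 0))"

lemma dot_bound:
  assumes u: "u permutes {lo..hi}" and \<beta>: "\<forall>i \<in> {lo..hi}. 0 \<le> \<beta> i + int n - int i"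
  shows "\<forall>i \<in> {lo..hi}. 0 \<le> dot u \<beta> i + int n - int i"
proof
  fix i assume "i \<in> {lo..hi}"
  then have "u i \<in> {lo..hi}" using permutes_in_image[OF u] by simp
  then have "0 \<le> \<beta> (u i) + int n - int (u i)" using \<beta> by blast
  then show "0 \<le> dot u \<beta> i + int n - int i" by (simp add: dot_def)
qed

lemma content_n: "content n = {#}"
  by (simp add: content_def)

lemma G_n: "G n (\<lambda>_. 0) = 1"
proof -
  have "rs = (\<lambda>_. {#})" if "rs \<in> fillings n {#} (\<lambda>_. 0)" for rs
  proof
    fix i show "rs i = {#}" using that by (cases "i \<in> {1..n}") (auto simp: fillings_def)
  qed
  then have "fillings n {#} (\<lambda>_. 0) = {\<lambda>_. {#}}" by (auto simp: fillings_def)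
  moreover have "word 1 n (\<lambda>_. {#}) = []" by (rule word_rows_empty) simp
  ultimately show ?thesis by (simp add: G_def content_n weighted_def charge.simps[of "[]"])
qed

lemma reduces_n: "reduces n n"
  unfolding reduces_def
proof (intro allI impI)
  fix \<beta> :: "nat \<Rightarrow> int"
  have id: "{w. w permutes {Suc n..n}} = {id}" by simp
  have "G n (\<lambda>i. if i \<le> n then \<beta> i - int (\<gamma> i) else \<beta> i) = 1" if "\<forall>i \<in> {1..n}. \<beta> i = int (\<gamma> i)"
    using G_cong[of "\<lambda>i. if i \<le> n then \<beta> i - int (\<gamma> i) else \<beta> i" "\<lambda>_. 0" n] that G_n by auto
  then show "(\<Sum>w | w permutes {Suc n..n}. of_int (sign w) * coeffs_at n (series n n) (dot w \<beta>)) =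
     (if \<forall>i \<in> {1..n}. \<beta> i = int (\<gamma> i) then \<Sum>w | w permutes {Suc n..n}. of_int (sign w) * shifted n n (dot w \<beta>) else 0)"
    unfolding id by (simp add: coeffs_at_root_series_n shifted_def)
qed

text \<open>Row t+1 of the roots distributes the k units by which entry t+1 exceeds \<gamma> over
  the block a+1..n; the Pieri rule collects them again as a row of size k in
  \<open>G\<close>.\<close>

lemma reduces_step:
  assumes ta: "t < a" "a \<le> n" and red: "reduces a (Suc t)"
  shows "reduces a t"
  unfolding reduces_def
proof (intro allI impI)
  fix \<beta> :: "nat \<Rightarrow> int"
  assume \<beta>: "\<forall>i \<in> {Suc a..n}. 0 \<le> \<beta> i + int n - int i"
  let ?W = "{w. w permutes {Suc a..n}}"
  define B where "B i = (if i \<le> a then \<beta> i - int (\<gamma> i) else \<beta> i)" for i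
  have fix_le: "dot w \<beta>' i = \<beta>' i" if "w \<in> ?W" "i \<le> a" for w i \<beta>'
    using that by (auto intro: dot_not_in)
  have wB: "(\<lambda>i. if i \<le> a then dot w \<beta> i - int (\<gamma> i) else dot w \<beta> i) = dot w B" if w: "w \<in> ?W" for w
  proof
    fix i
    have w': "w permutes {Suc a..n}" using w by simp
    show "(if i \<le> a then dot w \<beta> i - int (\<gamma> i) else dot w \<beta> i) = dot w B i"
    proof (cases "i \<le> a")
      case True then show ?thesis using fix_le[OF w, of i] by (simp add: B_def)
    next
      case False
      then have "\<not> w i \<le> a" using permutes_in_image[OF w', of i] permutes_not_in[OF w', of i] by (cases "i \<in> {Suc a..n}") auto
      then show ?thesis using False by (simp add: B_def dot_def)
    qed
  qed
  have sh: "shifted a t (dot w \<beta>) = fps_X ^ nat (\<Sum>i = Suc t..a. B i) * G a (dot w B)" if w: "w \<in> ?W" for w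
  proof -
    have "(\<Sum>i = Suc t..a. dot w \<beta> i - int (\<gamma> i)) = (\<Sum>i = Suc t..a. B i)"
      by (rule sum.cong) (use fix_le[OF w] in \<open>auto simp: B_def\<close>)
    then show ?thesis unfolding shifted_def wB[OF w] by simp
  qed
  show "(\<Sum>w \<in> ?W. of_int (sign w) * coeffs_at n (series a t) (dot w \<beta>)) =
     (if \<forall>i \<in> {1..t}. \<beta> i = int (\<gamma> i) then \<Sum>w \<in> ?W. of_int (sign w) * shifted a t (dot w \<beta>) else 0)"
  \<comment> \<open>The row series can only raise the exponent of x_(t+1) above \<gamma>, and a row
    of negative size has no fillings. So both sides vanish if the inequality fails.\<close>
  proof (cases "int (\<gamma> (Suc t)) \<le> \<beta> (Suc t)")
    case False
    have "coeffs_at n (series a t) (dot w \<beta>) = 0" if w: "w \<in> ?W" for w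
      using False fix_le[OF w, of "Suc t"] ta by (simp add: coeffs_at_root_series_step[OF ta])
    moreover have "shifted a t (dot w \<beta>) = 0" if w: "w \<in> ?W" for w
    proof -
      have "dot w B (Suc t) < 0" using False fix_le[OF w, of "Suc t"] ta by (simp add: B_def)
      then show ?thesis unfolding sh[OF w] using G_neg[of "Suc t" "dot w B" a] ta by simp
    qed
    ultimately show ?thesis by simp
  next
    case True
    then obtain k where k: "\<beta> (Suc t) - int (\<gamma> (Suc t)) = int k" by (metis diff_ge_0_iff_ge zero_le_imp_eq_int)
    define b where "b c = (\<lambda>l. if l = Suc t then int (\<gamma> (Suc t)) else \<beta> l + int (c l))" for c :: "nat \<Rightarrow> nat"
    let ?C = "comps {Suc a..n} k"
    \<comment> \<open>The compositions are renamed by \<open>w\<close>, so that the units are added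
      before the dot action instead of after it.\<close>
    have row: "coeffs_at n (series a t) (dot w \<beta>) = fps_X ^ k * (\<Sum>c \<in> ?C. coeffs_at n (series a (Suc t)) (dot w (b c)))" if w: "w \<in> ?W" for w
    proof -
      have w': "w permutes {Suc a..n}" using w by simp
      have i: "\<And>x. inv w (w x) = x" "\<And>x. w (inv w x) = x" using permutes_inverses[OF w'] by auto
      have wt: "w l = Suc t \<longleftrightarrow> l = Suc t" for l using permutes_not_in[OF w', of "Suc t"] i(1) ta by (metis atLeastAtMost_iff less_eq_Suc_le not_le)
      have mem: "w x \<in> {Suc a..n} \<longleftrightarrow> x \<in> {Suc a..n}" for x by (rule permutes_in_image[OF w'])
      have mem': "inv w x \<in> {Suc a..n} \<longleftrightarrow> x \<in> {Suc a..n}" for x by (rule permutes_in_image[OF permutes_inv[OF w']])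
      have "coeffs_at n (series a t) (dot w \<beta>) = fps_X ^ k * (\<Sum>c \<in> ?C. coeffs_at n (series a (Suc t)) (\<lambda>l. if l = Suc t then int (\<gamma> (Suc t)) else dot w \<beta> l + int (c l)))"
        unfolding coeffs_at_root_series_step[OF ta] using fix_le[OF w, of "Suc t"] ta True k by simp
      also have "(\<Sum>c \<in> ?C. coeffs_at n (series a (Suc t)) (\<lambda>l. if l = Suc t then int (\<gamma> (Suc t)) else dot w \<beta> l + int (c l))) =
         (\<Sum>c \<in> ?C. coeffs_at n (series a (Suc t)) (dot w (b c)))"
      proof (rule sum.reindex_bij_witness[where i = "\<lambda>c. c \<circ> w" and j = "\<lambda>c. c \<circ> inv w"])
        fix c :: "nat \<Rightarrow> nat"
        show "c \<circ> inv w \<circ> w = c" "c \<circ> w \<circ> inv w = c" using i by (auto simp: fun_eq_iff)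
        show "c \<circ> inv w \<in> ?C" if "c \<in> ?C"
          using that mem' sum.permute[OF permutes_inv[OF w'], of c] by (simp add: comps_def del: atLeastAtMost_iff)
        show "c \<circ> w \<in> ?C" if "c \<in> ?C"
          using that mem sum.permute[OF w', of c] by (simp add: comps_def del: atLeastAtMost_iff)
        have "dot w (b (c \<circ> inv w)) = (\<lambda>l. if l = Suc t then int (\<gamma> (Suc t)) else dot w \<beta> l + int (c l))"
        proof
          fix l
          show "dot w (b (c \<circ> inv w)) l = (if l = Suc t then int (\<gamma> (Suc t)) else dot w \<beta> l + int (c l))"
            using wt[of l] wt[of "Suc t"] by (auto simp: dot_def b_def i)
        qed
        then show "coeffs_at n (series a (Suc t)) (dot w (b (c \<circ> inv w))) = coeffs_at n (series a (Suc t)) (\<lambda>l. if l = Suc t then int (\<gamma> (Suc t)) else dot w \<beta> l + int (c l))"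
          by simp
      qed
      finally show ?thesis .
    qed
    define U where "U c = (\<Sum>w \<in> ?W. of_int (sign w) * G a (dot w ((\<lambda>i. B i + int (c i))(Suc t := 0))))" for c :: "nat \<Rightarrow> nat"
    have c0: "c i = 0" if "c \<in> ?C" "i \<le> a" for c i using that by (auto simp: comps_def)
    have sum_b: "(\<Sum>w \<in> ?W. of_int (sign w) * coeffs_at n (series a (Suc t)) (dot w (b c))) =
       (if \<forall>i \<in> {1..t}. \<beta> i = int (\<gamma> i) then fps_X ^ nat (\<Sum>i = Suc (Suc t)..a. B i) * U c else 0)" if c: "c \<in> ?C" for c
    proof -
      have pos: "\<forall>i \<in> {Suc a..n}. 0 \<le> b c i + int n - int i"
      proof
        fix i assume i: "i \<in> {Suc a..n}"
        then have "0 \<le> \<beta> i + int n - int i" using \<beta> by blast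
        then show "0 \<le> b c i + int n - int i" using i ta by (simp add: b_def)
      qed
      have cond: "(\<forall>i \<in> {1..Suc t}. b c i = int (\<gamma> i)) \<longleftrightarrow> (\<forall>i \<in> {1..t}. \<beta> i = int (\<gamma> i))"
      proof -
        have bi: "b c i = \<beta> i" if "i \<in> {1..t}" for i using that c0[OF c, of i] ta by (simp add: b_def)
        have bS: "b c (Suc t) = int (\<gamma> (Suc t))" by (simp add: b_def)
        have "{1..Suc t} = insert (Suc t) {1..t}" by auto
        then show ?thesis using bS bi by (simp only: ball_simps(7) simp_thms) (metis bi)
      qed
      have shb: "shifted a (Suc t) (dot w (b c)) = fps_X ^ nat (\<Sum>i = Suc (Suc t)..a. B i) * G a (dot w ((\<lambda>i. B i + int (c i))(Suc t := 0)))" if w: "w \<in> ?W" for w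
      proof -
        have w': "w permutes {Suc a..n}" using w by simp
        have "(\<Sum>i = Suc (Suc t)..a. dot w (b c) i - int (\<gamma> i)) = (\<Sum>i = Suc (Suc t)..a. B i)"
          by (rule sum.cong) (use fix_le[OF w] c0[OF c] in \<open>auto simp: B_def b_def\<close>)
        moreover have "(\<lambda>i. if i \<le> a then dot w (b c) i - int (\<gamma> i) else dot w (b c) i) = dot w ((\<lambda>i. B i + int (c i))(Suc t := 0))"
        proof
          fix i
          show "(if i \<le> a then dot w (b c) i - int (\<gamma> i) else dot w (b c) i) = dot w ((\<lambda>i. B i + int (c i))(Suc t := 0)) i"
          proof (cases "i \<le> a")
            case True
            then show ?thesis using fix_le[OF w True] c0[OF c True] by (simp add: B_def b_def)
          next
            case False
            then have "\<not> w i \<le> a" using permutes_in_image[OF w', of i] permutes_not_in[OF w', of i] by (cases "i \<in> {Suc a..n}") auto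
            then show ?thesis using False ta by (auto simp: B_def b_def dot_def)
          qed
        qed
        ultimately show ?thesis unfolding shifted_def by simp
      qed
      have "(\<Sum>w \<in> ?W. of_int (sign w) * shifted a (Suc t) (dot w (b c))) = fps_X ^ nat (\<Sum>i = Suc (Suc t)..a. B i) * U c"
        unfolding U_def sum_distrib_left by (rule sum.cong[OF refl]) (simp add: shb mult_ac)
      then show ?thesis using red pos cond by (simp add: reduces_def)
    qed
    have "(\<Sum>w \<in> ?W. of_int (sign w) * coeffs_at n (series a t) (dot w \<beta>)) =
       (\<Sum>w \<in> ?W. \<Sum>c \<in> ?C. fps_X ^ k * (of_int (sign w) * coeffs_at n (series a (Suc t)) (dot w (b c))))"
      by (rule sum.cong[OF refl]) (simp add: row sum_distrib_left mult_ac)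
    also have "\<dots> = (\<Sum>c \<in> ?C. \<Sum>w \<in> ?W. fps_X ^ k * (of_int (sign w) * coeffs_at n (series a (Suc t)) (dot w (b c))))"
      by (rule sum.swap)
    also have "\<dots> = (\<Sum>c \<in> ?C. fps_X ^ k * (if \<forall>i \<in> {1..t}. \<beta> i = int (\<gamma> i) then fps_X ^ nat (\<Sum>i = Suc (Suc t)..a. B i) * U c else 0))"
      by (rule sum.cong[OF refl]) (simp add: sum_b flip: sum_distrib_left)
    finally have L: "(\<Sum>w \<in> ?W. of_int (sign w) * coeffs_at n (series a t) (dot w \<beta>)) = \<dots>" .
    show ?thesis
    proof (cases "\<forall>i \<in> {1..t}. \<beta> i = int (\<gamma> i)")
      case False
      show ?thesis unfolding L if_not_P[OF False] by simp
    next
      case eqs: True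
      have p: "(\<Sum>w \<in> ?W. of_int (sign w) * G a (dot w B)) = (\<Sum>c \<in> ?C. U c)"
        unfolding U_def
      proof (rule pieri_block[where N = "n - a"])
        show "Suc t \<in> {1..a}" "a \<le> n" "n - a = n - a" using ta by auto
        show "B (Suc t) = int k" using ta k by (simp add: B_def)
        show "0 \<le> B i + int n - int i" if "i \<in> {Suc a..n}" for i using \<beta> that by (simp add: B_def)
        show "(\<Sum>w | w permutes {1..Suc (n - a)}. of_int (sign w) * G a (dot w \<beta>)) = 0"
          if "\<And>i. i \<in> {1..Suc (n - a)} \<Longrightarrow> 0 < \<beta> i + int (Suc (n - a)) - int i" for \<beta>
          using that ta by (intro G_alternating_vanish) auto
      qed (use G_permute G_neg in blast)+
      have R: "(\<Sum>w \<in> ?W. of_int (sign w) * shifted a t (dot w \<beta>)) = fps_X ^ nat (\<Sum>i = Suc t..a. B i) * (\<Sum>c \<in> ?C. U c)"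
        unfolding p[symmetric] sum_distrib_left by (rule sum.cong[OF refl]) (simp add: sh mult_ac)
      have L': "(\<Sum>w \<in> ?W. of_int (sign w) * coeffs_at n (series a t) (dot w \<beta>)) = fps_X ^ (k + nat (\<Sum>i = Suc (Suc t)..a. B i)) * (\<Sum>c \<in> ?C. U c)"
        unfolding L if_P[OF eqs] by (simp only: power_add mult.assoc sum_distrib_left)
      have s: "(\<Sum>i = Suc t..a. B i) = int k + (\<Sum>i = Suc (Suc t)..a. B i)"
        using ta k by (simp add: sum.atLeast_Suc_atMost B_def)
      \<comment> \<open>The exponents agree as integers. If a negative summand could spoil the
        conversion by \<open>nat\<close>, then \<open>G\<close> vanishes because of a negative row
        size.\<close>
      have "fps_X ^ (k + nat (\<Sum>i = Suc (Suc t)..a. B i)) * (\<Sum>c \<in> ?C. U c) = fps_X ^ nat (\<Sum>i = Suc t..a. B i) * (\<Sum>c \<in> ?C. U c)"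
      proof (cases "\<forall>i \<in> {Suc (Suc t)..a}. 0 \<le> B i")
        case True
        then have "0 \<le> (\<Sum>i = Suc (Suc t)..a. B i)" by (intro sum_nonneg) auto
        then show ?thesis unfolding s by (simp add: nat_add_distrib)
      next
        case False
        then obtain i where i: "i \<in> {Suc (Suc t)..a}" "B i < 0" unfolding not_le[symmetric] by blast
        have "G a (dot w B) = 0" if w: "w \<in> ?W" for w
          using G_neg[of i "dot w B" a] fix_le[OF w, of i B] i ta by simp
        then have "(\<Sum>c \<in> ?C. U c) = 0" unfolding p[symmetric] by (intro sum.neutral) simp
        then show ?thesis by simp
      qed
      then show ?thesis unfolding L' R using eqs by simp
    qed
  qed
qed

text \<open>Columns increase strictly, so the smallest letter a+1 occurs only in row a+1, the first
  row that may be nonempty; hence all its copies are there.\<close>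

lemma lattice_frozen:
  assumes an: "a < n" and rs: "rs \<in> fillings n (content a) \<beta>" and lat: "lattice_rows (Suc a) n rs" and \<beta>: "\<forall>i \<in> {1..a}. \<beta> i = 0"
  shows "frozen a (Suc a) rs"
  unfolding frozen_def
proof
  have low: "i \<le> z" if i: "i \<in> {1..n}" and z: "z \<in># rs i" for i z
  proof (cases "i \<le> a")
    case True
    then have "int (size (rs i)) = 0" using rs i \<beta> by (simp add: fillings_def)
    then show ?thesis using z by simp
  next
    case False
    then show ?thesis
      using lattice_rows_letters[OF lat _ _ _ z, of 0] fillings_letter[OF rs, of _ "Suc a"] i by fastforce
  qed
  have other: "Suc a \<notin># rs i" if i: "i \<in> {1..n}" "i \<noteq> Suc a" for i
  proof
    assume z: "Suc a \<in># rs i"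
    then have "i \<le> a" using low[OF i(1) z] i by simp
    then have "int (size (rs i)) = 0" using rs i \<beta> by (simp add: fillings_def)
    then show False using z by simp
  qed
  fix i assume i: "i \<in> {1..n}"
  show "{#z \<in># rs i. z \<le> Suc a#} = (if a < i \<and> i \<le> Suc a then replicate_mset (\<gamma> i) i else {#})"
  proof (cases "i = Suc a")
    case True
    have "\<gamma> (Suc a) = count (\<Sum>i = 1..n. rs i) (Suc a)" using rs an by (simp add: fillings_def count_content)
    also have "\<dots> = (\<Sum>i = 1..n. count (rs i) (Suc a))" by (simp add: count_sum)
    also have "\<dots> = (\<Sum>i = 1..n. if i = Suc a then count (rs i) (Suc a) else 0)"
      by (rule sum.cong[OF refl]) (use other in \<open>auto simp: not_in_iff\<close>)
    also have "\<dots> = count (rs (Suc a)) (Suc a)" using an by (simp add: sum.delta)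
    finally have c: "count (rs (Suc a)) (Suc a) = \<gamma> (Suc a)" ..
    have "{#z \<in># rs i. z \<le> Suc a#} = {#z \<in># rs i. z = Suc a#}"
    proof (intro filter_mset_cong refl)
      fix x assume "x \<in># rs i"
      then have "i \<le> x" by (rule low[OF i])
      then show "x \<le> Suc a \<longleftrightarrow> x = Suc a" using True by auto
    qed
    then show ?thesis using True c by (simp add: filter_eq_replicate_mset)
  next
    case False
    have "z > Suc a" if "z \<in># rs i" for z
      using fillings_letter[OF rs that] other[OF i False] that by (cases "z = Suc a") auto
    then have "set_mset {#z \<in># rs i. z \<le> Suc a#} = {}" by fastforce
    then have "{#z \<in># rs i. z \<le> Suc a#} = {#}" by (simp only: set_mset_eq_empty_iff)
    then show ?thesis using False by auto
  qed
qed

text \<open>Freezing one letter does not affect the signed sum: for decreasing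
  \<open>\<beta>\<close> both sides count the same lattice fillings, and both are antisymmetric
  under the dot action.\<close>

lemma alternating_frozen:
  assumes an: "a < n" and \<beta>: "\<forall>i \<in> {1..a}. \<beta> i = 0"
  shows "(\<Sum>w | w permutes {Suc a..n}. of_int (sign w) * (\<Sum>rs | rs \<in> fillings n (content a) (dot w \<beta>) \<and> frozen a (Suc a) rs. weighted a rs)) =
    (\<Sum>w | w permutes {Suc a..n}. of_int (sign w) * G a (dot w \<beta>))"
proof (rule antisymmetric_dot_eqI[where
      A = "\<lambda>\<beta>. \<Sum>w | w permutes {Suc a..n}. of_int (sign w) * (\<Sum>rs | rs \<in> fillings n (content a) (dot w \<beta>) \<and> frozen a (Suc a) rs. weighted a rs)"
      and B = "\<lambda>\<beta>. \<Sum>w | w permutes {Suc a..n}. of_int (sign w) * G a (dot w \<beta>)"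
      and lo = "Suc a" and hi = n and P = "\<lambda>\<beta>. \<forall>i \<in> {1..a}. \<beta> i = 0"])
  show "antisymmetric_dot (Suc a) n (\<lambda>\<beta>. \<Sum>w | w permutes {Suc a..n}. of_int (sign w) * (\<Sum>rs | rs \<in> fillings n (content a) (dot w \<beta>) \<and> frozen a (Suc a) rs. weighted a rs))"
    by (rule antisymmetric_dot_sum)
  show "antisymmetric_dot (Suc a) n (\<lambda>\<beta>. \<Sum>w | w permutes {Suc a..n}. of_int (sign w) * G a (dot w \<beta>))"
    by (rule antisymmetric_dot_sum)
  show "\<forall>i \<in> {1..a}. \<beta> i = 0" by (rule \<beta>)
  show "\<forall>i \<in> {1..a}. dot u \<beta> i = 0" if "u permutes {Suc a..n}" "\<forall>i \<in> {1..a}. \<beta> i = 0" for u \<beta>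
    using that dot_not_in[of u "{Suc a..n}"] by auto
next
  fix \<beta> :: "nat \<Rightarrow> int"
  assume \<beta>: "\<forall>i \<in> {1..a}. \<beta> i = 0" and dec: "\<And>i. Suc a \<le> i \<Longrightarrow> i < n \<Longrightarrow> \<beta> (Suc i) \<le> \<beta> i"
  have "(\<Sum>w | w permutes {Suc a..n}. of_int (sign w) * (\<Sum>rs | rs \<in> fillings n (content a) (dot w \<beta>) \<and> frozen a (Suc a) rs. weighted a rs)) =
    (\<Sum>rs | rs \<in> fillings n (content a) \<beta> \<and> frozen a (Suc a) rs \<and> lattice_rows (Suc a) n rs. weighted a rs)"
  proof (rule signed_sum_lattice)
    show "frozen a (Suc a) (raise i rs) \<longleftrightarrow> frozen a (Suc a) rs" if "violation (Suc a) n rs v i" "2 \<le> row_max_excess i rs" for rs v i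
      using that by (intro frozen_raise) (auto simp: violation_def)
  qed (use dec weighted_raise in auto)
  also have "\<dots> = (\<Sum>rs | rs \<in> fillings n (content a) \<beta> \<and> True \<and> lattice_rows (Suc a) n rs. weighted a rs)"
    using lattice_frozen[OF an _ _ \<beta>] by (intro sum.cong) auto
  also have "\<dots> = (\<Sum>w | w permutes {Suc a..n}. of_int (sign w) * G a (dot w \<beta>))"
    unfolding G_def
    by (rule signed_sum_lattice[symmetric]) (use dec weighted_raise in auto)
  finally show "(\<Sum>w | w permutes {Suc a..n}. of_int (sign w) * (\<Sum>rs | rs \<in> fillings n (content a) (dot w \<beta>) \<and> frozen a (Suc a) rs. weighted a rs)) =
    (\<Sum>w | w permutes {Suc a..n}. of_int (sign w) * G a (dot w \<beta>))" .
qed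

text \<open>Lowers the first parameter by one. Averaging enlarges the group by the position a+1. The
  value supplied by \<open>reduces (Suc a) a\<close> is a sum over fillings with the letter a+1
  frozen in row a+1, and this freezing is free in the signed sum.\<close>

lemma reduces_diagonal:
  assumes an: "a < n" and red: "reduces (Suc a) a"
  shows "reduces a a"
  unfolding reduces_def
proof (intro allI impI)
  fix \<beta> :: "nat \<Rightarrow> int"
  assume \<beta>: "\<forall>i \<in> {Suc a..n}. 0 \<le> \<beta> i + int n - int i"
  let ?W = "{w. w permutes {Suc a..n}}"
  define F where "F \<beta> = (if \<forall>i \<in> {1..a}. \<beta> i = int (\<gamma> i) then shifted (Suc a) a \<beta> else 0)" for \<beta>
  have cond: "(\<forall>i \<in> {1..a}. dot w \<beta> i = int (\<gamma> i)) \<longleftrightarrow> (\<forall>i \<in> {1..a}. \<beta> i = int (\<gamma> i))" if "w permutes {b..n}" "a < b" for w b \<beta>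
    using that dot_not_in[of w "{b..n}" _ \<beta>] by auto
  have "(\<Sum>w \<in> ?W. of_int (sign w) * coeffs_at n (series a a) (dot w \<beta>)) = (\<Sum>w \<in> ?W. of_int (sign w) * F (dot w \<beta>))"
  proof (rule signed_sum_subgroup[where lo' = "Suc (Suc a)" and P = "\<lambda>\<beta>. \<forall>i \<in> {Suc a..n}. 0 \<le> \<beta> i + int n - int i"])
    show "\<forall>i \<in> {Suc a..n}. 0 \<le> dot u \<beta> i + int n - int i" if "u permutes {Suc a..n}" "\<forall>i \<in> {Suc a..n}. 0 \<le> \<beta> i + int n - int i" for u \<beta>
      using that by (rule dot_bound)
    fix \<beta> :: "nat \<Rightarrow> int" assume \<beta>: "\<forall>i \<in> {Suc a..n}. 0 \<le> \<beta> i + int n - int i"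
    then have "\<forall>i \<in> {Suc (Suc a)..n}. 0 \<le> \<beta> i + int n - int i" by simp
    then have "(\<Sum>v | v permutes {Suc (Suc a)..n}. of_int (sign v) * coeffs_at n (series a a) (dot v \<beta>)) =
       (if \<forall>i \<in> {1..a}. \<beta> i = int (\<gamma> i) then \<Sum>v | v permutes {Suc (Suc a)..n}. of_int (sign v) * shifted (Suc a) a (dot v \<beta>) else 0)"
      using red unfolding root_series_Suc reduces_def by blast
    also have "\<dots> = (\<Sum>v | v permutes {Suc (Suc a)..n}. of_int (sign v) * F (dot v \<beta>))"
    proof -
      define Z where "Z \<longleftrightarrow> (\<forall>i \<in> {1..a}. \<beta> i = int (\<gamma> i))"
      have "F (dot v \<beta>) = (if Z then shifted (Suc a) a (dot v \<beta>) else 0)" if "v permutes {Suc (Suc a)..n}" for v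
        unfolding F_def Z_def using cond[OF that] by simp
      then show ?thesis unfolding Z_def[symmetric] by (cases Z) simp_all
    qed
    finally show "(\<Sum>v | v permutes {Suc (Suc a)..n}. of_int (sign v) * coeffs_at n (series a a) (dot v \<beta>)) =
      (\<Sum>v | v permutes {Suc (Suc a)..n}. of_int (sign v) * F (dot v \<beta>))" .
  qed (use \<beta> in auto)
  also have "\<dots> = (if \<forall>i \<in> {1..a}. \<beta> i = int (\<gamma> i) then \<Sum>w \<in> ?W. of_int (sign w) * shifted a a (dot w \<beta>) else 0)"
  proof (cases "\<forall>i \<in> {1..a}. \<beta> i = int (\<gamma> i)")
    case False
    have "F (dot w \<beta>) = 0" if "w \<in> ?W" for w
    proof -
      have "\<not> (\<forall>i \<in> {1..a}. dot w \<beta> i = int (\<gamma> i))" using cond[OF _ lessI, of w] that False by blast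
      then show ?thesis unfolding F_def by (rule if_not_P)
    qed
    then show ?thesis unfolding if_not_P[OF False] by simp
  next
    case True
    \<comment> \<open>Since the first \<open>a\<close> entries of \<open>\<beta>\<close> equal
      \<gamma>, the corresponding rows have size 0 in \<open>G\<close>; \<open>z\<close> records
      these sizes.\<close>
    define z where "z i = (if i \<le> a then 0 else \<beta> i)" for i
    have dz: "dot w z i = (if i \<le> a then 0 else dot w \<beta> i)" if w: "w \<in> ?W" for w i
    proof (cases "i \<le> a")
      case True
      then have "w i = i" using w by (auto intro: permutes_not_in)
      then show ?thesis using True by (simp add: dot_def z_def)
    next
      case False
      have w': "w permutes {Suc a..n}" using w by simp
      have "\<not> w i \<le> a" using False permutes_in_image[OF w', of i] permutes_not_in[OF w', of i] by (cases "i \<in> {Suc a..n}") auto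
      then show ?thesis using False by (simp add: dot_def z_def)
    qed
    have dg: "dot w \<beta> i = int (\<gamma> i)" if "w \<in> ?W" "i \<in> {1..a}" for w i
      using cond[of w "Suc a" \<beta>] that True by simp
    have "(\<Sum>w \<in> ?W. of_int (sign w) * F (dot w \<beta>)) =
      (\<Sum>w \<in> ?W. of_int (sign w) * (\<Sum>rs | rs \<in> fillings n (content a) (dot w z) \<and> frozen a (Suc a) rs. weighted a rs))"
    proof (rule sum.cong[OF refl])
      fix w assume w: "w \<in> ?W"
      have "F (dot w \<beta>) = shifted (Suc a) a (dot w \<beta>)" unfolding F_def using dg[OF w] by simp
      also have "\<dots> = fps_X ^ nat (\<Sum>i = Suc a..Suc a. dot w z i - int (\<gamma> i)) * G (Suc a) (\<lambda>i. if a < i \<and> i \<le> Suc a then dot w z i - int (\<gamma> i) else dot w z i)"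
        unfolding shifted_def using dz[OF w] dg[OF w] by (intro arg_cong2[where f = times] G_cong) auto
      also have "\<dots> = (\<Sum>rs | rs \<in> fillings n (content a) (dot w z) \<and> frozen a (Suc a) rs. weighted a rs)"
        using an dz[OF w] by (intro frozen_sum[symmetric]) auto
      finally show "of_int (sign w) * F (dot w \<beta>) = of_int (sign w) * (\<Sum>rs | rs \<in> fillings n (content a) (dot w z) \<and> frozen a (Suc a) rs. weighted a rs)" by simp
    qed
    also have "\<dots> = (\<Sum>w \<in> ?W. of_int (sign w) * G a (dot w z))"
      by (rule alternating_frozen[OF an]) (simp add: z_def)
    also have "\<dots> = (\<Sum>w \<in> ?W. of_int (sign w) * shifted a a (dot w \<beta>))"
    proof (rule sum.cong[OF refl])
      fix w assume w: "w \<in> ?W"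
      have "G a (dot w z) = G a (\<lambda>i. if i \<le> a then dot w \<beta> i - int (\<gamma> i) else dot w \<beta> i)"
        using dz[OF w] dg[OF w] by (intro G_cong) auto
      then show "of_int (sign w) * G a (dot w z) = of_int (sign w) * shifted a a (dot w \<beta>)" by (simp add: shifted_def)
    qed
    finally show ?thesis using True by simp
  qed
  finally show "(\<Sum>w \<in> ?W. of_int (sign w) * coeffs_at n (series a a) (dot w \<beta>)) =
    (if \<forall>i \<in> {1..a}. \<beta> i = int (\<gamma> i) then \<Sum>w \<in> ?W. of_int (sign w) * shifted a a (dot w \<beta>) else 0)" .
qed

lemma reduces_row: "t \<le> a \<Longrightarrow> a \<le> n \<Longrightarrow> reduces a a \<Longrightarrow> reduces a t"
proof (induction t rule: inc_induct)
  case (step t)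
  show ?case by (rule reduces_step) (use step in auto)
qed

lemma reduces_all: "a \<le> n \<Longrightarrow> reduces a a"
proof (induction a rule: inc_induct)
  case base show ?case by (rule reduces_n)
next
  case (step a)
  then show ?case using reduces_row[of a "Suc a"] by (intro reduces_diagonal) auto
qed

text \<open>The recursion stops at column m, and averaging over all positions turns the rows 1..m of
  \<open>G\<close> into rows with frozen letters 1..m. For several letters freezing is a genuine
  restriction, so it stays in the result.\<close>

lemma alternating_series:
  assumes m: "m \<le> n" and pos: "\<And>i. i \<in> {1..n} \<Longrightarrow> 0 \<le> \<beta> i" and dec: "\<And>i. 1 \<le> i \<Longrightarrow> i < n \<Longrightarrow> \<beta> (Suc i) \<le> \<beta> i"
  shows "(\<Sum>w | w permutes {1..n}. of_int (sign w) * coeffs_at n (series m 0) (dot w \<beta>)) =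
    (\<Sum>rs | rs \<in> fillings n (content 0) \<beta> \<and> frozen 0 m rs \<and> lattice_rows 1 n rs. weighted 0 rs)"
proof -
  have red: "reduces m 0" using reduces_row[OF _ m reduces_all[OF m], of 0] by simp
  have "(\<Sum>w | w permutes {1..n}. of_int (sign w) * coeffs_at n (series m 0) (dot w \<beta>)) = (\<Sum>w | w permutes {1..n}. of_int (sign w) * shifted m 0 (dot w \<beta>))"
  proof (rule signed_sum_subgroup[where lo' = "Suc m" and P = "\<lambda>\<beta>. \<forall>i \<in> {1..n}. 0 \<le> \<beta> i + int n - int i"])
    show "\<forall>i \<in> {1..n}. 0 \<le> dot u \<beta> i + int n - int i" if "u permutes {1..n}" "\<forall>i \<in> {1..n}. 0 \<le> \<beta> i + int n - int i" for u \<beta>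
      using that by (rule dot_bound)
    show "\<forall>i \<in> {1..n}. 0 \<le> \<beta> i + int n - int i"
    proof
      fix i assume "i \<in> {1..n}"
      then show "0 \<le> \<beta> i + int n - int i" using pos[of i] by simp
    qed
    fix \<beta> :: "nat \<Rightarrow> int" assume "\<forall>i \<in> {1..n}. 0 \<le> \<beta> i + int n - int i"
    then have "\<forall>i \<in> {Suc m..n}. 0 \<le> \<beta> i + int n - int i" by simp
    then show "(\<Sum>v | v permutes {Suc m..n}. of_int (sign v) * coeffs_at n (series m 0) (dot v \<beta>)) =
        (\<Sum>v | v permutes {Suc m..n}. of_int (sign v) * shifted m 0 (dot v \<beta>))"
      using red by (simp add: reduces_def)
  qed auto
  also have "\<dots> = (\<Sum>w | w permutes {1..n}. of_int (sign w) * (\<Sum>rs | rs \<in> fillings n (content 0) (dot w \<beta>) \<and> frozen 0 m rs. weighted 0 rs))"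
  proof (rule sum.cong[OF refl])
    fix w
    have "shifted m 0 (dot w \<beta>) = (\<Sum>rs | rs \<in> fillings n (content 0) (dot w \<beta>) \<and> frozen 0 m rs. weighted 0 rs)"
      unfolding shifted_def using m
      by (subst frozen_sum) (auto intro!: arg_cong2[where f = times] G_cong)
    then show "of_int (sign w) * shifted m 0 (dot w \<beta>) = of_int (sign w) * (\<Sum>rs | rs \<in> fillings n (content 0) (dot w \<beta>) \<and> frozen 0 m rs. weighted 0 rs)" by simp
  qed
  also have "\<dots> = (\<Sum>rs | rs \<in> fillings n (content 0) \<beta> \<and> frozen 0 m rs \<and> lattice_rows 1 n rs. weighted 0 rs)"
  proof (rule signed_sum_lattice)
    show "frozen 0 m (raise i rs) \<longleftrightarrow> frozen 0 m rs" if "violation 1 n rs v i" "2 \<le> row_max_excess i rs" for rs v i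
      using that by (intro frozen_raise) (auto simp: violation_def)
  qed (use dec weighted_raise in auto)
  finally show ?thesis .
qed

end


section \<open>Tableaux as fillings\<close>

text \<open>Rows are left-justified and sorted by construction, so only the column condition is left
  to \<open>lattice_rows\<close>.\<close>

definition tab :: "(nat \<Rightarrow> nat multiset) \<Rightarrow> tableau" where
  "tab rs = (\<lambda>(i, j). if 1 \<le> j \<and> j \<le> size (rs i) then Some (sorted_list_of_multiset (rs i) ! (j - 1)) else None)"

definition rows :: "tableau \<Rightarrow> nat \<Rightarrow> nat multiset" where
  "rows T i = mset (row_word T i)"

definition straight :: "tableau \<Rightarrow> bool" where
  "straight T \<longleftrightarrow> column_strict T \<and> (\<exists>\<mu>. has_shape T \<mu>)"

definition supported_rows :: "nat \<Rightarrow> (nat \<Rightarrow> nat multiset) \<Rightarrow> bool" where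
  "supported_rows N rs \<longleftrightarrow> (\<forall>i. i \<notin> {1..N} \<longrightarrow> rs i = {#})"

lemma tab_eq_Some: "tab rs (i, j) = Some z \<longleftrightarrow> 1 \<le> j \<and> j \<le> size (rs i) \<and> z = sorted_list_of_multiset (rs i) ! (j - 1)"
  by (auto simp: tab_def)

lemma dom_tab: "(i, j) \<in> dom (tab rs) \<longleftrightarrow> 1 \<le> j \<and> j \<le> size (rs i)"
  by (simp add: tab_def dom_def)

lemma row_word_interval:
  assumes "\<And>j. (i, j) \<in> dom T \<longleftrightarrow> 1 \<le> j \<and> j \<le> k"
  shows "row_word T i = map (\<lambda>j. the (T (i, Suc j))) [0..<k]"
proof -
  have "{j. (i, j) \<in> dom T} = {1..k}" using assms by auto
  moreover have "sorted_list_of_set {1..k} = map Suc [0..<k]"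
    by (simp add: map_Suc_upt sorted_list_of_set_range atLeastLessThanSuc_atLeastAtMost[symmetric] del: upt_Suc)
  ultimately show ?thesis by (simp add: row_word_def comp_def)
qed

lemma row_word_tab: "row_word (tab rs) i = sorted_list_of_multiset (rs i)"
proof -
  have "row_word (tab rs) i = map (\<lambda>j. the (tab rs (i, Suc j))) [0..<size (rs i)]"
    by (rule row_word_interval) (rule dom_tab)
  also have "\<dots> = map ((!) (sorted_list_of_multiset (rs i))) [0..<length (sorted_list_of_multiset (rs i))]"
    by (intro map_cong) (auto simp: tab_def length_sorted_list_of_multiset)
  also have "\<dots> = sorted_list_of_multiset (rs i)" by (rule map_nth)
  finally show ?thesis .
qed

lemma rows_tab: "rows (tab rs) = rs"
  by (rule ext) (simp add: rows_def row_word_tab)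

lemma sorted_list_of_subset:
  assumes "A \<subseteq> {1..N}"
  shows "sorted_list_of_set A = filter (\<lambda>i. i \<in> A) [1..<Suc N]"
proof (rule sorted_distinct_set_unique)
  have "finite A" using assms by (rule finite_subset) simp
  then show "set (sorted_list_of_set A) = set (filter (\<lambda>i. i \<in> A) [1..<Suc N])"
    using assms by (auto simp del: upt_Suc)
qed (simp_all add: sorted_wrt_filter del: upt_Suc)

lemma reading_word_rows:
  assumes "fst ` dom T \<subseteq> {1..N}"
  shows "reading_word T = concat (map (row_word T) (rev [1..<Suc N]))"
proof -
  let ?A = "fst ` dom T"
  have "reading_word T = concat (map (row_word T) (filter (\<lambda>i. i \<in> ?A) (rev [1..<Suc N])))"
    by (simp add: reading_word_def rev_filter sorted_list_of_subset[OF assms] del: upt_Suc)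
  moreover have "row_word T i = []" if "i \<notin> ?A" for i
  proof -
    have "{j. (i, j) \<in> dom T} = {}" using that by force
    then show ?thesis by (simp add: row_word_def)
  qed
  then have "concat (map (row_word T) (filter (\<lambda>i. i \<in> ?A) xs)) = concat (map (row_word T) xs)" for xs
    by (induction xs) auto
  ultimately show ?thesis by simp
qed

lemma reading_word_tab:
  assumes "supported_rows N rs"
  shows "reading_word (tab rs) = word 1 N rs"
proof -
  have "fst ` dom (tab rs) \<subseteq> {1..N}"
  proof
    fix i assume "i \<in> fst ` dom (tab rs)"
    then obtain j where "(i, j) \<in> dom (tab rs)" by force
    then have "rs i \<noteq> {#}" by (auto simp: dom_tab)
    then show "i \<in> {1..N}" using assms unfolding supported_rows_def by blast
  qed
  moreover have "row_word (tab rs) = (\<lambda>i. sorted_list_of_multiset (rs i))" by (rule ext) (rule row_word_tab)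
  ultimately show ?thesis unfolding word_def using reading_word_rows by metis
qed

lemma mset_reading_word:
  assumes "finite (dom T)"
  shows "mset (reading_word T) = (\<Sum>c \<in> dom T. {#the (T c)#})"
proof -
  let ?A = "fst ` dom T" and ?B = "\<lambda>i. {j. (i, j) \<in> dom T}"
  have finB: "finite (?B i)" for i
  proof (rule finite_subset)
    show "?B i \<subseteq> snd ` dom T" by force
  qed (use assms in simp)
  have row: "mset (row_word T i) = (\<Sum>j \<in> ?B i. {#the (T (i, j))#})" for i
  proof -
    have "mset (row_word T i) = sum_list (map (\<lambda>j. {#the (T (i, j))#}) (sorted_list_of_set (?B i)))"
    proof -
      have "mset (map f xs) = sum_list (map (\<lambda>j. {#f j#}) xs)" for f :: "nat \<Rightarrow> nat" and xs by (induction xs) auto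
      then show ?thesis unfolding row_word_def .
    qed
    also have "\<dots> = (\<Sum>j \<in> set (sorted_list_of_set (?B i)). {#the (T (i, j))#})"
      by (rule sum_list_distinct_conv_sum_set) simp
    finally show ?thesis using finB by simp
  qed
  have "mset (reading_word T) = sum_list (map (\<lambda>i. mset (row_word T i)) (rev (sorted_list_of_set ?A)))"
    by (simp add: reading_word_def mset_concat comp_def)
  also have "\<dots> = (\<Sum>i \<in> ?A. mset (row_word T i))" using assms by (simp add: sum_list_distinct_conv_sum_set)
  also have "\<dots> = (\<Sum>i \<in> ?A. \<Sum>j \<in> ?B i. {#the (T (i, j))#})" by (simp add: row)
  also have "\<dots> = (\<Sum>(i, j) \<in> Sigma ?A ?B. {#the (T (i, j))#})" using assms finB by (intro sum.Sigma) auto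
  also have "Sigma ?A ?B = dom T" by force
  finally show ?thesis by (simp add: case_prod_unfold)
qed

definition dominates :: "nat list \<Rightarrow> nat list \<Rightarrow> bool" where
  "dominates a b \<longleftrightarrow> length b \<le> length a \<and> (\<forall>j < length b. a ! j < b ! j)"

text \<open>Comparing sorted lists entry by entry is the same as comparing their counting functions.
  This is the dictionary between strict columns and the excess used by the crystal
  operators.\<close>

lemma dominates_iff_excess:
  "dominates (sorted_list_of_multiset r1) (sorted_list_of_multiset r2) \<longleftrightarrow> (\<forall>v. excess r1 r2 v \<le> 0)"
proof -
  define a where "a = sorted_list_of_multiset r1"
  define b where "b = sorted_list_of_multiset r2"
  have sa: "sorted a" "sorted b" by (simp_all add: a_def b_def)
  have e: "excess r1 r2 v \<le> 0 \<longleftrightarrow> length (filter (\<lambda>z. z \<le> v) b) \<le> length (filter (\<lambda>z. z < v) a)" for v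
    by (simp add: excess_def a_def b_def length_filter_sorted_list_of_multiset)
  have la: "length a = size r1" "length b = size r2" by (simp_all add: a_def b_def length_sorted_list_of_multiset)
  show ?thesis
    unfolding a_def[symmetric] b_def[symmetric]
  proof
    assume d: "dominates a b"
    show "\<forall>v. excess r1 r2 v \<le> 0"
    proof
      fix v
      have "{i. i < length b \<and> b ! i \<le> v} \<subseteq> {i. i < length a \<and> a ! i < v}"
        using d unfolding dominates_def by force
      then have "card {i. i < length b \<and> b ! i \<le> v} \<le> card {i. i < length a \<and> a ! i < v}" by (intro card_mono) auto
      then show "excess r1 r2 v \<le> 0" by (simp add: e length_filter_conv_card)
    qed
  next
    assume lat: "\<forall>v. excess r1 r2 v \<le> 0"
    obtain v where "excess r1 r2 v = int (size r2) - int (size r1)" using excess_eventually[of r1 r2] by blast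
    then have "length b \<le> length a" using lat[rule_format, of v] la by simp
    moreover have "a ! j < b ! j" if j: "j < length b" for j
    proof -
      have "j < length (filter (\<lambda>z. z \<le> b ! j) b)" using sorted_filter_le[OF sa(2) j] .
      also have "\<dots> \<le> length (filter (\<lambda>z. z < b ! j) a)" using lat e by blast
      finally show ?thesis using sorted_filter_less[OF sa(1)] by blast
    qed
    ultimately show "dominates a b" by (simp add: dominates_def)
  qed
qed

lemma lattice_rows_iff:
  "lattice_rows lo hi rs \<longleftrightarrow>
   (\<forall>i. lo \<le> i \<longrightarrow> i < hi \<longrightarrow> dominates (sorted_list_of_multiset (rs i)) (sorted_list_of_multiset (rs (Suc i))))"
  unfolding lattice_rows_def dominates_iff_excess by blast

lemma tab_columns:
  assumes lat: "lattice_rows 1 N rs" and sup: "supported_rows N rs"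
    and i: "1 \<le> i" "i < i'" and t: "tab rs (i', j) = Some b"
  shows "\<exists>a < b. tab rs (i, j) = Some a"
  using i(2) t
proof (induction "i' - i" arbitrary: i' b)
  case (Suc d)
  obtain k where k: "i' = Suc k" "i \<le> k" using Suc.prems(1) by (cases i') auto
  have b: "1 \<le> j" "j \<le> size (rs (Suc k))" "b = sorted_list_of_multiset (rs (Suc k)) ! (j - 1)"
    using Suc.prems(2) by (auto simp: k tab_eq_Some)
  then have "rs (Suc k) \<noteq> {#}" by auto
  then have "Suc k \<in> {1..N}" using sup unfolding supported_rows_def by blast
  then have "dominates (sorted_list_of_multiset (rs k)) (sorted_list_of_multiset (rs (Suc k)))"
    using lat i k by (simp add: lattice_rows_iff)
  then have "j \<le> size (rs k)" "sorted_list_of_multiset (rs k) ! (j - 1) < b"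
    using b by (auto simp: dominates_def length_sorted_list_of_multiset)
  then obtain a where a: "tab rs (k, j) = Some a" "a < b" using b(1) by (auto simp: tab_eq_Some)
  show ?case
  proof (cases "k = i")
    case True then show ?thesis using a by blast
  next
    case False
    then have "d = k - i" "i < k" using Suc.hyps(2) k by auto
    then show ?thesis using Suc.hyps(1)[OF _ _ a(1)] a(2) by (meson less_trans)
  qed
qed simp

lemma column_strict_tab:
  assumes lat: "lattice_rows 1 N rs" and sup: "supported_rows N rs"
  shows "column_strict (tab rs)"
  unfolding column_strict_def
proof (intro conjI allI impI)
  fix i j j' a b assume "tab rs (i, j) = Some a" "tab rs (i, j') = Some b" "j < j'"
  then show "a \<le> b"
    by (auto simp: tab_eq_Some length_sorted_list_of_multiset intro!: sorted_nth_mono)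
next
  fix i i' j a b assume t: "tab rs (i, j) = Some a" "tab rs (i', j) = Some b" "i < i'"
  have "rs i \<noteq> {#}" using t(1) by (auto simp: tab_eq_Some)
  then have "1 \<le> i" using sup unfolding supported_rows_def by (metis atLeastAtMost_iff)
  then show "a < b" using tab_columns[OF lat sup _ t(3,2)] t(1) by auto
qed

lemma has_shape_tab:
  assumes lat: "lattice_rows 1 N rs" and sup: "supported_rows N rs"
    and \<mu>: "length \<mu> = N" "\<And>i. i \<in> {1..N} \<Longrightarrow> size (rs i) = \<mu> ! (i - 1)"
  shows "has_shape (tab rs) \<mu>"
  unfolding has_shape_def
proof
  have "\<mu> ! Suc i \<le> \<mu> ! i" if "Suc i < length \<mu>" for i
  proof -
    have "dominates (sorted_list_of_multiset (rs (Suc i))) (sorted_list_of_multiset (rs (Suc (Suc i))))"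
      using lat that \<mu>(1) by (simp add: lattice_rows_iff)
    then show ?thesis using \<mu>(2)[of "Suc i"] \<mu>(2)[of "Suc (Suc i)"] that \<mu>(1)
      by (simp add: dominates_def length_sorted_list_of_multiset)
  qed
  then have "sorted_wrt (\<lambda>x y. y \<le> x) \<mu>"
    by (subst sorted_wrt_iff_nth_Suc_transp) (auto intro: transpI)
  then show "sorted_wrt (\<ge>) \<mu>" .
  show "dom (tab rs) = diagram \<mu>"
  proof (intro set_eqI)
    fix c :: "nat \<times> nat"
    obtain i j where c: "c = (i, j)" by (cases c)
    show "c \<in> dom (tab rs) \<longleftrightarrow> c \<in> diagram \<mu>"
    proof (cases "i \<in> {1..N}")
      case True
      then show ?thesis using \<mu> unfolding c dom_tab by (simp add: diagram_def)
    next
      case False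
      then have "rs i = {#}" using sup by (simp add: supported_rows_def)
      then show ?thesis using \<mu>(1) False unfolding c dom_tab by (auto simp: diagram_def)
    qed
  qed
qed

lemma straight_tab:
  assumes "lattice_rows 1 N rs" "supported_rows N rs"
  shows "straight (tab rs)"
proof -
  have "has_shape (tab rs) (map (\<lambda>i. size (rs i)) [1..<Suc N])"
    by (rule has_shape_tab[OF assms]) (auto simp del: upt_Suc)
  then show ?thesis using column_strict_tab[OF assms] by (auto simp: straight_def)
qed

text \<open>With \<open>rows_tab\<close> this makes \<open>rows\<close> and \<open>tab\<close>
  inverse to each other on tableaux of partition shape. The lattice condition holds for every
  \<open>N\<close>, because the rows beyond the shape are empty.\<close>

lemma straight_rows:
  assumes cs: "column_strict T" and sh: "has_shape T \<mu>"
  shows "tab (rows T) = T" "supported_rows (length \<mu>) (rows T)" "lattice_rows 1 N (rows T)"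
    "i \<in> {1..length \<mu>} \<Longrightarrow> size (rows T i) = \<mu> ! (i - 1)"
proof -
  define k where "k i = (if i \<in> {1..length \<mu>} then \<mu> ! (i - 1) else 0)" for i
  have dom: "(i, j) \<in> dom T \<longleftrightarrow> 1 \<le> j \<and> j \<le> k i" for i j
    using sh by (auto simp: has_shape_def diagram_def k_def)
  have rw: "row_word T i = map (\<lambda>j. the (T (i, Suc j))) [0..<k i]" for i
    by (rule row_word_interval) (rule dom)
  have val: "T (i, Suc j) = Some (row_word T i ! j)" if "j < k i" for i j
  proof -
    have "(i, Suc j) \<in> dom T" using dom that by simp
    then show ?thesis using that by (auto simp: rw)
  qed
  have len: "length (row_word T i) = k i" for i by (simp add: rw)
  have srt: "sorted (row_word T i)" for i
    unfolding sorted_iff_nth_mono_less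
  proof (intro allI impI)
    fix j j' assume j: "j < j'" "j' < length (row_word T i)"
    then have "T (i, Suc j) = Some (row_word T i ! j)" "T (i, Suc j') = Some (row_word T i ! j')"
      using val len by auto
    then show "row_word T i ! j \<le> row_word T i ! j'" using cs j(1) unfolding column_strict_def by (meson Suc_less_eq)
  qed
  have sl: "sorted_list_of_multiset (rows T i) = row_word T i" for i
    by (rule sorted_list_of_multiset_eqI) (auto simp: rows_def srt)
  have sz: "size (rows T i) = k i" for i by (simp add: rows_def len)
  show "tab (rows T) = T"
  proof
    fix c :: "nat \<times> nat"
    obtain i j where c: "c = (i, j)" by (cases c)
    show "tab (rows T) c = T c"
    proof (cases "1 \<le> j \<and> j \<le> k i")
      case True
      then have "T (i, Suc (j - 1)) = Some (row_word T i ! (j - 1))" by (intro val) auto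
      then show ?thesis using True by (simp add: c tab_def sz sl)
    next
      case False
      then have "T (i, j) = None" using dom[of i j] by (auto simp: domIff)
      then show ?thesis using False by (auto simp: c tab_def sz)
    qed
  qed
  show "supported_rows (length \<mu>) (rows T)"
    unfolding supported_rows_def
  proof (intro allI impI)
    fix i assume "i \<notin> {1..length \<mu>}"
    then have "size (rows T i) = 0" unfolding sz k_def by auto
    then show "rows T i = {#}" by simp
  qed
  show "size (rows T i) = \<mu> ! (i - 1)" if "i \<in> {1..length \<mu>}" using that by (simp add: sz k_def)
  have dec: "k (Suc i) \<le> k i" if "1 \<le> i" for i
  proof (cases "Suc i \<in> {1..length \<mu>}")
    case True
    have "sorted_wrt (\<ge>) \<mu>" using sh by (simp add: has_shape_def)
    then have "\<mu> ! i \<le> \<mu> ! (i - 1)" using True that by (intro sorted_wrt_nth_less[where P = "(\<ge>)"]) auto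
    then show ?thesis using True that by (simp add: k_def)
  qed (auto simp: k_def)
  show "lattice_rows 1 N (rows T)"
    unfolding lattice_rows_iff sl dominates_def len
  proof (intro allI impI conjI)
    fix i :: nat assume i: "1 \<le> i"
    show "k (Suc i) \<le> k i" using dec i by simp
    fix j assume j: "j < k (Suc i)"
    then have "T (i, Suc j) = Some (row_word T i ! j)" "T (Suc i, Suc j) = Some (row_word T (Suc i) ! j)"
      using val dec[OF i] by auto
    then show "row_word T i ! j < row_word T (Suc i) ! j" using cs unfolding column_strict_def by (meson lessI)
  qed
qed

lemma supported_rows_mono: "supported_rows N rs \<Longrightarrow> N \<le> M \<Longrightarrow> supported_rows M rs"
  unfolding supported_rows_def by auto

section \<open>The Knuth class of a tableau\<close>

text \<open>Each row, when inserted, pushes out the row below it. So inserting the reading word of a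
  tableau into an empty row rebuilds the top row and ejects the reading word of the others.\<close>

lemma pass_word:
  assumes "lattice_rows lo hi rs" "lo \<le> hi"
  shows "pass_row {#} (word lo hi rs) = rs lo \<and> pass_bumps {#} (word lo hi rs) = word (Suc lo) hi rs"
  using assms(2,1)
proof (induction lo rule: inc_induct)
  case base
  then show ?case using pass_sorted[of "sorted_list_of_multiset (rs hi)"] by (simp add: word_def)
next
  case (step lo)
  have lat: "lattice_rows (Suc lo) hi rs" using step.prems by (simp add: lattice_rows_def)
  have "dominates (sorted_list_of_multiset (rs lo)) (sorted_list_of_multiset (rs (Suc lo)))"
    using step by (simp add: lattice_rows_iff)
  then have p: "pass_row (rs (Suc lo)) (sorted_list_of_multiset (rs lo)) = rs lo"
    "pass_bumps (rs (Suc lo)) (sorted_list_of_multiset (rs lo)) = sorted_list_of_multiset (rs (Suc lo))"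
    using pass_strict[of "sorted_list_of_multiset (rs lo)" "sorted_list_of_multiset (rs (Suc lo))"] by (auto simp: dominates_def)
  have w: "word lo hi rs = word (Suc lo) hi rs @ sorted_list_of_multiset (rs lo)" using step by (intro word_snoc) auto
  have w': "word (Suc lo) hi rs = word (Suc (Suc lo)) hi rs @ sorted_list_of_multiset (rs (Suc lo))" using step by (intro word_snoc) auto
  show ?case using step.IH[OF lat] p w' by (simp add: w pass_row_append pass_bumps_append)
qed

text \<open>Passing through a row preserves Knuth equivalence of the ejected words, so the rows can
  be recovered from the Knuth class one after another.\<close>

lemma knuth_equiv_rows_eq:
  assumes lat: "lattice_rows 1 N rs" "lattice_rows 1 N rs'" and eq: "knuth_equiv (word 1 N rs) (word 1 N rs')"
    and i: "i \<in> {1..N}"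
  shows "rs i = rs' i"
proof -
  have "knuth_equiv (word i N rs) (word i N rs')" if "1 \<le> i" "i \<le> N" for i
    using that
  proof (induction i rule: dec_induct)
    case base show ?case by (rule eq)
  next
    case (step i)
    have l: "lattice_rows i N rs" "lattice_rows i N rs'" using lat step by (auto simp: lattice_rows_def)
    have "knuth_equiv (pass_bumps {#} (word i N rs)) (pass_bumps {#} (word i N rs'))"
      using pass_knuth_equiv[of "word i N rs" "word i N rs'"] step by simp
    then show ?case using pass_word l step by simp
  qed
  then have "pass_row {#} (word i N rs) = pass_row {#} (word i N rs')" using pass_knuth_equiv i by fastforce
  moreover have "lattice_rows i N rs" "lattice_rows i N rs'" using lat i by (auto simp: lattice_rows_def)
  ultimately show ?thesis using pass_word[of i N rs] pass_word[of i N rs'] i by simp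
qed

lemma straight_unique:
  assumes "straight T" "straight T'" and eq: "knuth_equiv (reading_word T) (reading_word T')"
  shows "T = T'"
proof -
  obtain \<mu> \<mu>' where T: "column_strict T" "has_shape T \<mu>" "column_strict T'" "has_shape T' \<mu>'"
    using assms by (auto simp: straight_def)
  define N where "N = max (length \<mu>) (length \<mu>')"
  have sup: "supported_rows N (rows T)" "supported_rows N (rows T')"
    using straight_rows(2)[OF T(1,2)] straight_rows(2)[OF T(3,4)] by (auto simp: N_def intro: supported_rows_mono)
  have t: "tab (rows T) = T" "tab (rows T') = T'" using straight_rows(1) T by blast+
  have "knuth_equiv (word 1 N (rows T)) (word 1 N (rows T'))"
    using eq reading_word_tab[OF sup(1)] reading_word_tab[OF sup(2)] by (simp add: t)
  then have "rows T i = rows T' i" if "i \<in> {1..N}" for i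
    using knuth_equiv_rows_eq straight_rows(3)[OF T(1,2)] straight_rows(3)[OF T(3,4)] that by blast
  then have "rows T i = rows T' i" for i using sup by (cases "i \<in> {1..N}") (auto simp: supported_rows_def)
  then have "rows T = rows T'" by (rule ext)
  then show ?thesis using t by metis
qed

text \<open>Among all fillings whose word is Knuth equivalent to \<open>u\<close>, one with all letters as high up as possible.\<close>
lemma straight_exists: "\<exists>T. straight T \<and> knuth_equiv (reading_word T) u"
proof -
  define N where "N = length u"
  define f where "f rs = (\<Sum>i = 1..N. i * size (rs i))" for rs :: "nat \<Rightarrow> nat multiset"
  let ?P = "\<lambda>rs. supported_rows N rs \<and> knuth_equiv (word 1 N rs) u"
  \<comment> \<open>One letter per row, entered from the bottom row upwards, so that the word of
    this filling is \<open>u\<close>.\<close>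
  define r0 where "r0 i = (if i \<in> {1..N} then {#u ! (N - i)#} else {#})" for i
  have "word 1 N r0 = concat (map (\<lambda>i. [u ! (N - i)]) (rev [1..<Suc N]))"
    unfolding word_def by (intro arg_cong[where f = concat] map_cong) (auto simp: r0_def)
  also have "\<dots> = map (\<lambda>i. u ! (N - i)) (rev [1..<Suc N])" by (simp del: upt_Suc)
  also have "\<dots> = u" by (rule nth_equalityI) (auto simp: N_def rev_nth simp del: upt_Suc)
  finally have "?P r0" by (auto simp: supported_rows_def r0_def)
  then obtain rs where rs: "?P rs" and least: "\<And>rs'. ?P rs' \<Longrightarrow> f rs \<le> f rs'"
    using arg_min_natI[of ?P r0 f] arg_min_nat_le[of ?P _ f] by metis
  have "lattice_rows 1 N rs"
  proof (rule ccontr)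
    assume "\<not> lattice_rows 1 N rs"
    then obtain i v where i: "1 \<le> i" "i < N" "1 \<le> excess (rs i) (rs (Suc i)) v"
      unfolding lattice_rows_def by (metis int_one_le_iff_zero_less not_le)
    then have m: "1 \<le> row_max_excess i rs" using excess_le_max order_trans by blast
    define x where "x = first_max (rs i) (rs (Suc i))"
    have x: "x \<in># rs (Suc i)" unfolding x_def by (rule first_max_in[OF m])
    have r: "raise i rs = rs(i := add_mset x (rs i), Suc i := rs (Suc i) - {#x#})"
      by (simp add: raise_def x_def Let_def)
    have "supported_rows N (raise i rs)" using rs i by (auto simp: supported_rows_def r)
    moreover have "knuth_equiv (word 1 N (raise i rs)) u"
      using knuth_raise[OF i(1,2) m] rs knuth_equiv_sym knuth_equiv_trans by blast
    ultimately have "f rs \<le> f (raise i rs)" using least by blast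
    moreover have "f (raise i rs) < f rs"
    proof -
      have N: "{1..N} = insert i (insert (Suc i) ({1..N} - {i, Suc i}))" using i by auto
      have "size (rs (Suc i)) \<noteq> 0" using x by auto
      then obtain k where k: "size (rs (Suc i)) = Suc k" by (cases "size (rs (Suc i))") auto
      have "f (raise i rs) = i * Suc (size (rs i)) + Suc i * k + (\<Sum>j \<in> {1..N} - {i, Suc i}. j * size (rs j))"
      proof -
        have "(\<Sum>j \<in> {1..N} - {i, Suc i}. j * size (raise i rs j)) = (\<Sum>j \<in> {1..N} - {i, Suc i}. j * size (rs j))"
          by (rule sum.cong) (auto simp: r)
        moreover have "size (raise i rs i) = Suc (size (rs i))" "size (raise i rs (Suc i)) = k"
          by (simp_all add: r size_Diff_singleton[OF x] k)
        ultimately show ?thesis unfolding f_def by (subst N) simp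
      qed
      moreover have "f rs = i * size (rs i) + Suc i * Suc k + (\<Sum>j \<in> {1..N} - {i, Suc i}. j * size (rs j))"
        unfolding f_def by (subst N) (simp add: k)
      ultimately show ?thesis by simp
    qed
    ultimately show False by simp
  qed
  then have "straight (tab rs)" using rs by (intro straight_tab) auto
  moreover have "knuth_equiv (reading_word (tab rs)) u" using rs reading_word_tab[of N rs] by metis
  ultimately show ?thesis by blast
qed

text \<open>Existence and uniqueness of the tableau in each Knuth class discharge the definite
  description in \<open>P_tab\<close>.\<close>

lemma P_tab_props: "straight (P_tab u)" "knuth_equiv (reading_word (P_tab u)) u"
proof -
  obtain T where T: "straight T" "knuth_equiv (reading_word T) u" using straight_exists by blast
  have "P_tab u = (THE T. straight T \<and> knuth_equiv (reading_word T) u)"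
    by (simp add: P_tab_def straight_def conj_assoc)
  also have "\<dots> = T"
    using T straight_unique knuth_equiv_sym knuth_equiv_trans by (intro the_equality) blast+
  finally show "straight (P_tab u)" "knuth_equiv (reading_word (P_tab u)) u" using T by auto
qed

section \<open>Catabolizability in terms of the content\<close>

lemma finite_dom_straight: "straight T \<Longrightarrow> finite (dom T)"
  by (auto simp: straight_def has_shape_def finite_diagram)

text \<open>The two parts of the tableau are concatenated in another order and replaced by a Knuth
  equivalent word, and neither changes the content.\<close>

lemma mset_reading_word_H_tab:
  assumes "finite (dom T)"
  shows "mset (reading_word (H_tab r T)) = mset (reading_word T)"
proof -
  have "mset (reading_word (H_tab r T)) = mset (reading_word (T |` {(i, j). i \<le> r})) + mset (reading_word (T |` {(i, j). r < i}))"
    unfolding H_tab_def using knuth_equiv_mset[OF P_tab_props(2)] by simp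
  also have "\<dots> = (\<Sum>c \<in> dom T \<inter> {(i, j). i \<le> r}. {#the (T c)#}) + (\<Sum>c \<in> dom T \<inter> {(i, j). r < i}. {#the (T c)#})"
    using assms by (simp add: mset_reading_word)
  also have "\<dots> = (\<Sum>c \<in> dom T. {#the (T c)#})"
    using assms by (subst sum.union_disjoint[symmetric]) (auto intro!: sum.cong)
  finally show ?thesis using assms by (simp add: mset_reading_word)
qed

lemma mset_Y_tab: "mset (reading_word (Y_tab a r)) = (\<Sum>i = 1..length r. replicate_mset (r ! (i - 1)) (a + i))"
proof -
  have d: "dom (Y_tab a r) = diagram r" by (auto simp: Y_tab_def dom_def split: if_splits)
  have D: "diagram r = Sigma {1..length r} (\<lambda>i. {1..r ! (i - 1)})" by (auto simp: diagram_def)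
  have "mset (reading_word (Y_tab a r)) = (\<Sum>c \<in> diagram r. {#the (Y_tab a r c)#})"
    using mset_reading_word[of "Y_tab a r"] by (simp add: d finite_diagram)
  also have "\<dots> = (\<Sum>(i, j) \<in> diagram r. {#a + i#})"
    by (rule sum.cong) (auto simp: Y_tab_def)
  also have "\<dots> = (\<Sum>i = 1..length r. \<Sum>j \<in> {1..r ! (i - 1)}. {#a + i#})"
    unfolding D by (rule sum.Sigma[symmetric]) auto
  also have "\<dots> = (\<Sum>i = 1..length r. replicate_mset (r ! (i - 1)) (a + i))"
  proof (rule sum.cong[OF refl])
    fix i
    have "(\<Sum>j \<in> {1..k}. {#a + i#}) = replicate_mset k (a + i)" for k :: nat by (induction k) auto
    then show "(\<Sum>j \<in> {1..r ! (i - 1)}. {#a + i#}) = replicate_mset (r ! (i - 1)) (a + i)" .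
  qed
  finally show ?thesis .
qed

lemma mset_catabolism:
  assumes fin: "finite (dom S)" and Y: "restrict_letters S A = Y_tab a r"
  shows "mset (reading_word S) = (\<Sum>i = 1..length r. replicate_mset (r ! (i - 1)) (a + i)) +
    mset (reading_word (H_tab k (skew_minus S (Y_tab a r))))"
proof -
  let ?Y = "Y_tab a r"
  have sub: "dom ?Y \<subseteq> dom S" unfolding Y[symmetric] by (auto simp: restrict_letters_def)
  have val: "S c = ?Y c" if "c \<in> dom ?Y" for c
    using that unfolding Y[symmetric] restrict_letters_def by (auto simp: restrict_map_def split: if_splits)
  have fY: "finite (dom ?Y)" using sub fin by (rule finite_subset)
  have fs: "finite (dom (skew_minus S ?Y))" using fin by (simp add: skew_minus_def)
  have "mset (reading_word S) = (\<Sum>c \<in> dom S. {#the (S c)#})" by (rule mset_reading_word[OF fin])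
  also have "\<dots> = (\<Sum>c \<in> dom S - dom ?Y. {#the (S c)#}) + (\<Sum>c \<in> dom ?Y. {#the (S c)#})"
    by (rule sum.subset_diff[OF sub fin])
  also have "(\<Sum>c \<in> dom ?Y. {#the (S c)#}) = mset (reading_word ?Y)"
    unfolding mset_reading_word[OF fY] by (rule sum.cong) (auto simp: val)
  also have "(\<Sum>c \<in> dom S - dom ?Y. {#the (S c)#}) = mset (reading_word (skew_minus S ?Y))"
    unfolding mset_reading_word[OF fs] by (rule sum.cong) (auto simp: skew_minus_def)
  finally show ?thesis unfolding mset_reading_word_H_tab[OF fs] mset_Y_tab by simp
qed


lemma sum_shift_one: "(\<Sum>i = 1..Suc L. f i) = f 1 + (\<Sum>i = 1..L. f (Suc i))"
  for f :: "nat \<Rightarrow> 'a::comm_monoid_add"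
  by (induction L) (auto simp: add.assoc)

lemma sum_split_at: "(\<Sum>i = 1..m + d. f i) = (\<Sum>i = 1..m. f i) + (\<Sum>i = 1..d. f (m + i))"
  for f :: "nat \<Rightarrow> 'a::comm_monoid_add"
  by (induction d) (auto simp: add.assoc)

lemma set_reading_word:
  assumes "finite (dom T)"
  shows "set (reading_word T) = ran T"
proof -
  have "set (reading_word T) = set_mset (\<Sum>c \<in> dom T. {#the (T c)#})"
    unfolding mset_reading_word[OF assms, symmetric] by simp
  also have "\<dots> = (\<lambda>c. the (T c)) ` dom T" using assms by (auto simp: set_mset_sum)
  also have "\<dots> = ran T" by (force simp: ran_def)
  finally show ?thesis .
qed

text \<open>In a sorted list the letters up to \<open>b\<close> form an initial segment, so a
  condition on these letters becomes one on positions.\<close>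

lemma prefix_filter_iff:
  fixes L :: "nat list"
  assumes L: "sorted L" and k: "0 < k \<Longrightarrow> v \<le> b"
  shows "filter (\<lambda>z. z \<le> b) L = replicate k v \<longleftrightarrow>
    (\<forall>j. j < length L \<and> L ! j \<le> b \<longleftrightarrow> j < k) \<and> (\<forall>j < k. L ! j = v)" (is "?A \<longleftrightarrow> ?B")
proof
  assume A: ?A
  have "L = filter (\<lambda>z. z \<le> b) L @ filter (\<lambda>z. \<not> z \<le> b) L"
    using L
  proof (induction L)
    case (Cons z L)
    show ?case
    proof (cases "z \<le> b")
      case True then show ?thesis using Cons by simp
    next
      case False
      then have "\<forall>y \<in> set L. \<not> y \<le> b" using Cons.prems by auto
      then have "filter (\<lambda>z. z \<le> b) L = []" "filter (\<lambda>z. \<not> z \<le> b) L = L"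
        by (simp_all add: filter_empty_conv filter_id_conv)
      then show ?thesis using False by simp
    qed
  qed simp
  also have "\<dots> = replicate k v @ filter (\<lambda>z. \<not> z \<le> b) L" unfolding A ..
  finally have e: "L = replicate k v @ filter (\<lambda>z. \<not> z \<le> b) L" .
  obtain L' where L': "L = replicate k v @ L'" "\<forall>z \<in> set L'. b < z"
    by (rule that[OF e]) (simp add: not_le)
  show ?B
  proof (intro conjI allI impI)
    fix j
    show "j < length L \<and> L ! j \<le> b \<longleftrightarrow> j < k"
      using L' k by (cases "j < k") (auto simp: nth_append not_le)
  next
    fix j assume "j < k" then show "L ! j = v" using L' by (simp add: nth_append)
  qed
next
  assume B: ?B
  have kL: "k \<le> length L" using B by (metis not_le order_less_irrefl)
  have t: "take k L = replicate k v" using B kL by (intro nth_equalityI) auto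
  have "\<forall>z \<in> set (drop k L). b < z"
  proof
    fix z assume "z \<in> set (drop k L)"
    then obtain j where j: "j < length L - k" "z = L ! (k + j)" by (auto simp: in_set_conv_nth)
    then show "b < z" using B[THEN conjunct1, rule_format, of "k + j"] by auto
  qed
  then have "filter (\<lambda>z. z \<le> b) (drop k L) = []" by (auto simp: filter_empty_conv not_le)
  moreover have "filter (\<lambda>z. z \<le> b) (replicate k v) = replicate k v" using k by (cases k) auto
  ultimately show ?A using append_take_drop_id[of k L] t by (metis append_Nil2 filter_append)
qed

text \<open>The small letters of a sorted row stand at its beginning, so equality with
  \<open>Y_tab\<close> cell by cell amounts to equality of multisets row by row.\<close>

lemma restrict_letters_tab:
  assumes low: "\<And>i z. z \<in># rs i \<Longrightarrow> a < z"
  shows "restrict_letters (tab rs) {a + 1..a + length r} = Y_tab a r \<longleftrightarrow>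
    (\<forall>i. {#z \<in># rs i. z \<le> a + length r#} = (if 1 \<le> i \<and> i \<le> length r then replicate_mset (r ! (i - 1)) (a + i) else {#}))"
proof -
  let ?b = "a + length r"
  define k where "k i = (if 1 \<le> i \<and> i \<le> length r then r ! (i - 1) else 0)" for i
  define L where "L i = sorted_list_of_multiset (rs i)" for i
  have lenL: "length (L i) = size (rs i)" for i by (simp add: L_def length_sorted_list_of_multiset)
  have row: "{#z \<in># rs i. z \<le> ?b#} = (if 1 \<le> i \<and> i \<le> length r then replicate_mset (r ! (i - 1)) (a + i) else {#}) \<longleftrightarrow>
     (\<forall>j. j < length (L i) \<and> L i ! j \<le> ?b \<longleftrightarrow> j < k i) \<and> (\<forall>j < k i. L i ! j = a + i)" for i
  proof -
    have e: "(if 1 \<le> i \<and> i \<le> length r then replicate_mset (r ! (i - 1)) (a + i) else {#}) = mset (replicate (k i) (a + i))"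
      by (simp add: k_def)
    have f: "{#z \<in># rs i. z \<le> ?b#} = mset (filter (\<lambda>z. z \<le> ?b) (L i))" by (simp add: L_def)
    have "{#z \<in># rs i. z \<le> ?b#} = mset (replicate (k i) (a + i)) \<longleftrightarrow> filter (\<lambda>z. z \<le> ?b) (L i) = replicate (k i) (a + i)"
    proof
      assume "{#z \<in># rs i. z \<le> ?b#} = mset (replicate (k i) (a + i))"
      then have "mset (filter (\<lambda>z. z \<le> ?b) (L i)) = mset (replicate (k i) (a + i))" unfolding f .
      moreover have "sorted (filter (\<lambda>z. z \<le> ?b) (L i))" by (simp add: L_def sorted_wrt_filter)
      ultimately show "filter (\<lambda>z. z \<le> ?b) (L i) = replicate (k i) (a + i)"
        by (metis sorted_list_of_multiset_eqI sorted_replicate)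
    qed (simp add: f)
    also have "\<dots> \<longleftrightarrow> (\<forall>j. j < length (L i) \<and> L i ! j \<le> ?b \<longleftrightarrow> j < k i) \<and> (\<forall>j < k i. L i ! j = a + i)"
      by (rule prefix_filter_iff) (auto simp: L_def k_def split: if_splits)
    finally show ?thesis unfolding e .
  qed
  have Y: "Y_tab a r (i, Suc j) = (if j < k i then Some (a + i) else None)" for i j
    by (auto simp: Y_tab_def diagram_def k_def)
  have Y0: "Y_tab a r (i, 0) = None" for i by (simp add: Y_tab_def diagram_def)
  have lowL: "a < L i ! j" if "j < length (L i)" for i j
    using low[of "L i ! j" i] nth_mem[OF that] by (simp add: L_def)
  have R: "restrict_letters (tab rs) {a + 1..?b} (i, Suc j) = (if j < length (L i) \<and> L i ! j \<le> ?b then Some (L i ! j) else None)" for i j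
    using lowL[of j i] by (auto simp: restrict_letters_def restrict_map_def tab_def lenL L_def[symmetric])
  have R0: "restrict_letters (tab rs) {a + 1..?b} (i, 0) = None" for i
    by (simp add: restrict_letters_def restrict_map_def tab_def)
  have "restrict_letters (tab rs) {a + 1..?b} = Y_tab a r \<longleftrightarrow>
     (\<forall>i j. (if j < length (L i) \<and> L i ! j \<le> ?b then Some (L i ! j) else None) = (if j < k i then Some (a + i) else None))"
  proof
    assume e: "restrict_letters (tab rs) {a + 1..?b} = Y_tab a r"
    show "\<forall>i j. (if j < length (L i) \<and> L i ! j \<le> ?b then Some (L i ! j) else None) = (if j < k i then Some (a + i) else None)"
      unfolding R[symmetric] Y[symmetric] e by simp
  next
    assume e: "\<forall>i j. (if j < length (L i) \<and> L i ! j \<le> ?b then Some (L i ! j) else None) = (if j < k i then Some (a + i) else None)"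
    show "restrict_letters (tab rs) {a + 1..?b} = Y_tab a r"
    proof
      fix c :: "nat \<times> nat"
      obtain i j where c: "c = (i, j)" by (cases c)
      show "restrict_letters (tab rs) {a + 1..?b} c = Y_tab a r c"
      proof (cases j)
        case 0 then show ?thesis by (simp only: c R0 Y0)
      next
        case (Suc j') then show ?thesis using e by (simp only: c R Y)
      qed
    qed
  qed
  also have "\<dots> \<longleftrightarrow> (\<forall>i. (\<forall>j. j < length (L i) \<and> L i ! j \<le> ?b \<longleftrightarrow> j < k i) \<and> (\<forall>j < k i. L i ! j = a + i))"
  proof -
    have "(if P then Some x else None) = (if Q then Some y else None) \<longleftrightarrow> (P \<longleftrightarrow> Q) \<and> (Q \<longrightarrow> x = y)" for P Q and x y :: nat by auto
    then show ?thesis by (simp only:) blast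
  qed
  finally show ?thesis unfolding row .
qed

text \<open>Columns increase strictly, so the smallest letter of the alphabet cannot occur below the
  top row, and weakly increasing rows put it at the start of that row.\<close>

lemma restrict_smallest_letter:
  assumes S: "straight S" and c: "mset (reading_word S) = replicate_mset x (Suc a) + C" and C: "\<And>z. z \<in># C \<Longrightarrow> Suc a < z"
  shows "restrict_letters S {a + 1..a + length [x]} = Y_tab a [x]"
proof -
  obtain \<mu> where \<mu>: "column_strict S" "has_shape S \<mu>" using S by (auto simp: straight_def)
  define N where "N = Suc (length \<mu>)"
  define rs where "rs = rows S"
  have sup: "supported_rows N rs" unfolding rs_def using straight_rows(2)[OF \<mu>] by (rule supported_rows_mono) (simp add: N_def)
  have lat: "lattice_rows 1 N rs" using straight_rows(3)[OF \<mu>] by (simp add: rs_def)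
  have t: "tab rs = S" using straight_rows(1)[OF \<mu>] by (simp add: rs_def)
  have tot: "(\<Sum>i = 1..N. rs i) = replicate_mset x (Suc a) + C"
    using reading_word_tab[OF sup] c by (simp add: t mset_word)
  have low: "a < z" if "z \<in># rs i" for i z
  proof -
    have "i \<in> {1..N}" using that sup by (metis empty_iff set_mset_empty supported_rows_def)
    then have "rs i \<subseteq># (\<Sum>i = 1..N. rs i)" by (metis finite_atLeastAtMost mset_subset_eq_add_left sum.remove)
    then have "z \<in># replicate_mset x (Suc a) + C" unfolding tot using that by (metis mset_subset_eqD)
    then show ?thesis using C by (auto split: if_splits dest: Suc_lessD)
  qed
  have row: "a + i \<le> z" if "z \<in># rs i" for i z
  proof -
    have i: "i \<in> {1..N}" using that sup by (metis empty_iff set_mset_empty supported_rows_def)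
    show ?thesis
    proof (rule lattice_rows_letters[OF lat])
      show "a + 1 \<le> z'" if "z' \<in># rs 1" for z' using low[OF that] by simp
    qed (use i that in auto)
  qed
  have "count (rs 1) (Suc a) = x"
  proof -
    have "count (rs i) (Suc a) = 0" if "i \<in> {1..N} - {1}" for i
      using row[of "Suc a" i] that by (force simp: count_eq_zero_iff)
    then have "(\<Sum>i = 1..N. count (rs i) (Suc a)) = count (rs 1) (Suc a)"
      by (subst sum.remove[of _ 1]) (auto simp: N_def)
    moreover have "(\<Sum>i = 1..N. count (rs i) (Suc a)) = x + count C (Suc a)"
      unfolding count_sum[symmetric] tot by simp
    moreover have "count C (Suc a) = 0" using C by (meson count_eq_zero_iff less_irrefl)
    ultimately show ?thesis by simp
  qed
  have main: "{#z \<in># rs i. z \<le> a + length [x]#} = (if 1 \<le> i \<and> i \<le> length [x] then replicate_mset ([x] ! (i - 1)) (a + i) else {#})" for i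
  proof (cases "i = 1")
    case True
    have "{#z \<in># rs i. z \<le> a + length [x]#} = {#z \<in># rs i. z = Suc a#}"
    proof (intro filter_mset_cong refl)
      fix z assume "z \<in># rs i"
      then have "Suc a \<le> z" using row[of z i] True by simp
      then show "z \<le> a + length [x] \<longleftrightarrow> z = Suc a" by auto
    qed
    then show ?thesis using True \<open>count (rs 1) (Suc a) = x\<close> by (simp add: filter_eq_replicate_mset)
  next
    case False
    have "\<not> z \<le> a + length [x]" if "z \<in># rs i" for z
    proof -
      have "i \<in> {1..N}" using that sup by (metis empty_iff set_mset_empty supported_rows_def)
      then show ?thesis using row[OF that] False by simp
    qed
    then have "set_mset {#z \<in># rs i. z \<le> a + length [x]#} = {}" by auto
    then have "{#z \<in># rs i. z \<le> a + length [x]#} = {#}" by (simp only: set_mset_eq_empty_iff)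
    then show ?thesis using False by auto
  qed
  show ?thesis unfolding t[symmetric] using restrict_letters_tab[of rs a "[x]"] low main by blast
qed

lemma straight_H_tab: "straight (H_tab k T)"
  unfolding H_tab_def by (rule P_tab_props)

lemma catabolizable_from_Cons:
  "catabolizable_from a (r # R) S \<longleftrightarrow> straight S \<and> ran S \<subseteq> {a + 1..a + length (concat (r # R))} \<and>
     restrict_letters S {a + 1..a + length r} = Y_tab a r \<and>
     catabolizable_from (a + length r) R (H_tab (length r) (skew_minus S (Y_tab a r)))"
  by (simp add: straight_def)

text \<open>
  For one-row blocks there is no condition beyond the content: the smallest letters of a
  tableau necessarily start its first row.
\<close>
lemma catabolizable_singletons:
  "catabolizable_from a (map (\<lambda>x. [x]) xs) S \<longleftrightarrow>
   straight S \<and> mset (reading_word S) = (\<Sum>i = 1..length xs. replicate_mset (xs ! (i - 1)) (a + i))"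
proof (induction xs arbitrary: a S)
  case Nil
  have e: "straight Map.empty"
    by (auto simp: straight_def column_strict_def has_shape_def diagram_def intro!: exI[of _ "[]"])
  have r: "reading_word Map.empty = []" by (simp add: reading_word_def)
  show ?case
  proof
    assume "catabolizable_from a (map (\<lambda>x. [x]) []) S"
    then show "straight S \<and> mset (reading_word S) = (\<Sum>i = 1..length []. replicate_mset ([] ! (i - 1)) (a + i))"
      using e r by simp
  next
    assume S: "straight S \<and> mset (reading_word S) = (\<Sum>i = 1..length []. replicate_mset ([] ! (i - 1)) (a + i))"
    then have "reading_word S = reading_word Map.empty" using r by simp
    then have "S = Map.empty" using straight_unique[of S Map.empty] S e by simp
    then show "catabolizable_from a (map (\<lambda>x. [x]) []) S" by simp
  qed
next
  case (Cons x xs)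
  let ?H = "H_tab (length [x]) (skew_minus S (Y_tab a [x]))"
  define C where "C = (\<Sum>i = 1..length xs. replicate_mset (xs ! (i - 1)) (a + 1 + i))"
  have tot: "(\<Sum>i = 1..length (x # xs). replicate_mset ((x # xs) ! (i - 1)) (a + i)) = replicate_mset x (Suc a) + C"
  proof -
    have "(\<Sum>i = 1..length xs. replicate_mset ((x # xs) ! (Suc i - 1)) (a + Suc i)) = C"
      unfolding C_def by (rule sum.cong) auto
    then show ?thesis using sum_shift_one[of "\<lambda>i. replicate_mset ((x # xs) ! (i - 1)) (a + i)" "length xs"] by simp
  qed
  have C: "a + 1 < z \<and> z \<le> a + 1 + length xs" if "z \<in># C" for z
    using that unfolding C_def by (auto simp: set_mset_sum split: if_splits)
  have IH: "catabolizable_from (a + length [x]) (map (\<lambda>x. [x]) xs) ?H \<longleftrightarrow> mset (reading_word ?H) = C"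
    using Cons.IH[of "a + 1" ?H] straight_H_tab by (simp add: C_def)
  have len: "length (concat ([x] # map (\<lambda>x. [x]) xs)) = Suc (length xs)" by (induction xs) auto
  have step: "mset (reading_word S) = replicate_mset x (Suc a) + mset (reading_word ?H)"
    if "straight S" "restrict_letters S {a + 1..a + length [x]} = Y_tab a [x]"
    using mset_catabolism[OF finite_dom_straight[OF that(1)] that(2), of "length [x]"] by simp
  show ?case
    unfolding tot list.map catabolizable_from_Cons IH len
  proof
    assume "straight S \<and> ran S \<subseteq> {a + 1..a + Suc (length xs)} \<and> restrict_letters S {a + 1..a + length [x]} = Y_tab a [x] \<and> mset (reading_word ?H) = C"
    then show "straight S \<and> mset (reading_word S) = replicate_mset x (Suc a) + C" using step by simp
  next
    assume S: "straight S \<and> mset (reading_word S) = replicate_mset x (Suc a) + C"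
    have r: "restrict_letters S {a + 1..a + length [x]} = Y_tab a [x]"
      by (rule restrict_smallest_letter[of S x a C]) (use S C in auto)
    have "ran S = set (reading_word S)" using set_reading_word[OF finite_dom_straight] S by blast
    also have "\<dots> = set_mset (replicate_mset x (Suc a) + C)" using S by (metis set_mset_mset)
    also have "\<dots> \<subseteq> {a + 1..a + Suc (length xs)}" using C by (fastforce split: if_splits)
    finally have "ran S \<subseteq> {a + 1..a + Suc (length xs)}" .
    moreover have "mset (reading_word ?H) = C" using step r S by simp
    ultimately show "straight S \<and> ran S \<subseteq> {a + 1..a + Suc (length xs)} \<and> restrict_letters S {a + 1..a + length [x]} = Y_tab a [x] \<and> mset (reading_word ?H) = C"
      using S r by blast
  qed
qed

text \<open>After one catabolism only one-row blocks remain, and for them the content decides. The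
  content of the catabolized tableau is that of \<open>S\<close> minus that of \<open>Y_tab\<close>,
  so no further condition arises.\<close>

lemma catabolizable_hook:
  assumes m: "m \<le> length \<gamma>"
  shows "catabolizable (take m \<gamma> # map (\<lambda>x. [x]) (drop m \<gamma>)) S \<longleftrightarrow>
    straight S \<and> mset (reading_word S) = (\<Sum>i = 1..length \<gamma>. replicate_mset (\<gamma> ! (i - 1)) i) \<and>
    restrict_letters S {0 + 1..0 + length (take m \<gamma>)} = Y_tab 0 (take m \<gamma>)"
proof -
  let ?r = "take m \<gamma>" and ?xs = "drop m \<gamma>"
  let ?H = "H_tab (length ?r) (skew_minus S (Y_tab 0 ?r))"
  have lr: "length ?r = m" using m by simp
  define C where "C = (\<Sum>i = 1..length ?xs. replicate_mset (?xs ! (i - 1)) (m + i))"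
  have tot: "(\<Sum>i = 1..length \<gamma>. replicate_mset (\<gamma> ! (i - 1)) i) = (\<Sum>i = 1..length ?r. replicate_mset (?r ! (i - 1)) (0 + i)) + C"
  proof -
    have "(\<Sum>i = 1..m. replicate_mset (\<gamma> ! (i - 1)) i) = (\<Sum>i = 1..length ?r. replicate_mset (?r ! (i - 1)) (0 + i))"
      unfolding lr by (rule sum.cong) auto
    moreover have "(\<Sum>i = 1..length \<gamma> - m. replicate_mset (\<gamma> ! (m + i - 1)) (m + i)) = C"
      unfolding C_def by (rule sum.cong) (use m in \<open>auto simp: Suc_le_eq\<close>)
    ultimately show ?thesis
      using sum_split_at[of "\<lambda>i. replicate_mset (\<gamma> ! (i - 1)) i" m "length \<gamma> - m"] m by simp
  qed
  have IH: "catabolizable_from (0 + length ?r) (map (\<lambda>x. [x]) ?xs) ?H \<longleftrightarrow> mset (reading_word ?H) = C"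
    using catabolizable_singletons[of m ?xs ?H] straight_H_tab[of "length ?r"] lr by (simp add: C_def)
  have len: "length (concat (?r # map (\<lambda>x. [x]) ?xs)) = length \<gamma>"
  proof -
    have "concat (map (\<lambda>x. [x]) xs) = xs" for xs :: "nat list" by (induction xs) auto
    then show ?thesis by simp
  qed
  have step: "mset (reading_word S) = (\<Sum>i = 1..length ?r. replicate_mset (?r ! (i - 1)) (0 + i)) + mset (reading_word ?H)"
    if "straight S" "restrict_letters S {0 + 1..0 + length ?r} = Y_tab 0 ?r"
    by (rule mset_catabolism[OF finite_dom_straight[OF that(1)] that(2)])
  have ran: "ran S \<subseteq> {0 + 1..0 + length \<gamma>}"
    if S: "straight S" "mset (reading_word S) = (\<Sum>i = 1..length \<gamma>. replicate_mset (\<gamma> ! (i - 1)) i)"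
  proof -
    have "ran S = set_mset (mset (reading_word S))" using set_reading_word[OF finite_dom_straight[OF S(1)]] by simp
    also have "\<dots> \<subseteq> {0 + 1..0 + length \<gamma>}" unfolding S(2) by (auto simp: set_mset_sum split: if_splits)
    finally show ?thesis .
  qed
  show ?thesis
    unfolding catabolizable_from_Cons IH len
  proof (intro iffI conjI; elim conjE)
    assume S: "straight S" and r: "restrict_letters S {0 + 1..0 + length ?r} = Y_tab 0 ?r" and c: "mset (reading_word ?H) = C"
    show "straight S" by (rule S)
    show "mset (reading_word S) = (\<Sum>i = 1..length \<gamma>. replicate_mset (\<gamma> ! (i - 1)) i)" unfolding tot step[OF S r] c ..
    show "restrict_letters S {0 + 1..0 + length ?r} = Y_tab 0 ?r" by (rule r)
  next
    assume S: "straight S" and r: "restrict_letters S {0 + 1..0 + length ?r} = Y_tab 0 ?r"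
      and c: "mset (reading_word S) = (\<Sum>i = 1..length \<gamma>. replicate_mset (\<gamma> ! (i - 1)) i)"
    show "straight S" by (rule S)
    show "ran S \<subseteq> {0 + 1..0 + length \<gamma>}" by (rule ran[OF S c])
    show "restrict_letters S {0 + 1..0 + length ?r} = Y_tab 0 ?r" by (rule r)
    show "mset (reading_word ?H) = C" using c unfolding tot step[OF S r] by (rule add_left_imp_eq)
  qed
qed

lemma assoc_seq_hook:
  assumes m: "m \<le> length \<gamma>"
  shows "assoc_seq (m # replicate (length \<gamma> - m) 1) \<gamma> = take m \<gamma> # map (\<lambda>x. [x]) (drop m \<gamma>)"
proof (rule nth_equalityI)
  let ?\<eta> = "m # replicate (length \<gamma> - m) (1 :: nat)"
  show "length (assoc_seq ?\<eta> \<gamma>) = length (take m \<gamma> # map (\<lambda>x. [x]) (drop m \<gamma>))" by (simp add: assoc_seq_def)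
  fix i assume "i < length (assoc_seq ?\<eta> \<gamma>)"
  then have i: "i < length ?\<eta>" by (simp add: assoc_seq_def)
  have e: "assoc_seq ?\<eta> \<gamma> ! i = map (\<lambda>j. \<gamma> ! (j - 1)) [sum_list (take i ?\<eta>) + 1..<sum_list (take (Suc i) ?\<eta>) + 1]"
    unfolding assoc_seq_def using i by (subst nth_map) (simp_all del: upt_Suc take_Suc_Cons)
  show "assoc_seq ?\<eta> \<gamma> ! i = (take m \<gamma> # map (\<lambda>x. [x]) (drop m \<gamma>)) ! i"
  proof (cases i)
    case 0
    have "map (\<lambda>j. \<gamma> ! (j - 1)) [1..<m + 1] = take m \<gamma>" using m by (intro nth_equalityI) (auto simp del: upt_Suc)
    then show ?thesis unfolding e by (simp add: 0 del: upt_Suc)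
  next
    case (Suc k)
    have k: "k < length \<gamma> - m" using i Suc by simp
    have s: "sum_list (take i ?\<eta>) = m + k" "sum_list (take (Suc i) ?\<eta>) = m + Suc k"
      using k by (simp_all add: Suc sum_list_replicate min_def)
    have "[m + k + 1..<m + Suc k + 1] = [Suc (m + k)]" by (simp add: upt_rec)
    then show ?thesis unfolding e s using k by (simp add: Suc)
  qed
qed

theorem corollary39:
  fixes m n :: nat and \<eta> \<gamma> lam :: "nat list" and R :: "nat list list"
  assumes "1 \<le> m" and "m \<le> n"
    and "\<eta> = m # replicate (n - m) 1"
    and "length \<gamma> = n" and "sorted_wrt (\<ge>) \<gamma>"
    and "R = assoc_seq \<eta> \<gamma>"
    and "length lam = n" and "sorted_wrt (\<ge>) lam"
    and "sum_list lam = sum_list \<gamma>"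
  shows "K_poly lam R =
    (\<Sum>S | catabolizable R S \<and> has_shape S lam. fps_X ^ charge (reading_word S))"
proof -
  have R: "R = take m \<gamma> # map (\<lambda>x. [x]) (drop m \<gamma>)"
    unfolding assms(3,6) assms(4)[symmetric] by (rule assoc_seq_hook) (use assms in simp)
  have cm: "concat (map (\<lambda>x. [x]) xs) = xs" "map (\<lambda>x. length [x]) xs = replicate (length xs) 1" for xs :: "nat list"
    by (induction xs) auto
  have lenR: "map length R = m # replicate (n - m) 1"
    using assms(2,4) cm(2)[of "drop m \<gamma>"] by (simp add: R comp_def)
  have conR: "concat R = \<gamma>" by (simp add: R cm)
  interpret partition_function n "\<lambda>i. \<gamma> ! (i - 1)"
  proof
    fix i assume i: "1 \<le> i" "i < n"
    then have "\<gamma> ! i \<le> \<gamma> ! (i - 1)" using assms(4,5) by (intro sorted_wrt_nth_less[where P = "(\<ge>)"]) auto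
    then show "\<gamma> ! (Suc i - 1) \<le> \<gamma> ! (i - 1)" by simp
  qed
  define b where "b i = int (lam ! (i - 1))" for i
  have lam: "dominant_weight n (map int lam)"
    using assms(7,8) by (auto simp: dominant_weight_def sorted_wrt_map)
  have "K_poly lam R = K_series (m # replicate (n - m) 1) (map int \<gamma>) (map int lam)"
    by (simp add: K_poly_def lenR conR)
  also have "\<dots> = (\<Sum>w | w permutes {1..n}. of_int (sign w) * coeffs_at n (root_series n (\<lambda>i. map int \<gamma> ! (i - 1)) m 0) (dot w (\<lambda>i. map int lam ! (i - 1))))"
    using assms lam by (intro K_series_eq) auto
  also have "\<dots> = (\<Sum>w | w permutes {1..n}. of_int (sign w) * coeffs_at n (series m 0) (dot w b))"
  proof (rule sum.cong[OF refl])
    fix w assume "w \<in> {w. w permutes {1..n}}"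
    then have w: "w i \<in> {1..n}" if "i \<in> {1..n}" for i using permutes_in_image[of w "{1..n}" i] that by simp
    have "expo n (\<lambda>i. map int \<gamma> ! (i - 1)) = expo n (\<lambda>i. int (\<gamma> ! (i - 1)))"
      using assms(4) by (intro expo_cong) auto
    then have "root_series n (\<lambda>i. map int \<gamma> ! (i - 1)) m 0 = series m 0" by (simp add: root_series_def)
    moreover have "coeffs_at n f (dot w (\<lambda>i. map int lam ! (i - 1))) = coeffs_at n f (dot w b)" for f
    proof (rule coeffs_at_cong)
      fix i assume "i \<in> {1..n}"
      then have "w i - 1 < length lam" using w[of i] assms(7) by auto
      then show "dot w (\<lambda>i. map int lam ! (i - 1)) i = dot w b i" by (simp add: dot_def b_def)
    qed
    ultimately show "of_int (sign w) * coeffs_at n (root_series n (\<lambda>i. map int \<gamma> ! (i - 1)) m 0) (dot w (\<lambda>i. map int lam ! (i - 1))) =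
      of_int (sign w) * coeffs_at n (series m 0) (dot w b)" by simp
  qed
  also have "\<dots> = (\<Sum>rs | rs \<in> fillings n (content 0) b \<and> frozen 0 m rs \<and> lattice_rows 1 n rs. weighted 0 rs)"
  proof (rule alternating_series[OF assms(2)])
    show "0 \<le> b i" for i by (simp add: b_def)
    fix i assume "1 \<le> i" "i < n"
    then have "lam ! i \<le> lam ! (i - 1)" using assms(7,8) by (intro sorted_wrt_nth_less[where P = "(\<ge>)"]) auto
    then show "b (Suc i) \<le> b i" by (simp add: b_def)
  qed
  also have "\<dots> = (\<Sum>S | catabolizable R S \<and> has_shape S lam. fps_X ^ charge (reading_word S))"
  \<comment> \<open>The conditions correspond one by one: row sizes to the shape, the sum of the
    rows to the content, the lattice condition to strict columns, and \<open>frozen\<close> to the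
    condition on the first block.\<close>
  proof (rule sum.reindex_bij_witness[where i = rows and j = tab])
    have lt: "length (take m \<gamma>) = m" using assms by simp
    have cat: "catabolizable R S \<longleftrightarrow> straight S \<and> mset (reading_word S) = content 0 \<and>
       restrict_letters S {0 + 1..0 + length (take m \<gamma>)} = Y_tab 0 (take m \<gamma>)" for S
      unfolding R content_def using catabolizable_hook[of m \<gamma> S] assms by simp
    have fr: "restrict_letters (tab rs) {0 + 1..0 + length (take m \<gamma>)} = Y_tab 0 (take m \<gamma>) \<longleftrightarrow> frozen 0 m rs"
      if rs: "rs \<in> fillings n (content 0) b" for rs
    proof -
      have "restrict_letters (tab rs) {0 + 1..0 + length (take m \<gamma>)} = Y_tab 0 (take m \<gamma>) \<longleftrightarrow>
        (\<forall>i. {#z \<in># rs i. z \<le> 0 + length (take m \<gamma>)#} = (if 1 \<le> i \<and> i \<le> length (take m \<gamma>) then replicate_mset (take m \<gamma> ! (i - 1)) (0 + i) else {#}))"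
        by (rule restrict_letters_tab) (use fillings_letter[OF rs] in blast)
      also have "\<dots> \<longleftrightarrow> (\<forall>i. {#z \<in># rs i. z \<le> m#} = (if 0 < i \<and> i \<le> m then replicate_mset (\<gamma> ! (i - 1)) i else {#}))"
      proof (rule all_cong1)
        fix i
        have "(if 1 \<le> i \<and> i \<le> length (take m \<gamma>) then replicate_mset (take m \<gamma> ! (i - 1)) (0 + i) else {#}) =
          (if 0 < i \<and> i \<le> m then replicate_mset (\<gamma> ! (i - 1)) i else {#})" using lt by auto
        then show "({#z \<in># rs i. z \<le> 0 + length (take m \<gamma>)#} = (if 1 \<le> i \<and> i \<le> length (take m \<gamma>) then replicate_mset (take m \<gamma> ! (i - 1)) (0 + i) else {#})) \<longleftrightarrow>
          ({#z \<in># rs i. z \<le> m#} = (if 0 < i \<and> i \<le> m then replicate_mset (\<gamma> ! (i - 1)) i else {#}))"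
          unfolding lt by simp
      qed
      also have "\<dots> \<longleftrightarrow> frozen 0 m rs"
      proof -
        have "{#z \<in># rs i. z \<le> m#} = (if 0 < i \<and> i \<le> m then replicate_mset (\<gamma> ! (i - 1)) i else {#})" if "i \<notin> {1..n}" for i
        proof -
          have "rs i = {#}" using rs that by (simp add: fillings_def)
          then show ?thesis using that assms(2) by auto
        qed
        then show ?thesis unfolding frozen_def by metis
      qed
      finally show ?thesis .
    qed
    {
      fix rs assume "rs \<in> {rs. rs \<in> fillings n (content 0) b \<and> frozen 0 m rs \<and> lattice_rows 1 n rs}"
      then have rs: "rs \<in> fillings n (content 0) b" "frozen 0 m rs" "lattice_rows 1 n rs" by auto
      have sup: "supported_rows n rs" using rs(1) by (simp add: fillings_def supported_rows_def)
      show "rows (tab rs) = rs" by (rule rows_tab)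
      have w: "reading_word (tab rs) = word 1 n rs" by (rule reading_word_tab[OF sup])
      have "has_shape (tab rs) lam"
      proof (rule has_shape_tab[OF rs(3) sup assms(7)])
        fix i assume "i \<in> {1..n}"
        then have "int (size (rs i)) = b i" using rs(1) by (simp add: fillings_def)
        then show "size (rs i) = lam ! (i - 1)" by (simp add: b_def)
      qed
      moreover have "catabolizable R (tab rs)"
        unfolding cat fr[OF rs(1)] w using straight_tab[OF rs(3) sup] fillings_mset_word[OF rs(1)] rs(2) by blast
      ultimately show "tab rs \<in> {S. catabolizable R S \<and> has_shape S lam}" by blast
      show "fps_X ^ charge (reading_word (tab rs)) = weighted 0 rs"
        unfolding w weighted_def by simp
    next
      fix S assume "S \<in> {S. catabolizable R S \<and> has_shape S lam}"
      then have S: "catabolizable R S" "has_shape S lam" by auto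
      have cs: "column_strict S" using S(1) cat by (simp add: straight_def)
      note sr = straight_rows[OF cs S(2), unfolded assms(7)]
      show t: "tab (rows S) = S" by (rule sr(1))
      have "(\<Sum>i = 1..n. rows S i) = content 0"
        using reading_word_tab[OF sr(2)] S(1) unfolding t cat mset_word[symmetric] by simp
      moreover have "\<forall>i. i \<notin> {1..n} \<longrightarrow> rows S i = {#}" using sr(2) by (simp add: supported_rows_def)
      moreover have "\<forall>i \<in> {1..n}. int (size (rows S i)) = b i" using sr(4) by (simp add: b_def)
      ultimately have f: "rows S \<in> fillings n (content 0) b" by (simp add: fillings_def)
      have "frozen 0 m (rows S)" using S(1) fr[OF f] unfolding cat t by blast
      then show "rows S \<in> {rs. rs \<in> fillings n (content 0) b \<and> frozen 0 m rs \<and> lattice_rows 1 n rs}"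
        using f sr(3) by blast
    }
  qed
  finally show ?thesis .
qed

end
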